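(* Let $f \in \mathbb{Z}[x_1,\dots,x_n]$ be a nonzero polynomial with integer coefficients, with Bernstein--Sato polynomial $b_f(s)$. Then for every large enough prime $p$ (depending on $f$) the following holds. For every integer $m \ge 0$ let $f_m \in (\mathbb{Z}/p^{m+1})[x_1,\dots,x_n]$ be the mod-$p^{m+1}$ reduction of $f$. Given $\alpha \in \mathbb{Z}_{(p)}$, the sequence $\big(\mathrm{str}(\alpha, f_m)\big)_{m=0}^\infty$ is nondecreasing and satisfies $$\nu_p\big(b_f(\alpha)\big) \ge \mathrm{str}(\alpha, f_m)$$ for every $m \ge 0$, where $\nu_p$ denotes $p$-adic valuation. In particular, if $\big(\mathrm{str}(\alpha, f_m)\big)_{m=0}^\infty$ is unbounded, then $b_f(\alpha) = 0$.
   Context: $b_f(s) \in \mathbb{C}[s]$ is the classical Bernstein--Sato polynomial of $f$ viewed in $\mathbb{C}[x_1,\dots,x_n]$: the monic polynomial of least degree with $b_f(s) f^s = P(s) f^{s+1}$ for some $P(s) \in \mathcal{D}[s]$, where $\mathcal{D} = \mathbb{C}\langle x_i, \partial/\partial x_i\rangle$ is the Weyl algebra. Its roots are rational, so $b_f(\alpha) \in \mathbb{Q}$ for $\alpha \in \mathbb{Q}$; $\nu_p(0) = \infty$. $\mathbb{Z}_{(p)} \subseteq \mathbb{Z}_p$ is the ring of rational numbers whose denominator is not divisible by $p$. Strength: let $A = \mathbb{Z}/p^{m+1}$, $R = A[x_1,\dots,x_n]$, and let $g \in R$ be a nonzerodivisor (for $p$ large, each $f_m$ is one). For a commutative $A$-algebra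 $S$, let $\mathcal{D}_S \subseteq \operatorname{End}_A(S)$ be the ring of $A$-linear differential operators on $S$ in Grothendieck's sense: with $S \otimes_A S$ acting on $\operatorname{End}_A(S)$ by $((r\otimes s)\cdot\varphi)(x) = r\varphi(sx)$ and $J = \ker(S\otimes_A S \to S)$ the kernel of multiplication, $\mathcal{D}_S = \{\varphi : J^n\cdot \varphi = 0 \text{ for some } n \gg 0\}$. Grade $R[t]$ by $\deg R = 0$, $\deg t = 1$; this induces a $\mathbb{Z}$-grading on $\mathcal{D}_{R[t]}$, with degree-zero subring $(\mathcal{D}_{R[t]})_0$. Localizations of $R[t]$ carry the unique $\mathcal{D}_{R[t]}$-module structures extending that on $R[t]$. Let $H_g = R[t, g^{-1}, (g-t)^{-1}] / R[t, g^{-1}]$, $\delta_0 = [(g-t)^{-1}] \in H_g$, and $N_g = \big((\mathcal{D}_{R[t]})_0 \cdot \delta_0\big) / \big((\mathcal{D}_{R[t]})_0 \cdot g\delta_0\big)$. Let $C_m = (\mathcal{D}_{A[t]})_0$ be the commutative ring of degree-zero $A$-linear differential operators on $A[t]$ ($\deg t=1$), acting on $N_g$ via $C_m \subseteq (\mathcal{D}_{R[t]})_0$ (extend operators $R$-linearly). For every $P \in C_m$ there is a unique locally constant $\varphi_P : \mathbb{Z}_p \to A$ with $P(t^a) = \varphi_P(-1-a)t^a$ for all integers $a \ge 0$. For $\alpha \in \mathbb{Z}_p$ let $\mathfrak{m}_\alpha = \{P \in C_m : \varphi_P(\alpha) \in pA\}$, a maximal ideal of $C_m$, and let $(N_g)_\alpha$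 be the localization of $N_g$ at $\mathfrak{m}_\alpha$. The strength of $\alpha$ in $g$ is $$\mathrm{str}(\alpha, g) = \min\{k \ge 0 : \mathfrak{m}_\alpha^k (N_g)_\alpha = 0\}.$$ *)

theory Defs
  imports
    "HOL-Algebra.Module"
    "HOL-Algebra.Ideal_Product"
    "HOL-Number_Theory.Residues"
    "HOL-Library.Poly_Mapping"
    "HOL-Library.Extended_Real"
    "HOL-Computational_Algebra.Polynomial"
    "HOL-Computational_Algebra.Fraction_Field"
    Complex_Main
begin

section \<open>Polynomials\<close>

text \<open>
  Polynomials in countably many variables, the variables being indexed by the natural numbers.
  Throughout, \<open>x\<^sub>1, \<dots>, x\<^sub>n\<close> are the variables with index \<open>1, \<dots>, n\<close>, and
  the variable with index \<open>0\<close> is reserved for \<open>t\<close>.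
\<close>

type_synonym 'a mpoly = "(nat \<Rightarrow>\<^sub>0 nat) \<Rightarrow>\<^sub>0 'a"

definition mpolys :: "nat set \<Rightarrow> 'a::zero mpoly set" where
  "mpolys V = {h. \<forall>e\<in>Poly_Mapping.keys h. Poly_Mapping.keys e \<subseteq> V}"

definition Var :: "nat \<Rightarrow> 'a::{zero,one} mpoly" where
  "Var i = Poly_Mapping.single (Poly_Mapping.single i 1) 1"

definition mderiv :: "nat \<Rightarrow> 'a::comm_semiring_1 mpoly \<Rightarrow> 'a mpoly" where
  "mderiv i h = (\<Sum>e\<in>Poly_Mapping.keys h.
     Poly_Mapping.single (e - Poly_Mapping.single i 1) 
       (of_nat (Poly_Mapping.lookup e i) * Poly_Mapping.lookup h e))"


section \<open>The Bernstein--Sato polynomial\<close>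

text \<open>
  The module \<open>\<complex>[x\<^sub>1,\<dots>,x\<^sub>n]\<^sub>f[s] f\<^sup>s\<close> is a submodule of the one-dimensional vector space
  \<open>K f\<^sup>s\<close> over the fraction field \<open>K\<close> of \<open>\<complex>[s][x\<^sub>1, x\<^sub>2, \<dots>]\<close>.  An element \<open>u f\<^sup>s\<close> is represented
  by its coefficient \<open>u\<close>; so \<open>f\<^sup>s\<close> is represented by \<open>1\<close> and \<open>f\<^sup>s\<^sup>+\<^sup>1\<close> by \<open>f\<close>.
  Coefficients are polynomials in \<open>s\<close>, of type \<^typ>\<open>complex poly\<close>.
\<close>

type_synonym bs_field = "complex poly mpoly fract"

definition of_Cs :: "complex poly \<Rightarrow> bs_field" where
  "of_Cs c = Fract (Poly_Mapping.single 0 c) 1"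

definition of_Cx :: "complex mpoly \<Rightarrow> bs_field" where
  "of_Cx h = Fract (Poly_Mapping.map (\<lambda>c. [:c:]) h) 1"

definition fderiv :: "nat \<Rightarrow> bs_field \<Rightarrow> bs_field" where
  "fderiv i u = (THE w. \<exists>a b. b \<noteq> 0 \<and> u = Fract a b \<and>
     w = Fract (mderiv i a * b - a * mderiv i b) (b * b))"

text \<open>\<open>\<partial>\<^sub>i (u f\<^sup>s) = (\<partial>\<^sub>i u + s u \<partial>\<^sub>i f / f) f\<^sup>s\<close>.\<close>

definition fs_deriv :: "complex mpoly \<Rightarrow> nat \<Rightarrow> bs_field \<Rightarrow> bs_field" where
  "fs_deriv f i u = fderiv i u + of_Cs [:0, 1:] * u * of_Cx (mderiv i f) / of_Cx f"

text \<open>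
  The operators by which the elements of \<open>D[s]\<close> act, for
  \<open>D = \<complex>\<langle>x\<^sub>i, \<partial>\<^sub>i | 1 \<le> i \<le> n\<rangle>\<close> the Weyl algebra: the algebra \<open>D[s]\<close> is generated
  over \<open>\<complex>[s]\<close> by the \<open>x\<^sub>i\<close> and the \<open>\<partial>\<^sub>i\<close>, so its image in the endomorphisms
  of \<open>K f\<^sup>s\<close> is generated by the actions of these generators.
\<close>

inductive_set Weyl_s_actions :: "nat \<Rightarrow> complex mpoly \<Rightarrow> (bs_field \<Rightarrow> bs_field) set"
  for n :: nat and f :: "complex mpoly"
where
  scalar: "(\<lambda>u. of_Cs c * u) \<in> Weyl_s_actions n f"
| var: "i \<in> {1..n} \<Longrightarrow> (\<lambda>u. of_Cx (Var i) * u) \<in> Weyl_s_actions n f"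
| deriv: "i \<in> {1..n} \<Longrightarrow> fs_deriv f i \<in> Weyl_s_actions n f"
| add: "\<lbrakk>P \<in> Weyl_s_actions n f; Q \<in> Weyl_s_actions n f\<rbrakk>
         \<Longrightarrow> (\<lambda>u. P u + Q u) \<in> Weyl_s_actions n f"
| comp: "\<lbrakk>P \<in> Weyl_s_actions n f; Q \<in> Weyl_s_actions n f\<rbrakk> \<Longrightarrow> P \<circ> Q \<in> Weyl_s_actions n f"

text \<open>\<open>b(s) f\<^sup>s = P(s) f\<^sup>s\<^sup>+\<^sup>1\<close> for some \<open>P(s) \<in> D[s]\<close>.\<close>

definition functional_eq :: "nat \<Rightarrow> complex mpoly \<Rightarrow> complex poly \<Rightarrow> bool" where
  "functional_eq n f b \<longleftrightarrow> (\<exists>P \<in> Weyl_s_actions n f. of_Cs b = P (of_Cx f))"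

text \<open>
  As for minimal polynomials, the value is \<open>0\<close> if there is no monic polynomial
  satisfying a functional equation.  By Bernstein's theorem this only happens for \<open>f = 0\<close>, where the
  fractions above are degenerate.
\<close>

definition is_bernstein_sato :: "nat \<Rightarrow> complex mpoly \<Rightarrow> complex poly \<Rightarrow> bool" where
  "is_bernstein_sato n f b \<longleftrightarrow> lead_coeff b = 1 \<and> functional_eq n f b \<and>
     (\<forall>c. lead_coeff c = 1 \<and> functional_eq n f c \<longrightarrow> Polynomial.degree b \<le> Polynomial.degree c)"

definition bernstein_sato :: "nat \<Rightarrow> complex mpoly \<Rightarrow> complex poly" where
  "bernstein_sato n f =
     (if \<exists>b. is_bernstein_sato n f b then THE b. is_bernstein_sato n f b else 0)"


section \<open>The \<open>p\<close>-adic numbers\<close>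

definition padic_valuation :: "nat \<Rightarrow> rat \<Rightarrow> ereal" where
  "padic_valuation p q = (if q = 0 then \<infinity> else
     ereal (real (multiplicity (int p) (fst (quotient_of q)))
            - real (multiplicity (int p) (snd (quotient_of q)))))"

text \<open>\<open>\<int>\<^bsub>(p)\<^esub>\<close> as a set of rational numbers.\<close>

definition Z_loc :: "nat \<Rightarrow> rat set" where
  "Z_loc p = {q. \<not> int p dvd snd (quotient_of q)}"

text \<open>\<open>\<int>\<^sub>p\<close> as the inverse limit of the rings \<open>\<int>/p\<^sup>k\<close>, with residues in \<open>{0..<p\<^sup>k}\<close>.\<close>

definition padic_ints :: "nat \<Rightarrow> (nat \<Rightarrow> int) set" where
  "padic_ints p =
     {x. \<forall>k. x k \<in> {0..<int p ^ k} \<and> x (Suc k) mod int p ^ k = x k}"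

text \<open>The inclusion of \<open>\<int>\<^bsub>(p)\<^esub>\<close> in \<open>\<int>\<^sub>p\<close>.\<close>

definition padic_of_rat :: "nat \<Rightarrow> rat \<Rightarrow> nat \<Rightarrow> int" where
  "padic_of_rat p q = (\<lambda>k. THE r. r \<in> {0..<int p ^ k} \<and>
     [r * snd (quotient_of q) = fst (quotient_of q)] (mod int p ^ k))"

text \<open>The sets \<open>{y \<in> \<int>\<^sub>p. y k = x k} = x + p\<^sup>k \<int>\<^sub>p\<close> form a basis of neighbourhoods of \<open>x\<close>.\<close>

definition locally_constant :: "nat \<Rightarrow> ((nat \<Rightarrow> int) \<Rightarrow> 'a) \<Rightarrow> bool" where
  "locally_constant p \<phi> \<longleftrightarrow>
     (\<forall>x\<in>padic_ints p. \<exists>k. \<forall>y\<in>padic_ints p. y k = x k \<longrightarrow> \<phi> y = \<phi> x)"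


section \<open>Modules\<close>

text \<open>
  The fields \<open>mult\<close> and \<open>one\<close> of a module record are irrelevant for modules.  The scalars of a
  module record may also be elements of a noncommutative ring.
\<close>

definition with_smult :: "('b, 'm) ring_scheme \<Rightarrow> ('r \<Rightarrow> 'b \<Rightarrow> 'b) \<Rightarrow> ('r, 'b) module" where
  "with_smult M act = \<lparr>carrier = carrier M, monoid.mult = monoid.mult M, one = monoid.one M,
     zero = ring.zero M, add = ring.add M, module.smult = act\<rparr>"

definition regular_module :: "('b, 'm) ring_scheme \<Rightarrow> ('b, 'b) module" where
  "regular_module S = with_smult S (monoid.mult S)"

definition quotient_module ::
    "('r, 'b, 'm) module_scheme \<Rightarrow> 'b set \<Rightarrow> ('r, 'b set) module" where
  "quotient_module M B = \<lparr>carrier = a_rcosets\<^bsub>M\<^esub> B, monoid.mult = undefined, one = undefined,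
     zero = B, add = set_add M, module.smult = (\<lambda>r X. \<Union>x\<in>X. B +>\<^bsub>M\<^esub> (r \<odot>\<^bsub>M\<^esub> x))\<rparr>"

text \<open>The fraction \<open>x/w\<close>, as an equivalence class of pairs.\<close>

definition fraction :: "('r, 'b, 'm) module_scheme \<Rightarrow> 'r set \<Rightarrow> 'b \<Rightarrow> 'r \<Rightarrow> ('b \<times> 'r) set" where
  "fraction M W x w = {(y, v). y \<in> carrier M \<and> v \<in> W \<and>
     (\<exists>u\<in>W. u \<odot>\<^bsub>M\<^esub> (v \<odot>\<^bsub>M\<^esub> x) = u \<odot>\<^bsub>M\<^esub> (w \<odot>\<^bsub>M\<^esub> y))}"

text \<open>
  The localization of an \<open>R\<close>-module at a multiplicative set \<open>W\<close>, as an \<open>R\<close>-module.  The unions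
  are unions of equal sets.
\<close>

definition localization ::
    "('r, 'n) ring_scheme \<Rightarrow> ('r, 'b, 'm) module_scheme \<Rightarrow> 'r set \<Rightarrow> ('r, ('b \<times> 'r) set) module"
where
  "localization R M W = \<lparr>carrier = {fraction M W x w | x w. x \<in> carrier M \<and> w \<in> W},
     monoid.mult = undefined, one = undefined,
     zero = fraction M W \<zero>\<^bsub>M\<^esub> \<one>\<^bsub>R\<^esub>,
     add = (\<lambda>X Y. \<Union>(x, w)\<in>X. \<Union>(y, v)\<in>Y.
              fraction M W (v \<odot>\<^bsub>M\<^esub> x \<oplus>\<^bsub>M\<^esub> w \<odot>\<^bsub>M\<^esub> y) (w \<otimes>\<^bsub>R\<^esub> v)),
     module.smult = (\<lambda>r X. \<Union>(x, w)\<in>X. fraction M W (r \<odot>\<^bsub>M\<^esub> x) w)\<rparr>"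


section \<open>Differential operators\<close>

text \<open>In this section \<open>S\<close> is a commutative \<open>A\<close>-algebra.\<close>

definition linear_endos ::
    "('a, 'n) ring_scheme \<Rightarrow> ('a, 'b, 'm) module_scheme \<Rightarrow> ('b \<Rightarrow> 'b) set" where
  "linear_endos A S = {\<phi> \<in> carrier S \<rightarrow>\<^sub>E carrier S.
     (\<forall>x\<in>carrier S. \<forall>y\<in>carrier S. \<phi> (x \<oplus>\<^bsub>S\<^esub> y) = \<phi> x \<oplus>\<^bsub>S\<^esub> \<phi> y) \<and>
     (\<forall>a\<in>carrier A. \<forall>x\<in>carrier S. \<phi> (a \<odot>\<^bsub>S\<^esub> x) = a \<odot>\<^bsub>S\<^esub> \<phi> x)}"

text \<open>
  A list \<open>[(r\<^sub>1, s\<^sub>1), \<dots>, (r\<^sub>k, s\<^sub>k)]\<close> represents the element \<open>\<Sum>\<^sub>i r\<^sub>i \<otimes> s\<^sub>i\<close> of \<open>S \<otimes>\<^sub>A S\<close>; every element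
  is of this form.  The two functions below depend only on the represented element
  (the second one for \<open>A\<close>-linear \<open>\<phi>\<close>): they are the multiplication \<open>S \<otimes>\<^sub>A S \<rightarrow> S\<close>
  and the action of \<open>S \<otimes>\<^sub>A S\<close> on the \<open>A\<close>-linear endomorphisms of \<open>S\<close>.
\<close>

definition tensor_mult :: "('b, 'm) ring_scheme \<Rightarrow> ('b \<times> 'b) list \<Rightarrow> 'b" where
  "tensor_mult S u = (\<Oplus>\<^bsub>S\<^esub>i\<in>{..<length u}. fst (u ! i) \<otimes>\<^bsub>S\<^esub> snd (u ! i))"

definition tensor_act ::
    "('b, 'm) ring_scheme \<Rightarrow> ('b \<times> 'b) list \<Rightarrow> ('b \<Rightarrow> 'b) \<Rightarrow> ('b \<Rightarrow> 'b)" where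
  "tensor_act S u \<phi> = (\<lambda>x\<in>carrier S.
     \<Oplus>\<^bsub>S\<^esub>i\<in>{..<length u}. fst (u ! i) \<otimes>\<^bsub>S\<^esub> \<phi> (snd (u ! i) \<otimes>\<^bsub>S\<^esub> x))"

definition diagonal_ideal :: "('b, 'm) ring_scheme \<Rightarrow> ('b \<times> 'b) list set" where
  "diagonal_ideal S = {u. set u \<subseteq> carrier S \<times> carrier S \<and> tensor_mult S u = \<zero>\<^bsub>S\<^esub>}"

text \<open>
  \<open>J\<^sup>k \<cdot> \<phi> = 0\<close> for \<open>J\<close> the kernel of multiplication: since \<open>J\<^sup>k\<close> is additively generated by
  the products of \<open>k\<close> elements of \<open>J\<close>, this says \<open>u\<^sub>1 \<cdot> (\<dots> \<cdot> (u\<^sub>k \<cdot> \<phi>)) = 0\<close> for all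
  \<open>u\<^sub>1, \<dots>, u\<^sub>k \<in> J\<close>.
\<close>

fun killed_by_power :: "('b, 'm) ring_scheme \<Rightarrow> nat \<Rightarrow> ('b \<Rightarrow> 'b) \<Rightarrow> bool" where
  "killed_by_power S 0 \<phi> \<longleftrightarrow> (\<forall>x\<in>carrier S. \<phi> x = \<zero>\<^bsub>S\<^esub>)"
| "killed_by_power S (Suc k) \<phi> \<longleftrightarrow> (\<forall>u\<in>diagonal_ideal S. killed_by_power S k (tensor_act S u \<phi>))"

definition diff_ops ::
    "('a, 'n) ring_scheme \<Rightarrow> ('a, 'b, 'm) module_scheme \<Rightarrow> ('b \<Rightarrow> 'b) set" where
  "diff_ops A S = {\<phi> \<in> linear_endos A S. \<exists>k. killed_by_power S k \<phi>}"

definition diff_op_ring ::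
    "('a, 'n) ring_scheme \<Rightarrow> ('a, 'b, 'm) module_scheme \<Rightarrow> ('b \<Rightarrow> 'b) ring" where
  "diff_op_ring A S = \<lparr>carrier = diff_ops A S,
     monoid.mult = compose (carrier S), one = (\<lambda>x\<in>carrier S. x),
     zero = (\<lambda>x\<in>carrier S. \<zero>\<^bsub>S\<^esub>), add = (\<lambda>\<phi> \<psi>. \<lambda>x\<in>carrier S. \<phi> x \<oplus>\<^bsub>S\<^esub> \<psi> x)\<rparr>"

definition mult_op :: "('b, 'm) ring_scheme \<Rightarrow> 'b \<Rightarrow> ('b \<Rightarrow> 'b)" where
  "mult_op S r = (\<lambda>x\<in>carrier S. r \<otimes>\<^bsub>S\<^esub> x)"

text \<open>
  \<open>act\<close> is a structure of module over the ring of differential operators of \<open>S\<close> on the localization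
  of \<open>S\<close> at \<open>W\<close>, which extends the \<open>S\<close>-module structure and
  makes \<open>S \<rightarrow> W\<^sup>-\<^sup>1 S\<close> linear over the differential operators.
\<close>

definition extends_to_localization ::
    "('a, 'n) ring_scheme \<Rightarrow> ('a, 'b, 'm) module_scheme \<Rightarrow> 'b set
      \<Rightarrow> (('b \<Rightarrow> 'b) \<Rightarrow> ('b \<times> 'b) set \<Rightarrow> ('b \<times> 'b) set) \<Rightarrow> bool" where
  "extends_to_localization A S W act \<longleftrightarrow>
    (let D = diff_op_ring A S; L = localization S (regular_module S) W in
      act \<in> carrier D \<rightarrow>\<^sub>E (carrier L \<rightarrow>\<^sub>E carrier L) \<and>
      (\<forall>\<phi>\<in>carrier D. \<forall>x\<in>carrier L. \<forall>y\<in>carrier L.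
         act \<phi> (x \<oplus>\<^bsub>L\<^esub> y) = act \<phi> x \<oplus>\<^bsub>L\<^esub> act \<phi> y) \<and>
      (\<forall>\<phi>\<in>carrier D. \<forall>\<psi>\<in>carrier D. \<forall>x\<in>carrier L.
         act (\<phi> \<oplus>\<^bsub>D\<^esub> \<psi>) x = act \<phi> x \<oplus>\<^bsub>L\<^esub> act \<psi> x) \<and>
      (\<forall>\<phi>\<in>carrier D. \<forall>\<psi>\<in>carrier D. \<forall>x\<in>carrier L.
         act (\<phi> \<otimes>\<^bsub>D\<^esub> \<psi>) x = act \<phi> (act \<psi> x)) \<and>
      (\<forall>x\<in>carrier L. act \<one>\<^bsub>D\<^esub> x = x) \<and>
      (\<forall>r\<in>carrier S. \<forall>x\<in>carrier L. act (mult_op S r) x = r \<odot>\<^bsub>L\<^esub> x) \<and>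
      (\<forall>\<phi>\<in>carrier D. \<forall>h\<in>carrier S.
         act \<phi> (fraction (regular_module S) W h \<one>\<^bsub>S\<^esub>) = fraction (regular_module S) W (\<phi> h) \<one>\<^bsub>S\<^esub>))"

definition D_localization ::
    "('a, 'n) ring_scheme \<Rightarrow> ('a, 'b, 'm) module_scheme \<Rightarrow> 'b set
      \<Rightarrow> ('b \<Rightarrow> 'b, ('b \<times> 'b) set) module" where
  "D_localization A S W = with_smult (localization S (regular_module S) W)
     (THE act. extends_to_localization A S W act)"


section \<open>Strength\<close>

text \<open>\<open>A[x\<^sub>v | v \<in> V]\<close> for \<open>A = \<int>/N\<close>, with coefficients represented in \<open>{0..<N}\<close>.\<close>

definition reduce :: "int \<Rightarrow> int mpoly \<Rightarrow> int mpoly" where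
  "reduce N h = Poly_Mapping.map (\<lambda>c. c mod N) h"

definition poly_alg :: "int \<Rightarrow> nat set \<Rightarrow> (int, int mpoly) module" where
  "poly_alg N V = \<lparr>carrier =
       {h \<in> mpolys V. \<forall>e. Poly_Mapping.lookup h e \<in> carrier (residue_ring N)},
     monoid.mult = (\<lambda>g h. reduce N (g * h)), one = reduce N 1,
     zero = 0, add = (\<lambda>g h. reduce N (g + h)),
     module.smult = (\<lambda>a h. reduce N (Poly_Mapping.map (\<lambda>c. a * c) h))\<rparr>"

text \<open>
  In what follows \<open>A = \<int>/p\<^sup>m\<^sup>+\<^sup>1\<close>.  The variable \<open>t\<close> has index \<open>0\<close>, so
  \<open>R = A[x\<^sub>1, \<dots>, x\<^sub>n]\<close> and \<open>A[t]\<close> are literally subrings of \<open>R[t]\<close>.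
\<close>

definition modulus :: "nat \<Rightarrow> nat \<Rightarrow> int" where
  "modulus p m = int p ^ (m + 1)"

abbreviation A_ring :: "nat \<Rightarrow> nat \<Rightarrow> int ring" where
  "A_ring p m \<equiv> residue_ring (modulus p m)"

abbreviation R_alg :: "nat \<Rightarrow> nat \<Rightarrow> nat \<Rightarrow> (int, int mpoly) module" where
  "R_alg p m n \<equiv> poly_alg (modulus p m) {1..n}"

abbreviation Rt_alg :: "nat \<Rightarrow> nat \<Rightarrow> nat \<Rightarrow> (int, int mpoly) module" where
  "Rt_alg p m n \<equiv> poly_alg (modulus p m) {0..n}"

abbreviation At_alg :: "nat \<Rightarrow> nat \<Rightarrow> (int, int mpoly) module" where
  "At_alg p m \<equiv> poly_alg (modulus p m) {0}"

abbreviation t_var :: "int mpoly" where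
  "t_var \<equiv> Var 0"

definition t_part :: "(int, int mpoly) module \<Rightarrow> nat \<Rightarrow> int mpoly set" where
  "t_part S i = {h \<in> carrier S. \<forall>e\<in>Poly_Mapping.keys h. Poly_Mapping.lookup e 0 = i}"

definition diff_op_ring_0 ::
    "int ring \<Rightarrow> (int, int mpoly) module \<Rightarrow> (int mpoly \<Rightarrow> int mpoly) ring" where
  "diff_op_ring_0 A S = (diff_op_ring A S)
     \<lparr>carrier := {\<phi> \<in> diff_ops A S. \<forall>i. \<forall>h\<in>t_part S i. \<phi> h \<in> t_part S i}\<rparr>"

abbreviation C_ring :: "nat \<Rightarrow> nat \<Rightarrow> (int mpoly \<Rightarrow> int mpoly) ring" where
  "C_ring p m \<equiv> diff_op_ring_0 (A_ring p m) (At_alg p m)"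

text \<open>The \<open>R\<close>-linear extension to \<open>R[t]\<close> of an operator on \<open>A[t]\<close>.\<close>

definition R_extension ::
    "nat \<Rightarrow> nat \<Rightarrow> nat \<Rightarrow> (int mpoly \<Rightarrow> int mpoly) \<Rightarrow> (int mpoly \<Rightarrow> int mpoly)" where
  "R_extension p m n P = (let S = Rt_alg p m n in
     THE Q. Q \<in> carrier S \<rightarrow>\<^sub>E carrier S \<and>
       (\<forall>x\<in>carrier S. \<forall>y\<in>carrier S. Q (x \<oplus>\<^bsub>S\<^esub> y) = Q x \<oplus>\<^bsub>S\<^esub> Q y) \<and>
       (\<forall>r\<in>carrier (R_alg p m n). \<forall>x\<in>carrier S. Q (r \<otimes>\<^bsub>S\<^esub> x) = r \<otimes>\<^bsub>S\<^esub> Q x) \<and>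
       (\<forall>h\<in>carrier (At_alg p m). Q h = P h))"

definition denominators :: "nat \<Rightarrow> nat \<Rightarrow> nat \<Rightarrow> int mpoly \<Rightarrow> int mpoly set" where
  "denominators p m n g = (let S = Rt_alg p m n in
     {g [^]\<^bsub>S\<^esub> i \<otimes>\<^bsub>S\<^esub> (g \<ominus>\<^bsub>S\<^esub> t_var) [^]\<^bsub>S\<^esub> j | (i::nat) (j::nat). True})"

abbreviation Rt_frac ::
    "nat \<Rightarrow> nat \<Rightarrow> nat \<Rightarrow> int mpoly \<Rightarrow> int mpoly \<Rightarrow> int mpoly \<Rightarrow> (int mpoly \<times> int mpoly) set"
where
  "Rt_frac p m n g x w \<equiv> fraction (regular_module (Rt_alg p m n)) (denominators p m n g) x w"

text \<open>\<open>R[t, g\<^sup>-\<^sup>1, (g - t)\<^sup>-\<^sup>1]\<close> as a module over the differential operators on \<open>R[t]\<close>.\<close>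

definition L_module ::
    "nat \<Rightarrow> nat \<Rightarrow> nat \<Rightarrow> int mpoly \<Rightarrow> (int mpoly \<Rightarrow> int mpoly, (int mpoly \<times> int mpoly) set) module"
where
  "L_module p m n g = D_localization (A_ring p m) (Rt_alg p m n) (denominators p m n g)"

text \<open>The image of \<open>R[t, g\<^sup>-\<^sup>1]\<close> in \<open>R[t, g\<^sup>-\<^sup>1, (g - t)\<^sup>-\<^sup>1]\<close>.\<close>

definition L_sub :: "nat \<Rightarrow> nat \<Rightarrow> nat \<Rightarrow> int mpoly \<Rightarrow> (int mpoly \<times> int mpoly) set set" where
  "L_sub p m n g = {Rt_frac p m n g x (g [^]\<^bsub>Rt_alg p m n\<^esub> i) | x (i :: nat).
     x \<in> carrier (Rt_alg p m n)}"

definition H_module ::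
    "nat \<Rightarrow> nat \<Rightarrow> nat \<Rightarrow> int mpoly
      \<Rightarrow> (int mpoly \<Rightarrow> int mpoly, (int mpoly \<times> int mpoly) set set) module" where
  "H_module p m n g = quotient_module (L_module p m n g) (L_sub p m n g)"

definition delta :: "nat \<Rightarrow> nat \<Rightarrow> nat \<Rightarrow> int mpoly \<Rightarrow> (int mpoly \<times> int mpoly) set set" where
  "delta p m n g = L_sub p m n g +>\<^bsub>L_module p m n g\<^esub>
     Rt_frac p m n g \<one>\<^bsub>Rt_alg p m n\<^esub> (g \<ominus>\<^bsub>Rt_alg p m n\<^esub> t_var)"

definition D0_span ::
    "nat \<Rightarrow> nat \<Rightarrow> nat \<Rightarrow> int mpoly \<Rightarrow> (int mpoly \<times> int mpoly) set set
      \<Rightarrow> (int mpoly \<times> int mpoly) set set set" where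
  "D0_span p m n g z = {\<phi> \<odot>\<^bsub>H_module p m n g\<^esub> z | \<phi>.
     \<phi> \<in> carrier (diff_op_ring_0 (A_ring p m) (Rt_alg p m n))}"

text \<open>\<open>N\<^sub>g\<close>, as a module over \<open>C\<^sub>m\<close>.\<close>

definition N_module ::
    "nat \<Rightarrow> nat \<Rightarrow> nat \<Rightarrow> int mpoly
      \<Rightarrow> (int mpoly \<Rightarrow> int mpoly, (int mpoly \<times> int mpoly) set set set) module" where
  "N_module p m n g =
    (let H = H_module p m n g;
         \<delta> = delta p m n g;
         N = quotient_module (H\<lparr>carrier := D0_span p m n g \<delta>\<rparr>)
               (D0_span p m n g (mult_op (Rt_alg p m n) g \<odot>\<^bsub>H\<^esub> \<delta>))
     in with_smult N (\<lambda>P. module.smult N (R_extension p m n P)))"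

text \<open>The function \<open>\<phi>\<^sub>P\<close>, characterized by \<open>P (t\<^sup>a) = \<phi>\<^sub>P (-1 - a) t\<^sup>a\<close>.\<close>

definition eigenvalue_fun ::
    "nat \<Rightarrow> nat \<Rightarrow> (int mpoly \<Rightarrow> int mpoly) \<Rightarrow> ((nat \<Rightarrow> int) \<Rightarrow> int)" where
  "eigenvalue_fun p m P = (THE \<phi>. \<phi> \<in> padic_ints p \<rightarrow>\<^sub>E carrier (A_ring p m) \<and>
     locally_constant p \<phi> \<and>
     (\<forall>a::nat. P (t_var [^]\<^bsub>At_alg p m\<^esub> a) =
        \<phi> (padic_of_rat p (- 1 - of_nat a)) \<odot>\<^bsub>At_alg p m\<^esub> (t_var [^]\<^bsub>At_alg p m\<^esub> a)))"

definition max_ideal :: "nat \<Rightarrow> nat \<Rightarrow> (nat \<Rightarrow> int) \<Rightarrow> (int mpoly \<Rightarrow> int mpoly) set" where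
  "max_ideal p m \<alpha> = {P \<in> carrier (C_ring p m).
     eigenvalue_fun p m P \<alpha> \<in> PIdl\<^bsub>A_ring p m\<^esub> (int p mod modulus p m)}"

definition N_localized ::
    "nat \<Rightarrow> nat \<Rightarrow> nat \<Rightarrow> (nat \<Rightarrow> int) \<Rightarrow> int mpoly
      \<Rightarrow> (int mpoly \<Rightarrow> int mpoly,
          ((int mpoly \<times> int mpoly) set set set \<times> (int mpoly \<Rightarrow> int mpoly)) set) module" where
  "N_localized p m n \<alpha> g = localization (C_ring p m) (N_module p m n g)
     (carrier (C_ring p m) - max_ideal p m \<alpha>)"

text \<open>
  The minimum exists: identifying \<open>C\<^sub>m\<close> with the ring of locally constant functions \<open>\<int>\<^sub>p \<rightarrow> A\<close>, its
  localization at the maximal ideal is \<open>A\<close>, where \<open>p\<^sup>m\<^sup>+\<^sup>1 = 0\<close>.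
\<close>

definition strength :: "nat \<Rightarrow> nat \<Rightarrow> nat \<Rightarrow> (nat \<Rightarrow> int) \<Rightarrow> int mpoly \<Rightarrow> nat" where
  "strength p m n \<alpha> g = (LEAST k.
     \<forall>P \<in> max_ideal p m \<alpha> [^]\<^bsub>ideals_set (C_ring p m)\<^esub> k. \<forall>x \<in> carrier (N_localized p m n \<alpha> g).
       P \<odot>\<^bsub>N_localized p m n \<alpha> g\<^esub> x = \<zero>\<^bsub>N_localized p m n \<alpha> g\<^esub>)"

end

(* Over A = Z/p^(m+1), the differential operators on R = A[x_1,...,x_n] are the additive endomorphisms
   that commute with multiplication by all p^N-th powers for some N.  This makes localizations
   computable: such an operator acts on a fraction by acting on the numerator, once the denominator is
   a p^N-th power.  Writing 1/(g - t) as (g - t)^(p^N - 1) / (g - t)^(p^N) and comparing coefficients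
   of t, membership of p^k delta_0 (near alpha) in the submodule generated by g delta_0 becomes the
   condition p^k g^b = psi(g^(b+1)) for an operator psi commuting with p^N-th powers and a natural
   number b congruent to alpha modulo p^N.  Since C_m is the ring of locally constant functions on
   Z_p, the maximal ideal of its localization at alpha is generated by p, so the strength is the
   least such k.  Reducing psi modulo p^(m+1) shows that the strength is monotone in m.

   For the bound, apply a Q-linear functional mu from C to Q with mu(1) = 1 to the functional equation
   of f: up to a common denominator D it has integer coefficients, so if p does not divide D it can be
   reduced modulo p^(m+1).  Specializing s to a large b congruent to alpha gives
   b_f(alpha) f^b = Q(f^(b+1)) for a differential operator Q, hence the condition above with k the
   valuation of b_f(alpha). *)

theory Submission
  imports Defs "HOL-Algebra.Subrings"
begin

text \<open>An operator that commutes with \<open>v^(p^N)\<close> has nilpotent commutation with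
  \<open>v\<close>, because the latter is a difference \<open>b - a\<close> of two commuting shifts:
  if their \<open>p^N\<close>-th powers agree and \<open>p\<close> is odd, then
  \<open>(b - a)^(p^N * r)\<close> is divisible by \<open>p^r\<close>. Coefficients of
  \<open>t\<close> can be compared although \<open>H_g\<close> is a quotient. Degree-zero operators
  keep the numerators below \<open>t\<close>-degree \<open>p^N\<close>, while
  \<open>(g - t)^(p^N)\<close> is monic up to sign and \<open>g\<close> is regular; so such a
  numerator over \<open>(g - t)^(p^N)\<close> lies in \<open>R[t, 1/g]\<close> only if it is zero.
  The coefficient of \<open>t^a\<close> in \<open>(g - t)^(p^N - 1)\<close> is
  \<open>g^(p^N - 1 - a)\<close> times a signed binomial coefficient prime to \<open>p\<close>. Its
  exponent is congruent to \<open>-1 - a\<close>, which explains the convention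
  \<open>P(t^a) = \<phi>_P(-1 - a) t^a\<close>. The threshold for \<open>p\<close> ensures that
  \<open>p\<close> is odd, that it does not divide \<open>D\<close>, and that it does not divide a
  chosen nonzero coefficient of \<open>f\<close>. The last condition makes \<open>f\<close> nonzero
  modulo \<open>p\<close>, hence regular modulo every power of \<open>p\<close> by Gauss's
  lemma.\<close>

abbreviation (input) "lookup \<equiv> Poly_Mapping.lookup"
abbreviation (input) "keys \<equiv> Poly_Mapping.keys"
abbreviation (input) "single \<equiv> Poly_Mapping.single"

section \<open>Differential operators and commutators\<close>

text \<open>Scalars are left out: over \<open>Z/N\<close> every additive map is already linear, see
  \<open>linear_endos_poly_alg\<close>.\<close>

definition additive_endos :: "('b, 'm) ring_scheme \<Rightarrow> ('b \<Rightarrow> 'b) set" where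
  "additive_endos S = {\<phi> \<in> carrier S \<rightarrow>\<^sub>E carrier S.
     \<forall>x\<in>carrier S. \<forall>y\<in>carrier S. \<phi> (x \<oplus>\<^bsub>S\<^esub> y) = \<phi> x \<oplus>\<^bsub>S\<^esub> \<phi> y}"

definition commutes_with :: "('b, 'm) ring_scheme \<Rightarrow> ('b \<Rightarrow> 'b) \<Rightarrow> 'b \<Rightarrow> bool" where
  "commutes_with S \<phi> w \<longleftrightarrow> (\<forall>x\<in>carrier S. \<phi> (w \<otimes>\<^bsub>S\<^esub> x) = w \<otimes>\<^bsub>S\<^esub> \<phi> x)"

definition commutator :: "('b, 'm) ring_scheme \<Rightarrow> ('b \<Rightarrow> 'b) \<Rightarrow> 'b \<Rightarrow> ('b \<Rightarrow> 'b)" where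
  "commutator S \<phi> s = (\<lambda>x\<in>carrier S. \<phi> (s \<otimes>\<^bsub>S\<^esub> x) \<ominus>\<^bsub>S\<^esub> s \<otimes>\<^bsub>S\<^esub> \<phi> x)"

text \<open>Grothendieck's condition tested only on the elements
  \<open>1 \<otimes> s - s \<otimes> 1\<close> of \<open>J\<close>, which act as commutators. By
  \<open>killed_by_power_iff_order_less\<close> this is the full condition.\<close>

fun order_less :: "('b, 'm) ring_scheme \<Rightarrow> nat \<Rightarrow> ('b \<Rightarrow> 'b) \<Rightarrow> bool" where
  "order_less S 0 \<phi> \<longleftrightarrow> (\<forall>x\<in>carrier S. \<phi> x = \<zero>\<^bsub>S\<^esub>)"
| "order_less S (Suc k) \<phi> \<longleftrightarrow> (\<forall>s\<in>carrier S. order_less S k (commutator S \<phi> s))"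

context cring
begin

lemma additive_endosD:
  assumes "\<phi> \<in> additive_endos R"
  shows "x \<in> carrier R \<Longrightarrow> \<phi> x \<in> carrier R"
    and "x \<in> carrier R \<Longrightarrow> y \<in> carrier R \<Longrightarrow> \<phi> (x \<oplus> y) = \<phi> x \<oplus> \<phi> y"
    and "x \<notin> carrier R \<Longrightarrow> \<phi> x = undefined"
  using assms by (auto simp: additive_endos_def)

lemma additive_endosI:
  assumes "\<And>x. x \<in> carrier R \<Longrightarrow> \<phi> x \<in> carrier R"
    and "\<And>x y. x \<in> carrier R \<Longrightarrow> y \<in> carrier R \<Longrightarrow> \<phi> (x \<oplus> y) = \<phi> x \<oplus> \<phi> y"
    and "\<And>x. x \<notin> carrier R \<Longrightarrow> \<phi> x = undefined"
  shows "\<phi> \<in> additive_endos R"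
  using assms by (auto simp: additive_endos_def PiE_def extensional_def)

lemma additive_endos_zero:
  assumes "\<phi> \<in> additive_endos R" shows "\<phi> \<zero> = \<zero>"
  using additive_endosD(2)[OF assms, of \<zero> \<zero>] additive_endosD(1)[OF assms, of \<zero>]
  by (metis add.l_cancel_one' l_zero zero_closed)

lemma commutator_endo:
  assumes "\<phi> \<in> additive_endos R" "s \<in> carrier R"
  shows "commutator R \<phi> s \<in> additive_endos R"
proof (rule additive_endosI)
  fix x y assume x: "x \<in> carrier R" and y: "y \<in> carrier R"
  note c = additive_endosD(1)[OF assms(1)]
  have "\<phi> (s \<otimes> (x \<oplus> y)) = \<phi> (s \<otimes> x) \<oplus> \<phi> (s \<otimes> y)" "\<phi> (x \<oplus> y) = \<phi> x \<oplus> \<phi> y"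
    using x y assms by (simp_all add: r_distr additive_endosD)
  moreover have "\<phi> (s \<otimes> x) \<in> carrier R" "\<phi> (s \<otimes> y) \<in> carrier R" "\<phi> x \<in> carrier R" "\<phi> y \<in> carrier R"
    using x y c assms by auto
  ultimately show "commutator R \<phi> s (x \<oplus> y) = commutator R \<phi> s x \<oplus> commutator R \<phi> s y"
    using x y assms(2) unfolding commutator_def by (simp) algebra
qed (use assms in \<open>auto simp: commutator_def additive_endosD\<close>)

text \<open>The list encodes \<open>1 \<otimes> s - s \<otimes> 1\<close>. Testing \<open>J\<close>
  on these elements alone gives one half of the comparison with commutators.\<close>

lemma tensor_act_swap:
  assumes "\<phi> \<in> additive_endos R" "s \<in> carrier R"
  shows "tensor_act R [(\<one>, s), (\<ominus> s, \<one>)] \<phi> = commutator R \<phi> s"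
    and "[(\<one>, s), (\<ominus> s, \<one>)] \<in> diagonal_ideal R"
proof -
  have 2: "{..<length [(\<one>, s), (\<ominus> s, \<one>)]} = {0, 1}" by auto
  have "(\<Oplus>i\<in>{..<length [(\<one>, s), (\<ominus> s, \<one>)]}. fst ([(\<one>, s), (\<ominus> s, \<one>)] ! i) \<otimes> \<phi> (snd ([(\<one>, s), (\<ominus> s, \<one>)] ! i) \<otimes> x))
     = \<phi> (s \<otimes> x) \<ominus> s \<otimes> \<phi> x" if x: "x \<in> carrier R" for x
    unfolding 2 using assms x
    by (subst add.finprod_insert) (auto simp: additive_endosD l_minus a_minus_def)
  then show "tensor_act R [(\<one>, s), (\<ominus> s, \<one>)] \<phi> = commutator R \<phi> s"
    unfolding tensor_act_def commutator_def by (auto simp: restrict_def)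
  have "(\<Oplus>i\<in>{..<length [(\<one>, s), (\<ominus> s, \<one>)]}. fst ([(\<one>, s), (\<ominus> s, \<one>)] ! i) \<otimes> snd ([(\<one>, s), (\<ominus> s, \<one>)] ! i)) = \<zero>"
    unfolding 2 using assms by (subst add.finprod_insert) (auto simp: r_neg)
  then show "[(\<one>, s), (\<ominus> s, \<one>)] \<in> diagonal_ideal R"
    using assms by (simp add: diagonal_ideal_def tensor_mult_def)
qed

lemma order_less_add:
  assumes "\<phi> \<in> additive_endos R" "\<psi> \<in> additive_endos R" "order_less R k \<phi>" "order_less R k \<psi>"
  shows "order_less R k (\<lambda>x\<in>carrier R. \<phi> x \<oplus> \<psi> x)"
  using assms
proof (induction k arbitrary: \<phi> \<psi>)
  case (Suc k)
  have "commutator R (\<lambda>x\<in>carrier R. \<phi> x \<oplus> \<psi> x) s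
      = (\<lambda>x\<in>carrier R. commutator R \<phi> s x \<oplus> commutator R \<psi> s x)" if s: "s \<in> carrier R" for s
  proof
    fix x show "commutator R (\<lambda>x\<in>carrier R. \<phi> x \<oplus> \<psi> x) s x
      = (\<lambda>x\<in>carrier R. commutator R \<phi> s x \<oplus> commutator R \<psi> s x) x"
    proof (cases "x \<in> carrier R")
      case True
      then have "\<phi> (s \<otimes> x) \<in> carrier R" "\<psi> (s \<otimes> x) \<in> carrier R" "\<phi> x \<in> carrier R" "\<psi> x \<in> carrier R"
        using Suc.prems s by (auto simp: additive_endosD)
      then show ?thesis using True s unfolding commutator_def by simp algebra
    qed (simp add: commutator_def)
  qed
  then show ?case using Suc by (simp add: commutator_endo del: restrict_apply)
qed (auto simp: additive_endosD)

lemma order_less_lmult: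
  assumes "\<phi> \<in> additive_endos R" "r \<in> carrier R" "order_less R k \<phi>"
  shows "order_less R k (\<lambda>x\<in>carrier R. r \<otimes> \<phi> x)"
  using assms
proof (induction k arbitrary: \<phi>)
  case (Suc k)
  have "commutator R (\<lambda>x\<in>carrier R. r \<otimes> \<phi> x) s
      = (\<lambda>x\<in>carrier R. r \<otimes> commutator R \<phi> s x)" if s: "s \<in> carrier R" for s
  proof
    fix x show "commutator R (\<lambda>x\<in>carrier R. r \<otimes> \<phi> x) s x
      = (\<lambda>x\<in>carrier R. r \<otimes> commutator R \<phi> s x) x"
    proof (cases "x \<in> carrier R")
      case True
      then have "\<phi> (s \<otimes> x) \<in> carrier R" "\<phi> x \<in> carrier R"
        using Suc.prems s by (auto simp: additive_endosD)
      then show ?thesis using True s Suc.prems unfolding commutator_def by simp algebra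
    qed (simp add: commutator_def)
  qed
  then show ?case using Suc by (simp add: commutator_endo del: restrict_apply)
qed (auto simp: additive_endosD)

lemma order_less_rmult:
  assumes "\<phi> \<in> additive_endos R" "r \<in> carrier R" "order_less R k \<phi>"
  shows "order_less R k (\<lambda>x\<in>carrier R. \<phi> (r \<otimes> x))"
  using assms
proof (induction k arbitrary: \<phi>)
  case (Suc k)
  have "commutator R (\<lambda>x\<in>carrier R. \<phi> (r \<otimes> x)) s
      = (\<lambda>x\<in>carrier R. commutator R \<phi> s (r \<otimes> x))" if s: "s \<in> carrier R" for s
    using s Suc.prems(2) by (auto simp: commutator_def restrict_def m_lcomm)
  then show ?case using Suc by (simp add: commutator_endo del: restrict_apply)
qed (auto simp: additive_endosD)

lemma additive_endos_add:
  assumes "\<phi> \<in> additive_endos R" "\<psi> \<in> additive_endos R"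
  shows "(\<lambda>x\<in>carrier R. \<phi> x \<oplus> \<psi> x) \<in> additive_endos R"
  using assms by (intro additive_endosI) (auto simp: additive_endosD a_ac)

lemma additive_endos_lmult:
  assumes "\<phi> \<in> additive_endos R" "r \<in> carrier R"
  shows "(\<lambda>x\<in>carrier R. r \<otimes> \<phi> x) \<in> additive_endos R"
  using assms by (intro additive_endosI) (auto simp: additive_endosD r_distr)

text \<open>If \<open>\<Sum> r_i s_i = 0\<close>, then
  \<open>\<Sum> r_i \<phi>(s_i x) = \<Sum> r_i [\<phi>, s_i](x)\<close>, because the two sums differ
  by \<open>(\<Sum> r_i s_i) \<phi>(x)\<close>. So an element of \<open>J\<close> acts as a left
  combination of commutators, each of smaller order.\<close>

lemma tensor_act_order:
  assumes \<phi>: "\<phi> \<in> additive_endos R" and o: "order_less R (Suc k) \<phi>" and u: "u \<in> diagonal_ideal R"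
  shows "order_less R k (tensor_act R u \<phi>)" "tensor_act R u \<phi> \<in> additive_endos R"
proof -
  have us: "fst (u ! i) \<in> carrier R" "snd (u ! i) \<in> carrier R" if "i < length u" for i
    using u nth_mem[OF that] by (auto simp: diagonal_ideal_def)
  \<comment> \<open>Partial sums of \<open>\<Sum> r_i [\<phi>, s_i](x)\<close>, so that additivity
    and the order bound follow by induction on the number of terms.\<close>
  define G where "G = (\<lambda>n. \<lambda>x\<in>carrier R. \<Oplus>i\<in>{..<n}. fst (u ! i) \<otimes> commutator R \<phi> (snd (u ! i)) x)"
  have G: "G n \<in> additive_endos R \<and> order_less R k (G n)" if "n \<le> length u" for n
    using that
  proof (induction n)
    case 0
    have "order_less R k (\<lambda>x\<in>carrier R. \<zero>)" for k
    proof (induction k)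
      case (Suc k)
      have "commutator R (\<lambda>x\<in>carrier R. \<zero>) s = (\<lambda>x\<in>carrier R. \<zero>)" if "s \<in> carrier R" for s
        using that by (auto simp: commutator_def restrict_def)
      then show ?case using Suc by (simp del: restrict_apply)
    qed auto
    moreover have "(\<lambda>x\<in>carrier R. \<zero>) \<in> additive_endos R" by (rule additive_endosI) auto
    ultimately show ?case by (simp add: G_def del: restrict_apply)
  next
    case (Suc n)
    then have n: "n < length u" by simp
    note c = commutator_endo[OF \<phi> us(2)[OF n]]
    have "G (Suc n) = (\<lambda>x\<in>carrier R. (\<lambda>x\<in>carrier R. fst (u ! n) \<otimes> commutator R \<phi> (snd (u ! n)) x) x \<oplus> G n x)"
    proof
      fix x
      have "(\<Oplus>i\<in>{..<Suc n}. fst (u ! i) \<otimes> commutator R \<phi> (snd (u ! i)) x) =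
        fst (u ! n) \<otimes> commutator R \<phi> (snd (u ! n)) x \<oplus> (\<Oplus>i\<in>{..<n}. fst (u ! i) \<otimes> commutator R \<phi> (snd (u ! i)) x)"
        if x: "x \<in> carrier R"
        unfolding lessThan_Suc using n
        by (subst add.finprod_insert) (auto intro!: m_closed us additive_endosD(1)[OF commutator_endo[OF \<phi>]] x)
      then show "G (Suc n) x = (\<lambda>x\<in>carrier R. (\<lambda>x\<in>carrier R. fst (u ! n) \<otimes> commutator R \<phi> (snd (u ! n)) x) x \<oplus> G n x) x"
        by (simp add: G_def restrict_def)
    qed
    moreover have "order_less R k (commutator R \<phi> (snd (u ! n)))" using o us n by auto
    ultimately show ?case
      using order_less_add[OF additive_endos_lmult[OF c us(1)[OF n]] _ order_less_lmult[OF c us(1)[OF n]]]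
        additive_endos_add[OF additive_endos_lmult[OF c us(1)[OF n]]] Suc by (simp del: restrict_apply)
  qed
  have "tensor_act R u \<phi> = G (length u)"
  proof
    fix x
    show "tensor_act R u \<phi> x = G (length u) x"
    proof (cases "x \<in> carrier R")
      case x: True
      \<comment> \<open>The correction term \<open>(\<Sum> r_i s_i) \<phi>(x)\<close> is kept for
        partial sums; it vanishes only for the whole list.\<close>
      have *: "(\<Oplus>i\<in>{..<n}. fst (u ! i) \<otimes> \<phi> (snd (u ! i) \<otimes> x)) =
          G n x \<oplus> (\<Oplus>i\<in>{..<n}. fst (u ! i) \<otimes> snd (u ! i)) \<otimes> \<phi> x" if "n \<le> length u" for n
        using that
      proof (induction n)
        case 0 then show ?case using x \<phi> by (simp add: G_def additive_endosD)
      next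
        case (Suc n)
        then have n: "n < length u" by simp
        have cl: "fst (u ! i) \<in> carrier R" "snd (u ! i) \<in> carrier R" if "i < Suc n" for i
          using us that n by auto
        have 1: "(\<Oplus>i\<in>{..<Suc n}. fst (u ! i) \<otimes> \<phi> (snd (u ! i) \<otimes> x)) = fst (u ! n) \<otimes> \<phi> (snd (u ! n) \<otimes> x)
             \<oplus> (\<Oplus>i\<in>{..<n}. fst (u ! i) \<otimes> \<phi> (snd (u ! i) \<otimes> x))"
          unfolding lessThan_Suc by (subst add.finprod_insert) (auto intro!: m_closed cl additive_endosD(1)[OF \<phi>] x)
        have 2: "G (Suc n) x = fst (u ! n) \<otimes> (\<phi> (snd (u ! n) \<otimes> x) \<ominus> snd (u ! n) \<otimes> \<phi> x) \<oplus> G n x"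
          unfolding G_def lessThan_Suc using x
          by (simp, subst add.finprod_insert)
            (auto intro!: m_closed minus_closed cl additive_endosD(1)[OF \<phi>] simp: commutator_def)
        have 3: "(\<Oplus>i\<in>{..<Suc n}. fst (u ! i) \<otimes> snd (u ! i)) = fst (u ! n) \<otimes> snd (u ! n) \<oplus> (\<Oplus>i\<in>{..<n}. fst (u ! i) \<otimes> snd (u ! i))"
          unfolding lessThan_Suc by (subst add.finprod_insert) (auto intro!: m_closed cl)
        have 4: "(\<Oplus>i\<in>{..<n}. fst (u ! i) \<otimes> snd (u ! i)) \<in> carrier R"
          by (rule add.finprod_closed) (auto intro!: m_closed cl)
        have 5: "G n x \<in> carrier R" using G[of n] n x by (auto simp: additive_endosD)
        have 6: "\<phi> (snd (u ! n) \<otimes> x) \<in> carrier R" "\<phi> x \<in> carrier R"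
          using \<phi> x cl by (auto simp: additive_endosD)
        have alg: "a \<otimes> p' \<oplus> (g \<oplus> s \<otimes> q') = (a \<otimes> (p' \<ominus> b \<otimes> q') \<oplus> g) \<oplus> (a \<otimes> b \<oplus> s) \<otimes> q'"
          if "a \<in> carrier R" "b \<in> carrier R" "p' \<in> carrier R" "q' \<in> carrier R" "g \<in> carrier R" "s \<in> carrier R"
          for a b p' q' g s using that by algebra
        show ?case unfolding 1 2 3 Suc.IH[OF less_imp_le[OF n]] using 4 5 6 cl[of n] by (intro alg) auto
      qed
      have "(\<Oplus>i\<in>{..<length u}. fst (u ! i) \<otimes> snd (u ! i)) = \<zero>"
        using u by (simp add: diagonal_ideal_def tensor_mult_def)
      then show ?thesis using *[of "length u"] x \<phi> G[of "length u"]
        by (simp add: tensor_act_def additive_endosD)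
    qed (simp add: tensor_act_def G_def)
  qed
  then show "order_less R k (tensor_act R u \<phi>)" "tensor_act R u \<phi> \<in> additive_endos R"
    using G[of "length u"] by auto
qed

lemma killed_by_power_iff_order_less:
  assumes "\<phi> \<in> additive_endos R"
  shows "killed_by_power R k \<phi> \<longleftrightarrow> order_less R k \<phi>"
proof
  show "killed_by_power R k \<phi> \<Longrightarrow> order_less R k \<phi>" using assms
  proof (induction k arbitrary: \<phi>)
    case (Suc k)
    show ?case
      using Suc.IH[OF _ commutator_endo[OF Suc.prems(2)]] Suc.prems(1) tensor_act_swap[OF Suc.prems(2)]
      by (metis killed_by_power.simps(2) order_less.simps(2))
  qed auto
  show "order_less R k \<phi> \<Longrightarrow> killed_by_power R k \<phi>" using assms
  proof (induction k arbitrary: \<phi>)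
    case (Suc k)
    show ?case using Suc.IH tensor_act_order[OF Suc.prems(2,1)] by simp
  qed auto
qed

lemma commutes_with_pow:
  assumes "\<phi> \<in> additive_endos R" "w \<in> carrier R" "commutes_with R \<phi> w"
  shows "commutes_with R \<phi> (w [^] (n::nat))"
proof (induction n)
  case (Suc n)
  have "\<phi> (w [^] Suc n \<otimes> x) = w [^] Suc n \<otimes> \<phi> x" if x: "x \<in> carrier R" for x
  proof -
    have "\<phi> (w [^] Suc n \<otimes> x) = \<phi> (w [^] n \<otimes> (w \<otimes> x))" using x assms by (simp add: m_assoc)
    also have "\<dots> = w [^] n \<otimes> (w \<otimes> \<phi> x)" using Suc assms(3) x assms(2) by (simp add: commutes_with_def)
    finally show ?thesis using x assms by (simp add: m_assoc additive_endosD)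
  qed
  then show ?case by (simp add: commutes_with_def)
qed (use assms in \<open>auto simp: commutes_with_def additive_endosD\<close>)

text \<open>If \<open>\<psi> = [\<phi>, v]\<close> commutes with \<open>v\<close>, then \<open>[\<phi>, v\<^sup>q] = q v\<^sup>q\<^sup>-\<^sup>1 \<psi>\<close>, which vanishes in characteristic \<open>q\<close>.\<close>

lemma order_less_imp_commutes:
  fixes q :: nat
  assumes "\<And>x. x \<in> carrier R \<Longrightarrow> add_pow R q x = \<zero>" "q > 0"
    and "\<phi> \<in> additive_endos R" "order_less R k \<phi>" "w \<in> carrier R"
  shows "commutes_with R \<phi> (w [^] (q ^ k))"
  using assms(3,4)
proof (induction k arbitrary: \<phi>)
  case 0
  have "w [^] (q ^ 0) = w" using assms(5) by simp
  with 0 show ?case using assms(5) by (simp add: commutes_with_def del: power_0)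
next
  case (Suc k)
  note w = assms(5) and \<phi> = Suc.prems(1)
  note \<phi>c = additive_endosD(1)[OF \<phi>]
  define v where "v = w [^] (q ^ k)"
  have v: "v \<in> carrier R" using w by (simp add: v_def)
  \<comment> \<open>All commutators with powers of \<open>w\<close> commute with \<open>v\<close>:
    in \<open>[\<phi>, w^(n+1)] = [\<phi>, w] w^n + w [\<phi>, w^n]\<close> the operator
    \<open>[\<phi>, w]\<close> has smaller order and falls under the outer induction.\<close>
  have *: "commutes_with R (commutator R \<phi> (w [^] n)) v" for n :: nat
  proof (induction n)
    case 0
    have "commutator R \<phi> (w [^] (0::nat)) x = \<zero>" if "x \<in> carrier R" for x
      using \<phi>c that by (simp add: commutator_def r_right_minus_eq)
    then show ?case using v by (simp add: commutes_with_def)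
  next
    case (Suc n)
    have wn: "w [^] n \<in> carrier R" using w by simp
    have 1: "commutator R \<phi> (w [^] Suc n) x = commutator R \<phi> w (w [^] n \<otimes> x) \<oplus> w \<otimes> commutator R \<phi> (w [^] n) x"
      if x: "x \<in> carrier R" for x
    proof -
      have "\<phi> (w \<otimes> (w [^] n \<otimes> x)) \<in> carrier R" "\<phi> (w [^] n \<otimes> x) \<in> carrier R" "\<phi> x \<in> carrier R"
        using \<phi>c w wn x by simp_all
      moreover have "w [^] Suc n \<otimes> x = w \<otimes> (w [^] n \<otimes> x)" "w [^] Suc n = w \<otimes> w [^] n"
        using wn w x by (simp_all add: m_ac)
      moreover have alg: "a \<ominus> w \<otimes> v \<otimes> f = (a \<ominus> w \<otimes> g) \<oplus> w \<otimes> (g \<ominus> v \<otimes> f)"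
        if "a \<in> carrier R" "g \<in> carrier R" "f \<in> carrier R" "v \<in> carrier R" for a f g v
        using that w by algebra
      note this[of "\<phi> (w \<otimes> (w [^] n \<otimes> x))" "\<phi> (w [^] n \<otimes> x)" "\<phi> x" "w [^] n"]
      ultimately show ?thesis using wn w x unfolding commutator_def by (simp only: restrict_apply m_closed if_True)
    qed
    have c1: "commutes_with R (commutator R \<phi> w) v"
      using \<open>order_less R (Suc k) \<phi>\<close> w Suc.IH commutator_endo[OF \<phi> w] \<open>\<And>\<phi>. \<phi> \<in> additive_endos R \<Longrightarrow> order_less R k \<phi> \<Longrightarrow> commutes_with R \<phi> (w [^] (q ^ k))\<close>
      by (auto simp: v_def)
    have "commutator R \<phi> (w [^] Suc n) (v \<otimes> x) = v \<otimes> commutator R \<phi> (w [^] Suc n) x"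
      if x: "x \<in> carrier R" for x
    proof -
      have "w [^] n \<otimes> (v \<otimes> x) = v \<otimes> (w [^] n \<otimes> x)" using wn v x by algebra
      moreover have "commutator R \<phi> w (w [^] n \<otimes> x) \<in> carrier R" "commutator R \<phi> (w [^] n) x \<in> carrier R"
        using additive_endosD(1)[OF commutator_endo[OF \<phi>]] w wn x by simp_all
      ultimately show ?thesis
        using c1 Suc.IH w wn v x unfolding commutes_with_def 1[OF x] 1[OF m_closed[OF v x]] by simp algebra
    qed
    then show ?case by (simp add: commutes_with_def)
  qed
  define \<chi> where "\<chi> = commutator R \<phi> v"
  have \<chi>: "commutes_with R \<chi> v" using *[of "q ^ k"] by (simp add: \<chi>_def v_def)
  have \<chi>a: "\<chi> \<in> additive_endos R" using commutator_endo[OF \<phi> v] by (simp add: \<chi>_def)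
  have \<chi>1: "\<phi> (v \<otimes> x) = v \<otimes> \<phi> x \<oplus> \<chi> x" if "x \<in> carrier R" for x
  proof -
    have "\<phi> (v \<otimes> x) \<in> carrier R" "\<phi> x \<in> carrier R" using \<phi>c v that by simp_all
    then show ?thesis using that v by (simp add: \<chi>_def commutator_def) algebra
  qed
  have Q: "\<phi> (v [^] Suc j \<otimes> x) = v [^] Suc j \<otimes> \<phi> x \<oplus> add_pow R (Suc j) (v [^] j \<otimes> \<chi> x)"
    if x: "x \<in> carrier R" for j x
  proof (induction j)
    case 0
    then show ?case using \<chi>1[OF x] v x \<phi>c additive_endosD(1)[OF \<chi>a] by simp
  next
    case (Suc j)
    have vj: "v [^] j \<in> carrier R" using v by simp
    have \<chi>x: "\<chi> x \<in> carrier R" using additive_endosD(1)[OF \<chi>a] x by simp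
    have ap: "add_pow R n (v [^] j \<otimes> \<chi> x) \<in> carrier R" for n :: nat using vj \<chi>x by simp
    have 0: "v [^] Suc (Suc j) \<otimes> x = v \<otimes> (v [^] Suc j \<otimes> x)" using v vj x by (simp add: m_ac)
    have 1: "\<chi> (v [^] Suc j \<otimes> x) = v [^] Suc j \<otimes> \<chi> x"
      using commutes_with_pow[OF \<chi>a v \<chi>, of "Suc j"] x by (simp add: commutes_with_def)
    have 2: "v \<otimes> add_pow R n (v [^] j \<otimes> \<chi> x) = add_pow R n (v [^] Suc j \<otimes> \<chi> x)" for n :: nat
      using add_pow_rdistr[of v "v [^] j \<otimes> \<chi> x" n] v vj \<chi>x by (simp add: m_ac)
    have "\<phi> (v [^] Suc (Suc j) \<otimes> x) = v \<otimes> \<phi> (v [^] Suc j \<otimes> x) \<oplus> \<chi> (v [^] Suc j \<otimes> x)"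
      unfolding 0 using \<chi>1 v vj x by simp
    also have "\<dots> = v \<otimes> (v [^] Suc j \<otimes> \<phi> x) \<oplus> (v \<otimes> add_pow R (Suc j) (v [^] j \<otimes> \<chi> x) \<oplus> v [^] Suc j \<otimes> \<chi> x)"
      unfolding Suc 1 using v vj x \<phi>c[OF x] \<chi>x ap[of "Suc j"] by (simp only: r_distr m_closed nat_pow_closed a_assoc)
    also have "v \<otimes> (v [^] Suc j \<otimes> \<phi> x) = v [^] Suc (Suc j) \<otimes> \<phi> x"
      using v vj x \<phi>c[OF x] by (simp add: m_ac)
    also have "v \<otimes> add_pow R (Suc j) (v [^] j \<otimes> \<chi> x) \<oplus> v [^] Suc j \<otimes> \<chi> x = add_pow R (Suc (Suc j)) (v [^] Suc j \<otimes> \<chi> x)"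
      unfolding 2 by (rule add.nat_pow_Suc[symmetric])
    finally show ?case .
  qed
  have "commutes_with R \<phi> (v [^] q)"
    unfolding commutes_with_def
  proof
    fix x assume x: "x \<in> carrier R"
    have \<chi>x: "\<chi> x \<in> carrier R" using additive_endosD(1)[OF \<chi>a] x by simp
    obtain j where "q = Suc j" using assms(2) gr0_conv_Suc by auto
    then show "\<phi> (v [^] q \<otimes> x) = v [^] q \<otimes> \<phi> x"
      using Q[OF x, of j] assms(1)[of "v [^] j \<otimes> \<chi> x"] v x \<phi>c[OF x] \<chi>x by simp
  qed
  moreover have "v [^] q = w [^] (q ^ Suc k)" unfolding v_def using w by (simp add: nat_pow_pow mult.commute)
  ultimately show ?case by simp
qed

end

section \<open>Left modules, their submodules and quotients\<close>

lemma with_smult_simps [simp]: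
  "carrier (with_smult M act) = carrier M" "ring.zero (with_smult M act) = ring.zero M"
  "ring.add (with_smult M act) = ring.add M" "module.smult (with_smult M act) = act"
  by (simp_all add: with_smult_def)

lemma quotient_module_simps [simp]:
  "carrier (quotient_module M B) = a_rcosets\<^bsub>M\<^esub> B" "ring.zero (quotient_module M B) = B"
  "ring.add (quotient_module M B) = set_add M"
  "module.smult (quotient_module M B) = (\<lambda>r X. \<Union>x\<in>X. B +>\<^bsub>M\<^esub> (r \<odot>\<^bsub>M\<^esub> x))"
  by (simp_all add: quotient_module_def)

text \<open>The library's modules are over commutative rings.\<close>

locale left_module = R?: ring R + M?: abelian_group M
  for R :: "('r, 'n) ring_scheme" (structure) and M :: "('r, 'b, 'm) module_scheme" (structure) +
  assumes smult_closed [simp, intro]: "r \<in> carrier R \<Longrightarrow> x \<in> carrier M \<Longrightarrow> r \<odot>\<^bsub>M\<^esub> x \<in> carrier M"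
    and smult_l_distr: "r \<in> carrier R \<Longrightarrow> s \<in> carrier R \<Longrightarrow> x \<in> carrier M
      \<Longrightarrow> (r \<oplus>\<^bsub>R\<^esub> s) \<odot>\<^bsub>M\<^esub> x = r \<odot>\<^bsub>M\<^esub> x \<oplus>\<^bsub>M\<^esub> s \<odot>\<^bsub>M\<^esub> x"
    and smult_r_distr: "r \<in> carrier R \<Longrightarrow> x \<in> carrier M \<Longrightarrow> y \<in> carrier M
      \<Longrightarrow> r \<odot>\<^bsub>M\<^esub> (x \<oplus>\<^bsub>M\<^esub> y) = r \<odot>\<^bsub>M\<^esub> x \<oplus>\<^bsub>M\<^esub> r \<odot>\<^bsub>M\<^esub> y"
    and smult_assoc1: "r \<in> carrier R \<Longrightarrow> s \<in> carrier R \<Longrightarrow> x \<in> carrier M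
      \<Longrightarrow> (r \<otimes>\<^bsub>R\<^esub> s) \<odot>\<^bsub>M\<^esub> x = r \<odot>\<^bsub>M\<^esub> (s \<odot>\<^bsub>M\<^esub> x)"
    and smult_one [simp]: "x \<in> carrier M \<Longrightarrow> \<one>\<^bsub>R\<^esub> \<odot>\<^bsub>M\<^esub> x = x"
begin

lemma smult_r_null [simp]: "r \<in> carrier R \<Longrightarrow> r \<odot>\<^bsub>M\<^esub> \<zero>\<^bsub>M\<^esub> = \<zero>\<^bsub>M\<^esub>"
  by (metis M.add.l_cancel_one' M.l_zero M.zero_closed smult_closed smult_r_distr)

lemma smult_r_minus: "r \<in> carrier R \<Longrightarrow> x \<in> carrier M \<Longrightarrow> r \<odot>\<^bsub>M\<^esub> (\<ominus>\<^bsub>M\<^esub> x) = \<ominus>\<^bsub>M\<^esub> (r \<odot>\<^bsub>M\<^esub> x)"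
  by (metis M.a_inv_closed M.minus_equality M.r_neg M.a_comm smult_closed smult_r_distr smult_r_null)

lemma smult_l_null [simp]: "x \<in> carrier M \<Longrightarrow> \<zero>\<^bsub>R\<^esub> \<odot>\<^bsub>M\<^esub> x = \<zero>\<^bsub>M\<^esub>"
  by (metis M.add.l_cancel_one' R.l_zero R.zero_closed smult_closed smult_l_distr)

lemma smult_l_minus: "r \<in> carrier R \<Longrightarrow> x \<in> carrier M \<Longrightarrow> (\<ominus>\<^bsub>R\<^esub> r) \<odot>\<^bsub>M\<^esub> x = \<ominus>\<^bsub>M\<^esub> (r \<odot>\<^bsub>M\<^esub> x)"
  by (metis M.minus_equality R.a_inv_closed R.l_neg smult_closed smult_l_distr smult_l_null)

lemma smult_minus_r: "r \<in> carrier R \<Longrightarrow> x \<in> carrier M \<Longrightarrow> y \<in> carrier M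
    \<Longrightarrow> r \<odot>\<^bsub>M\<^esub> (x \<ominus>\<^bsub>M\<^esub> y) = r \<odot>\<^bsub>M\<^esub> x \<ominus>\<^bsub>M\<^esub> r \<odot>\<^bsub>M\<^esub> y"
  by (simp add: a_minus_def smult_r_distr smult_r_minus)

end

locale left_submodule = left_module +
  fixes B
  assumes B_subset: "B \<subseteq> carrier M"
    and B_zero: "\<zero>\<^bsub>M\<^esub> \<in> B"
    and B_add: "x \<in> B \<Longrightarrow> y \<in> B \<Longrightarrow> x \<oplus>\<^bsub>M\<^esub> y \<in> B"
    and B_smult: "r \<in> carrier R \<Longrightarrow> x \<in> B \<Longrightarrow> r \<odot>\<^bsub>M\<^esub> x \<in> B"
begin

lemma B_neg: "x \<in> B \<Longrightarrow> \<ominus>\<^bsub>M\<^esub> x \<in> B"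
  by (metis B_smult B_subset R.a_inv_closed R.one_closed smult_l_minus smult_one subsetD)

lemma abelian_subgroup_B: "abelian_subgroup B M"
proof -
  have "subgroup B (add_monoid M)"
    by (rule subgroup.intro) (use B_subset B_zero B_add B_neg in \<open>auto simp: a_inv_def[symmetric]\<close>)
  then show ?thesis using M.abelian_group_axioms by (intro abelian_subgroupI3 additive_subgroupI)
qed

sublocale B: abelian_subgroup B M by (rule abelian_subgroup_B)

lemma coset_eq_iff:
  assumes "x \<in> carrier M" "y \<in> carrier M"
  shows "B +>\<^bsub>M\<^esub> x = B +>\<^bsub>M\<^esub> y \<longleftrightarrow> x \<ominus>\<^bsub>M\<^esub> y \<in> B"
proof
  assume "B +>\<^bsub>M\<^esub> x = B +>\<^bsub>M\<^esub> y"
  then have "x \<in> B +>\<^bsub>M\<^esub> y" using B.a_rcos_self[OF assms(1)] by simp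
  then show "x \<ominus>\<^bsub>M\<^esub> y \<in> B" unfolding a_minus_def by (rule B.a_rcos_module_imp[OF assms(2)])
next
  assume "x \<ominus>\<^bsub>M\<^esub> y \<in> B"
  then have "x \<in> B +>\<^bsub>M\<^esub> y" unfolding a_minus_def by (rule B.a_rcos_module_rev[OF assms(2,1)])
  then show "B +>\<^bsub>M\<^esub> x = B +>\<^bsub>M\<^esub> y" using B.a_repr_independence'[OF _ assms(2)] by simp
qed

lemma coset_zero_iff: "x \<in> carrier M \<Longrightarrow> B +>\<^bsub>M\<^esub> x = B \<longleftrightarrow> x \<in> B"
  using coset_eq_iff[of x "\<zero>\<^bsub>M\<^esub>"] B_subset by (simp add: a_minus_def M.add.inv_one[folded a_inv_def])

text \<open>The union in \<open>quotient_module\<close> runs over all representatives. Their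
  differences lie in \<open>B\<close>, which is stable under \<open>r\<close>, so all of them give
  the same coset.\<close>

lemma quotient_smult:
  assumes "r \<in> carrier R" "x \<in> carrier M"
  shows "r \<odot>\<^bsub>quotient_module M B\<^esub> (B +>\<^bsub>M\<^esub> x) = B +>\<^bsub>M\<^esub> (r \<odot>\<^bsub>M\<^esub> x)"
proof -
  have "B +>\<^bsub>M\<^esub> (r \<odot>\<^bsub>M\<^esub> y) = B +>\<^bsub>M\<^esub> (r \<odot>\<^bsub>M\<^esub> x)" if "y \<in> B +>\<^bsub>M\<^esub> x" for y
  proof -
    have y: "y \<in> carrier M" using that assms(2) B.a_elemrcos_carrier by blast
    have "y \<ominus>\<^bsub>M\<^esub> x \<in> B" unfolding a_minus_def by (rule B.a_rcos_module_imp[OF assms(2) that])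
    then have "r \<odot>\<^bsub>M\<^esub> y \<ominus>\<^bsub>M\<^esub> r \<odot>\<^bsub>M\<^esub> x \<in> B" using smult_minus_r[OF assms(1) y assms(2)] B_smult[OF assms(1)] by metis
    then show ?thesis using coset_eq_iff assms y by blast
  qed
  moreover have "x \<in> B +>\<^bsub>M\<^esub> x" using B.a_rcos_self assms(2) by blast
  ultimately show ?thesis unfolding quotient_module_simps by (intro UN_constant_eq ballI)
qed

lemma quotient_add:
  "x \<in> carrier M \<Longrightarrow> y \<in> carrier M \<Longrightarrow>
    (B +>\<^bsub>M\<^esub> x) \<oplus>\<^bsub>quotient_module M B\<^esub> (B +>\<^bsub>M\<^esub> y) = B +>\<^bsub>M\<^esub> (x \<oplus>\<^bsub>M\<^esub> y)"
  by (simp add: B.a_rcos_sum)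

lemma quotient_carrier: "carrier (quotient_module M B) = {B +>\<^bsub>M\<^esub> x | x. x \<in> carrier M}"
  by (auto simp: A_RCOSETS_def')

lemma left_module_quotient: "left_module R (quotient_module M B)"
proof -
  have ag: "abelian_group (quotient_module M B)"
  proof (rule abelian_groupI)
    have mem: "B +>\<^bsub>M\<^esub> x \<in> carrier (quotient_module M B)" if "x \<in> carrier M" for x
      using that quotient_carrier by auto
    have 0: "\<zero>\<^bsub>quotient_module M B\<^esub> = B +>\<^bsub>M\<^esub> \<zero>\<^bsub>M\<^esub>" using coset_zero_iff[OF M.zero_closed] B_zero by simp
    show "\<zero>\<^bsub>quotient_module M B\<^esub> \<in> carrier (quotient_module M B)"
      unfolding 0 by (rule mem) simp
    fix X Y assume "X \<in> carrier (quotient_module M B)" "Y \<in> carrier (quotient_module M B)"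
    then obtain x y where x: "X = B +>\<^bsub>M\<^esub> x" "x \<in> carrier M" and y: "Y = B +>\<^bsub>M\<^esub> y" "y \<in> carrier M"
      unfolding quotient_carrier by auto
    show "X \<oplus>\<^bsub>quotient_module M B\<^esub> Y \<in> carrier (quotient_module M B)"
      unfolding x(1) y(1) quotient_add[OF x(2) y(2)] using x y by (intro mem) simp
    show "X \<oplus>\<^bsub>quotient_module M B\<^esub> Y = Y \<oplus>\<^bsub>quotient_module M B\<^esub> X"
      unfolding x(1) y(1) quotient_add[OF x(2) y(2)] quotient_add[OF y(2) x(2)] using x y by (simp add: M.a_comm)
    show "\<zero>\<^bsub>quotient_module M B\<^esub> \<oplus>\<^bsub>quotient_module M B\<^esub> X = X"
      unfolding x(1) 0 quotient_add[OF M.zero_closed x(2)] using x by simp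
    have "(B +>\<^bsub>M\<^esub> \<ominus>\<^bsub>M\<^esub> x) \<oplus>\<^bsub>quotient_module M B\<^esub> X = \<zero>\<^bsub>quotient_module M B\<^esub>"
      unfolding x(1) 0 quotient_add[OF M.a_inv_closed[OF x(2)] x(2)] using x by (simp add: M.l_neg)
    then show "\<exists>Y\<in>carrier (quotient_module M B). Y \<oplus>\<^bsub>quotient_module M B\<^esub> X = \<zero>\<^bsub>quotient_module M B\<^esub>"
      using mem x by blast
    fix Z assume "Z \<in> carrier (quotient_module M B)"
    then obtain z where z: "Z = B +>\<^bsub>M\<^esub> z" "z \<in> carrier M" unfolding quotient_carrier by auto
    show "X \<oplus>\<^bsub>quotient_module M B\<^esub> Y \<oplus>\<^bsub>quotient_module M B\<^esub> Z = X \<oplus>\<^bsub>quotient_module M B\<^esub> (Y \<oplus>\<^bsub>quotient_module M B\<^esub> Z)"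
      using x y z by (simp only: quotient_add M.add.m_closed M.a_assoc)
  qed
  show ?thesis
  proof (intro left_module.intro left_module_axioms.intro R.ring_axioms ag)
    fix r X assume r: "r \<in> carrier R" and "X \<in> carrier (quotient_module M B)"
    then obtain x where [simp]: "X = B +>\<^bsub>M\<^esub> x" "x \<in> carrier M" unfolding quotient_carrier by auto
    show "r \<odot>\<^bsub>quotient_module M B\<^esub> X \<in> carrier (quotient_module M B)"
      unfolding \<open>X = _\<close> quotient_smult[OF r \<open>x \<in> _\<close>] by (use r \<open>x \<in> _\<close> quotient_carrier smult_closed in blast)
    fix Y assume "Y \<in> carrier (quotient_module M B)"
    then obtain y where y: "Y = B +>\<^bsub>M\<^esub> y" "y \<in> carrier M" unfolding quotient_carrier by auto
    show "r \<odot>\<^bsub>quotient_module M B\<^esub> (X \<oplus>\<^bsub>quotient_module M B\<^esub> Y) =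
      r \<odot>\<^bsub>quotient_module M B\<^esub> X \<oplus>\<^bsub>quotient_module M B\<^esub> r \<odot>\<^bsub>quotient_module M B\<^esub> Y"
      using r y by (simp only: quotient_add quotient_smult smult_closed M.add.m_closed smult_r_distr \<open>X = _\<close> \<open>x \<in> _\<close>)
  next
    fix X assume "X \<in> carrier (quotient_module M B)"
    then obtain x where "X = B +>\<^bsub>M\<^esub> x" "x \<in> carrier M" unfolding quotient_carrier by auto
    then show "\<one> \<odot>\<^bsub>quotient_module M B\<^esub> X = X" by (simp only: quotient_smult R.one_closed smult_one)
  next
    fix r s X assume r: "r \<in> carrier R" "s \<in> carrier R" and "X \<in> carrier (quotient_module M B)"
    then obtain x where x: "X = B +>\<^bsub>M\<^esub> x" "x \<in> carrier M" unfolding quotient_carrier by auto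
    show "(r \<oplus> s) \<odot>\<^bsub>quotient_module M B\<^esub> X =
      r \<odot>\<^bsub>quotient_module M B\<^esub> X \<oplus>\<^bsub>quotient_module M B\<^esub> s \<odot>\<^bsub>quotient_module M B\<^esub> X"
      using r x by (simp only: quotient_add quotient_smult smult_closed R.add.m_closed smult_l_distr)
    show "r \<otimes> s \<odot>\<^bsub>quotient_module M B\<^esub> X = r \<odot>\<^bsub>quotient_module M B\<^esub> (s \<odot>\<^bsub>quotient_module M B\<^esub> X)"
      using r x by (simp only: quotient_smult smult_closed R.m_closed smult_assoc1)
  qed
qed

lemma left_module_carrier_update: "left_module R (M\<lparr>carrier := B\<rparr>)"
proof -
  have "abelian_group (M\<lparr>carrier := B\<rparr>)"
    by (rule abelian_groupI)
      (use B_subset B_zero B_add in \<open>auto simp: M.a_ac subset_iff intro!: bexI[OF _ B_neg] M.r_neg\<close>)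
  then show ?thesis
    by (intro left_module.intro left_module_axioms.intro R.ring_axioms)
      (use B_subset B_smult in \<open>auto simp: smult_l_distr smult_r_distr smult_assoc1 subset_iff\<close>)
qed

end

text \<open>Restriction of scalars; it turns \<open>N_g\<close> from a module over the degree-zero
  operators into one over \<open>C_m\<close>.\<close>

lemma (in left_module) left_module_pullback:
  assumes "ring C" "\<And>c. c \<in> carrier C \<Longrightarrow> h c \<in> carrier R"
    and "\<And>c d. c \<in> carrier C \<Longrightarrow> d \<in> carrier C \<Longrightarrow> h (c \<oplus>\<^bsub>C\<^esub> d) = h c \<oplus>\<^bsub>R\<^esub> h d"
    and "\<And>c d. c \<in> carrier C \<Longrightarrow> d \<in> carrier C \<Longrightarrow> h (c \<otimes>\<^bsub>C\<^esub> d) = h c \<otimes>\<^bsub>R\<^esub> h d"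
    and "h \<one>\<^bsub>C\<^esub> = \<one>\<^bsub>R\<^esub>"
  shows "left_module C (with_smult M (\<lambda>c. module.smult M (h c)))"
proof -
  have "abelian_group (with_smult M (\<lambda>c. module.smult M (h c)))"
    by (rule abelian_groupI) (auto simp: M.a_ac intro: M.l_neg)
  then show ?thesis
    by (intro left_module.intro left_module_axioms.intro assms(1))
      (use assms in \<open>auto simp: smult_l_distr smult_r_distr smult_assoc1\<close>)
qed

section \<open>Localization\<close>

locale module_localization = left_module + R?: cring R +
  fixes W
  assumes W_subset: "W \<subseteq> carrier R" and W_one: "\<one> \<in> W"
    and W_mult: "v \<in> W \<Longrightarrow> w \<in> W \<Longrightarrow> v \<otimes> w \<in> W"
begin

lemma W_closed [simp]: "w \<in> W \<Longrightarrow> w \<in> carrier R" using W_subset by auto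

lemma smult_commute: "r \<in> carrier R \<Longrightarrow> s \<in> carrier R \<Longrightarrow> x \<in> carrier M
    \<Longrightarrow> r \<odot>\<^bsub>M\<^esub> (s \<odot>\<^bsub>M\<^esub> x) = s \<odot>\<^bsub>M\<^esub> (r \<odot>\<^bsub>M\<^esub> x)"
  by (simp flip: smult_assoc1 add: R.m_comm)

definition fraction_rel where
  "fraction_rel x w y v \<longleftrightarrow> (\<exists>u\<in>W. u \<odot>\<^bsub>M\<^esub> (v \<odot>\<^bsub>M\<^esub> x) = u \<odot>\<^bsub>M\<^esub> (w \<odot>\<^bsub>M\<^esub> y))"

lemma fraction_rel_sym: "fraction_rel x w y v \<Longrightarrow> fraction_rel y v x w"
  unfolding fraction_rel_def by metis

text \<open>Multiplying by \<open>u' u v\<close> allows both given relations to be applied in turn.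
  The middle denominator \<open>v\<close> has to be part of the multiplier, as it cannot be
  cancelled.\<close>

lemma fraction_rel_trans:
  assumes "fraction_rel x w y v" "fraction_rel y v z t"
    and c: "x \<in> carrier M" "y \<in> carrier M" "z \<in> carrier M" "w \<in> W" "v \<in> W" "t \<in> W"
  shows "fraction_rel x w z t"
proof -
  obtain u u' where u: "u \<in> W" "u \<odot>\<^bsub>M\<^esub> (v \<odot>\<^bsub>M\<^esub> x) = u \<odot>\<^bsub>M\<^esub> (w \<odot>\<^bsub>M\<^esub> y)"
    and u': "u' \<in> W" "u' \<odot>\<^bsub>M\<^esub> (t \<odot>\<^bsub>M\<^esub> y) = u' \<odot>\<^bsub>M\<^esub> (v \<odot>\<^bsub>M\<^esub> z)"
    using assms(1,2) by (auto simp: fraction_rel_def)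
  have "(u' \<otimes> (u \<otimes> v)) \<odot>\<^bsub>M\<^esub> (t \<odot>\<^bsub>M\<^esub> x) = (u' \<otimes> t) \<odot>\<^bsub>M\<^esub> (u \<odot>\<^bsub>M\<^esub> (v \<odot>\<^bsub>M\<^esub> x))"
    using u(1) u'(1) c by (simp flip: smult_assoc1 add: R.m_ac)
  also have "\<dots> = (u \<otimes> w) \<odot>\<^bsub>M\<^esub> (u' \<odot>\<^bsub>M\<^esub> (t \<odot>\<^bsub>M\<^esub> y))"
    unfolding u(2) using u(1) u'(1) c by (simp flip: smult_assoc1 add: R.m_ac)
  also have "\<dots> = (u' \<otimes> (u \<otimes> v)) \<odot>\<^bsub>M\<^esub> (w \<odot>\<^bsub>M\<^esub> z)"
    unfolding u'(2) using u(1) u'(1) c by (simp flip: smult_assoc1 add: R.m_ac)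
  finally have "(u' \<otimes> (u \<otimes> v)) \<odot>\<^bsub>M\<^esub> (t \<odot>\<^bsub>M\<^esub> x) = (u' \<otimes> (u \<otimes> v)) \<odot>\<^bsub>M\<^esub> (w \<odot>\<^bsub>M\<^esub> z)" .
  moreover have "u' \<otimes> (u \<otimes> v) \<in> W" using u u' c W_mult by auto
  ultimately show ?thesis unfolding fraction_rel_def by blast
qed

lemma fraction_eq_iff:
  assumes "x \<in> carrier M" "y \<in> carrier M" "w \<in> W" "v \<in> W"
  shows "fraction M W x w = fraction M W y v \<longleftrightarrow> fraction_rel x w y v"
proof
  assume "fraction M W x w = fraction M W y v"
  moreover have "(y, v) \<in> fraction M W y v"
    using assms W_one by (auto simp: fraction_def)
  ultimately have "(y, v) \<in> fraction M W x w" by simp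
  then show "fraction_rel x w y v" by (auto simp: fraction_def fraction_rel_def)
next
  assume r: "fraction_rel x w y v"
  have f: "fraction M W x w = {(z, t). z \<in> carrier M \<and> t \<in> W \<and> fraction_rel x w z t}" for x w
    by (auto simp: fraction_def fraction_rel_def)
  show "fraction M W x w = fraction M W y v"
    unfolding f using r assms fraction_rel_trans fraction_rel_sym by blast
qed

lemma mem_fraction_iff:
  assumes "x \<in> carrier M" "w \<in> W"
  shows "(y, v) \<in> fraction M W x w \<longleftrightarrow> y \<in> carrier M \<and> v \<in> W \<and> fraction M W y v = fraction M W x w"
proof -
  have "(y, v) \<in> fraction M W x w \<longleftrightarrow> y \<in> carrier M \<and> v \<in> W \<and> fraction_rel x w y v"
    by (auto simp: fraction_def fraction_rel_def)
  then show ?thesis using assms fraction_rel_sym fraction_eq_iff by metis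
qed

lemma fraction_self: "x \<in> carrier M \<Longrightarrow> w \<in> W \<Longrightarrow> (x, w) \<in> fraction M W x w"
  by (simp add: mem_fraction_iff)

lemma localization_carrier: "carrier (localization R M W) = {fraction M W x w | x w. x \<in> carrier M \<and> w \<in> W}"
  and localization_zero: "\<zero>\<^bsub>localization R M W\<^esub> = fraction M W \<zero>\<^bsub>M\<^esub> \<one>"
  by (simp_all add: localization_def)

lemma localization_smult:
  assumes "r \<in> carrier R" "x \<in> carrier M" "w \<in> W"
  shows "r \<odot>\<^bsub>localization R M W\<^esub> fraction M W x w = fraction M W (r \<odot>\<^bsub>M\<^esub> x) w"
proof -
  have "fraction M W (r \<odot>\<^bsub>M\<^esub> y) v = fraction M W (r \<odot>\<^bsub>M\<^esub> x) w" if yv: "(y, v) \<in> fraction M W x w" for y v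
  proof -
    have y: "y \<in> carrier M" "v \<in> W" and "fraction_rel y v x w"
      using yv assms by (auto simp: mem_fraction_iff fraction_eq_iff)
    then obtain u where u: "u \<in> W" "u \<odot>\<^bsub>M\<^esub> (w \<odot>\<^bsub>M\<^esub> y) = u \<odot>\<^bsub>M\<^esub> (v \<odot>\<^bsub>M\<^esub> x)" by (auto simp: fraction_rel_def)
    have "u \<odot>\<^bsub>M\<^esub> (w \<odot>\<^bsub>M\<^esub> (r \<odot>\<^bsub>M\<^esub> y)) = r \<odot>\<^bsub>M\<^esub> (u \<odot>\<^bsub>M\<^esub> (w \<odot>\<^bsub>M\<^esub> y))"
      using u(1) y assms by (simp flip: smult_assoc1 add: R.m_ac)
    also have "\<dots> = u \<odot>\<^bsub>M\<^esub> (v \<odot>\<^bsub>M\<^esub> (r \<odot>\<^bsub>M\<^esub> x))"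
      unfolding u(2) using u(1) y assms by (simp flip: smult_assoc1 add: R.m_ac)
    finally have "fraction_rel (r \<odot>\<^bsub>M\<^esub> y) v (r \<odot>\<^bsub>M\<^esub> x) w" using u by (auto simp: fraction_rel_def)
    then show ?thesis using y assms by (subst fraction_eq_iff) auto
  qed
  then have "(\<Union>p\<in>fraction M W x w. fraction M W (r \<odot>\<^bsub>M\<^esub> fst p) (snd p)) = fraction M W (r \<odot>\<^bsub>M\<^esub> x) w"
    by (intro UN_constant_eq[OF fraction_self[OF assms(2,3)]] ballI) simp
  then show ?thesis by (simp add: localization_def case_prod_beta)
qed

lemma localization_add:
  assumes "x \<in> carrier M" "w \<in> W" "y \<in> carrier M" "v \<in> W"
  shows "fraction M W x w \<oplus>\<^bsub>localization R M W\<^esub> fraction M W y v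
    = fraction M W (v \<odot>\<^bsub>M\<^esub> x \<oplus>\<^bsub>M\<^esub> w \<odot>\<^bsub>M\<^esub> y) (w \<otimes> v)"
proof -
  have "fraction M W (v' \<odot>\<^bsub>M\<^esub> x' \<oplus>\<^bsub>M\<^esub> w' \<odot>\<^bsub>M\<^esub> y') (w' \<otimes> v') = fraction M W (v \<odot>\<^bsub>M\<^esub> x \<oplus>\<^bsub>M\<^esub> w \<odot>\<^bsub>M\<^esub> y) (w \<otimes> v)"
    if xw: "(x', w') \<in> fraction M W x w" and yv: "(y', v') \<in> fraction M W y v" for x' w' y' v'
  proof -
    have c: "x' \<in> carrier M" "w' \<in> W" "y' \<in> carrier M" "v' \<in> W"
      and "fraction_rel x' w' x w" "fraction_rel y' v' y v"
      using xw yv assms by (auto simp: mem_fraction_iff fraction_eq_iff)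
    then obtain s t where s: "s \<in> W" "s \<odot>\<^bsub>M\<^esub> (w \<odot>\<^bsub>M\<^esub> x') = s \<odot>\<^bsub>M\<^esub> (w' \<odot>\<^bsub>M\<^esub> x)"
      and t: "t \<in> W" "t \<odot>\<^bsub>M\<^esub> (v \<odot>\<^bsub>M\<^esub> y') = t \<odot>\<^bsub>M\<^esub> (v' \<odot>\<^bsub>M\<^esub> y)" by (auto simp: fraction_rel_def)
    note cc = c assms s(1) t(1)
    have 1: "(s \<otimes> t) \<odot>\<^bsub>M\<^esub> ((w \<otimes> v) \<odot>\<^bsub>M\<^esub> (v' \<odot>\<^bsub>M\<^esub> x')) = (s \<otimes> t) \<odot>\<^bsub>M\<^esub> ((w' \<otimes> v') \<odot>\<^bsub>M\<^esub> (v \<odot>\<^bsub>M\<^esub> x))"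
    proof -
      have "(s \<otimes> t) \<odot>\<^bsub>M\<^esub> ((w \<otimes> v) \<odot>\<^bsub>M\<^esub> (v' \<odot>\<^bsub>M\<^esub> x')) = t \<odot>\<^bsub>M\<^esub> (v \<odot>\<^bsub>M\<^esub> (v' \<odot>\<^bsub>M\<^esub> (s \<odot>\<^bsub>M\<^esub> (w \<odot>\<^bsub>M\<^esub> x'))))"
        using cc by (simp flip: smult_assoc1 add: R.m_ac)
      also have "\<dots> = (s \<otimes> t) \<odot>\<^bsub>M\<^esub> ((w' \<otimes> v') \<odot>\<^bsub>M\<^esub> (v \<odot>\<^bsub>M\<^esub> x))"
        unfolding s(2) using cc by (simp flip: smult_assoc1 add: R.m_ac)
      finally show ?thesis .
    qed
    have 2: "(s \<otimes> t) \<odot>\<^bsub>M\<^esub> ((w \<otimes> v) \<odot>\<^bsub>M\<^esub> (w' \<odot>\<^bsub>M\<^esub> y')) = (s \<otimes> t) \<odot>\<^bsub>M\<^esub> ((w' \<otimes> v') \<odot>\<^bsub>M\<^esub> (w \<odot>\<^bsub>M\<^esub> y))"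
    proof -
      have "(s \<otimes> t) \<odot>\<^bsub>M\<^esub> ((w \<otimes> v) \<odot>\<^bsub>M\<^esub> (w' \<odot>\<^bsub>M\<^esub> y')) = s \<odot>\<^bsub>M\<^esub> (w \<odot>\<^bsub>M\<^esub> (w' \<odot>\<^bsub>M\<^esub> (t \<odot>\<^bsub>M\<^esub> (v \<odot>\<^bsub>M\<^esub> y'))))"
        using cc by (simp flip: smult_assoc1 add: R.m_ac)
      also have "\<dots> = (s \<otimes> t) \<odot>\<^bsub>M\<^esub> ((w' \<otimes> v') \<odot>\<^bsub>M\<^esub> (w \<odot>\<^bsub>M\<^esub> y))"
        unfolding t(2) using cc by (simp flip: smult_assoc1 add: R.m_ac)
      finally show ?thesis .
    qed
    have "(s \<otimes> t) \<odot>\<^bsub>M\<^esub> ((w \<otimes> v) \<odot>\<^bsub>M\<^esub> (v' \<odot>\<^bsub>M\<^esub> x' \<oplus>\<^bsub>M\<^esub> w' \<odot>\<^bsub>M\<^esub> y'))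
        = (s \<otimes> t) \<odot>\<^bsub>M\<^esub> ((w' \<otimes> v') \<odot>\<^bsub>M\<^esub> (v \<odot>\<^bsub>M\<^esub> x \<oplus>\<^bsub>M\<^esub> w \<odot>\<^bsub>M\<^esub> y))"
      using 1 2 cc by (simp add: smult_r_distr)
    then have "fraction_rel (v' \<odot>\<^bsub>M\<^esub> x' \<oplus>\<^bsub>M\<^esub> w' \<odot>\<^bsub>M\<^esub> y') (w' \<otimes> v') (v \<odot>\<^bsub>M\<^esub> x \<oplus>\<^bsub>M\<^esub> w \<odot>\<^bsub>M\<^esub> y) (w \<otimes> v)"
      unfolding fraction_rel_def using W_mult[OF s(1) t(1)] by blast
    then show ?thesis using cc W_mult by (subst fraction_eq_iff) auto
  qed
  note key = this
  define F where "F = (\<lambda>p q. fraction M W (snd q \<odot>\<^bsub>M\<^esub> fst p \<oplus>\<^bsub>M\<^esub> snd p \<odot>\<^bsub>M\<^esub> fst q) (snd p \<otimes> snd q))"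
  have self: "(x, w) \<in> fraction M W x w" "(y, v) \<in> fraction M W y v"
    using assms by (simp_all add: fraction_self)
  have "(\<Union>q\<in>fraction M W y v. F p q) = F (x, w) (y, v)" if p: "p \<in> fraction M W x w" for p
  proof (rule UN_constant_eq[OF self(2)], rule ballI)
    fix q assume "q \<in> fraction M W y v"
    then show "F p q = F (x, w) (y, v)" using key[of "fst p" "snd p" "fst q" "snd q"] p by (simp add: F_def)
  qed
  then have "(\<Union>p\<in>fraction M W x w. \<Union>q\<in>fraction M W y v. F p q) = F (x, w) (y, v)"
    by (intro UN_constant_eq[OF self(1)] ballI)
  then show ?thesis by (simp add: localization_def F_def case_prod_beta)
qed

text \<open>Turns vanishing in the localization into a statement about the module itself; the
  strength is computed through this criterion.\<close>

lemma smult_fraction_eq_zero_iff: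
  assumes "r \<in> carrier R" "x \<in> carrier M" "w \<in> W"
  shows "r \<odot>\<^bsub>localization R M W\<^esub> fraction M W x w = \<zero>\<^bsub>localization R M W\<^esub> \<longleftrightarrow> (\<exists>u\<in>W. u \<odot>\<^bsub>M\<^esub> (r \<odot>\<^bsub>M\<^esub> x) = \<zero>\<^bsub>M\<^esub>)"
  unfolding localization_smult[OF assms] localization_zero
    fraction_eq_iff[OF smult_closed[OF assms(1,2)] M.zero_closed assms(3) W_one] fraction_rel_def
  using assms by simp

lemma fraction_cancel:
  assumes "x \<in> carrier M" "w \<in> W" "v \<in> W"
  shows "fraction M W (v \<odot>\<^bsub>M\<^esub> x) (v \<otimes> w) = fraction M W x w"
proof -
  have "\<one> \<odot>\<^bsub>M\<^esub> (w \<odot>\<^bsub>M\<^esub> (v \<odot>\<^bsub>M\<^esub> x)) = \<one> \<odot>\<^bsub>M\<^esub> ((v \<otimes> w) \<odot>\<^bsub>M\<^esub> x)"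
    using assms smult_commute[of w v x] by (simp add: smult_assoc1)
  then have "fraction_rel (v \<odot>\<^bsub>M\<^esub> x) (v \<otimes> w) x w" unfolding fraction_rel_def using W_one by blast
  then show ?thesis
    by (intro fraction_eq_iff[THEN iffD2, OF smult_closed[OF W_closed[OF assms(3)] assms(1)] assms(1) W_mult[OF assms(3,2)] assms(2)])
qed

lemma localization_add_same:
  assumes "x \<in> carrier M" "w \<in> W" "y \<in> carrier M"
  shows "fraction M W x w \<oplus>\<^bsub>localization R M W\<^esub> fraction M W y w = fraction M W (x \<oplus>\<^bsub>M\<^esub> y) w"
  using localization_add[OF assms(1,2,3,2)] fraction_cancel[OF M.add.m_closed[OF assms(1,3)] assms(2,2)]
    smult_r_distr[OF W_closed[OF assms(2)] assms(1,3)] by argo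

lemma common_denominator:
  assumes "X \<in> carrier (localization R M W)" "Y \<in> carrier (localization R M W)"
  obtains x y w where "x \<in> carrier M" "y \<in> carrier M" "w \<in> W" "X = fraction M W x w" "Y = fraction M W y w"
proof -
  obtain x w y v where *: "x \<in> carrier M" "w \<in> W" "X = fraction M W x w" "y \<in> carrier M" "v \<in> W" "Y = fraction M W y v"
    using assms by (auto simp: localization_carrier)
  have XY: "X = fraction M W (v \<odot>\<^bsub>M\<^esub> x) (v \<otimes> w)" "Y = fraction M W (w \<odot>\<^bsub>M\<^esub> y) (v \<otimes> w)"
    using fraction_cancel[OF *(1,2,5)] fraction_cancel[OF *(4,5,2)] R.m_comm[OF W_closed[OF *(2)] W_closed[OF *(5)]] *(3,6)
    by metis+
  have "v \<odot>\<^bsub>M\<^esub> x \<in> carrier M" "w \<odot>\<^bsub>M\<^esub> y \<in> carrier M" "v \<otimes> w \<in> W"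
    using *(1,2,4,5) W_mult by simp_all
  then show thesis using that XY by blast
qed

text \<open>Over a common denominator, the group laws are those of the numerators.\<close>

lemma abelian_group_localization: "abelian_group (localization R M W)"
proof (rule abelian_groupI)
  let ?L = "localization R M W"
  have mem: "fraction M W x w \<in> carrier ?L" if "x \<in> carrier M" "w \<in> W" for x w
    using that by (auto simp: localization_carrier)
  show "\<zero>\<^bsub>?L\<^esub> \<in> carrier ?L" using W_one by (auto simp: localization_zero intro: mem)
  fix X Y assume X: "X \<in> carrier ?L" and Y: "Y \<in> carrier ?L"
  obtain x y w where *: "x \<in> carrier M" "y \<in> carrier M" "w \<in> W" "X = fraction M W x w" "Y = fraction M W y w"
    using common_denominator[OF X Y] by metis
  note add = localization_add_same
  show "X \<oplus>\<^bsub>?L\<^esub> Y \<in> carrier ?L" unfolding *(4,5) add[OF *(1,3,2)] using * by (intro mem) auto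
  show "X \<oplus>\<^bsub>?L\<^esub> Y = Y \<oplus>\<^bsub>?L\<^esub> X"
    unfolding *(4,5) add[OF *(1,3,2)] add[OF *(2,3,1)] using * by (simp only: M.a_comm)
  have 0: "\<zero>\<^bsub>?L\<^esub> = fraction M W \<zero>\<^bsub>M\<^esub> w"
    using fraction_cancel[OF M.zero_closed W_one *(3)] *(3) by (simp add: localization_zero)
  show "\<zero>\<^bsub>?L\<^esub> \<oplus>\<^bsub>?L\<^esub> X = X" unfolding 0 *(4) add[OF M.zero_closed *(3,1)] using * by (simp only: M.l_zero)
  have "fraction M W (\<ominus>\<^bsub>M\<^esub> x) w \<oplus>\<^bsub>?L\<^esub> X = \<zero>\<^bsub>?L\<^esub>"
    unfolding 0 *(4) add[OF M.a_inv_closed[OF *(1)] *(3,1)] using * by (simp only: M.l_neg)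
  then show "\<exists>Y\<in>carrier ?L. Y \<oplus>\<^bsub>?L\<^esub> X = \<zero>\<^bsub>?L\<^esub>" using *(1,3) mem M.a_inv_closed by blast
  fix Z assume Z: "Z \<in> carrier ?L"
  then obtain z v where z: "z \<in> carrier M" "v \<in> W" "Z = fraction M W z v" by (auto simp: localization_carrier)
  have "X = fraction M W (v \<odot>\<^bsub>M\<^esub> x) (v \<otimes> w)" "Y = fraction M W (v \<odot>\<^bsub>M\<^esub> y) (v \<otimes> w)"
    "Z = fraction M W (w \<odot>\<^bsub>M\<^esub> z) (v \<otimes> w)"
    using fraction_cancel[OF *(1,3) z(2)] fraction_cancel[OF *(2,3) z(2)] fraction_cancel[OF z(1,2) *(3)]
      R.m_comm[OF W_closed[OF *(3)] W_closed[OF z(2)]] *(4,5) z(3) by metis+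
  then show "X \<oplus>\<^bsub>?L\<^esub> Y \<oplus>\<^bsub>?L\<^esub> Z = X \<oplus>\<^bsub>?L\<^esub> (Y \<oplus>\<^bsub>?L\<^esub> Z)"
    using *(1-3) z(1,2) W_mult by (simp only: add smult_closed W_closed M.add.m_closed M.a_assoc)
qed

end

section \<open>Differential operators in characteristic \<open>p\<^sup>m\<^sup>+\<^sup>1\<close>\<close>

text \<open>Isolates the facts about polynomials over \<open>Z/p^(m+1)\<close> on which the ring
  structure of the operators and their action on localizations rest. They are established in
  \<open>frobenius_diff_ops_poly_alg\<close>.\<close>

locale frobenius_diff_ops = S?: cring S
  for A :: "('a, 'n) ring_scheme" and S :: "('a, 'b, 'm) module_scheme" (structure) +
  fixes p :: nat
  assumes p_pos: "p > 0"
    and linear_endos_eq: "linear_endos A S = additive_endos S"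
    and diff_op_iff: "\<phi> \<in> additive_endos S \<Longrightarrow> (\<exists>k. killed_by_power S k \<phi>) \<longleftrightarrow>
      (\<exists>N. \<forall>w\<in>carrier S. commutes_with S \<phi> (w [^]\<^bsub>S\<^esub> (p ^ N)))"
begin

abbreviation D where "D \<equiv> diff_op_ring A S"

definition has_level :: "('b \<Rightarrow> 'b) \<Rightarrow> nat \<Rightarrow> bool" where
  "has_level \<phi> N \<longleftrightarrow> (\<forall>w\<in>carrier S. commutes_with S \<phi> (w [^]\<^bsub>S\<^esub> (p ^ N)))"

lemma D_carrier: "carrier D = diff_ops A S" by (simp add: diff_op_ring_def)

lemma D_simps:
  "\<phi> \<otimes>\<^bsub>D\<^esub> \<psi> = compose (carrier S) \<phi> \<psi>" "\<one>\<^bsub>D\<^esub> = (\<lambda>x\<in>carrier S. x)"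
  "\<zero>\<^bsub>D\<^esub> = (\<lambda>x\<in>carrier S. \<zero>\<^bsub>S\<^esub>)" "\<phi> \<oplus>\<^bsub>D\<^esub> \<psi> = (\<lambda>x\<in>carrier S. \<phi> x \<oplus>\<^bsub>S\<^esub> \<psi> x)"
  by (simp_all add: diff_op_ring_def)

lemma D_iff: "\<phi> \<in> carrier D \<longleftrightarrow> \<phi> \<in> additive_endos S \<and> (\<exists>N. has_level \<phi> N)"
  using diff_op_iff linear_endos_eq by (auto simp: D_carrier diff_ops_def has_level_def)

lemma D_endo: "\<phi> \<in> carrier D \<Longrightarrow> \<phi> \<in> additive_endos S" by (simp add: D_iff)

lemma D_closed [simp]: "\<phi> \<in> carrier D \<Longrightarrow> x \<in> carrier S \<Longrightarrow> \<phi> x \<in> carrier S"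
  using D_endo additive_endosD(1) by blast

lemma D_add: "\<phi> \<in> carrier D \<Longrightarrow> x \<in> carrier S \<Longrightarrow> y \<in> carrier S \<Longrightarrow> \<phi> (x \<oplus>\<^bsub>S\<^esub> y) = \<phi> x \<oplus>\<^bsub>S\<^esub> \<phi> y"
  using D_endo additive_endosD(2) by blast

lemma has_level_mono:
  assumes "\<phi> \<in> additive_endos S" "has_level \<phi> N" "N \<le> N'" shows "has_level \<phi> N'"
  unfolding has_level_def
proof
  fix w assume w: "w \<in> carrier S"
  have "p ^ N' = p ^ N * p ^ (N' - N)" using assms(3) by (simp flip: power_add)
  then have "w [^]\<^bsub>S\<^esub> (p ^ N') = (w [^]\<^bsub>S\<^esub> (p ^ N)) [^]\<^bsub>S\<^esub> (p ^ (N' - N))" using w by (simp add: nat_pow_pow)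
  then show "commutes_with S \<phi> (w [^]\<^bsub>S\<^esub> (p ^ N'))"
    using commutes_with_pow[OF assms(1)] assms(2) w by (simp add: has_level_def)
qed

lemma common_level:
  assumes "\<phi> \<in> carrier D" "\<psi> \<in> carrier D" obtains N where "has_level \<phi> N" "has_level \<psi> N"
proof -
  obtain N N' where "has_level \<phi> N" "has_level \<psi> N'" using assms by (auto simp: D_iff)
  then have "has_level \<phi> (max N N')" "has_level \<psi> (max N N')" using has_level_mono assms D_endo by fastforce+
  then show thesis using that by blast
qed

lemma D_compose:
  assumes "\<phi> \<in> carrier D" "\<psi> \<in> carrier D" shows "compose (carrier S) \<phi> \<psi> \<in> carrier D"
proof -
  obtain N where N: "has_level \<phi> N" "has_level \<psi> N" using common_level assms by blast
  have "compose (carrier S) \<phi> \<psi> \<in> additive_endos S"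
    using assms by (intro additive_endosI) (auto simp: compose_def D_add)
  moreover have "has_level (compose (carrier S) \<phi> \<psi>) N"
    using N assms by (auto simp: has_level_def commutes_with_def compose_def)
  ultimately show ?thesis by (auto simp: D_iff)
qed

lemma D_plus:
  assumes "\<phi> \<in> carrier D" "\<psi> \<in> carrier D" shows "(\<lambda>x\<in>carrier S. \<phi> x \<oplus>\<^bsub>S\<^esub> \<psi> x) \<in> carrier D"
proof -
  obtain N where N: "has_level \<phi> N" "has_level \<psi> N" using common_level assms by blast
  have "has_level (\<lambda>x\<in>carrier S. \<phi> x \<oplus>\<^bsub>S\<^esub> \<psi> x) N"
    using N assms by (auto simp: has_level_def commutes_with_def r_distr)
  then show ?thesis using additive_endos_add D_endo assms unfolding D_iff by blast
qed

lemma D_lmult: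
  assumes "\<phi> \<in> carrier D" "r \<in> carrier S" shows "(\<lambda>x\<in>carrier S. r \<otimes>\<^bsub>S\<^esub> \<phi> x) \<in> carrier D"
proof -
  obtain N where N: "has_level \<phi> N" using assms D_iff by blast
  have "has_level (\<lambda>x\<in>carrier S. r \<otimes>\<^bsub>S\<^esub> \<phi> x) N"
    using N assms by (auto simp: has_level_def commutes_with_def m_lcomm)
  then show ?thesis using additive_endos_lmult D_endo assms unfolding D_iff by blast
qed

lemma D_id: "(\<lambda>x\<in>carrier S. x) \<in> carrier D"
proof -
  have "has_level (\<lambda>x\<in>carrier S. x) 0" by (auto simp: has_level_def commutes_with_def)
  moreover have "(\<lambda>x\<in>carrier S. x) \<in> additive_endos S" by (rule additive_endosI) auto
  ultimately show ?thesis unfolding D_iff by blast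
qed

lemma D_mult_op: "r \<in> carrier S \<Longrightarrow> mult_op S r \<in> carrier D"
  using D_lmult[OF D_id, of r] by (simp add: mult_op_def cong: restrict_cong)

lemma mult_op_apply: "x \<in> carrier S \<Longrightarrow> mult_op S r x = r \<otimes>\<^bsub>S\<^esub> x" by (simp add: mult_op_def)

lemma D_ext:
  assumes "\<phi> \<in> carrier D" "\<psi> \<in> carrier D" "\<And>x. x \<in> carrier S \<Longrightarrow> \<phi> x = \<psi> x" shows "\<phi> = \<psi>"
  using assms additive_endosD(3)[OF D_endo] by (intro ext) metis

lemma D_zero: "(\<lambda>x\<in>carrier S. \<zero>\<^bsub>S\<^esub>) \<in> carrier D"
  using D_lmult[OF D_id zero_closed] by (simp cong: restrict_cong)

lemma D_neg:
  assumes "\<phi> \<in> carrier D" shows "(\<lambda>x\<in>carrier S. \<ominus>\<^bsub>S\<^esub> \<phi> x) \<in> carrier D"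
proof -
  have "(\<lambda>x\<in>carrier S. \<ominus>\<^bsub>S\<^esub> \<phi> x) = (\<lambda>x\<in>carrier S. (\<ominus>\<^bsub>S\<^esub> \<one>\<^bsub>S\<^esub>) \<otimes>\<^bsub>S\<^esub> \<phi> x)"
    using assms by (intro restrict_ext) (simp add: l_minus)
  then show ?thesis using D_lmult[OF assms, of "\<ominus>\<^bsub>S\<^esub> \<one>\<^bsub>S\<^esub>"] by simp
qed

lemma ring_D: "ring D"
proof (rule ringI)
  show "abelian_group D"
  proof (rule abelian_groupI)
    fix \<phi> assume \<phi>: "\<phi> \<in> carrier D"
    have "(\<lambda>x\<in>carrier S. \<ominus>\<^bsub>S\<^esub> \<phi> x) \<oplus>\<^bsub>D\<^esub> \<phi> = \<zero>\<^bsub>D\<^esub>"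
      unfolding D_simps using \<phi> by (intro restrict_ext) (simp add: l_neg)
    then show "\<exists>\<psi>\<in>carrier D. \<psi> \<oplus>\<^bsub>D\<^esub> \<phi> = \<zero>\<^bsub>D\<^esub>" using D_neg[OF \<phi>] by blast
    show "\<zero>\<^bsub>D\<^esub> \<oplus>\<^bsub>D\<^esub> \<phi> = \<phi>"
    proof (rule D_ext)
      show "\<zero>\<^bsub>D\<^esub> \<oplus>\<^bsub>D\<^esub> \<phi> \<in> carrier D" unfolding D_simps(4) by (rule D_plus[OF _ \<phi>]) (use D_zero in \<open>simp only: D_simps(3)\<close>)
    qed (use \<phi> in \<open>auto simp: D_simps\<close>)
  qed (unfold D_simps, auto simp: D_plus D_zero a_ac intro!: restrict_ext simp del: restrict_apply[abs_def])
  show "monoid D"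
  proof (rule monoidI)
    fix \<phi> assume \<phi>: "\<phi> \<in> carrier D"
    show "\<one>\<^bsub>D\<^esub> \<otimes>\<^bsub>D\<^esub> \<phi> = \<phi>" "\<phi> \<otimes>\<^bsub>D\<^esub> \<one>\<^bsub>D\<^esub> = \<phi>"
      by (rule D_ext; use \<phi> D_compose D_id in \<open>simp add: D_simps\<close>; simp add: compose_def \<phi>)+
  qed (auto simp: D_simps D_compose[unfolded compose_def] D_id compose_def intro!: restrict_ext)
qed (auto simp: D_simps compose_def D_add intro!: restrict_ext)

end

section \<open>The action of differential operators on a localization\<close>

locale diff_op_localization = frobenius_diff_ops A S p
  for A :: "('a, 'n) ring_scheme" and S :: "('a, 'b, 'm) module_scheme" (structure) and p +
  fixes W
  assumes W_sub: "W \<subseteq> carrier S" and one_W: "\<one>\<^bsub>S\<^esub> \<in> W"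
    and mult_W: "v \<in> W \<Longrightarrow> w \<in> W \<Longrightarrow> v \<otimes>\<^bsub>S\<^esub> w \<in> W"
    and regular: "w \<in> W \<Longrightarrow> x \<in> carrier S \<Longrightarrow> w \<otimes>\<^bsub>S\<^esub> x = \<zero>\<^bsub>S\<^esub> \<Longrightarrow> x = \<zero>\<^bsub>S\<^esub>"
begin

lemma regular_simps [simp]:
  "carrier (regular_module S) = carrier S" "\<zero>\<^bsub>regular_module S\<^esub> = \<zero>\<^bsub>S\<^esub>"
  "x \<oplus>\<^bsub>regular_module S\<^esub> y = x \<oplus>\<^bsub>S\<^esub> y" "r \<odot>\<^bsub>regular_module S\<^esub> x = r \<otimes>\<^bsub>S\<^esub> x"
  by (simp_all add: regular_module_def)

lemma left_module_regular: "left_module S (regular_module S)"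
proof -
  have "abelian_group (regular_module S)"
    by (rule abelian_groupI) (auto simp: a_ac intro: l_neg)
  then show ?thesis
    by (intro left_module.intro left_module_axioms.intro ring_axioms)
      (auto simp: l_distr r_distr m_assoc)
qed

sublocale L: module_localization S "regular_module S" W
  by (intro module_localization.intro left_module_regular module_localization_axioms.intro
      S.is_cring W_sub one_W mult_W)

abbreviation L where "L \<equiv> localization S (regular_module S) W"
abbreviation frac where "frac \<equiv> fraction (regular_module S) W"

lemma cancel_W:
  assumes "w \<in> W" "x \<in> carrier S" "y \<in> carrier S" "w \<otimes>\<^bsub>S\<^esub> x = w \<otimes>\<^bsub>S\<^esub> y" shows "x = y"
proof -
  have "w \<otimes>\<^bsub>S\<^esub> (x \<ominus>\<^bsub>S\<^esub> y) = \<zero>\<^bsub>S\<^esub>"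
    using assms by (simp add: a_minus_def r_distr r_minus r_neg)
  then show ?thesis using regular[OF assms(1), of "x \<ominus>\<^bsub>S\<^esub> y"] assms by (simp add: r_right_minus_eq)
qed

lemma frac_eq_iff:
  assumes "x \<in> carrier S" "y \<in> carrier S" "w \<in> W" "v \<in> W"
  shows "frac x w = frac y v \<longleftrightarrow> v \<otimes>\<^bsub>S\<^esub> x = w \<otimes>\<^bsub>S\<^esub> y"
proof -
  have "frac x w = frac y v \<longleftrightarrow> L.fraction_rel x w y v" using assms by (intro L.fraction_eq_iff) auto
  also have "\<dots> \<longleftrightarrow> v \<otimes>\<^bsub>S\<^esub> x = w \<otimes>\<^bsub>S\<^esub> y"
    using assms cancel_W[of _ "v \<otimes>\<^bsub>S\<^esub> x" "w \<otimes>\<^bsub>S\<^esub> y"] one_W by (auto simp: L.fraction_rel_def)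
  finally show ?thesis .
qed

lemma pow_W: "w \<in> W \<Longrightarrow> w [^]\<^bsub>S\<^esub> (k::nat) \<in> W"
  by (induction k) (auto simp: one_W mult_W)

lemma frac_in_L: "x \<in> carrier S \<Longrightarrow> w \<in> W \<Longrightarrow> frac x w \<in> carrier L"
  by (auto simp: L.localization_carrier)

lemma L_zero: "\<zero>\<^bsub>L\<^esub> = frac \<zero>\<^bsub>S\<^esub> \<one>\<^bsub>S\<^esub>" by (simp add: L.localization_zero)

lemma frac_add: "x \<in> carrier S \<Longrightarrow> y \<in> carrier S \<Longrightarrow> w \<in> W \<Longrightarrow> frac x w \<oplus>\<^bsub>L\<^esub> frac y w = frac (x \<oplus>\<^bsub>S\<^esub> y) w"
  using L.localization_add_same[of x w y] by simp

lemma frac_smult: "r \<in> carrier S \<Longrightarrow> x \<in> carrier S \<Longrightarrow> w \<in> W \<Longrightarrow> r \<odot>\<^bsub>L\<^esub> frac x w = frac (r \<otimes>\<^bsub>S\<^esub> x) w"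
  using L.localization_smult[of r x w] by simp

text \<open>Any fraction \<open>x/w\<close> equals \<open>x w\<^sup>q\<^sup>-\<^sup>1/w\<^sup>q\<close>, where \<open>q = p\<^sup>N\<close> is such that the operators commute with \<open>w\<^sup>q\<close>.\<close>

lemma good_denominator:
  assumes "\<phi> \<in> carrier D" "\<psi> \<in> carrier D" "X \<in> carrier L" "Y \<in> carrier L"
  obtains x y w where "x \<in> carrier S" "y \<in> carrier S" "w \<in> W" "X = frac x w" "Y = frac y w"
    "commutes_with S \<phi> w" "commutes_with S \<psi> w"
proof -
  obtain x y w where c: "x \<in> carrier S" "y \<in> carrier S" and w: "w \<in> W" and XY: "X = frac x w" "Y = frac y w"
    using L.common_denominator[OF assms(3,4)] by auto
  obtain N where N: "has_level \<phi> N" "has_level \<psi> N" using common_level[OF assms(1,2)] by blast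
  obtain k where k: "p ^ N = Suc k" using p_pos by (metis gr0_conv_Suc zero_less_power)
  define v where "v = w [^]\<^bsub>S\<^esub> k"
  have v: "v \<in> W" using pow_W[OF w] by (simp add: v_def)
  have vw: "v \<otimes>\<^bsub>S\<^esub> w = w [^]\<^bsub>S\<^esub> (p ^ N)" by (simp add: v_def k)
  have "X = frac (v \<otimes>\<^bsub>S\<^esub> x) (v \<otimes>\<^bsub>S\<^esub> w)" "Y = frac (v \<otimes>\<^bsub>S\<^esub> y) (v \<otimes>\<^bsub>S\<^esub> w)"
    using L.fraction_cancel[of x w v] L.fraction_cancel[of y w v] c w v XY by simp_all
  moreover have "commutes_with S \<phi> (v \<otimes>\<^bsub>S\<^esub> w)" "commutes_with S \<psi> (v \<otimes>\<^bsub>S\<^esub> w)"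
    using N w unfolding vw has_level_def by auto
  moreover have "v \<otimes>\<^bsub>S\<^esub> x \<in> carrier S" "v \<otimes>\<^bsub>S\<^esub> y \<in> carrier S" "v \<otimes>\<^bsub>S\<^esub> w \<in> W"
    using c v w mult_W by auto
  ultimately show thesis using that by blast
qed

text \<open>Acting on the numerator is legitimate only if the denominator commutes with
  \<open>\<phi>\<close>, hence the filter on representatives. By \<open>good_denominator\<close>
  some representative passes it, and by \<open>loc_act_frac\<close> all of these give the same
  fraction.\<close>

definition loc_act :: "('b \<Rightarrow> 'b) \<Rightarrow> ('b \<times> 'b) set \<Rightarrow> ('b \<times> 'b) set" where
  "loc_act = (\<lambda>\<phi>\<in>carrier D. \<lambda>X\<in>carrier L. \<Union>q\<in>{q\<in>X. commutes_with S \<phi> (snd q)}. frac (\<phi> (fst q)) (snd q))"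

text \<open>For commuting denominators, \<open>w y = v x\<close> gives
  \<open>w \<phi>(y) = \<phi>(w y) = \<phi>(v x) = v \<phi>(x)\<close>, so the choice of
  representative does not matter.\<close>

lemma loc_act_frac:
  assumes \<phi>: "\<phi> \<in> carrier D" and x: "x \<in> carrier S" and w: "w \<in> W" "commutes_with S \<phi> w"
  shows "loc_act \<phi> (frac x w) = frac (\<phi> x) w"
proof -
  have "(\<Union>q\<in>{q\<in>frac x w. commutes_with S \<phi> (snd q)}. frac (\<phi> (fst q)) (snd q)) = frac (\<phi> x) w"
  proof (rule UN_constant_eq)
    show "(x, w) \<in> {q\<in>frac x w. commutes_with S \<phi> (snd q)}"
      using L.fraction_self[of x w] x w by simp
    show "\<forall>q\<in>{q \<in> frac x w. commutes_with S \<phi> (snd q)}. frac (\<phi> (fst q)) (snd q) = frac (\<phi> x) w"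
    proof
      fix q assume q: "q \<in> {q \<in> frac x w. commutes_with S \<phi> (snd q)}"
      obtain y v where [simp]: "q = (y, v)" by fastforce
      have yv: "(y, v) \<in> frac x w" "commutes_with S \<phi> (snd (y, v))" using q by auto
      then have c: "y \<in> carrier S" "v \<in> W" and "frac y v = frac x w"
        using L.mem_fraction_iff[of x w y v] x w by auto
      then have "w \<otimes>\<^bsub>S\<^esub> y = v \<otimes>\<^bsub>S\<^esub> x" using frac_eq_iff c x w by auto
      then have "w \<otimes>\<^bsub>S\<^esub> \<phi> y = v \<otimes>\<^bsub>S\<^esub> \<phi> x"
        using w(2) yv(2) c(1) x unfolding commutes_with_def by (metis snd_conv)
      then show "frac (\<phi> (fst q)) (snd q) = frac (\<phi> x) w"
        using frac_eq_iff[of "\<phi> y" "\<phi> x" v w] c x w \<phi> by simp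
    qed
  qed
  then show ?thesis using \<phi> frac_in_L[OF x w(1)] by (simp add: loc_act_def)
qed

lemma commutes_with_one: "\<phi> \<in> carrier D \<Longrightarrow> commutes_with S \<phi> \<one>\<^bsub>S\<^esub>"
  by (simp add: commutes_with_def)

lemma loc_act_closed: "\<phi> \<in> carrier D \<Longrightarrow> X \<in> carrier L \<Longrightarrow> loc_act \<phi> X \<in> carrier L"
  by (rule good_denominator[of \<phi> \<phi> X X]) (auto simp: loc_act_frac intro: frac_in_L)

lemma loc_act_add:
  assumes "\<phi> \<in> carrier D" "X \<in> carrier L" "Y \<in> carrier L"
  shows "loc_act \<phi> (X \<oplus>\<^bsub>L\<^esub> Y) = loc_act \<phi> X \<oplus>\<^bsub>L\<^esub> loc_act \<phi> Y"
proof -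
  obtain x y w where *: "x \<in> carrier S" "y \<in> carrier S" "w \<in> W" "X = frac x w" "Y = frac y w" "commutes_with S \<phi> w"
    using good_denominator[OF assms(1,1,2,3)] by metis
  show ?thesis unfolding *(4,5) frac_add[OF *(1,2,3)] using * assms by (simp add: loc_act_frac frac_add D_add)
qed

lemma loc_act_plus:
  assumes "\<phi> \<in> carrier D" "\<psi> \<in> carrier D" "X \<in> carrier L"
  shows "loc_act (\<phi> \<oplus>\<^bsub>D\<^esub> \<psi>) X = loc_act \<phi> X \<oplus>\<^bsub>L\<^esub> loc_act \<psi> X"
proof -
  obtain x w where *: "x \<in> carrier S" "w \<in> W" "X = frac x w" "commutes_with S \<phi> w" "commutes_with S \<psi> w"
    using good_denominator[OF assms(1,2,3,3)] by metis
  have d: "\<phi> \<oplus>\<^bsub>D\<^esub> \<psi> \<in> carrier D" using assms by (simp only: D_simps D_plus)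
  have "commutes_with S (\<phi> \<oplus>\<^bsub>D\<^esub> \<psi>) w"
    using * assms by (auto simp: commutes_with_def D_simps r_distr)
  then show ?thesis unfolding *(3) loc_act_frac[OF d *(1,2) \<open>commutes_with S (\<phi> \<oplus>\<^bsub>D\<^esub> \<psi>) w\<close>]
      loc_act_frac[OF assms(1) *(1,2,4)] loc_act_frac[OF assms(2) *(1,2,5)]
    using * assms by (simp add: frac_add D_simps)
qed

lemma loc_act_mult:
  assumes "\<phi> \<in> carrier D" "\<psi> \<in> carrier D" "X \<in> carrier L"
  shows "loc_act (\<phi> \<otimes>\<^bsub>D\<^esub> \<psi>) X = loc_act \<phi> (loc_act \<psi> X)"
proof -
  obtain x w where *: "x \<in> carrier S" "w \<in> W" "X = frac x w" "commutes_with S \<phi> w" "commutes_with S \<psi> w"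
    using good_denominator[OF assms(1,2,3,3)] by metis
  have d: "\<phi> \<otimes>\<^bsub>D\<^esub> \<psi> \<in> carrier D" using assms by (simp only: D_simps D_compose)
  have c: "commutes_with S (\<phi> \<otimes>\<^bsub>D\<^esub> \<psi>) w"
    using * assms by (auto simp: commutes_with_def D_simps compose_def)
  show ?thesis unfolding *(3) loc_act_frac[OF d *(1,2) c] loc_act_frac[OF assms(2) *(1,2,5)]
      loc_act_frac[OF assms(1) D_closed[OF assms(2) *(1)] *(2,4)]
    using * by (simp add: D_simps compose_def)
qed

lemma loc_act_mult_op:
  assumes "r \<in> carrier S" "X \<in> carrier L"
  shows "loc_act (mult_op S r) X = r \<odot>\<^bsub>L\<^esub> X"
proof -
  note d = D_mult_op[OF assms(1)]
  obtain x w where *: "x \<in> carrier S" "w \<in> W" "X = frac x w" "commutes_with S (mult_op S r) w"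
    using good_denominator[OF d d assms(2,2)] by metis
  show ?thesis unfolding *(3) loc_act_frac[OF d *(1,2,4)] frac_smult[OF assms(1) *(1,2)] using * by (simp add: mult_op_apply)
qed

lemma loc_act_one:
  assumes "X \<in> carrier L" shows "loc_act \<one>\<^bsub>D\<^esub> X = X"
proof -
  have d: "\<one>\<^bsub>D\<^esub> \<in> carrier D" using D_id by (simp only: D_simps)
  obtain x w where *: "x \<in> carrier S" "w \<in> W" "X = frac x w" "commutes_with S \<one>\<^bsub>D\<^esub> w"
    using good_denominator[OF d d assms assms] by metis
  show ?thesis unfolding *(3) loc_act_frac[OF d *(1,2,4)] using * by (simp add: D_simps)
qed

lemma extends_loc_act: "extends_to_localization A S W loc_act"
proof -
  have "loc_act \<in> carrier D \<rightarrow>\<^sub>E carrier L \<rightarrow>\<^sub>E carrier L"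
  proof (intro PiE_I)
    show "\<phi> \<notin> carrier D \<Longrightarrow> loc_act \<phi> = undefined" for \<phi> by (simp add: loc_act_def)
    show "\<phi> \<in> carrier D \<Longrightarrow> X \<notin> carrier L \<Longrightarrow> loc_act \<phi> X = undefined" for \<phi> X by (simp add: loc_act_def)
  qed (rule loc_act_closed)
  moreover have "loc_act \<phi> (frac h \<one>\<^bsub>S\<^esub>) = frac (\<phi> h) \<one>\<^bsub>S\<^esub>" if "\<phi> \<in> carrier D" "h \<in> carrier S" for \<phi> h
    using that by (intro loc_act_frac one_W commutes_with_one)
  ultimately show ?thesis
    unfolding extends_to_localization_def Let_def
    by (intro conjI ballI loc_act_add loc_act_plus loc_act_mult loc_act_one loc_act_mult_op; assumption?)
qed

text \<open>Write \<open>X = x/w\<close> with \<open>w\<close> commuting with \<open>\<phi>\<close>.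
  In any extension \<open>w (\<phi> X) = \<phi> (w X) = \<phi>(x)/1\<close>, and cancelling the
  nonzerodivisor \<open>w\<close> leaves no choice for \<open>\<phi> X\<close>.\<close>

lemma extends_unique:
  assumes ext: "extends_to_localization A S W act" shows "act = loc_act"
proof -
  note e = ext[unfolded extends_to_localization_def Let_def]
  have PiE: "act \<in> carrier D \<rightarrow>\<^sub>E carrier L \<rightarrow>\<^sub>E carrier L" by (rule e[THEN conjunct1])
  have actm: "act (\<phi> \<otimes>\<^bsub>D\<^esub> \<psi>) x = act \<phi> (act \<psi> x)" if "\<phi> \<in> carrier D" "\<psi> \<in> carrier D" "x \<in> carrier L" for \<phi> \<psi> x
    using e[THEN conjunct2, THEN conjunct2, THEN conjunct2, THEN conjunct1, THEN bspec, THEN bspec, THEN bspec, OF that] .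
  have acto: "act (mult_op S r) X = r \<odot>\<^bsub>L\<^esub> X" if "r \<in> carrier S" "X \<in> carrier L" for r X
    using e[THEN conjunct2, THEN conjunct2, THEN conjunct2, THEN conjunct2, THEN conjunct2, THEN conjunct1, THEN bspec, THEN bspec, OF that] .
  have act1: "act \<phi> (frac h \<one>\<^bsub>S\<^esub>) = frac (\<phi> h) \<one>\<^bsub>S\<^esub>" if "\<phi> \<in> carrier D" "h \<in> carrier S" for \<phi> h
    using e[THEN conjunct2, THEN conjunct2, THEN conjunct2, THEN conjunct2, THEN conjunct2, THEN conjunct2, THEN bspec, THEN bspec, OF that] .
  have "act \<phi> X = loc_act \<phi> X" if \<phi>: "\<phi> \<in> carrier D" and X: "X \<in> carrier L" for \<phi> X
  proof -
    obtain x w where *: "x \<in> carrier S" "w \<in> W" "X = frac x w" "commutes_with S \<phi> w"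
      using good_denominator[OF \<phi> \<phi> X X] by metis
    have w: "w \<in> carrier S" using *(2) by simp
    note d = D_mult_op[OF w]
    have aX: "act \<phi> X \<in> carrier L" using PiE \<phi> X by (auto simp: PiE_def Pi_def)
    have comm: "\<phi> \<otimes>\<^bsub>D\<^esub> mult_op S w = mult_op S w \<otimes>\<^bsub>D\<^esub> \<phi>"
      unfolding D_simps compose_def using *(4) \<phi> by (intro restrict_ext) (simp add: mult_op_apply commutes_with_def)
    have wX: "w \<odot>\<^bsub>L\<^esub> X = frac x \<one>\<^bsub>S\<^esub>"
      unfolding *(3) frac_smult[OF w *(1,2)] using frac_eq_iff[of "w \<otimes>\<^bsub>S\<^esub> x" x w "\<one>\<^bsub>S\<^esub>"] *(1,2) one_W by simp
    have "w \<odot>\<^bsub>L\<^esub> act \<phi> X = act (mult_op S w \<otimes>\<^bsub>D\<^esub> \<phi>) X"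
      using actm[OF d \<phi> X] acto[OF w aX] by simp
    also have "\<dots> = act \<phi> (w \<odot>\<^bsub>L\<^esub> X)" unfolding comm[symmetric] using actm[OF \<phi> d X] acto[OF w X] by simp
    also have "\<dots> = frac (\<phi> x) \<one>\<^bsub>S\<^esub>" unfolding wX using act1[OF \<phi> *(1)] .
    finally have 1: "w \<odot>\<^bsub>L\<^esub> act \<phi> X = frac (\<phi> x) \<one>\<^bsub>S\<^esub>" .
    obtain y v where y: "y \<in> carrier S" "v \<in> W" "act \<phi> X = frac y v" using aX by (auto simp: L.localization_carrier)
    have "frac (w \<otimes>\<^bsub>S\<^esub> y) v = frac (\<phi> x) \<one>\<^bsub>S\<^esub>" using 1 unfolding y(3) frac_smult[OF w y(1,2)] .
    then have "w \<otimes>\<^bsub>S\<^esub> y = v \<otimes>\<^bsub>S\<^esub> \<phi> x"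
      using frac_eq_iff[of "w \<otimes>\<^bsub>S\<^esub> y" "\<phi> x" v "\<one>\<^bsub>S\<^esub>"] y(1,2) w \<phi> *(1) one_W by simp
    then have "frac y v = frac (\<phi> x) w" using frac_eq_iff[of y "\<phi> x" v w] y(1,2) \<phi> *(1,2) by simp
    then show ?thesis unfolding y(3) unfolding *(3) loc_act_frac[OF \<phi> *(1,2,4)] .
  qed
  note eq = this
  have L2: "loc_act \<in> carrier D \<rightarrow>\<^sub>E carrier L \<rightarrow>\<^sub>E carrier L"
    by (rule extends_loc_act[unfolded extends_to_localization_def Let_def, THEN conjunct1])
  show ?thesis
  proof (rule PiE_ext[OF PiE L2])
    fix \<phi> assume \<phi>: "\<phi> \<in> carrier D"
    show "act \<phi> = loc_act \<phi>"
      by (rule PiE_ext[OF PiE_mem[OF PiE \<phi>] PiE_mem[OF L2 \<phi>]]) (rule eq[OF \<phi>])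
  qed
qed

lemma D_localization_eq: "D_localization A S W = with_smult L loc_act"
  unfolding D_localization_def
  using the_equality[of "extends_to_localization A S W", OF extends_loc_act extends_unique] by simp

lemma left_module_D_localization: "left_module D (D_localization A S W)"
proof -
  have "abelian_group L" by (rule L.abelian_group_localization)
  then interpret Lg: abelian_group L .
  have "abelian_group (with_smult L loc_act)"
    by (rule abelian_groupI) (auto simp: Lg.a_ac intro: Lg.l_neg)
  then show ?thesis unfolding D_localization_eq
    by (intro left_module.intro left_module_axioms.intro ring_D)
      (simp_all add: loc_act_closed loc_act_add loc_act_plus loc_act_mult loc_act_one)
qed

lemma D_localization_smult:
  "\<phi> \<in> carrier D \<Longrightarrow> x \<in> carrier S \<Longrightarrow> w \<in> W \<Longrightarrow> commutes_with S \<phi> w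
    \<Longrightarrow> \<phi> \<odot>\<^bsub>D_localization A S W\<^esub> frac x w = frac (\<phi> x) w"
  by (simp add: D_localization_eq loc_act_frac)

end

section \<open>Polynomials modulo an integer\<close>

lemma lookup_reduce [simp]: "lookup (reduce N h) e = lookup h e mod N"
  by (simp add: reduce_def Poly_Mapping.map.rep_eq when_def)

lemma reduce_eq_iff: "reduce N a = reduce N b \<longleftrightarrow> (\<forall>e. [lookup a e = lookup b e] (mod N))"
  by (auto simp: poly_mapping_eq_iff fun_eq_iff cong_def)

lemma lookup_const_mult [simp]:
  "lookup (single 0 c * h) e = c * lookup h e" for c :: "'a::comm_semiring_1"
  by (simp add: mult_map_scale_conv_mult[symmetric] Poly_Mapping.map.rep_eq when_def)

lemma map_mult_eq: "Poly_Mapping.map (\<lambda>c. a * c) h = single 0 a * h" for a :: "'a::comm_semiring_1"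
  using mult_map_scale_conv_mult[of a h] by simp

lemma reduce_add_multiple: "reduce N (b + single 0 N * c) = reduce N b"
  by (rule poly_mapping_eqI) (simp add: lookup_add)

lemma reduce_eq_imp_multiple:
  assumes "reduce N a = reduce N b" shows "\<exists>c. a = b + single 0 N * c"
proof -
  have "\<exists>k. lookup (a - b) e = N * k" for e
    using assms by (auto simp: reduce_eq_iff lookup_minus cong_iff_dvd_diff dvd_def)
  then obtain k where k: "\<And>e. lookup (a - b) e = N * k e" by metis
  have "a - b = single 0 N * Poly_Mapping.map (\<lambda>x. x div N) (a - b)"
    by (rule poly_mapping_eqI) (simp add: Poly_Mapping.map.rep_eq when_def k)
  then show ?thesis by (metis add_diff_cancel_left' diff_add_cancel add.commute)
qed

lemma reduce_reduce [simp]: "reduce N (reduce N h) = reduce N h"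
  by (rule poly_mapping_eqI) simp

lemma reduce_add_cong: "reduce N a = reduce N a' \<Longrightarrow> reduce N b = reduce N b' \<Longrightarrow> reduce N (a + b) = reduce N (a' + b')"
  by (auto simp: reduce_eq_iff lookup_add cong_add)

lemma reduce_diff_cong: "reduce N a = reduce N a' \<Longrightarrow> reduce N b = reduce N b' \<Longrightarrow> reduce N (a - b) = reduce N (a' - b')"
  by (auto simp: reduce_eq_iff lookup_minus cong_diff)

lemma reduce_mult_cong:
  assumes "reduce N a = reduce N a'" "reduce N b = reduce N b'" shows "reduce N (a * b) = reduce N (a' * b')"
proof -
  obtain c d where "a = a' + single 0 N * c" "b = b' + single 0 N * d"
    using assms reduce_eq_imp_multiple by metis
  then have "a * b = a' * b' + single 0 N * (c * b + a' * d)" by (simp add: algebra_simps)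
  then show ?thesis by (simp add: reduce_add_multiple)
qed

lemma reduce_power_cong: "reduce N a = reduce N a' \<Longrightarrow> reduce N (a ^ k) = reduce N (a' ^ k)"
  by (induction k) (auto intro: reduce_mult_cong)

lemma reduce_simps [simp]:
  "reduce N (reduce N a + b) = reduce N (a + b)" "reduce N (a + reduce N b) = reduce N (a + b)"
  "reduce N (reduce N a - b) = reduce N (a - b)" "reduce N (a - reduce N b) = reduce N (a - b)"
  "reduce N (reduce N a * b) = reduce N (a * b)" "reduce N (a * reduce N b) = reduce N (a * b)"
  "reduce N (reduce N a ^ k) = reduce N (a ^ k)"
  by (auto intro: reduce_add_cong reduce_diff_cong reduce_mult_cong reduce_power_cong)

lemma reduce_zero [simp]: "reduce N 0 = 0" by (rule poly_mapping_eqI) simp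

lemma mpolys_iff: "h \<in> mpolys V \<longleftrightarrow> (\<forall>e. lookup h e \<noteq> 0 \<longrightarrow> keys e \<subseteq> V)"
  by (auto simp: mpolys_def in_keys_iff)

lemma mpolys_add: "a \<in> mpolys V \<Longrightarrow> b \<in> mpolys V \<Longrightarrow> a + b \<in> mpolys V" for a :: "'a::comm_monoid_add mpoly"
  unfolding mpolys_iff lookup_add by (metis add.right_neutral add.left_neutral)

lemma mpolys_uminus: "a \<in> mpolys V \<Longrightarrow> - a \<in> mpolys V" for a :: "'a::ab_group_add mpoly"
  by (auto simp: mpolys_iff)

lemma mpolys_diff: "a \<in> mpolys V \<Longrightarrow> b \<in> mpolys V \<Longrightarrow> a - b \<in> mpolys V" for a :: "'a::ab_group_add mpoly"
  using mpolys_add[of a V "- b"] mpolys_uminus[of b V] by simp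

lemma mpolys_mult: "a \<in> mpolys V \<Longrightarrow> b \<in> mpolys V \<Longrightarrow> a * b \<in> mpolys V" for a :: "'a::comm_semiring_1 mpoly"
proof -
  assume a: "a \<in> mpolys V" and b: "b \<in> mpolys V"
  have "keys e \<subseteq> V" if e: "e \<in> keys (a * b)" for e
  proof -
    obtain x y where xy: "e = x + y" "x \<in> keys a" "y \<in> keys b"
      using e keys_mult[of a b] by blast
    have "keys x \<subseteq> V" "keys y \<subseteq> V" using a b xy unfolding mpolys_def by auto
    then show ?thesis using Poly_Mapping.keys_add[of x y] unfolding xy(1) by blast
  qed
  then show ?thesis unfolding mpolys_def by blast
qed

lemma mpolys_reduce: "a \<in> mpolys V \<Longrightarrow> reduce N a \<in> mpolys V"
  unfolding mpolys_iff lookup_reduce by (metis mod_0)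

lemma mpolys_zero [simp]: "0 \<in> mpolys V" by (simp add: mpolys_def)

lemma mpolys_const [simp]: "single 0 c \<in> mpolys V" by (simp add: mpolys_def)

lemma mpolys_one [simp]: "1 \<in> mpolys V" by (simp add: mpolys_def)

lemma mpolys_Var: "i \<in> V \<Longrightarrow> Var i \<in> mpolys V" by (auto simp: mpolys_def Var_def)

lemma mpolys_power: "a \<in> mpolys V \<Longrightarrow> a ^ k \<in> mpolys V" for a :: "'a::comm_semiring_1 mpoly"
  by (induction k) (auto intro: mpolys_mult)

lemma mpolys_mono: "V \<subseteq> V' \<Longrightarrow> a \<in> mpolys V \<Longrightarrow> a \<in> mpolys V'"
  by (auto simp: mpolys_def)

lemma mpolys_sum: "(\<And>i. i \<in> I \<Longrightarrow> f i \<in> mpolys V) \<Longrightarrow> sum f I \<in> mpolys V" for f :: "'i \<Rightarrow> 'a::comm_monoid_add mpoly"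
  by (induction I rule: infinite_finite_induct) (auto intro: mpolys_add)

lemma mpoly_sum_monomials: "h = (\<Sum>e\<in>keys h. single e (lookup h e))"
  for h :: "'a::comm_monoid_add mpoly"
proof (rule poly_mapping_eqI)
  fix k show "lookup h k = lookup (\<Sum>e\<in>keys h. single e (lookup h e)) k"
    by (cases "k \<in> keys h")
      (auto simp: lookup_sum lookup_single when_def in_keys_iff sum.delta)
qed

lemma single_eq_Var_powers:
  "single e c = single 0 c * (\<Prod>i\<in>keys e. Var i ^ lookup e i)"
  for c :: "'a::comm_semiring_1"
proof -
  have vp: "Var i ^ k = single (single i k) (1::'a)" for i k
    by (induction k) (auto simp: Var_def mult_single single_add[symmetric])
  have "(\<Prod>i\<in>I. Var i ^ lookup e i) = single (\<Sum>i\<in>I. single i (lookup e i)) (1::'a)" for I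
    by (induction I rule: infinite_finite_induct) (auto simp: vp mult_single)
  moreover have "(\<Sum>i\<in>keys e. single i (lookup e i)) = e"
    by (rule poly_mapping_eqI) (auto simp: lookup_sum lookup_single when_def in_keys_iff sum.delta)
  ultimately show ?thesis by (simp add: mult_single)
qed

lemma mpolys_induct [consumes 1, case_names const var add mult]:
  fixes h :: "'a::comm_semiring_1 mpoly"
  assumes "h \<in> mpolys V"
    and const: "\<And>c. P (single 0 c)"
    and var: "\<And>i. i \<in> V \<Longrightarrow> P (Var i)"
    and add: "\<And>a b. a \<in> mpolys V \<Longrightarrow> b \<in> mpolys V \<Longrightarrow> P a \<Longrightarrow> P b \<Longrightarrow> P (a + b)"
    and mult: "\<And>a b. a \<in> mpolys V \<Longrightarrow> b \<in> mpolys V \<Longrightarrow> P a \<Longrightarrow> P b \<Longrightarrow> P (a * b)"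
  shows "P h"
proof -
  let ?Q = "\<lambda>a. a \<in> mpolys V \<and> P a"
  have pow: "?Q (a ^ k)" if "?Q a" for a k
    using that const[of 1] by (induction k) (auto intro: mult mpolys_mult)
  have prd: "?Q (\<Prod>i\<in>I. Var i ^ f i)" if "I \<subseteq> V" for I f
    using that
  proof (induction I rule: infinite_finite_induct)
    case (insert i I)
    then have "?Q (Var i ^ f i)" using pow mpolys_Var var by blast
    then show ?case using insert by (auto intro: mult mpolys_mult)
  qed (use const[of 1] in auto)
  have "?Q (\<Sum>e\<in>E. single e (lookup h e))" if "E \<subseteq> keys h" for E
    using that
  proof (induction E rule: infinite_finite_induct)
    case (insert e E)
    then have "keys e \<subseteq> V" using assms(1) by (auto simp: mpolys_def)
    then have "?Q (single e (lookup h e))"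
      unfolding single_eq_Var_powers[of e] using prd const by (auto intro!: mult mpolys_mult)
    then show ?case using insert by (auto intro: add mpolys_add)
  qed (use const[of 0] in auto)
  then show ?thesis using mpoly_sum_monomials[of h] by (metis subset_refl)
qed

lemma poly_alg_carrier: "N > 0 \<Longrightarrow> carrier (poly_alg N V) = {h \<in> mpolys V. reduce N h = h}"
proof -
  assume N: "N > 0"
  have "(\<forall>e. lookup h e \<in> carrier (residue_ring N)) \<longleftrightarrow> reduce N h = h" for h
  proof -
    have "c \<in> {0..N - 1} \<longleftrightarrow> c mod N = c" for c using N mod_pos_pos_trivial pos_mod_bound[OF N, of c] pos_mod_sign[OF N, of c] by auto
    then show ?thesis by (auto simp: residue_ring_def poly_mapping_eq_iff fun_eq_iff)
  qed
  then show ?thesis by (auto simp: poly_alg_def)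
qed

lemma poly_alg_simps:
  "x \<otimes>\<^bsub>poly_alg N V\<^esub> y = reduce N (x * y)" "\<one>\<^bsub>poly_alg N V\<^esub> = reduce N 1"
  "\<zero>\<^bsub>poly_alg N V\<^esub> = 0" "x \<oplus>\<^bsub>poly_alg N V\<^esub> y = reduce N (x + y)"
  "a \<odot>\<^bsub>poly_alg N V\<^esub> x = reduce N (single 0 a * x)"
  by (simp_all add: poly_alg_def map_mult_eq)

lemma reduce_in_poly_alg: "N > 0 \<Longrightarrow> h \<in> mpolys V \<Longrightarrow> reduce N h \<in> carrier (poly_alg N V)"
  by (simp add: poly_alg_carrier mpolys_reduce)

lemma poly_algD: "N > 0 \<Longrightarrow> h \<in> carrier (poly_alg N V) \<Longrightarrow> h \<in> mpolys V"
  "N > 0 \<Longrightarrow> h \<in> carrier (poly_alg N V) \<Longrightarrow> reduce N h = h"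
  by (simp_all add: poly_alg_carrier)

lemma cring_poly_alg: assumes N: "N > 0" shows "cring (poly_alg N V)"
proof (rule cringI)
  note c = poly_alg_carrier[OF N]
  show "abelian_group (poly_alg N V)"
  proof (rule abelian_groupI)
    fix x assume x: "x \<in> carrier (poly_alg N V)"
    have "reduce N (- x) \<oplus>\<^bsub>poly_alg N V\<^esub> x = \<zero>\<^bsub>poly_alg N V\<^esub>" by (simp add: poly_alg_simps)
    then show "\<exists>y\<in>carrier (poly_alg N V). y \<oplus>\<^bsub>poly_alg N V\<^esub> x = \<zero>\<^bsub>poly_alg N V\<^esub>"
      using x by (intro bexI[of _ "reduce N (- x)"]) (auto simp: c mpolys_uminus mpolys_reduce)
  qed (auto simp: c poly_alg_simps mpolys_add mpolys_reduce ac_simps)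
  show "Group.comm_monoid (poly_alg N V)"
    by (rule comm_monoidI) (auto simp: c poly_alg_simps mpolys_mult mpolys_reduce ac_simps)
qed (auto simp: poly_alg_simps algebra_simps)

lemma poly_alg_pow:
  assumes N: "N > 0" shows "x [^]\<^bsub>poly_alg N V\<^esub> (k::nat) = reduce N (x ^ k)"
proof -
  interpret cring "poly_alg N V" by (rule cring_poly_alg[OF N])
  show ?thesis by (induction k) (auto simp: poly_alg_simps mult.commute)
qed

lemma poly_alg_uminus:
  assumes N: "N > 0" and x: "x \<in> carrier (poly_alg N V)"
  shows "\<ominus>\<^bsub>poly_alg N V\<^esub> x = reduce N (- x)"
proof -
  interpret cring "poly_alg N V" by (rule cring_poly_alg[OF N])
  have "reduce N (- x) \<in> carrier (poly_alg N V)" using x N by (auto simp: poly_alg_carrier mpolys_uminus mpolys_reduce)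
  then show ?thesis using x by (intro minus_equality) (auto simp: poly_alg_simps)
qed

lemma poly_alg_minus:
  assumes N: "N > 0" and "y \<in> carrier (poly_alg N V)"
  shows "x \<ominus>\<^bsub>poly_alg N V\<^esub> y = reduce N (x - y)"
  using poly_alg_uminus[OF assms] by (simp add: a_minus_def poly_alg_simps)

lemma poly_alg_add_pow:
  assumes N: "N > 0" and x: "x \<in> carrier (poly_alg N V)"
  shows "add_pow (poly_alg N V) (k::nat) x = reduce N (single 0 (int k) * x)"
proof -
  interpret cring "poly_alg N V" by (rule cring_poly_alg[OF N])
  show ?thesis
  proof (induction k)
    case (Suc k)
    have "single 0 (int (Suc k)) * x = single 0 (int k) * x + x"
      unfolding single_of_nat by (simp add: distrib_right add.commute)
    then show ?case using Suc by (simp add: poly_alg_simps)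
  qed (simp add: poly_alg_simps)
qed

lemma (in cring) additive_endos_add_pow:
  assumes "\<phi> \<in> additive_endos R" "x \<in> carrier R" shows "\<phi> (add_pow R (k::nat) x) = add_pow R k (\<phi> x)"
  using assms by (induction k) (auto simp: additive_endos_zero additive_endosD)

text \<open>A scalar is represented by an integer in \<open>{0..<N}\<close>, so multiplication by it
  is repeated addition.\<close>

lemma linear_endos_poly_alg:
  assumes N: "N > 0"
  shows "linear_endos (residue_ring N) (poly_alg N V) = additive_endos (poly_alg N V)"
proof -
  interpret cring "poly_alg N V" by (rule cring_poly_alg[OF N])
  have "\<phi> (a \<odot>\<^bsub>poly_alg N V\<^esub> x) = a \<odot>\<^bsub>poly_alg N V\<^esub> \<phi> x"
    if "\<phi> \<in> additive_endos (poly_alg N V)" "a \<in> carrier (residue_ring N)" "x \<in> carrier (poly_alg N V)" for \<phi> a x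
  proof -
    have a: "a = int (nat a)" using that(2) by (simp add: residue_ring_def)
    have "a \<odot>\<^bsub>poly_alg N V\<^esub> y = add_pow (poly_alg N V) (nat a) y" if "y \<in> carrier (poly_alg N V)" for y
      unfolding poly_alg_add_pow[OF N that] poly_alg_simps using a by simp
    then show ?thesis using that additive_endos_add_pow additive_endosD(1) by auto
  qed
  then show ?thesis by (auto simp: linear_endos_def additive_endos_def)
qed

section \<open>Differential operators on polynomial rings\<close>

context cring
begin

lemma commutator_commute:
  assumes "\<phi> \<in> additive_endos R" "v \<in> carrier R" "w \<in> carrier R"
  shows "commutator R (commutator R \<phi> v) w = commutator R (commutator R \<phi> w) v"
proof
  fix x
  show "commutator R (commutator R \<phi> v) w x = commutator R (commutator R \<phi> w) v x"
  proof (cases "x \<in> carrier R")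
    case True
    have alg: "a \<ominus> v \<otimes> b \<ominus> w \<otimes> (c \<ominus> v \<otimes> d) = a \<ominus> w \<otimes> c \<ominus> v \<otimes> (b \<ominus> w \<otimes> d)"
      if "a \<in> carrier R" "b \<in> carrier R" "c \<in> carrier R" "d \<in> carrier R" for a b c d
      using that assms by algebra
    have "v \<otimes> (w \<otimes> x) = w \<otimes> (v \<otimes> x)" using True assms by (simp add: m_lcomm)
    then show ?thesis
      using alg[of "\<phi> (v \<otimes> (w \<otimes> x))" "\<phi> (w \<otimes> x)" "\<phi> (v \<otimes> x)" "\<phi> x"] True assms
      by (simp add: commutator_def additive_endosD)
  qed (simp add: commutator_def)
qed

lemma commutator_add_right:
  assumes "\<phi> \<in> additive_endos R" "v \<in> carrier R" "w \<in> carrier R"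
  shows "commutator R \<phi> (v \<oplus> w) = (\<lambda>x\<in>carrier R. commutator R \<phi> v x \<oplus> commutator R \<phi> w x)"
  unfolding commutator_def
proof (rule restrict_ext)
  fix x assume x: "x \<in> carrier R"
  have alg: "a \<oplus> b \<ominus> (v \<oplus> w) \<otimes> c = a \<ominus> v \<otimes> c \<oplus> (b \<ominus> w \<otimes> c)"
    if "a \<in> carrier R" "b \<in> carrier R" "c \<in> carrier R" for a b c using that assms by algebra
  show "\<phi> ((v \<oplus> w) \<otimes> x) \<ominus> (v \<oplus> w) \<otimes> \<phi> x =
     (\<lambda>x\<in>carrier R. \<phi> (v \<otimes> x) \<ominus> v \<otimes> \<phi> x) x \<oplus> (\<lambda>x\<in>carrier R. \<phi> (w \<otimes> x) \<ominus> w \<otimes> \<phi> x) x"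
    using alg[of "\<phi> (v \<otimes> x)" "\<phi> (w \<otimes> x)" "\<phi> x"] x assms by (simp add: additive_endosD l_distr)
qed

lemma commutator_mult_right:
  assumes "\<phi> \<in> additive_endos R" "v \<in> carrier R" "w \<in> carrier R"
  shows "commutator R \<phi> (v \<otimes> w) = (\<lambda>x\<in>carrier R. (\<lambda>x\<in>carrier R. commutator R \<phi> v (w \<otimes> x)) x \<oplus>
    (\<lambda>x\<in>carrier R. v \<otimes> commutator R \<phi> w x) x)"
  unfolding commutator_def
proof (rule restrict_ext)
  fix x assume x: "x \<in> carrier R"
  have alg: "a \<ominus> (v \<otimes> w) \<otimes> c = a \<ominus> v \<otimes> b \<oplus> v \<otimes> (b \<ominus> w \<otimes> c)"
    if "a \<in> carrier R" "b \<in> carrier R" "c \<in> carrier R" for a b c using that assms by algebra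
  show "\<phi> (v \<otimes> w \<otimes> x) \<ominus> v \<otimes> w \<otimes> \<phi> x =
     (\<lambda>x\<in>carrier R. (\<lambda>x\<in>carrier R. \<phi> (v \<otimes> x) \<ominus> v \<otimes> \<phi> x) (w \<otimes> x)) x \<oplus>
     (\<lambda>x\<in>carrier R. v \<otimes> (\<lambda>x\<in>carrier R. \<phi> (w \<otimes> x) \<ominus> w \<otimes> \<phi> x) x) x"
    using alg[of "\<phi> (v \<otimes> (w \<otimes> x))" "\<phi> (w \<otimes> x)" "\<phi> x"] x assms by (simp add: additive_endosD m_assoc)
qed

text \<open>Up to sign, this is \<open>ad(v)^k\<close> applied to \<open>\<phi>\<close>.\<close>

fun iter_commutator :: "('a \<Rightarrow> 'a) \<Rightarrow> 'a \<Rightarrow> nat \<Rightarrow> ('a \<Rightarrow> 'a)" where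
  "iter_commutator \<phi> v 0 = \<phi>"
| "iter_commutator \<phi> v (Suc k) = commutator R (iter_commutator \<phi> v k) v"

lemma iter_commutator_endo:
  "\<phi> \<in> additive_endos R \<Longrightarrow> v \<in> carrier R \<Longrightarrow> iter_commutator \<phi> v k \<in> additive_endos R"
  by (induction k) (auto intro: commutator_endo)

lemma iter_commutator_commute:
  assumes "\<phi> \<in> additive_endos R" "v \<in> carrier R" "w \<in> carrier R"
  shows "iter_commutator (commutator R \<phi> w) v k = commutator R (iter_commutator \<phi> v k) w"
  using assms by (induction k) (simp_all add: commutator_commute[OF iter_commutator_endo])

lemma order_less_zero: "(\<forall>x\<in>carrier R. \<phi> x = \<zero>) \<Longrightarrow> order_less R k \<phi>"
proof (induction k arbitrary: \<phi>)
  case (Suc k)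
  have "\<forall>x\<in>carrier R. commutator R \<phi> s x = \<zero>" if "s \<in> carrier R" for s
    using Suc.prems that by (simp add: commutator_def r_right_minus_eq)
  then show ?case using Suc.IH by simp
qed simp

end

text \<open>\<open>p^N\<close> divides \<open>l * (p^N choose l)\<close>; if the binomial
  coefficient were prime to \<open>p\<close>, then \<open>p^N\<close> would divide the smaller
  positive number \<open>l\<close>.\<close>

lemma prime_dvd_choose_prime_power:
  fixes p :: nat
  assumes "prime p" "0 < l" "l < p ^ N" shows "p dvd (p ^ N choose l)"
proof (rule ccontr)
  assume "\<not> p dvd (p ^ N choose l)"
  then have "coprime (p ^ N) (p ^ N choose l)" using assms(1) prime_imp_coprime by auto
  moreover have "p ^ N dvd l * (p ^ N choose l)" using times_binomial_minus1_eq[OF assms(2), of "p ^ N"] by simp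
  ultimately have "p ^ N dvd l" using coprime_dvd_mult_left_iff by blast
  then show False using dvd_imp_le[OF _ assms(2)] assms(3) by force
qed

text \<open>A model of commutators: if \<open>G i j\<close> is a coefficient of
  \<open>v^i \<phi>(v^j x)\<close>, then replacing \<open>\<phi>\<close> by its commutator with
  \<open>v\<close> replaces \<open>G\<close> by \<open>shift_diff G\<close>.\<close>

definition shift_diff :: "(nat \<Rightarrow> nat \<Rightarrow> int) \<Rightarrow> (nat \<Rightarrow> nat \<Rightarrow> int)" where
  "shift_diff G = (\<lambda>i j. G i (Suc j) - G (Suc i) j)"

text \<open>The binomial theorem for a difference of commuting shifts.\<close>

lemma shift_diff_funpow:
  "(shift_diff ^^ n) G i j = (\<Sum>l\<le>n. (-1) ^ l * int (n choose l) * G (i + l) (j + (n - l)))"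
proof (induction n arbitrary: i j)
  case (Suc n)
  define a where "a = (\<lambda>l. (-1) ^ l * int (n choose l) * G (i + l) (j + (Suc n - l)))"
  have 1: "(shift_diff ^^ n) G i (Suc j) = (\<Sum>l\<le>Suc n. a l)"
    unfolding Suc a_def by (simp add: Suc_diff_le)
  have 2: "(shift_diff ^^ n) G (Suc i) j = - (\<Sum>l\<le>n. (-1) ^ Suc l * int (n choose l) * G (i + Suc l) (j + (n - l)))"
    unfolding Suc by (simp add: sum_negf)
  have "(shift_diff ^^ Suc n) G i j = a 0 + (\<Sum>l\<le>n. a (Suc l)) + (\<Sum>l\<le>n. (-1) ^ Suc l * int (n choose l) * G (i + Suc l) (j + (n - l)))"
    using 1 2 by (simp add: shift_diff_def sum.atMost_Suc_shift del: sum.atMost_Suc)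
  also have "\<dots> = a 0 + (\<Sum>l\<le>n. (-1) ^ Suc l * int (Suc n choose Suc l) * G (i + Suc l) (j + (Suc n - Suc l)))"
    unfolding a_def by (simp add: sum.distrib[symmetric] algebra_simps)
  also have "\<dots> = (\<Sum>l\<le>Suc n. (-1) ^ l * int (Suc n choose l) * G (i + l) (j + (Suc n - l)))"
    unfolding sum.atMost_Suc_shift by (simp add: a_def)
  finally show ?case .
qed simp

lemma shift_diff_cong:
  "(\<And>i j. [G i j = H i j] (mod q)) \<Longrightarrow> [(shift_diff ^^ n) G i j = (shift_diff ^^ n) H i j] (mod q)"
  unfolding shift_diff_funpow by (intro cong_sum cong_mult cong_refl) auto

lemma shift_diff_scale: "(shift_diff ^^ n) (\<lambda>i j. c * G i j) i j = c * (shift_diff ^^ n) G i j"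
  unfolding shift_diff_funpow by (simp add: sum_distrib_left algebra_simps)

text \<open>\<open>shift_diff\<close> is the difference \<open>b - a\<close> of two commuting shifts, and \<open>(b - a)\<^sup>M\<close> is \<open>b\<^sup>M - a\<^sup>M\<close> plus a
  multiple of \<open>p\<close> if \<open>M\<close> is a power of an odd prime \<open>p\<close>.\<close>

lemma shift_diff_divisible:
  assumes p: "prime p" "odd p" and per: "\<And>i j. [G (i + p ^ N) j = G i (j + p ^ N)] (mod q)"
  shows "\<exists>H. (\<forall>i j. [H (i + p ^ N) j = H i (j + p ^ N)] (mod q)) \<and>
     (\<forall>i j. [(shift_diff ^^ (p ^ N * r)) G i j = int p ^ r * H i j] (mod q))"
proof (induction r)
  case 0 then show ?case using per by (intro exI[of _ G]) auto
next
  case (Suc r)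
  define M where "M = p ^ N"
  obtain H where H: "\<And>i j. [H (i + M) j = H i (j + M)] (mod q)"
    "\<And>i j. [(shift_diff ^^ (M * r)) G i j = int p ^ r * H i j] (mod q)"
    using Suc unfolding M_def by blast
  \<comment> \<open>The inner terms of the expansion of \<open>(b - a)^M\<close>, with a factor
    \<open>p\<close> removed. As a combination of shifts of \<open>H\<close>, it is periodic again,
    so that the induction can continue.\<close>
  define K where "K = (\<lambda>i j. \<Sum>l\<in>{1..<M}. (-1) ^ l * int ((M choose l) div p) * H (i + l) (j + (M - l)))"
  have M1: "M > 0" "odd M" using p prime_gt_0_nat by (auto simp: M_def)
  have "[K (i + M) j = K i (j + M)] (mod q)" for i j
    unfolding K_def
  proof (intro cong_sum cong_mult cong_refl)
    fix l assume "l \<in> {1..<M}"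
    show "[H (i + M + l) (j + (M - l)) = H (i + l) (j + M + (M - l))] (mod q)"
      using H(1)[of "i + l" "j + (M - l)"] by (simp add: ac_simps)
  qed
  moreover have "[(shift_diff ^^ (M * Suc r)) G i j = int p ^ Suc r * K i j] (mod q)" for i j
  proof -
    have "(shift_diff ^^ (M * Suc r)) G i j = (shift_diff ^^ M) ((shift_diff ^^ (M * r)) G) i j"
      by (simp add: funpow_add)
    also have "[\<dots> = (shift_diff ^^ M) (\<lambda>i j. int p ^ r * H i j) i j] (mod q)"
      by (intro shift_diff_cong H)
    also have "(shift_diff ^^ M) (\<lambda>i j. int p ^ r * H i j) i j = int p ^ r * (shift_diff ^^ M) H i j"
      by (rule shift_diff_scale)
    \<comment> \<open>As \<open>M\<close> is odd, the two end terms have opposite signs, so they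
      will cancel by periodicity. The inner binomial coefficients are divisible by
      \<open>p\<close>.\<close>
    also have "(shift_diff ^^ M) H i j = H i (j + M) - H (i + M) j + int p * K i j"
    proof -
      have "{..M} = insert 0 (insert M {1..<M})" using M1 by auto
      then have "(shift_diff ^^ M) H i j = H i (j + M) - H (i + M) j + (\<Sum>l\<in>{1..<M}. (-1) ^ l * int (M choose l) * H (i + l) (j + (M - l)))"
        unfolding shift_diff_funpow using M1 by simp
      also have "(\<Sum>l\<in>{1..<M}. (-1) ^ l * int (M choose l) * H (i + l) (j + (M - l))) = int p * K i j"
        unfolding K_def sum_distrib_left
      proof (rule sum.cong)
        fix l assume l: "l \<in> {1..<M}"
        have "p dvd (M choose l)" using prime_dvd_choose_prime_power[OF p(1), of l N] l by (simp add: M_def)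
        then have "int (M choose l) = int p * int ((M choose l) div p)" by (metis dvd_mult_div_cancel of_nat_mult)
        then show "(-1) ^ l * int (M choose l) * H (i + l) (j + (M - l)) = int p * ((-1) ^ l * int ((M choose l) div p) * H (i + l) (j + (M - l)))"
          by simp
      qed simp
      finally show ?thesis .
    qed
    also have "[int p ^ r * (H i (j + M) - H (i + M) j + int p * K i j) = int p ^ r * (0 + int p * K i j)] (mod q)"
      using H(1)[of i j] by (intro cong_mult cong_add cong_refl) (simp add: cong_iff_dvd_diff dvd_diff_commute)
    finally show ?thesis by (simp add: mult.assoc mult.left_commute)
  qed
  ultimately show ?case unfolding M_def by blast
qed

text \<open>Oddness costs nothing, as only large primes matter; it fixes the sign in
  \<open>shift_diff_divisible\<close>.\<close>

locale odd_prime_power =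
  fixes p m :: nat
  assumes prime_p: "prime p" and odd_p: "odd p"
begin

abbreviation q where "q \<equiv> modulus p m"

lemma q_pos: "q > 0" using prime_gt_0_nat[OF prime_p] by (simp add: modulus_def)

lemma cring_poly: "cring (poly_alg q V)" by (rule cring_poly_alg[OF q_pos])

text \<open>Each block of \<open>p^N\<close> commutators with \<open>v\<close> yields a factor
  \<open>p\<close>, by \<open>shift_diff_divisible\<close>; after \<open>m + 1\<close> blocks the
  result is a multiple of \<open>p^(m+1)\<close>.\<close>

lemma iter_commutator_eq_zero:
  assumes \<phi>: "\<phi> \<in> additive_endos (poly_alg q V)" and v: "v \<in> carrier (poly_alg q V)"
    and c: "commutes_with (poly_alg q V) \<phi> (v [^]\<^bsub>poly_alg q V\<^esub> (p ^ N))" and x: "x \<in> carrier (poly_alg q V)"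
  shows "cring.iter_commutator (poly_alg q V) \<phi> v (p ^ N * (m + 1)) x = 0"
proof -
  interpret S: cring "poly_alg q V" by (rule cring_poly)
  let ?S = "poly_alg q V"
  define it where "it = S.iter_commutator \<phi> v"
  have it_endo: "it k \<in> additive_endos ?S" for k using S.iter_commutator_endo[OF \<phi> v] by (simp add: it_def)
  have vx: "reduce q (v ^ j * x) \<in> carrier ?S" for j
    using v x q_pos by (simp add: poly_alg_carrier mpolys_mult mpolys_power mpolys_reduce)
  have itc: "reduce q (it k (reduce q (v ^ j * x))) = it k (reduce q (v ^ j * x))" for k j
    using S.additive_endosD(1)[OF it_endo vx] q_pos by (simp add: poly_alg_carrier)
  have "lookup (it (p ^ N * (m + 1)) x) e = 0" for e
  proof -
    \<comment> \<open>For a fixed monomial \<open>e\<close>, this is the coefficient of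
      \<open>v^i \<phi>_k(v^j x)\<close>, where \<open>\<phi>_k\<close> is the \<open>k\<close>-fold
      commutator. As products are reduced, the recursion in \<open>k\<close> holds only modulo
      \<open>q\<close>.\<close>
    define H where "H = (\<lambda>k i j. lookup (v ^ i * it k (reduce q (v ^ j * x))) e)"
    have step: "[H (Suc k) i j = H k i (Suc j) - H k (Suc i) j] (mod q)" for k i j
    proof -
      have 1: "v \<otimes>\<^bsub>?S\<^esub> reduce q (v ^ j * x) = reduce q (v ^ Suc j * x)" by (simp add: poly_alg_simps mult.assoc)
      have "it (Suc k) (reduce q (v ^ j * x)) = it k (reduce q (v ^ Suc j * x)) \<ominus>\<^bsub>?S\<^esub> v \<otimes>\<^bsub>?S\<^esub> it k (reduce q (v ^ j * x))"
        using vx by (simp add: it_def commutator_def 1 del: power_Suc)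
      also have "\<dots> = reduce q (it k (reduce q (v ^ Suc j * x)) - v * it k (reduce q (v ^ j * x)))"
        using S.m_closed[OF v S.additive_endosD(1)[OF it_endo vx], of k j] q_pos by (simp add: poly_alg_minus poly_alg_simps del: power_Suc)
      finally have "reduce q (v ^ i * it (Suc k) (reduce q (v ^ j * x)))
         = reduce q (v ^ i * it k (reduce q (v ^ Suc j * x)) - v ^ Suc i * it k (reduce q (v ^ j * x)))"
        by (simp add: algebra_simps)
      then show ?thesis unfolding H_def lookup_minus[symmetric] reduce_eq_iff by blast
    qed
    have H: "[H k i j = (shift_diff ^^ k) (H 0) i j] (mod q)" for k i j
    proof (induction k arbitrary: i j)
      case (Suc k)
      have "[H k i (Suc j) - H k (Suc i) j = (shift_diff ^^ Suc k) (H 0) i j] (mod q)"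
        using cong_diff[OF Suc[of i "Suc j"] Suc[of "Suc i" j]]
        by (simp add: shift_diff_def[of "(shift_diff ^^ k) (H 0)"])
      then show ?case using step cong_trans by blast
    qed simp
    have "[H 0 (i + p ^ N) j = H 0 i (j + p ^ N)] (mod q)" for i j
    proof -
      have "reduce q (v ^ (p ^ N)) \<otimes>\<^bsub>?S\<^esub> reduce q (v ^ j * x) = reduce q (v ^ (j + p ^ N) * x)"
        by (simp add: poly_alg_simps power_add ac_simps)
      then have "\<phi> (reduce q (v ^ (j + p ^ N) * x)) = reduce q (v ^ (p ^ N) * \<phi> (reduce q (v ^ j * x)))"
        using c vx[of j] unfolding commutes_with_def poly_alg_pow[OF q_pos] by (metis poly_alg_simps(1) reduce_simps(5))
      then have "reduce q (v ^ i * \<phi> (reduce q (v ^ (j + p ^ N) * x))) = reduce q (v ^ (i + p ^ N) * \<phi> (reduce q (v ^ j * x)))"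
        by (simp add: power_add ac_simps)
      then show ?thesis unfolding H_def reduce_eq_iff it_def by (simp add: cong_sym)
    qed
    then obtain K where "\<And>i j. [(shift_diff ^^ (p ^ N * (m + 1))) (H 0) i j = int p ^ (m + 1) * K i j] (mod q)"
      using shift_diff_divisible[OF prime_p odd_p, of "H 0" N q "m + 1"] by blast
    then have "[H (p ^ N * (m + 1)) 0 0 = int p ^ (m + 1) * K 0 0] (mod q)" using H cong_trans by blast
    then have "q dvd lookup (it (p ^ N * (m + 1)) x) e"
      using x q_pos by (simp add: H_def cong_def poly_alg_carrier mod_eq_0_iff_dvd modulus_def)
    moreover have "reduce q (it (p ^ N * (m + 1)) x) = it (p ^ N * (m + 1)) x"
      using S.additive_endosD(1)[OF it_endo x] q_pos by (simp add: poly_alg_carrier)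
    ultimately show ?thesis by (metis lookup_reduce mod_eq_0_iff_dvd)
  qed
  then show ?thesis unfolding it_def by (intro poly_mapping_eqI) simp
qed

text \<open>Constants commute with \<open>\<phi>\<close>, and the commutator with a sum or product
  is expressed by the commutators with its parts. So it suffices to test the variables.\<close>

lemma order_less_generators:
  assumes \<phi>: "\<phi> \<in> additive_endos (poly_alg q V)"
    and gen: "\<And>i. i \<in> V \<Longrightarrow> order_less (poly_alg q V) k (commutator (poly_alg q V) \<phi> (reduce q (Var i)))"
  shows "order_less (poly_alg q V) (Suc k) \<phi>"
proof -
  interpret S: cring "poly_alg q V" by (rule cring_poly)
  let ?S = "poly_alg q V"
  have "order_less ?S k (commutator ?S \<phi> (reduce q h))" if "h \<in> mpolys V" for h :: "int mpoly"
    using that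
  proof (induction h rule: mpolys_induct)
    case (const c)
    have c: "c mod q \<in> carrier (residue_ring q)" using q_pos by (simp add: residue_ring_def)
    have 1: "reduce q (single 0 c) \<otimes>\<^bsub>?S\<^esub> x = (c mod q) \<odot>\<^bsub>?S\<^esub> x" for x
    proof -
      have "reduce q (single 0 (c mod q)) = reduce q (single 0 c)"
        by (rule poly_mapping_eqI) (simp add: lookup_single when_def)
      then show ?thesis by (simp add: poly_alg_simps) (metis reduce_simps(5))
    qed
    have "\<phi> \<in> linear_endos (residue_ring q) ?S" using \<phi> linear_endos_poly_alg[OF q_pos] by simp
    then have "\<phi> ((c mod q) \<odot>\<^bsub>?S\<^esub> x) = (c mod q) \<odot>\<^bsub>?S\<^esub> \<phi> x" if "x \<in> carrier ?S" for x
      using that c by (auto simp: linear_endos_def)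
    then have "commutator ?S \<phi> (reduce q (single 0 c)) x = \<zero>\<^bsub>?S\<^esub>" if "x \<in> carrier ?S" for x
      using that S.m_closed[OF reduce_in_poly_alg[OF q_pos mpolys_const] S.additive_endosD(1)[OF \<phi> that], of c]
      by (simp add: commutator_def 1 S.r_right_minus_eq)
    then show ?case by (intro S.order_less_zero) blast
  next
    case (add a b)
    have c: "reduce q a \<in> carrier ?S" "reduce q b \<in> carrier ?S" using add reduce_in_poly_alg[OF q_pos] by auto
    have "reduce q (a + b) = reduce q a \<oplus>\<^bsub>?S\<^esub> reduce q b" by (simp add: poly_alg_simps)
    then show ?case unfolding S.commutator_add_right[OF \<phi> c, folded \<open>reduce q (a + b) = _\<close>]
      by (intro S.order_less_add S.commutator_endo \<phi> c add.IH)
  next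
    case (mult a b)
    have c: "reduce q a \<in> carrier ?S" "reduce q b \<in> carrier ?S" using mult reduce_in_poly_alg[OF q_pos] by auto
    have "reduce q (a * b) = reduce q a \<otimes>\<^bsub>?S\<^esub> reduce q b" by (simp add: poly_alg_simps)
    moreover have r: "(\<lambda>x\<in>carrier ?S. commutator ?S \<phi> (reduce q a) (reduce q b \<otimes>\<^bsub>?S\<^esub> x)) \<in> additive_endos ?S"
      using S.commutator_endo[OF \<phi> c(1)] c by (intro S.additive_endosI) (auto simp: S.additive_endosD S.r_distr)
    ultimately show ?case unfolding S.commutator_mult_right[OF \<phi> c, folded \<open>reduce q (a * b) = _\<close>]
      by (intro S.order_less_add S.order_less_lmult S.order_less_rmult S.additive_endos_lmult S.commutator_endo \<phi> c mult.IH r)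
  qed (use gen in auto)
  then show ?thesis using q_pos by (auto simp: poly_alg_carrier) metis
qed

text \<open>Induction on the sum of the exponents: a commutator with the \<open>j\<close>-th
  variable lowers \<open>e j\<close> by one, and it keeps the other exponents because commutators
  with different variables can be interchanged.\<close>

lemma order_less_of_nilpotent:
  assumes "finite V" "\<phi> \<in> additive_endos (poly_alg q V)"
    and "\<And>i x. i \<in> V \<Longrightarrow> x \<in> carrier (poly_alg q V) \<Longrightarrow>
      cring.iter_commutator (poly_alg q V) \<phi> (reduce q (Var i)) (e i) x = 0"
  shows "order_less (poly_alg q V) (Suc (\<Sum>i\<in>V. e i)) \<phi>"
  using assms(2,3)
proof (induction "\<Sum>i\<in>V. e i" arbitrary: e \<phi> rule: less_induct)
  case less
  interpret S: cring "poly_alg q V" by (rule cring_poly)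
  let ?S = "poly_alg q V"
  note \<phi> = less.prems(1)
  have Vc: "reduce q (Var i) \<in> carrier ?S" if "i \<in> V" for i using that reduce_in_poly_alg[OF q_pos mpolys_Var] by auto
  show ?case
  proof (cases "\<exists>i\<in>V. e i = 0")
    case True
    then obtain i where "i \<in> V" "e i = 0" by blast
    then have "\<forall>x\<in>carrier ?S. \<phi> x = \<zero>\<^bsub>?S\<^esub>" using less.prems(2)[of i] by (simp add: poly_alg_simps)
    then show ?thesis by (rule S.order_less_zero)
  next
    case False
    show ?thesis
    proof (rule order_less_generators[OF \<phi>])
      fix j assume j: "j \<in> V"
      define e' where "e' = e(j := e j - 1)"
      have ej: "e j > 0" using False j by auto
      have sum: "(\<Sum>i\<in>V. e i) = Suc (\<Sum>i\<in>V. e' i)"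
        using assms(1) j ej by (simp add: e'_def sum.remove[OF assms(1) j])
      have "order_less ?S (Suc (\<Sum>i\<in>V. e' i)) (commutator ?S \<phi> (reduce q (Var j)))"
      proof (rule less.hyps)
        show "(\<Sum>i\<in>V. e' i) < (\<Sum>i\<in>V. e i)" using sum by simp
        show "commutator ?S \<phi> (reduce q (Var j)) \<in> additive_endos ?S" using S.commutator_endo[OF \<phi> Vc[OF j]] .
        fix i x assume i: "i \<in> V" and x: "x \<in> carrier ?S"
        have eq: "S.iter_commutator (commutator ?S \<phi> (reduce q (Var j))) (reduce q (Var i)) (e' i)
          = commutator ?S (S.iter_commutator \<phi> (reduce q (Var i)) (e' i)) (reduce q (Var j))"
          using S.iter_commutator_commute[OF \<phi> Vc[OF i] Vc[OF j]] .
        show "S.iter_commutator (commutator ?S \<phi> (reduce q (Var j))) (reduce q (Var i)) (e' i) x = 0"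
        proof (cases "i = j")
          case True
          have "S.iter_commutator \<phi> (reduce q (Var j)) (Suc (e' j)) x = 0" using less.prems(2)[OF j x] ej by (simp add: e'_def)
          then show ?thesis unfolding eq using True by simp
        next
          case False
          have "S.iter_commutator \<phi> (reduce q (Var i)) (e' i) y = \<zero>\<^bsub>?S\<^esub>" if "y \<in> carrier ?S" for y
            using less.prems(2)[OF i that] False by (simp add: e'_def poly_alg_simps)
          then show ?thesis unfolding eq unfolding commutator_def
            using x Vc[OF j] S.r_right_minus_eq[OF S.zero_closed S.zero_closed] S.r_null[OF Vc[OF j]]
            by (simp add: poly_alg_simps(3))
        qed
      qed
      then show "order_less ?S (\<Sum>i\<in>V. e i) (commutator ?S \<phi> (reduce q (Var j)))" unfolding sum .
    qed
  qed
qed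

text \<open>Commutation needs to be checked only for powers of the finitely many variables. This is
  how the operators constructed below are recognized as differential operators.\<close>

lemma killed_by_power_of_level:
  assumes "finite V" "\<phi> \<in> additive_endos (poly_alg q V)"
    and "\<And>i. i \<in> V \<Longrightarrow> commutes_with (poly_alg q V) \<phi> (reduce q (Var i) [^]\<^bsub>poly_alg q V\<^esub> (p ^ N))"
  shows "\<exists>k. killed_by_power (poly_alg q V) k \<phi>"
proof -
  interpret S: cring "poly_alg q V" by (rule cring_poly)
  have "order_less (poly_alg q V) (Suc (\<Sum>i\<in>V. p ^ N * (m + 1))) \<phi>"
    using assms iter_commutator_eq_zero[OF assms(2) reduce_in_poly_alg[OF q_pos mpolys_Var] assms(3)]
    by (intro order_less_of_nilpotent) auto
  then show ?thesis using S.killed_by_power_iff_order_less[OF assms(2)] by blast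
qed

lemma frobenius_diff_ops_poly_alg:
  assumes "finite V" shows "frobenius_diff_ops (residue_ring q) (poly_alg q V) p"
proof (intro frobenius_diff_ops.intro frobenius_diff_ops_axioms.intro cring_poly linear_endos_poly_alg q_pos)
  show "p > 0" using prime_p prime_gt_0_nat by blast
  fix \<phi> assume \<phi>: "\<phi> \<in> additive_endos (poly_alg q V)"
  interpret S: cring "poly_alg q V" by (rule cring_poly)
  have tors: "add_pow (poly_alg q V) (p ^ (m + 1)) x = \<zero>\<^bsub>poly_alg q V\<^esub>" if "x \<in> carrier (poly_alg q V)" for x
    unfolding poly_alg_add_pow[OF q_pos that] poly_alg_simps
    by (rule poly_mapping_eqI)
      (simp only: modulus_def lookup_reduce lookup_const_mult of_nat_power lookup_zero mod_mult_self1_is_0)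
  show "(\<exists>k. killed_by_power (poly_alg q V) k \<phi>) \<longleftrightarrow>
    (\<exists>N. \<forall>w\<in>carrier (poly_alg q V). commutes_with (poly_alg q V) \<phi> (w [^]\<^bsub>poly_alg q V\<^esub> (p ^ N)))"
  proof
    assume "\<exists>k. killed_by_power (poly_alg q V) k \<phi>"
    then obtain k where "order_less (poly_alg q V) k \<phi>" using S.killed_by_power_iff_order_less[OF \<phi>] by blast
    \<comment> \<open>In a ring annihilated by \<open>q = p^(m+1)\<close>, an operator of order less
      than \<open>k\<close> commutes with \<open>q^k\<close>-th powers, so the exponent is
      \<open>N = (m + 1) * k\<close>.\<close>
    then have "commutes_with (poly_alg q V) \<phi> (w [^]\<^bsub>poly_alg q V\<^esub> ((p ^ (m + 1)) ^ k))" if "w \<in> carrier (poly_alg q V)" for w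
      using S.order_less_imp_commutes[OF tors _ \<phi> _ that] prime_p prime_gt_0_nat by simp
    then show "\<exists>N. \<forall>w\<in>carrier (poly_alg q V). commutes_with (poly_alg q V) \<phi> (w [^]\<^bsub>poly_alg q V\<^esub> (p ^ N))"
      unfolding power_mult[symmetric] by blast
  next
    assume "\<exists>N. \<forall>w\<in>carrier (poly_alg q V). commutes_with (poly_alg q V) \<phi> (w [^]\<^bsub>poly_alg q V\<^esub> (p ^ N))"
    then show "\<exists>k. killed_by_power (poly_alg q V) k \<phi>"
      using killed_by_power_of_level[OF assms \<phi>] reduce_in_poly_alg[OF q_pos mpolys_Var] by meson
  qed
qed

lemma diff_opI:
  assumes "finite V" "\<phi> \<in> additive_endos (poly_alg q V)"
    and "\<And>i. i \<in> V \<Longrightarrow> commutes_with (poly_alg q V) \<phi> (reduce q (Var i) [^]\<^bsub>poly_alg q V\<^esub> (p ^ N))"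
  shows "\<phi> \<in> diff_ops (residue_ring q) (poly_alg q V)"
  using killed_by_power_of_level[OF assms] assms(2) by (simp add: diff_ops_def linear_endos_poly_alg[OF q_pos])

end

declare One_nat_def [simp del]

section \<open>Expansion in powers of \<open>t\<close>\<close>

lemma poly_mapping_additive_induct [case_names zero single add]:
  fixes h :: "'k \<Rightarrow>\<^sub>0 'a::comm_monoid_add"
  assumes "P 0" "\<And>k c. P (single k c)" "\<And>a b. P a \<Longrightarrow> P b \<Longrightarrow> P (a + b)"
  shows "P h"
proof -
  have h: "h = (\<Sum>e\<in>keys h. single e (lookup h e))"
  proof (rule poly_mapping_eqI)
    fix k show "lookup h k = lookup (\<Sum>e\<in>keys h. single e (lookup h e)) k"
      by (cases "k \<in> keys h")
        (auto simp: lookup_sum lookup_single when_def in_keys_iff sum.delta)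
  qed
  have "P (\<Sum>e\<in>E. single e (lookup h e))" for E
    by (induction E rule: infinite_finite_induct) (auto intro: assms)
  then show ?thesis using h by metis
qed

text \<open>The coefficient of \<open>t^a\<close>, as a polynomial in the remaining variables: the
  condition on \<open>e\<close> discards every monomial that still contains
  \<open>t\<close>.\<close>

lift_definition tcoef :: "nat \<Rightarrow> 'a::zero mpoly \<Rightarrow> 'a mpoly" is
  "\<lambda>a f e. if lookup e 0 = 0 then f (e + single 0 a) else 0"
proof -
  fix a and f :: "(nat \<Rightarrow>\<^sub>0 nat) \<Rightarrow> 'a" assume "finite {x. f x \<noteq> 0}"
  then have "finite ((\<lambda>e. e + single 0 a) -` {x. f x \<noteq> 0})"
    by (rule finite_vimageI) (auto simp: inj_on_def)
  then show "finite {e. (if lookup e 0 = 0 then f (e + single 0 a) else 0) \<noteq> 0}"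
    by (rule rev_finite_subset) (auto split: if_splits)
qed

text \<open>The diagonal operators with eigenvalue \<open>c a\<close> on \<open>t^a\<close>; by
  \<open>C_ring_iff\<close> the elements of \<open>C_m\<close> are those with periodic
  \<open>c\<close>.\<close>

lift_definition tscale :: "(nat \<Rightarrow> 'a) \<Rightarrow> 'a::comm_semiring_1 mpoly \<Rightarrow> 'a mpoly" is
  "\<lambda>c f e. c (lookup e 0) * f e"
proof -
  fix c and f :: "(nat \<Rightarrow>\<^sub>0 nat) \<Rightarrow> 'a" assume "finite {x. f x \<noteq> 0}"
  then show "finite {e. c (lookup e 0) * f e \<noteq> 0}"
    by (rule rev_finite_subset) auto
qed

abbreviation tdegs :: "'a::zero mpoly \<Rightarrow> nat set" where
  "tdegs h \<equiv> (\<lambda>e. lookup e 0) ` keys h"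

lemma lookup_tcoef: "lookup (tcoef a h) e =
    (if lookup e 0 = 0 then lookup h (e + single 0 a) else 0)"
  by transfer simp

lemma lookup_tscale: "lookup (tscale c h) e = c (lookup e 0) * lookup h e"
  by transfer simp

lemma minus_plus_single: "lookup e i \<ge> a \<Longrightarrow> e - single i a + single i a = e"
  for e :: "nat \<Rightarrow>\<^sub>0 nat"
  by (rule poly_mapping_eqI) (auto simp: lookup_add lookup_minus lookup_single when_def)

lemma lookup_eq_tcoef: "lookup h e =
    lookup (tcoef (lookup e 0) h) (e - single 0 (lookup e 0))"
  by (simp add: lookup_tcoef lookup_minus minus_plus_single)

lemma tcoef_eqI: "(\<And>a. tcoef a g = tcoef a h) \<Longrightarrow> g = h"
  by (rule poly_mapping_eqI) (metis lookup_eq_tcoef)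

lemma tcoef_add: "tcoef a (g + h) = tcoef a g + tcoef a h"
  by (rule poly_mapping_eqI) (simp add: lookup_tcoef lookup_add)

lemma tcoef_diff: "tcoef a (g - h) = tcoef a g - tcoef a h" for g h :: "'a::ab_group_add mpoly"
  by (rule poly_mapping_eqI) (simp add: lookup_tcoef lookup_minus)

lemma tcoef_zero [simp]: "tcoef a 0 = 0"
  by (rule poly_mapping_eqI) (simp add: lookup_tcoef)

lemma tcoef_sum: "tcoef a (sum f I) = (\<Sum>i\<in>I. tcoef a (f i))"
  by (induction I rule: infinite_finite_induct) (auto simp: tcoef_add)

lemma tcoef_reduce: "tcoef a (reduce N h) = reduce N (tcoef a h)"
  by (rule poly_mapping_eqI) (simp add: lookup_tcoef)

lemma tcoef_notin: "a \<notin> tdegs h \<Longrightarrow> tcoef a h = 0"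
proof (rule poly_mapping_eqI)
  fix e :: "nat \<Rightarrow>\<^sub>0 nat" assume "a \<notin> tdegs h"
  moreover have "lookup e 0 = 0 \<Longrightarrow> lookup (e + single 0 a) 0 = a"
    by (simp add: lookup_add)
  ultimately have "lookup e 0 = 0 \<Longrightarrow> e + single 0 a \<notin> keys h" by force
  then show "lookup (tcoef a h) e = lookup 0 e" by (auto simp: lookup_tcoef in_keys_iff)
qed

lemma tcoef_mpolys: assumes "h \<in> mpolys {0..n}" shows "tcoef a h \<in> mpolys {1..n}"
  unfolding mpolys_iff
proof (intro allI impI subsetI)
  fix e i assume e: "lookup (tcoef a h) e \<noteq> 0" and i: "i \<in> keys e"
  have e0: "lookup e 0 = 0" and "lookup h (e + single 0 a) \<noteq> 0"
    using e by (auto simp: lookup_tcoef split: if_splits)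
  then have "keys (e + single 0 a) \<subseteq> {0..n}" using assms by (auto simp: mpolys_iff)
  moreover have "i \<in> keys (e + single 0 a)" using i by (auto simp: in_keys_iff lookup_add)
  moreover have "i \<noteq> 0" using e0 i by (metis in_keys_iff)
  ultimately show "i \<in> {1..n}" by auto
qed

lemma tcoef_single: "tcoef a (single e c) =
  (if lookup e 0 = a then single (e - single 0 a) c else 0)"
proof (rule poly_mapping_eqI)
  fix d
  have "lookup d 0 = 0 \<and> e = d + single 0 a \<longleftrightarrow>
     lookup e 0 = a \<and> d = e - single 0 a"
    using minus_plus_single[of a e 0] by (auto simp: lookup_add lookup_minus)
  then show "lookup (tcoef a (single e c)) d = lookup
     (if lookup e 0 = a then single (e - single 0 a) c else 0) d"
    by (auto simp: lookup_tcoef lookup_single when_def)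
qed

text \<open>Subtraction of exponents is truncated at zero; the bound on \<open>e\<close> makes it
  exact.\<close>

lemma minus_single_add:
  fixes k e :: "nat \<Rightarrow>\<^sub>0 nat"
  assumes "lookup e i \<ge> a"
  shows "k + e - single i a = k + (e - single i a)"
  using assms by (intro poly_mapping_eqI) (auto simp: lookup_add lookup_minus lookup_single when_def)

lemma tcoef_mult:
  fixes r h :: "'a::comm_semiring_1 mpoly"
  assumes "r \<in> mpolys V" "0 \<notin> V" shows "tcoef a (r * h) = r * tcoef a h"
proof -
  have 1: "tcoef a (single k c * h) = single k c * tcoef a h"
    if k: "lookup k 0 = 0" for k c
  proof (induction h rule: poly_mapping_additive_induct)
    case (single e d)
    show ?case using k minus_single_add[of a e 0 k] by (auto simp: mult_single tcoef_single lookup_add)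
  qed (auto simp: tcoef_add distrib_left)
  have k: "lookup k 0 = 0" if "k \<in> keys r" for k
  proof -
    have "keys k \<subseteq> V" using assms(1) that by (auto simp: mpolys_def)
    then show ?thesis using assms(2) by (auto simp: in_keys_iff subset_iff)
  qed
  have "tcoef a (r * h) = (\<Sum>k\<in>keys r. tcoef a (single k (lookup r k) * h))"
    by (subst mpoly_sum_monomials[of r]) (simp add: sum_distrib_right tcoef_sum)
  also have "\<dots> = (\<Sum>k\<in>keys r. single k (lookup r k)) * tcoef a h"
    unfolding sum_distrib_right using k by (intro sum.cong refl 1)
  finally show ?thesis by (simp flip: mpoly_sum_monomials)
qed

lemma Var_power: "Var i ^ k = single (single i k) (1::'a::comm_semiring_1)"
  by (induction k) (auto simp: Var_def mult_single single_add[symmetric] One_nat_def)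

lemma tcoef_t_power_mult:
  fixes h :: "'a::comm_semiring_1 mpoly"
  shows "tcoef a (Var 0 ^ b * h) = (if b \<le> a then tcoef (a - b) h else 0)"
  unfolding Var_power
proof (induction h rule: poly_mapping_additive_induct)
  case (single e d)
  have "single 0 b + e - single 0 a = e - single 0 (a - b)" if "b \<le> a"
    using that by (intro poly_mapping_eqI) (auto simp: lookup_add lookup_minus lookup_single when_def)
  then show ?case by (auto simp: mult_single tcoef_single lookup_add)
qed (auto simp: tcoef_add distrib_left)

lemma tcoef_of_t_free:
  fixes r :: "'a::comm_semiring_1 mpoly"
  assumes "r \<in> mpolys V" "0 \<notin> V" shows "tcoef a r = (if a = 0 then r else 0)"
proof -
  have "tcoef a (1::'a mpoly) = (if a = 0 then 1 else 0)" by (simp flip: single_one add: tcoef_single)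
  then show ?thesis using tcoef_mult[OF assms, of a 1] by auto
qed

lemma tcoef_t_power_mult_free:
  fixes r :: "'a::comm_semiring_1 mpoly"
  assumes "r \<in> mpolys V" "0 \<notin> V" shows "tcoef a (Var 0 ^ b * r) = (if a = b then r else 0)"
  by (auto simp: tcoef_t_power_mult tcoef_of_t_free[OF assms])

lemma t_expansion:
  fixes h :: "'a::comm_semiring_1 mpoly"
  assumes "h \<in> mpolys {0..n}" "finite T" "tdegs h \<subseteq> T"
  shows "h = (\<Sum>a\<in>T. Var 0 ^ a * tcoef a h)"
proof (rule tcoef_eqI)
  fix b
  have "tcoef b (\<Sum>a\<in>T. Var 0 ^ a * tcoef a h) = (\<Sum>a\<in>T. if b = a then tcoef a h else 0)"
    unfolding tcoef_sum using tcoef_t_power_mult_free[OF tcoef_mpolys[OF assms(1)]] by (intro sum.cong) auto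
  also have "\<dots> = tcoef b h" using assms(2,3) tcoef_notin[of b h] by (auto simp: sum.delta)
  finally show "tcoef b h = tcoef b (\<Sum>a\<in>T. Var 0 ^ a * tcoef a h)" by simp
qed

lemma t_part_iff:
  "h \<in> t_part S i \<longleftrightarrow> h \<in> carrier S \<and> (\<forall>a. a \<noteq> i \<longrightarrow> tcoef a h = 0)"
proof -
  have "(\<forall>e\<in>keys h. lookup e 0 = i) \<longleftrightarrow> (\<forall>a. a \<noteq> i \<longrightarrow> tcoef a h = 0)"
  proof
    assume "\<forall>a. a \<noteq> i \<longrightarrow> tcoef a h = 0"
    then show "\<forall>e\<in>keys h. lookup e 0 = i"
      by (metis in_keys_iff lookup_eq_tcoef lookup_zero)
  next
    assume "\<forall>e\<in>keys h. lookup e 0 = i"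
    then show "\<forall>a. a \<noteq> i \<longrightarrow> tcoef a h = 0" by (intro allI impI tcoef_notin) auto
  qed
  then show ?thesis by (simp add: t_part_def)
qed

lemma tscale_add: "tscale c (g + h) = tscale c g + tscale c h"
  by (rule poly_mapping_eqI) (simp add: lookup_tscale lookup_add distrib_left)

lemma tscale_tscale: "tscale c (tscale d h) = tscale (\<lambda>a. c a * d a) h"
  by (rule poly_mapping_eqI) (simp add: lookup_tscale mult.assoc)

lemma tscale_plus: "tscale (\<lambda>a. c a + d a) h = tscale c h + tscale d h"
  by (rule poly_mapping_eqI) (simp add: lookup_tscale lookup_add distrib_right)

lemma tscale_const: "tscale (\<lambda>a. c) h = single 0 c * h"
  by (rule poly_mapping_eqI) (simp add: lookup_tscale)

lemma tcoef_tscale: "tcoef a (tscale c h) = single 0 (c a) * tcoef a h"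
  by (rule poly_mapping_eqI) (simp add: lookup_tcoef lookup_tscale lookup_add)

lemma reduce_tscale [simp]: "reduce N (tscale c (reduce N h)) = reduce N (tscale c h)"
  by (rule poly_mapping_eqI) (simp add: lookup_tscale mod_mult_right_eq)

lemma mpolys_tscale: "h \<in> mpolys V \<Longrightarrow> tscale c h \<in> mpolys V"
  unfolding mpolys_iff lookup_tscale by (metis mult_zero_right)

lemma reduce_single_mod: "reduce N (single 0 (c mod N) * h) = reduce N (single 0 c * h)"
  by (rule poly_mapping_eqI) (simp add: mod_mult_left_eq)

lemma reduce_tscale_cong:
  "(\<And>a. [c a = d a] (mod N)) \<Longrightarrow> reduce N (tscale c h) = reduce N (tscale d h)"
  unfolding reduce_eq_iff lookup_tscale by (intro allI cong_mult cong_refl)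

lemma tscale_mult:
  assumes "r \<in> mpolys V" "0 \<notin> V" shows "tscale c (r * h) = r * tscale c h"
  by (rule tcoef_eqI) (simp add: tcoef_tscale tcoef_mult[OF assms] mult.left_commute)

lemma tscale_t_power_mult: "tscale c (Var 0 ^ b * h) = Var 0 ^ b * tscale (\<lambda>a. c (a + b)) h"
  by (rule tcoef_eqI) (auto simp: tcoef_tscale tcoef_t_power_mult)

section \<open>Operators of degree zero\<close>

context odd_prime_power
begin

definition tscale_op :: "nat set \<Rightarrow> (nat \<Rightarrow> int) \<Rightarrow> int mpoly \<Rightarrow> int mpoly" where
  "tscale_op V c = (\<lambda>h\<in>carrier (poly_alg q V). reduce q (tscale c h))"

text \<open>The counterpart on exponents of a function on \<open>Z_p\<close> that is constant on the
  cosets of \<open>p^N Z_p\<close>.\<close>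

definition periodic :: "nat \<Rightarrow> (nat \<Rightarrow> int) \<Rightarrow> bool" where
  "periodic N c \<longleftrightarrow> (\<forall>a. [c (a + p ^ N) = c a] (mod q))"

lemma tscale_op_apply: "h \<in> mpolys V \<Longrightarrow> tscale_op V c (reduce q h) = reduce q (tscale c h)"
  by (simp add: tscale_op_def reduce_in_poly_alg[OF q_pos])

lemma tscale_op_endo: "tscale_op V c \<in> additive_endos (poly_alg q V)"
proof -
  interpret S: cring "poly_alg q V" by (rule cring_poly)
  show ?thesis
    by (rule S.additive_endosI)
      (auto simp: tscale_op_def poly_alg_simps tscale_add poly_alg_carrier[OF q_pos] mpolys_reduce mpolys_tscale mpolys_add)
qed

lemma Var_power_reduce: "reduce q (Var i) [^]\<^bsub>poly_alg q V\<^esub> (k::nat) = reduce q (Var i ^ k)"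
  by (simp add: poly_alg_pow[OF q_pos])

text \<open>Multiplication by \<open>t^(p^N)\<close> shifts the argument of \<open>c\<close> by
  \<open>p^N\<close>, which periodicity permits; the other variables do not change the
  \<open>t\<close>-degree at all.\<close>

lemma tscale_op_commutes:
  assumes "periodic N c" "i \<in> V"
  shows "commutes_with (poly_alg q V) (tscale_op V c) (reduce q (Var i) [^]\<^bsub>poly_alg q V\<^esub> (p ^ N))"
  unfolding commutes_with_def
proof
  fix x assume x: "x \<in> carrier (poly_alg q V)"
  then have xm: "x \<in> mpolys V" "reduce q x = x" using q_pos by (auto simp: poly_alg_carrier)
  let ?M = "p ^ N"
  have vx: "Var i ^ ?M * x \<in> mpolys V" using assms xm by (auto intro!: mpolys_mult mpolys_power mpolys_Var)
  have "reduce q (tscale c (Var i ^ ?M * x)) = reduce q (Var i ^ ?M * tscale c x)"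
  proof (cases "i = 0")
    case True
    have "reduce q (tscale (\<lambda>a. c (a + ?M)) x) = reduce q (tscale c x)"
      using assms(1) by (intro reduce_tscale_cong) (simp add: periodic_def)
    then have "reduce q (Var 0 ^ ?M * tscale (\<lambda>a. c (a + ?M)) x) = reduce q (Var 0 ^ ?M * tscale c x)"
      by (intro reduce_mult_cong) auto
    then show ?thesis unfolding True tscale_t_power_mult .
  next
    case False
    then show ?thesis by (subst tscale_mult[of _ "{i}"]) (auto intro!: mpolys_power mpolys_Var)
  qed
  then show "tscale_op V c (reduce q (Var i) [^]\<^bsub>poly_alg q V\<^esub> ?M \<otimes>\<^bsub>poly_alg q V\<^esub> x) =
      reduce q (Var i) [^]\<^bsub>poly_alg q V\<^esub> ?M \<otimes>\<^bsub>poly_alg q V\<^esub> tscale_op V c x"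
    using tscale_op_apply[OF vx] tscale_op_apply[OF xm(1)] xm(2) by (simp add: Var_power_reduce poly_alg_simps)
qed

lemma tscale_op_t_part: "h \<in> t_part (poly_alg q V) i \<Longrightarrow> tscale_op V c h \<in> t_part (poly_alg q V) i"
proof -
  interpret S: cring "poly_alg q V" by (rule cring_poly)
  assume "h \<in> t_part (poly_alg q V) i"
  then show ?thesis using S.additive_endosD(1)[OF tscale_op_endo]
    by (auto simp: t_part_iff tscale_op_def tcoef_reduce tcoef_tscale)
qed

lemma D0_carrier: "carrier (diff_op_ring_0 A S) = {\<phi> \<in> diff_ops A S. \<forall>i. \<forall>h\<in>t_part S i. \<phi> h \<in> t_part S i}"
  by (simp add: diff_op_ring_0_def)

lemma tscale_op_D0:
  assumes "finite V" "periodic N c"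
  shows "tscale_op V c \<in> carrier (diff_op_ring_0 (residue_ring q) (poly_alg q V))"
  using diff_opI[OF assms(1) tscale_op_endo tscale_op_commutes[OF assms(2)]] tscale_op_t_part
  by (simp add: D0_carrier)

lemma D0_endo: "\<phi> \<in> carrier (diff_op_ring_0 (residue_ring q) (poly_alg q V)) \<Longrightarrow> \<phi> \<in> additive_endos (poly_alg q V)"
  by (auto simp: D0_carrier diff_ops_def linear_endos_poly_alg[OF q_pos])

lemma D0_levelE:
  assumes "\<phi> \<in> carrier (diff_op_ring_0 (residue_ring q) (poly_alg q V))" "finite V"
  obtains N where "\<And>w. w \<in> carrier (poly_alg q V) \<Longrightarrow> commutes_with (poly_alg q V) \<phi> (w [^]\<^bsub>poly_alg q V\<^esub> (p ^ N))"
proof -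
  interpret S: frobenius_diff_ops "residue_ring q" "poly_alg q V" p by (rule frobenius_diff_ops_poly_alg[OF assms(2)])
  have "\<exists>k. killed_by_power (poly_alg q V) k \<phi>" using assms(1) by (auto simp: D0_carrier diff_ops_def)
  then show thesis using S.diff_op_iff[OF D0_endo[OF assms(1)]] that by blast
qed

text \<open>The operator on \<open>R\<close> given by the action of a degree-zero operator on \<open>R t\<^sup>a\<close>.\<close>

definition tcomponent :: "nat \<Rightarrow> (int mpoly \<Rightarrow> int mpoly) \<Rightarrow> nat \<Rightarrow> int mpoly \<Rightarrow> int mpoly" where
  "tcomponent n \<phi> a = (\<lambda>r\<in>carrier (poly_alg q {1..n}). tcoef a (\<phi> (reduce q (Var 0 ^ a * r))))"

lemma t_mpolys: "r \<in> mpolys {1..n} \<Longrightarrow> Var 0 ^ a * r \<in> mpolys {0..n}" for r :: "int mpoly"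
  by (rule mpolys_mult[OF mpolys_power[OF mpolys_Var] mpolys_mono[of "{1..n}"]]) auto

lemma D0_tcoef_sum:
  assumes \<phi>: "\<phi> \<in> carrier (diff_op_ring_0 (residue_ring q) (poly_alg q {0..n}))"
    and "finite T" "\<And>a. a \<in> T \<Longrightarrow> r a \<in> carrier (poly_alg q {1..n})"
  shows "tcoef b (\<phi> (reduce q (\<Sum>a\<in>T. Var 0 ^ a * r a))) = (if b \<in> T then tcomponent n \<phi> b (r b) else 0)"
  using assms(2,3)
proof (induction T)
  case empty
  interpret S: cring "poly_alg q {0..n}" by (rule cring_poly)
  show ?case using S.additive_endos_zero[OF D0_endo[OF \<phi>]] by (simp add: poly_alg_simps(3))
next
  case (insert a T)
  interpret S: cring "poly_alg q {0..n}" by (rule cring_poly)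
  have rm: "r b \<in> mpolys {1..n}" if "b \<in> insert a T" for b using insert.prems[OF that] q_pos by (simp add: poly_alg_carrier)
  have m: "Var 0 ^ a * r a \<in> mpolys {0..n}" "(\<Sum>a\<in>T. Var 0 ^ a * r a) \<in> mpolys {0..n}"
    using rm t_mpolys by (auto intro!: mpolys_sum)
  note c = reduce_in_poly_alg[OF q_pos m(1)] reduce_in_poly_alg[OF q_pos m(2)]
  have "reduce q (\<Sum>a\<in>insert a T. Var 0 ^ a * r a) = reduce q (Var 0 ^ a * r a) \<oplus>\<^bsub>poly_alg q {0..n}\<^esub> reduce q (\<Sum>a\<in>T. Var 0 ^ a * r a)"
    using insert by (simp add: poly_alg_simps)
  then have "\<phi> (reduce q (\<Sum>a\<in>insert a T. Var 0 ^ a * r a)) =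
      reduce q (\<phi> (reduce q (Var 0 ^ a * r a)) + \<phi> (reduce q (\<Sum>a\<in>T. Var 0 ^ a * r a)))"
    using S.additive_endosD(2)[OF D0_endo[OF \<phi>] c] by (simp add: poly_alg_simps)
  then have 1: "tcoef b (\<phi> (reduce q (\<Sum>a\<in>insert a T. Var 0 ^ a * r a))) =
      reduce q (tcoef b (\<phi> (reduce q (Var 0 ^ a * r a))) + tcoef b (\<phi> (reduce q (\<Sum>a\<in>T. Var 0 ^ a * r a))))"
    by (simp add: tcoef_reduce tcoef_add)
  have red: "reduce q (\<phi> x) = \<phi> x" if "x \<in> carrier (poly_alg q {0..n})" for x
    using S.additive_endosD(1)[OF D0_endo[OF \<phi>] that] q_pos by (simp add: poly_alg_carrier)
  have "reduce q (Var 0 ^ a * r a) \<in> t_part (poly_alg q {0..n}) a"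
    using c(1) tcoef_t_power_mult_free[OF rm[of a], of _ a] by (simp add: t_part_iff tcoef_reduce)
  then have "\<phi> (reduce q (Var 0 ^ a * r a)) \<in> t_part (poly_alg q {0..n}) a" using \<phi> by (simp add: D0_carrier)
  then have "tcoef b (\<phi> (reduce q (Var 0 ^ a * r a))) = (if b = a then tcomponent n \<phi> a (r a) else 0)"
    using insert.prems[of a] by (auto simp: t_part_iff tcomponent_def)
  moreover have "reduce q (tcoef b (\<phi> (reduce q (Var 0 ^ a * r a)))) = tcoef b (\<phi> (reduce q (Var 0 ^ a * r a)))"
    "reduce q (tcoef b (\<phi> (reduce q (\<Sum>a\<in>T. Var 0 ^ a * r a)))) = tcoef b (\<phi> (reduce q (\<Sum>a\<in>T. Var 0 ^ a * r a)))"
    using red[OF c(1)] red[OF c(2)] by (simp_all flip: tcoef_reduce)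
  moreover have "tcoef b (\<phi> (reduce q (\<Sum>a\<in>T. Var 0 ^ a * r a))) = (if b \<in> T then tcomponent n \<phi> b (r b) else 0)"
    using insert.IH insert.prems by simp
  ultimately show ?case unfolding 1 using insert.hyps by auto
qed

text \<open>An operator of degree zero preserves every \<open>R t^a\<close>, so after expansion in
  powers of \<open>t\<close> it acts on each coefficient separately.\<close>

lemma D0_tcoef:
  assumes \<phi>: "\<phi> \<in> carrier (diff_op_ring_0 (residue_ring q) (poly_alg q {0..n}))"
    and h: "h \<in> carrier (poly_alg q {0..n})"
  shows "tcoef b (\<phi> h) = tcomponent n \<phi> b (tcoef b h)"
proof -
  have hm: "h \<in> mpolys {0..n}" "reduce q h = h" using h q_pos by (auto simp: poly_alg_carrier)
  have c: "tcoef a h \<in> carrier (poly_alg q {1..n})" for a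
    using tcoef_mpolys[OF hm(1)] hm(2) q_pos by (simp add: poly_alg_carrier flip: tcoef_reduce)
  have "h = (\<Sum>a\<in>insert b (tdegs h). Var 0 ^ a * tcoef a h)" by (rule t_expansion[OF hm(1)]) auto
  then have "tcoef b (\<phi> h) = tcoef b (\<phi> (reduce q (\<Sum>a\<in>insert b (tdegs h). Var 0 ^ a * tcoef a h)))"
    using hm(2) by simp
  also have "\<dots> = tcomponent n \<phi> b (tcoef b h)"
    by (subst D0_tcoef_sum[OF \<phi> _ c]) auto
  finally show ?thesis .
qed

lemma tcomponent_endo:
  assumes \<phi>: "\<phi> \<in> carrier (diff_op_ring_0 (residue_ring q) (poly_alg q {0..n}))"
  shows "tcomponent n \<phi> a \<in> additive_endos (poly_alg q {1..n})"
proof -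
  interpret S: cring "poly_alg q {0..n}" by (rule cring_poly)
  interpret R: cring "poly_alg q {1..n}" by (rule cring_poly)
  note \<phi>e = D0_endo[OF \<phi>]
  show ?thesis
  proof (rule R.additive_endosI)
    fix r assume r: "r \<in> carrier (poly_alg q {1..n})"
    then have rc: "reduce q (Var 0 ^ a * r) \<in> carrier (poly_alg q {0..n})"
      using q_pos t_mpolys by (intro reduce_in_poly_alg) (auto simp: poly_alg_carrier)
    have "\<phi> (reduce q (Var 0 ^ a * r)) \<in> mpolys {0..n}" "reduce q (\<phi> (reduce q (Var 0 ^ a * r))) = \<phi> (reduce q (Var 0 ^ a * r))"
      using S.additive_endosD(1)[OF \<phi>e rc] q_pos by (auto simp: poly_alg_carrier)
    then show "tcomponent n \<phi> a r \<in> carrier (poly_alg q {1..n})"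
      using r q_pos by (simp add: tcomponent_def poly_alg_carrier tcoef_mpolys flip: tcoef_reduce)
    fix s assume s: "s \<in> carrier (poly_alg q {1..n})"
    then have sc: "reduce q (Var 0 ^ a * s) \<in> carrier (poly_alg q {0..n})"
      using q_pos t_mpolys by (intro reduce_in_poly_alg) (auto simp: poly_alg_carrier)
    have "reduce q (Var 0 ^ a * (r \<oplus>\<^bsub>poly_alg q {1..n}\<^esub> s)) = reduce q (Var 0 ^ a * r) \<oplus>\<^bsub>poly_alg q {0..n}\<^esub> reduce q (Var 0 ^ a * s)"
      by (simp add: poly_alg_simps distrib_left)
    then have "\<phi> (reduce q (Var 0 ^ a * (r \<oplus>\<^bsub>poly_alg q {1..n}\<^esub> s))) = reduce q (\<phi> (reduce q (Var 0 ^ a * r)) + \<phi> (reduce q (Var 0 ^ a * s)))"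
      using S.additive_endosD(2)[OF \<phi>e rc sc] by (simp add: poly_alg_simps)
    then show "tcomponent n \<phi> a (r \<oplus>\<^bsub>poly_alg q {1..n}\<^esub> s) = tcomponent n \<phi> a r \<oplus>\<^bsub>poly_alg q {1..n}\<^esub> tcomponent n \<phi> a s"
      using r s R.a_closed[OF r s] by (simp add: tcomponent_def tcoef_reduce tcoef_add poly_alg_simps)
  qed (simp add: tcomponent_def)
qed

text \<open>As \<open>w\<close> is free of \<open>t\<close>, extracting a coefficient of
  \<open>t\<close> commutes with multiplication by \<open>w\<close>.\<close>

lemma tcomponent_commutes:
  assumes \<phi>: "\<phi> \<in> carrier (diff_op_ring_0 (residue_ring q) (poly_alg q {0..n}))"
    and w: "w \<in> carrier (poly_alg q {1..n})" and c: "commutes_with (poly_alg q {0..n}) \<phi> w"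
  shows "commutes_with (poly_alg q {1..n}) (tcomponent n \<phi> a) w"
  unfolding commutes_with_def
proof
  interpret R: cring "poly_alg q {1..n}" by (rule cring_poly)
  fix r assume r: "r \<in> carrier (poly_alg q {1..n})"
  then have rc: "reduce q (Var 0 ^ a * r) \<in> carrier (poly_alg q {0..n})"
    using q_pos t_mpolys by (intro reduce_in_poly_alg) (auto simp: poly_alg_carrier)
  have wm: "w \<in> mpolys {1..n}" using w q_pos by (simp add: poly_alg_carrier)
  have e1: "reduce q (Var 0 ^ a * (w \<otimes>\<^bsub>poly_alg q {1..n}\<^esub> r)) = w \<otimes>\<^bsub>poly_alg q {0..n}\<^esub> reduce q (Var 0 ^ a * r)"
    by (simp add: poly_alg_simps mult.left_commute)
  have "\<phi> (reduce q (Var 0 ^ a * (w \<otimes>\<^bsub>poly_alg q {1..n}\<^esub> r))) = reduce q (w * \<phi> (reduce q (Var 0 ^ a * r)))"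
    unfolding e1 bspec[OF c[unfolded commutes_with_def] rc] by (rule poly_alg_simps(1))
  then show "tcomponent n \<phi> a (w \<otimes>\<^bsub>poly_alg q {1..n}\<^esub> r) = w \<otimes>\<^bsub>poly_alg q {1..n}\<^esub> tcomponent n \<phi> a r"
    using r R.m_closed[OF w r] by (simp add: tcomponent_def tcoef_reduce tcoef_mult[OF wm] poly_alg_simps)
qed

lemma poly_alg_mono: "V \<subseteq> V' \<Longrightarrow> h \<in> carrier (poly_alg q V) \<Longrightarrow> h \<in> carrier (poly_alg q V')"
  using q_pos by (auto simp: poly_alg_carrier intro: mpolys_mono)

text \<open>The operator that acts as \<open>c(a) \<psi>\<close> on \<open>R t\<^sup>a\<close>.\<close>

definition tensor_op :: "nat \<Rightarrow> (nat \<Rightarrow> int) \<Rightarrow> (int mpoly \<Rightarrow> int mpoly) \<Rightarrow> int mpoly \<Rightarrow> int mpoly" where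
  "tensor_op n c \<psi> = (\<lambda>h\<in>carrier (poly_alg q {0..n}).
     reduce q (\<Sum>a\<in>tdegs h. Var 0 ^ a * (single 0 (c a) * \<psi> (tcoef a h))))"

lemma tcoef_carrier: "h \<in> carrier (poly_alg q {0..n}) \<Longrightarrow> tcoef a h \<in> carrier (poly_alg q {1..n})"
  using q_pos by (simp add: poly_alg_carrier tcoef_mpolys flip: tcoef_reduce)

lemma tcoef_tensor_op:
  assumes \<psi>: "\<psi> \<in> additive_endos (poly_alg q {1..n})" and h: "h \<in> carrier (poly_alg q {0..n})"
  shows "tcoef b (tensor_op n c \<psi> h) = reduce q (single 0 (c b) * \<psi> (tcoef b h))"
proof -
  interpret R: cring "poly_alg q {1..n}" by (rule cring_poly)
  have m: "single 0 (c a) * \<psi> (tcoef a h) \<in> mpolys {1..n}" for a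
    using R.additive_endosD(1)[OF \<psi> tcoef_carrier[OF h]] q_pos by (auto simp: poly_alg_carrier intro!: mpolys_mult)
  have "tcoef b (tensor_op n c \<psi> h) = reduce q (\<Sum>a\<in>tdegs h. if b = a then single 0 (c a) * \<psi> (tcoef a h) else 0)"
    using h tcoef_t_power_mult_free[OF m] by (simp add: tensor_op_def tcoef_reduce tcoef_sum)
  also have "(\<Sum>a\<in>tdegs h. if b = a then single 0 (c a) * \<psi> (tcoef a h) else 0) = single 0 (c b) * \<psi> (tcoef b h)"
    using tcoef_notin[of b h] R.additive_endos_zero[OF \<psi>] by (auto simp: sum.delta poly_alg_simps(3))
  finally show ?thesis .
qed

lemma tensor_op_closed:
  assumes \<psi>: "\<psi> \<in> additive_endos (poly_alg q {1..n})" and h: "h \<in> carrier (poly_alg q {0..n})"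
  shows "tensor_op n c \<psi> h \<in> carrier (poly_alg q {0..n})"
proof -
  interpret R: cring "poly_alg q {1..n}" by (rule cring_poly)
  have m: "single 0 (c a) * \<psi> (tcoef a h) \<in> mpolys {1..n}" for a
    using R.additive_endosD(1)[OF \<psi> tcoef_carrier[OF h]] q_pos by (auto simp: poly_alg_carrier intro!: mpolys_mult)
  then show ?thesis using h by (auto simp: tensor_op_def intro!: reduce_in_poly_alg[OF q_pos] mpolys_sum t_mpolys)
qed

lemma tensor_op_endo:
  assumes \<psi>: "\<psi> \<in> additive_endos (poly_alg q {1..n})"
  shows "tensor_op n c \<psi> \<in> additive_endos (poly_alg q {0..n})"
proof -
  interpret R: cring "poly_alg q {1..n}" by (rule cring_poly)
  interpret S: cring "poly_alg q {0..n}" by (rule cring_poly)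
  show ?thesis
  proof (rule S.additive_endosI)
    fix x y assume x: "x \<in> carrier (poly_alg q {0..n})" and y: "y \<in> carrier (poly_alg q {0..n})"
    show "tensor_op n c \<psi> (x \<oplus>\<^bsub>poly_alg q {0..n}\<^esub> y) = tensor_op n c \<psi> x \<oplus>\<^bsub>poly_alg q {0..n}\<^esub> tensor_op n c \<psi> y"
    proof (rule tcoef_eqI)
      fix a
      have "tcoef a (x \<oplus>\<^bsub>poly_alg q {0..n}\<^esub> y) = tcoef a x \<oplus>\<^bsub>poly_alg q {1..n}\<^esub> tcoef a y"
        by (simp add: poly_alg_simps tcoef_reduce tcoef_add)
      then have "\<psi> (tcoef a (x \<oplus>\<^bsub>poly_alg q {0..n}\<^esub> y)) = reduce q (\<psi> (tcoef a x) + \<psi> (tcoef a y))"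
        using R.additive_endosD(2)[OF \<psi> tcoef_carrier[OF x] tcoef_carrier[OF y]] by (simp add: poly_alg_simps)
      then show "tcoef a (tensor_op n c \<psi> (x \<oplus>\<^bsub>poly_alg q {0..n}\<^esub> y)) = tcoef a (tensor_op n c \<psi> x \<oplus>\<^bsub>poly_alg q {0..n}\<^esub> tensor_op n c \<psi> y)"
        unfolding tcoef_tensor_op[OF \<psi> S.a_closed[OF x y]]
        unfolding poly_alg_simps(4)[of q "{0..n}" "tensor_op n c \<psi> x"] tcoef_reduce tcoef_add tcoef_tensor_op[OF \<psi> x] tcoef_tensor_op[OF \<psi> y]
        by (simp add: distrib_left)
    qed
  qed (use tensor_op_closed[OF \<psi>] in \<open>auto simp: tensor_op_def\<close>)
qed

text \<open>Multiplication by \<open>t^(p^N)\<close> moves the component at \<open>t^a\<close> to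
  \<open>t^(a + p^N)\<close>, where \<open>c\<close> takes the same value modulo \<open>q\<close>.
  The other variables act inside the components, where \<open>\<psi>\<close> commutes with their
  \<open>p^N\<close>-th powers.\<close>

lemma tensor_op_commutes:
  assumes \<psi>: "\<psi> \<in> additive_endos (poly_alg q {1..n})" and c: "periodic N c"
    and comm: "\<And>i. i \<in> {1..n} \<Longrightarrow> commutes_with (poly_alg q {1..n}) \<psi> (reduce q (Var i) [^]\<^bsub>poly_alg q {1..n}\<^esub> (p ^ N))"
    and i: "i \<in> {0..n}"
  shows "commutes_with (poly_alg q {0..n}) (tensor_op n c \<psi>) (reduce q (Var i) [^]\<^bsub>poly_alg q {0..n}\<^esub> (p ^ N))"
  unfolding commutes_with_def Var_power_reduce
proof
  interpret R: cring "poly_alg q {1..n}" by (rule cring_poly)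
  interpret S: cring "poly_alg q {0..n}" by (rule cring_poly)
  fix x assume x: "x \<in> carrier (poly_alg q {0..n})"
  let ?M = "p ^ N" and ?S = "poly_alg q {0..n}"
  have v: "reduce q (Var i ^ ?M) \<in> carrier ?S" using i by (intro reduce_in_poly_alg[OF q_pos] mpolys_power mpolys_Var)
  show "tensor_op n c \<psi> (reduce q (Var i ^ ?M) \<otimes>\<^bsub>?S\<^esub> x) = reduce q (Var i ^ ?M) \<otimes>\<^bsub>?S\<^esub> tensor_op n c \<psi> x"
  proof (rule tcoef_eqI)
    fix a
    have l: "tcoef a (tensor_op n c \<psi> (reduce q (Var i ^ ?M) \<otimes>\<^bsub>?S\<^esub> x)) =
       reduce q (single 0 (c a) * \<psi> (reduce q (tcoef a (Var i ^ ?M * x))))"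
      unfolding tcoef_tensor_op[OF \<psi> S.m_closed[OF v x]] by (simp add: poly_alg_simps tcoef_reduce)
    have r: "tcoef a (reduce q (Var i ^ ?M) \<otimes>\<^bsub>?S\<^esub> tensor_op n c \<psi> x) = reduce q (tcoef a (Var i ^ ?M * tensor_op n c \<psi> x))"
      by (simp add: poly_alg_simps tcoef_reduce)
    have xr: "reduce q (tcoef a x) = tcoef a x" for a using tcoef_carrier[OF x] q_pos by (simp add: poly_alg_carrier)
    show "tcoef a (tensor_op n c \<psi> (reduce q (Var i ^ ?M) \<otimes>\<^bsub>?S\<^esub> x)) = tcoef a (reduce q (Var i ^ ?M) \<otimes>\<^bsub>?S\<^esub> tensor_op n c \<psi> x)"
    proof (cases "i = 0")
      case True
      have "[c a = c (a - ?M)] (mod q)" if "?M \<le> a" using c that unfolding periodic_def by (metis le_add_diff_inverse2)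
      then have "reduce q (single 0 (c a) * y) = reduce q (single 0 (c (a - ?M)) * y)" if "?M \<le> a" for y
        unfolding reduce_eq_iff lookup_const_mult using that by (intro allI cong_mult cong_refl)
      then show ?thesis unfolding l r unfolding True tcoef_t_power_mult
        using R.additive_endos_zero[OF \<psi>] tcoef_tensor_op[OF \<psi> x] xr by (auto simp: poly_alg_simps(3))
    next
      case False
      then have i': "i \<in> {1..n}" using i by auto
      have vm: "(Var i ^ ?M :: int mpoly) \<in> mpolys {1..n}" using i' by (intro mpolys_power mpolys_Var)
      have "\<psi> (reduce q (Var i ^ ?M * tcoef a x)) = reduce q (Var i ^ ?M * \<psi> (tcoef a x))"
        using comm[OF i'] tcoef_carrier[OF x, of a] unfolding commutes_with_def Var_power_reduce by (simp add: poly_alg_simps)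
      then show ?thesis unfolding l r tcoef_mult[OF vm, simplified] tcoef_tensor_op[OF \<psi> x]
        by (simp add: mult.left_commute)
    qed
  qed
qed

lemma tensor_op_D0:
  assumes \<psi>: "\<psi> \<in> additive_endos (poly_alg q {1..n})" and c: "periodic N c"
    and comm: "\<And>i. i \<in> {1..n} \<Longrightarrow> commutes_with (poly_alg q {1..n}) \<psi> (reduce q (Var i) [^]\<^bsub>poly_alg q {1..n}\<^esub> (p ^ N))"
  shows "tensor_op n c \<psi> \<in> carrier (diff_op_ring_0 (residue_ring q) (poly_alg q {0..n}))"
proof -
  interpret R: cring "poly_alg q {1..n}" by (rule cring_poly)
  have "tensor_op n c \<psi> \<in> diff_ops (residue_ring q) (poly_alg q {0..n})"
    using diff_opI[OF _ tensor_op_endo[OF \<psi>] tensor_op_commutes[OF \<psi> c comm]] by blast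
  moreover have "tensor_op n c \<psi> h \<in> t_part (poly_alg q {0..n}) i" if "h \<in> t_part (poly_alg q {0..n}) i" for i h
    using that tensor_op_closed[OF \<psi>] R.additive_endos_zero[OF \<psi>]
    by (simp add: t_part_iff tcoef_tensor_op[OF \<psi>] poly_alg_simps(3))
  ultimately show ?thesis by (simp add: D0_carrier)
qed

end

section \<open>The ring \<open>C\<^sub>m\<close>\<close>

lemma quotient_of_of_int: "quotient_of (of_int z) = (z, 1)"
  using quotient_of_int[of z] by (simp add: Rat.of_int_def)

text \<open>The denominator of \<alpha> is a unit modulo \<open>p^k\<close>, so exactly one residue
  satisfies the defining congruence.\<close>

lemma padic_of_rat_props:
  assumes "prime p" "\<alpha> \<in> Z_loc p"
  shows "padic_of_rat p \<alpha> k \<in> {0..<int p ^ k}"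
    and "[padic_of_rat p \<alpha> k * snd (quotient_of \<alpha>) = fst (quotient_of \<alpha>)] (mod int p ^ k)"
    and "\<And>r. r \<in> {0..<int p ^ k} \<Longrightarrow> [r * snd (quotient_of \<alpha>) = fst (quotient_of \<alpha>)] (mod int p ^ k) \<Longrightarrow> padic_of_rat p \<alpha> k = r"
proof -
  let ?d = "snd (quotient_of \<alpha>)" and ?n = "fst (quotient_of \<alpha>)"
  have "coprime (int p) ?d" using assms by (simp add: Z_loc_def prime_imp_coprime)
  then have cop: "coprime ?d (int p ^ k)" by (simp add: coprime_commute)
  have pk: "int p ^ k > 0" using assms(1) prime_gt_0_nat by simp
  obtain x where x: "[?d * x = 1] (mod int p ^ k)" using cong_solve_coprime_int[OF cop] by blast
  have ex: "\<exists>!r. r \<in> {0..<int p ^ k} \<and> [r * ?d = ?n] (mod int p ^ k)"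
  proof (rule ex1I[of _ "(x * ?n) mod int p ^ k"])
    have "[(x * ?n) mod int p ^ k * ?d = (?d * x) * ?n] (mod int p ^ k)"
      unfolding cong_def mod_mult_left_eq by (simp add: ac_simps)
    also have "[(?d * x) * ?n = 1 * ?n] (mod int p ^ k)" using x by (intro cong_mult cong_refl)
    finally show "(x * ?n) mod int p ^ k \<in> {0..<int p ^ k} \<and> [(x * ?n) mod int p ^ k * ?d = ?n] (mod int p ^ k)"
      using pk by simp
    then have 1: "[(x * ?n) mod int p ^ k * ?d = ?n] (mod int p ^ k)" by blast
    fix r assume r: "r \<in> {0..<int p ^ k} \<and> [r * ?d = ?n] (mod int p ^ k)"
    then have "[r * ?d = (x * ?n) mod int p ^ k * ?d] (mod int p ^ k)" using 1 cong_sym cong_trans by blast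
    then have "[r = (x * ?n) mod int p ^ k] (mod int p ^ k)" using cop by (simp add: cong_mult_rcancel)
    then show "r = (x * ?n) mod int p ^ k" using r pk by (simp add: cong_def)
  qed
  have def: "padic_of_rat p \<alpha> k = (THE r. r \<in> {0..<int p ^ k} \<and> [r * ?d = ?n] (mod int p ^ k))"
    by (simp add: padic_of_rat_def)
  show "padic_of_rat p \<alpha> k \<in> {0..<int p ^ k}" "[padic_of_rat p \<alpha> k * ?d = ?n] (mod int p ^ k)"
    using theI'[OF ex] unfolding def by blast+
  show "padic_of_rat p \<alpha> k = r" if "r \<in> {0..<int p ^ k}" "[r * ?d = ?n] (mod int p ^ k)" for r
    unfolding def using the1_equality[OF ex] that by blast
qed

lemma padic_of_rat_in_padic_ints:
  assumes "prime p" "\<alpha> \<in> Z_loc p" shows "padic_of_rat p \<alpha> \<in> padic_ints p"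
proof -
  have "padic_of_rat p \<alpha> (Suc k) mod int p ^ k = padic_of_rat p \<alpha> k" for k
  proof (rule padic_of_rat_props(3)[OF assms, symmetric])
    show "padic_of_rat p \<alpha> (Suc k) mod int p ^ k \<in> {0..<int p ^ k}" using assms(1) prime_gt_0_nat by simp
    have "[padic_of_rat p \<alpha> (Suc k) * snd (quotient_of \<alpha>) = fst (quotient_of \<alpha>)] (mod int p ^ k)"
      using padic_of_rat_props(2)[OF assms, of "Suc k"] by (rule cong_modulus_mult[of _ _ "int p ^ k" "int p", simplified mult.commute[of "int p ^ k"] power_Suc[symmetric]])
    then show "[padic_of_rat p \<alpha> (Suc k) mod int p ^ k * snd (quotient_of \<alpha>) = fst (quotient_of \<alpha>)] (mod int p ^ k)"
      by (simp add: cong_def mod_mult_left_eq)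
  qed
  then show ?thesis using padic_of_rat_props(1)[OF assms] by (simp add: padic_ints_def)
qed

lemma padic_of_int: "prime p \<Longrightarrow> padic_of_rat p (of_int z) k = z mod int p ^ k"
proof (rule padic_of_rat_props(3))
  note q = quotient_of_of_int[of z]
  assume p: "prime p"
  show "of_int z \<in> Z_loc p" using p prime_gt_1_nat[OF p] by (simp add: Z_loc_def q)
  show "z mod int p ^ k \<in> {0..<int p ^ k}" using p prime_gt_0_nat by simp
  show "[z mod int p ^ k * snd (quotient_of (rat_of_int z)) = fst (quotient_of (rat_of_int z))] (mod int p ^ k)"
    by (simp add: q cong_def)
qed

context odd_prime_power
begin

lemma pow_pos: "int p ^ k > 0" using prime_gt_0_nat[OF prime_p] by simp

lemma periodic_mod:
  assumes "periodic N c" shows "[c (a mod p ^ N) = c a] (mod q)"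
proof -
  have "[c (b + k * p ^ N) = c b] (mod q)" for b k
  proof (induction k)
    case (Suc k)
    have "[c ((b + k * p ^ N) + p ^ N) = c (b + k * p ^ N)] (mod q)" using assms unfolding periodic_def by blast
    moreover have "(b + k * p ^ N) + p ^ N = b + Suc k * p ^ N" by simp
    ultimately show ?case using Suc cong_trans by metis
  qed simp
  from this[of "a mod p ^ N" "a div p ^ N"] show ?thesis unfolding mod_div_mult_eq by (rule cong_sym)
qed

text \<open>An exponent \<open>a\<close> for which the eigenvalue on \<open>t\<^sup>a\<close> is \<open>\<phi>\<^sub>P (x)\<close> if \<open>\<phi>\<^sub>P\<close> is constant modulo \<open>p\<^sup>N\<close>.\<close>

definition dual_exponent :: "nat \<Rightarrow> (nat \<Rightarrow> int) \<Rightarrow> nat" where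
  "dual_exponent N x = nat ((- 1 - x N) mod int p ^ N)"

lemma int_dual_exponent: "int (dual_exponent N x) = (- 1 - x N) mod int p ^ N"
  using pow_pos by (simp add: dual_exponent_def)

lemma dual_exponent_less: "dual_exponent N x < p ^ N"
proof -
  have "int (dual_exponent N x) < int p ^ N" unfolding int_dual_exponent using pow_pos by (rule pos_mod_bound)
  then show ?thesis by (metis of_nat_less_iff of_nat_power)
qed

lemma t_power_carrier: "reduce q (Var 0 ^ a) \<in> carrier (poly_alg q {0})"
  by (intro reduce_in_poly_alg[OF q_pos] mpolys_power mpolys_Var) simp

lemma tscale_op_t_power:
  "tscale_op {0} c (reduce q (Var 0 ^ a)) = c a mod q \<odot>\<^bsub>poly_alg q {0}\<^esub> reduce q (Var 0 ^ a)"
proof -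
  have "tscale c (Var 0 ^ a) = single 0 (c a) * Var 0 ^ a"
    by (rule tcoef_eqI) (auto simp: Var_power tcoef_tscale tcoef_single mult_single)
  then show ?thesis using tscale_op_apply[of "Var 0 ^ a" "{0}" c] mpolys_power[OF mpolys_Var, of 0 "{0}" a]
    by (simp add: poly_alg_simps reduce_single_mod)
qed

lemma t_power_smult_inj:
  assumes "d \<odot>\<^bsub>poly_alg q {0}\<^esub> reduce q (Var 0 ^ a) = e \<odot>\<^bsub>poly_alg q {0}\<^esub> reduce q (Var 0 ^ a)"
  shows "[d = e] (mod q)"
proof -
  have "lookup (reduce q (single 0 d * Var 0 ^ a)) (single 0 a) =
    lookup (reduce q (single 0 e * Var 0 ^ a)) (single 0 a)"
    using assms by (simp add: poly_alg_simps)
  then show ?thesis by (simp add: Var_power mult_single cong_def)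
qed

lemma padic_minus_one_minus: "padic_of_rat p (- 1 - of_nat a) k = (- 1 - int a) mod int p ^ k"
  using padic_of_int[OF prime_p, of "- 1 - int a" k] by simp

lemma padic_minus_one_minus_in: "padic_of_rat p (- 1 - of_nat a) \<in> padic_ints p"
proof (rule padic_of_rat_in_padic_ints[OF prime_p])
  have "quotient_of (of_int (- 1 - int a)) = (- 1 - int a, 1)" by (rule quotient_of_of_int)
  then show "- 1 - of_nat a \<in> Z_loc p" using prime_gt_1_nat[OF prime_p] by (simp add: Z_loc_def)
qed

text \<open>The map \<open>x \<mapsto> -1 - x\<close> is an involution, so passing to the dual
  exponent recovers \<open>a\<close>.\<close>

lemma dual_exponent_padic: "dual_exponent N (padic_of_rat p (- 1 - of_nat a)) = a mod p ^ N"
proof -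
  have "int (dual_exponent N (padic_of_rat p (- 1 - of_nat a))) = (- 1 - (- 1 - int a) mod int p ^ N) mod int p ^ N"
    unfolding int_dual_exponent padic_minus_one_minus ..
  also have "\<dots> = int (a mod p ^ N)" by (simp add: mod_diff_right_eq of_nat_mod)
  finally show ?thesis by linarith
qed

text \<open>The right side depends only on \<open>x\<close> modulo \<open>p^N\<close>, hence is
  locally constant. It is the only candidate, because the integers \<open>-1 - a\<close> with
  \<open>a \<ge> 0\<close> are dense in \<open>Z_p\<close>.\<close>

lemma eigenvalue_fun_tscale_op:
  assumes c: "periodic N c" and x: "x \<in> padic_ints p"
  shows "eigenvalue_fun p m (tscale_op {0} c) x = c (dual_exponent N x) mod q"
proof -
  define \<phi> where "\<phi> = (\<lambda>x\<in>padic_ints p. c (dual_exponent N x) mod q)"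
  have pw: "t_var [^]\<^bsub>poly_alg q {0}\<^esub> a = reduce q (Var 0 ^ a)" for a :: nat by (rule poly_alg_pow[OF q_pos])
  have "(THE \<phi>. \<phi> \<in> padic_ints p \<rightarrow>\<^sub>E carrier (A_ring p m) \<and> locally_constant p \<phi> \<and>
     (\<forall>a::nat. tscale_op {0} c (t_var [^]\<^bsub>At_alg p m\<^esub> a) =
        \<phi> (padic_of_rat p (- 1 - of_nat a)) \<odot>\<^bsub>At_alg p m\<^esub> (t_var [^]\<^bsub>At_alg p m\<^esub> a))) = \<phi>"
  proof (rule the_equality, intro conjI allI)
    show "\<phi> \<in> padic_ints p \<rightarrow>\<^sub>E carrier (A_ring p m)"
      using q_pos by (auto simp: \<phi>_def residue_ring_def)
    show "locally_constant p \<phi>"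
      unfolding locally_constant_def
    proof (intro ballI exI[of _ N] impI)
      fix x y assume "x \<in> padic_ints p" "y \<in> padic_ints p" "y N = x N"
      then show "\<phi> y = \<phi> x" by (simp add: \<phi>_def dual_exponent_def)
    qed
    fix a
    have "c (a mod p ^ N) mod q = c a mod q" using periodic_mod[OF c, of a] by (simp add: cong_def)
    then show "tscale_op {0} c (t_var [^]\<^bsub>At_alg p m\<^esub> a) =
        \<phi> (padic_of_rat p (- 1 - of_nat a)) \<odot>\<^bsub>At_alg p m\<^esub> (t_var [^]\<^bsub>At_alg p m\<^esub> a)"
      unfolding pw tscale_op_t_power using padic_minus_one_minus_in[of a] by (simp add: \<phi>_def dual_exponent_padic)
  next
    fix \<psi> assume \<psi>: "\<psi> \<in> padic_ints p \<rightarrow>\<^sub>E carrier (A_ring p m) \<and> locally_constant p \<psi> \<and>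
     (\<forall>a::nat. tscale_op {0} c (t_var [^]\<^bsub>At_alg p m\<^esub> a) =
        \<psi> (padic_of_rat p (- 1 - of_nat a)) \<odot>\<^bsub>At_alg p m\<^esub> (t_var [^]\<^bsub>At_alg p m\<^esub> a))"
    have "\<psi> x = \<phi> x" if x: "x \<in> padic_ints p" for x
    proof -
      obtain k where k: "\<And>y. y \<in> padic_ints p \<Longrightarrow> y k = x k \<Longrightarrow> \<psi> y = \<psi> x"
        using \<psi> x unfolding locally_constant_def by blast
      \<comment> \<open>Precise enough for both functions: \<open>\<psi>\<close> is constant near
        \<open>x\<close> modulo \<open>p^k\<close>, and \<open>\<phi>\<close> modulo
        \<open>p^N\<close>. The integer \<open>-1 - a\<close> agrees with \<open>x\<close> modulo
        \<open>p^K\<close>.\<close>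
      define K where "K = max k N"
      define a where "a = dual_exponent K x"
      let ?y = "padic_of_rat p (- 1 - of_nat a)"
      have trunc: "y i = y j mod int p ^ i" if "y \<in> padic_ints p" "i \<le> j" for y i j
        using that(2)
      proof (induction j rule: dec_induct)
        case base
        then show ?case using that(1) by (simp add: padic_ints_def)
      next
        case (step j)
        have "y (Suc j) mod int p ^ j = y j" using that(1) by (simp add: padic_ints_def)
        then have "y i = y (Suc j) mod int p ^ j mod int p ^ i" using step by simp
        also have "\<dots> = y (Suc j) mod int p ^ i" using step.hyps by (simp add: mod_mod_cancel le_imp_power_dvd)
        finally show ?case .
      qed
      have "x K \<in> {0..<int p ^ K}" using x by (simp add: padic_ints_def)
      then have yK: "?y K = x K"
        unfolding padic_minus_one_minus a_def int_dual_exponent by (simp add: mod_diff_right_eq)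
      have y: "?y \<in> padic_ints p" by (rule padic_minus_one_minus_in)
      have "?y k = x k" "?y N = x N" using trunc[OF y, of k K] trunc[OF x, of k K] trunc[OF y, of N K] trunc[OF x, of N K] yK
        by (simp_all add: K_def)
      then have 1: "\<psi> x = \<psi> ?y" "\<phi> x = \<phi> ?y" using k[OF y] x y by (simp_all add: \<phi>_def dual_exponent_def)
      have "[c a mod q = \<psi> ?y] (mod q)"
        using \<psi> unfolding pw tscale_op_t_power by (intro t_power_smult_inj[of _ a]) blast
      moreover have "\<psi> ?y \<in> carrier (A_ring p m)" using \<psi> y by (auto simp: PiE_def Pi_def)
      ultimately have "\<psi> ?y = c a mod q" using q_pos by (simp add: residue_ring_def cong_def)
      also have "\<dots> = \<phi> ?y" using y periodic_mod[OF c, of a] by (simp add: \<phi>_def dual_exponent_padic cong_def)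
      finally show ?thesis using 1 by simp
    qed
    moreover have "\<phi> \<in> padic_ints p \<rightarrow>\<^sub>E carrier (A_ring p m)" using q_pos by (auto simp: \<phi>_def residue_ring_def)
    ultimately show "\<psi> = \<phi>" using \<psi> by (intro PiE_ext[of \<psi> "padic_ints p" "\<lambda>_. carrier (A_ring p m)"]) auto
  qed
  then show ?thesis using x by (simp add: eigenvalue_fun_def \<phi>_def)
qed

lemma p_dvd_q: "int p dvd q" by (simp add: modulus_def)

lemma mem_PIdl_p:
  assumes "0 \<le> e" "e < q" shows "e \<in> PIdl\<^bsub>A_ring p m\<^esub> (int p mod q) \<longleftrightarrow> int p dvd e"
proof
  assume "e \<in> PIdl\<^bsub>A_ring p m\<^esub> (int p mod q)"
  then obtain x where "e = x * (int p mod q) mod q" by (auto simp: cgenideal_def residue_ring_def)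
  then show "int p dvd e" using p_dvd_q by (simp add: mod_mult_right_eq dvd_mod)
next
  assume "int p dvd e"
  then obtain k where k: "e = int p * k" by blast
  have "e = (k mod q) * (int p mod q) mod q" using assms by (simp add: mod_mult_eq k mult.commute)
  moreover have "k mod q \<in> {0..q - 1}" using q_pos by simp
  ultimately show "e \<in> PIdl\<^bsub>A_ring p m\<^esub> (int p mod q)" by (auto simp: cgenideal_def residue_ring_def)
qed

text \<open>The polynomial ring in no variables is a copy of \<open>Z/q\<close>, where an additive
  map is determined by the image of 1.\<close>

lemma const_endo:
  assumes \<psi>: "\<psi> \<in> additive_endos (poly_alg q {})" and r: "r \<in> carrier (poly_alg q {})"
  shows "\<psi> r = reduce q (single 0 (lookup (\<psi> (reduce q 1)) 0) * r)"
proof -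
  interpret S: cring "poly_alg q {}" by (rule cring_poly)
  have const: "h = single 0 (lookup h 0)" "reduce q h = h" if "h \<in> carrier (poly_alg q {})" for h
  proof -
    have "h \<in> mpolys {}" using that q_pos by (simp add: poly_alg_carrier)
    then have "lookup h e = 0" if "e \<noteq> 0" for e using that by (auto simp: mpolys_iff)
    then show "h = single 0 (lookup h 0)"
      by (intro poly_mapping_eqI) (auto simp: lookup_single when_def)
  qed (use that q_pos in \<open>simp add: poly_alg_carrier\<close>)
  define k where "k = lookup r 0"
  have one: "reduce q 1 \<in> carrier (poly_alg q {})" using S.one_closed by (simp add: poly_alg_simps)
  have rk: "r = k \<odot>\<^bsub>poly_alg q {}\<^esub> reduce q 1"
    using const[OF r] by (simp add: poly_alg_simps k_def)
  have "k mod q = k" using const(2)[OF r] unfolding k_def by (metis lookup_reduce)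
  then have "k \<in> carrier (residue_ring q)" using q_pos pos_mod_bound[OF q_pos, of k] pos_mod_sign[OF q_pos, of k] by (simp add: residue_ring_def)
  moreover have "\<psi> \<in> linear_endos (residue_ring q) (poly_alg q {})" using \<psi> linear_endos_poly_alg[OF q_pos] by simp
  ultimately have "\<psi> r = k \<odot>\<^bsub>poly_alg q {}\<^esub> \<psi> (reduce q 1)" using one unfolding rk linear_endos_def by blast
  also have "\<dots> = reduce q (single 0 (lookup (\<psi> (reduce q 1)) 0) * single 0 k)"
    using const(1)[OF S.additive_endosD(1)[OF \<psi> one]] by (simp add: poly_alg_simps mult.commute)
  finally show ?thesis using const(1)[OF r] by (simp add: k_def)
qed

text \<open>On each \<open>A t^b\<close> an operator of degree zero is an additive endomorphism of a
  copy of \<open>Z/q\<close>, hence a scalar \<open>c b\<close>. Commuting with multiplication by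
  \<open>t^(p^N)\<close> makes \<open>c\<close> periodic.\<close>

lemma C_ring_iff: "P \<in> carrier (C_ring p m) \<longleftrightarrow> (\<exists>N c. periodic N c \<and> P = tscale_op {0} c)"
proof
  assume "P \<in> carrier (C_ring p m)"
  \<comment> \<open>Since \<open>{0..0} = {0}\<close>, the results about \<open>R[t]\<close> apply
    with \<open>n = 0\<close>, where \<open>R = A\<close>.\<close>
  then have P: "P \<in> carrier (diff_op_ring_0 (residue_ring q) (poly_alg q {0..0}))" by simp
  interpret S: cring "poly_alg q {0}" by (rule cring_poly)
  define c where "c = (\<lambda>b. lookup (tcomponent 0 P b (reduce q 1)) 0)"
  have Pe: "P \<in> additive_endos (poly_alg q {0})" using D0_endo[OF P] by simp
  have "P h = tscale_op {0} c h" for h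
  proof (cases "h \<in> carrier (poly_alg q {0})")
    case True
    show ?thesis
    proof (rule tcoef_eqI)
      fix a
      have e: "{1..0::nat} = {}" by auto
      have "tcoef a (P h) = tcomponent 0 P a (tcoef a h)" using D0_tcoef[OF P] True by simp
      also have "\<dots> = reduce q (single 0 (c a) * tcoef a h)"
        using const_endo[of "tcomponent 0 P a" "tcoef a h"] tcomponent_endo[OF P, of a] tcoef_carrier[of h 0 a] True
        unfolding e c_def by simp
      finally show "tcoef a (P h) = tcoef a (tscale_op {0} c h)" using True by (simp add: tscale_op_def tcoef_reduce tcoef_tscale)
    qed
  qed (simp add: S.additive_endosD(3)[OF Pe] tscale_op_def)
  then have Pc: "P = tscale_op {0} c" by blast
  obtain N where N: "\<And>w. w \<in> carrier (poly_alg q {0}) \<Longrightarrow> commutes_with (poly_alg q {0}) P (w [^]\<^bsub>poly_alg q {0}\<^esub> (p ^ N))"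
    using D0_levelE[OF P] by auto
  have "periodic N c"
    unfolding periodic_def
  proof
    fix a
    have "P (reduce q (Var 0 ^ p ^ N) \<otimes>\<^bsub>poly_alg q {0}\<^esub> reduce q (Var 0 ^ a)) =
      reduce q (Var 0 ^ p ^ N) \<otimes>\<^bsub>poly_alg q {0}\<^esub> P (reduce q (Var 0 ^ a))"
      using N[of "reduce q (Var 0)"] t_power_carrier[of 1] t_power_carrier[of a]
      by (simp add: commutes_with_def Var_power_reduce)
    moreover have "reduce q (Var 0 ^ p ^ N) \<otimes>\<^bsub>poly_alg q {0}\<^esub> reduce q (Var 0 ^ a) = reduce q (Var 0 ^ (a + p ^ N))"
      by (simp add: poly_alg_simps power_add mult.commute)
    moreover have "reduce q (Var 0 ^ p ^ N) \<otimes>\<^bsub>poly_alg q {0}\<^esub> (d \<odot>\<^bsub>poly_alg q {0}\<^esub> reduce q (Var 0 ^ a)) =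
        d \<odot>\<^bsub>poly_alg q {0}\<^esub> reduce q (Var 0 ^ (a + p ^ N))" for d
      unfolding poly_alg_simps reduce_simps by (simp add: power_add mult.commute mult.left_commute)
    ultimately have "c (a + p ^ N) mod q \<odot>\<^bsub>poly_alg q {0}\<^esub> reduce q (Var 0 ^ (a + p ^ N)) = c a mod q \<odot>\<^bsub>poly_alg q {0}\<^esub> reduce q (Var 0 ^ (a + p ^ N))"
      unfolding Pc tscale_op_t_power by (simp only: tscale_op_t_power)
    from t_power_smult_inj[OF this] show "[c (a + p ^ N) = c a] (mod q)" by (simp add: cong_def)
  qed
  then show "\<exists>N c. periodic N c \<and> P = tscale_op {0} c" using Pc by blast
next
  assume "\<exists>N c. periodic N c \<and> P = tscale_op {0} c"
  then show "P \<in> carrier (C_ring p m)" using tscale_op_D0[of "{0}"] by auto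
qed

lemma mem_max_ideal_iff:
  assumes "periodic N c" "x \<in> padic_ints p"
  shows "tscale_op {0} c \<in> max_ideal p m x \<longleftrightarrow> int p dvd c (dual_exponent N x)"
  using mem_PIdl_p[of "c (dual_exponent N x) mod q"] q_pos assms C_ring_iff[of "tscale_op {0} c"] p_dvd_q
  by (auto simp: max_ideal_def eigenvalue_fun_tscale_op dvd_mod_iff)

lemma additive_endos_eqI:
  assumes Q: "Q \<in> additive_endos (poly_alg q {0..n})" "Q' \<in> additive_endos (poly_alg q {0..n})"
    and eq: "\<And>a r. r \<in> carrier (poly_alg q {1..n}) \<Longrightarrow> Q (reduce q (Var 0 ^ a * r)) = Q' (reduce q (Var 0 ^ a * r))"
  shows "Q = Q'"
proof
  interpret S: cring "poly_alg q {0..n}" by (rule cring_poly)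
  fix h show "Q h = Q' h"
  proof (cases "h \<in> carrier (poly_alg q {0..n})")
    case True
    then have hm: "h \<in> mpolys {0..n}" "reduce q h = h" using q_pos by (auto simp: poly_alg_carrier)
    note c = tcoef_carrier[OF True]
    then have m: "Var 0 ^ a * tcoef a h \<in> mpolys {0..n}" for a using q_pos by (intro t_mpolys) (simp add: poly_alg_carrier)
    have "Q (reduce q (\<Sum>a\<in>T. Var 0 ^ a * tcoef a h)) = Q' (reduce q (\<Sum>a\<in>T. Var 0 ^ a * tcoef a h))" for T
    proof (induction T rule: infinite_finite_induct)
      case (insert a T)
      have "reduce q (\<Sum>a\<in>insert a T. Var 0 ^ a * tcoef a h) = reduce q (Var 0 ^ a * tcoef a h) \<oplus>\<^bsub>poly_alg q {0..n}\<^esub> reduce q (\<Sum>a\<in>T. Var 0 ^ a * tcoef a h)"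
        using insert by (simp add: poly_alg_simps)
      moreover have "reduce q (Var 0 ^ a * tcoef a h) \<in> carrier (poly_alg q {0..n})" "reduce q (\<Sum>a\<in>T. Var 0 ^ a * tcoef a h) \<in> carrier (poly_alg q {0..n})"
        using m by (auto intro!: reduce_in_poly_alg[OF q_pos] mpolys_sum)
      ultimately show ?case using S.additive_endosD(2)[OF Q(1)] S.additive_endosD(2)[OF Q(2)] eq[OF c] insert.IH by simp
    qed (use S.additive_endos_zero[OF Q(1)] S.additive_endos_zero[OF Q(2)] in \<open>simp_all add: poly_alg_simps(3)\<close>)
    from this[of "tdegs h"] show ?thesis using t_expansion[OF hm(1), of "tdegs h"] hm(2) by simp
  qed (simp add: S.additive_endosD(3)[OF Q(1)] S.additive_endosD(3)[OF Q(2)])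
qed

lemma R_extension_tscale_op: "R_extension p m n (tscale_op {0} c) = tscale_op {0..n} c"
  unfolding R_extension_def Let_def
proof (rule the_equality, intro conjI ballI)
  interpret S: cring "poly_alg q {0..n}" by (rule cring_poly)
  show "tscale_op {0..n} c \<in> carrier (Rt_alg p m n) \<rightarrow>\<^sub>E carrier (Rt_alg p m n)"
    using tscale_op_endo[of "{0..n}" c] by (auto simp: additive_endos_def)
  show "tscale_op {0..n} c (x \<oplus>\<^bsub>Rt_alg p m n\<^esub> y) = tscale_op {0..n} c x \<oplus>\<^bsub>Rt_alg p m n\<^esub> tscale_op {0..n} c y"
    if "x \<in> carrier (Rt_alg p m n)" "y \<in> carrier (Rt_alg p m n)" for x y
    using S.additive_endosD(2)[OF tscale_op_endo that] .
  show "tscale_op {0..n} c (r \<otimes>\<^bsub>Rt_alg p m n\<^esub> x) = r \<otimes>\<^bsub>Rt_alg p m n\<^esub> tscale_op {0..n} c x"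
    if r: "r \<in> carrier (R_alg p m n)" and x: "x \<in> carrier (Rt_alg p m n)" for r x
  proof -
    have rm: "r \<in> mpolys {1..n}" using r q_pos by (simp add: poly_alg_carrier)
    have "r \<otimes>\<^bsub>Rt_alg p m n\<^esub> x \<in> carrier (Rt_alg p m n)" using S.m_closed[OF _ x] poly_alg_mono[OF _ r, of "{0..n}"] by auto
    then show ?thesis using x tscale_mult[OF rm, of c x] by (simp add: tscale_op_def poly_alg_simps)
  qed
  show "tscale_op {0..n} c h = tscale_op {0} c h" if "h \<in> carrier (At_alg p m)" for h
    using that poly_alg_mono[OF _ that, of "{0..n}"] by (simp add: tscale_op_def)
next
  fix Q assume Q: "Q \<in> carrier (Rt_alg p m n) \<rightarrow>\<^sub>E carrier (Rt_alg p m n) \<and>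
       (\<forall>x\<in>carrier (Rt_alg p m n). \<forall>y\<in>carrier (Rt_alg p m n). Q (x \<oplus>\<^bsub>Rt_alg p m n\<^esub> y) = Q x \<oplus>\<^bsub>Rt_alg p m n\<^esub> Q y) \<and>
       (\<forall>r\<in>carrier (R_alg p m n). \<forall>x\<in>carrier (Rt_alg p m n). Q (r \<otimes>\<^bsub>Rt_alg p m n\<^esub> x) = r \<otimes>\<^bsub>Rt_alg p m n\<^esub> Q x) \<and>
       (\<forall>h\<in>carrier (At_alg p m). Q h = tscale_op {0} c h)"
  show "Q = tscale_op {0..n} c"
  proof (rule additive_endos_eqI[OF _ tscale_op_endo])
    show "Q \<in> additive_endos (poly_alg q {0..n})" using Q by (simp add: additive_endos_def)
    fix a r assume r: "r \<in> carrier (poly_alg q {1..n})"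
    have t: "reduce q (Var 0 ^ a) \<in> carrier (Rt_alg p m n)" using poly_alg_mono[OF _ t_power_carrier, of "{0..n}" a] by simp
    have rt: "reduce q (Var 0 ^ a * r) = r \<otimes>\<^bsub>Rt_alg p m n\<^esub> reduce q (Var 0 ^ a)" by (simp add: poly_alg_simps mult.commute)
    have rm: "r \<in> mpolys {1..n}" using r q_pos by (simp add: poly_alg_carrier)
    have m: "(Var 0 ^ a :: int mpoly) \<in> mpolys {0}" by (intro mpolys_power mpolys_Var) simp
    have "Q (reduce q (Var 0 ^ a * r)) = r \<otimes>\<^bsub>Rt_alg p m n\<^esub> tscale_op {0} c (reduce q (Var 0 ^ a))"
      unfolding rt using Q r t t_power_carrier[of a] by simp
    also have "\<dots> = reduce q (r * tscale c (Var 0 ^ a))" unfolding tscale_op_apply[OF m] by (simp add: poly_alg_simps)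
    also have "\<dots> = tscale_op {0..n} c (reduce q (Var 0 ^ a * r))"
      unfolding tscale_op_apply[OF t_mpolys[OF rm]] using tscale_mult[OF rm, of c "Var 0 ^ a"] by (simp add: mult.commute)
    finally show "Q (reduce q (Var 0 ^ a * r)) = tscale_op {0..n} c (reduce q (Var 0 ^ a * r))" .
  qed
qed

lemma diff_op_ring_0_ring:
  assumes "finite V" shows "ring (diff_op_ring_0 (residue_ring q) (poly_alg q V))"
proof -
  interpret F: frobenius_diff_ops "residue_ring q" "poly_alg q V" p by (rule frobenius_diff_ops_poly_alg[OF assms])
  interpret D: ring F.D by (rule F.ring_D)
  let ?S = "poly_alg q V"
  let ?B = "{\<phi> \<in> diff_ops (residue_ring q) ?S. \<forall>i. \<forall>h\<in>t_part ?S i. \<phi> h \<in> t_part ?S i}"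
  have S: "h \<in> carrier ?S" if "h \<in> t_part ?S i" for h i using that by (simp add: t_part_def)
  have add: "g \<oplus>\<^bsub>?S\<^esub> h \<in> t_part ?S i" if "g \<in> t_part ?S i" "h \<in> t_part ?S i" for g h i
    using that F.add.m_closed[of g h] by (simp add: t_part_iff poly_alg_simps tcoef_reduce tcoef_add)
  have neg: "\<ominus>\<^bsub>?S\<^esub> h \<in> t_part ?S i" if "h \<in> t_part ?S i" for h i
  proof -
    have "\<ominus>\<^bsub>?S\<^esub> h = reduce q (0 - h)" using poly_alg_uminus[OF q_pos S[OF that]] by simp
    then show ?thesis using that F.add.inv_closed[OF S[OF that]] by (simp add: t_part_iff tcoef_reduce tcoef_diff del: diff_0)
  qed
  have "subring ?B F.D"
  proof (rule D.subringI)
    show "?B \<subseteq> carrier F.D" by (auto simp: F.D_carrier)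
    show "\<one>\<^bsub>F.D\<^esub> \<in> ?B" using F.D_id S by (auto simp: F.D_simps F.D_carrier)
    fix \<phi> assume \<phi>: "\<phi> \<in> ?B"
    then have \<phi>D: "\<phi> \<in> carrier F.D" by (simp add: F.D_carrier)
    have "\<ominus>\<^bsub>F.D\<^esub> \<phi> = (\<lambda>x\<in>carrier ?S. \<ominus>\<^bsub>?S\<^esub> \<phi> x)"
    proof (rule D.minus_equality[OF _ \<phi>D F.D_neg[OF \<phi>D]])
      show "(\<lambda>x\<in>carrier ?S. \<ominus>\<^bsub>?S\<^esub> \<phi> x) \<oplus>\<^bsub>F.D\<^esub> \<phi> = \<zero>\<^bsub>F.D\<^esub>"
        unfolding F.D_simps using \<phi>D by (intro restrict_ext) (simp add: F.l_neg)
    qed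
    then show "\<ominus>\<^bsub>F.D\<^esub> \<phi> \<in> ?B" using F.D_neg[OF \<phi>D] \<phi> neg S by (auto simp: F.D_carrier)
    fix \<psi> assume \<psi>: "\<psi> \<in> ?B"
    then have \<psi>D: "\<psi> \<in> carrier F.D" by (simp add: F.D_carrier)
    show "\<phi> \<otimes>\<^bsub>F.D\<^esub> \<psi> \<in> ?B" using F.D_compose[OF \<phi>D \<psi>D] \<phi> \<psi> S by (auto simp: F.D_carrier F.D_simps compose_def)
    show "\<phi> \<oplus>\<^bsub>F.D\<^esub> \<psi> \<in> ?B" using F.D_plus[OF \<phi>D \<psi>D] \<phi> \<psi> S add by (auto simp: F.D_carrier F.D_simps)
  qed
  then show ?thesis using D.subring_is_ring by (simp add: diff_op_ring_0_def)
qed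

lemma D0_simps:
  "monoid.mult (diff_op_ring_0 A S) = compose (carrier S)" "\<one>\<^bsub>diff_op_ring_0 A S\<^esub> = (\<lambda>x\<in>carrier S. x)"
  "\<zero>\<^bsub>diff_op_ring_0 A S\<^esub> = (\<lambda>x\<in>carrier S. \<zero>\<^bsub>S\<^esub>)" "\<phi> \<oplus>\<^bsub>diff_op_ring_0 A S\<^esub> \<psi> = (\<lambda>x\<in>carrier S. \<phi> x \<oplus>\<^bsub>S\<^esub> \<psi> x)"
  by (simp_all add: diff_op_ring_0_def diff_op_ring_def)

lemma tscale_op_mult: "tscale_op V c \<otimes>\<^bsub>diff_op_ring_0 A (poly_alg q V)\<^esub> tscale_op V d = tscale_op V (\<lambda>a. c a * d a)"
  unfolding D0_simps compose_def tscale_op_def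
proof (rule restrict_ext)
  fix h assume h: "h \<in> carrier (poly_alg q V)"
  then have "reduce q (tscale d h) \<in> carrier (poly_alg q V)" using q_pos by (intro reduce_in_poly_alg mpolys_tscale) (auto simp: poly_alg_carrier)
  then show "(\<lambda>h\<in>carrier (poly_alg q V). reduce q (tscale c h)) ((\<lambda>h\<in>carrier (poly_alg q V). reduce q (tscale d h)) h) = reduce q (tscale (\<lambda>a. c a * d a) h)"
    using h by (simp add: tscale_tscale)
qed

lemma tscale_op_add: "tscale_op V c \<oplus>\<^bsub>diff_op_ring_0 A (poly_alg q V)\<^esub> tscale_op V d = tscale_op V (\<lambda>a. c a + d a)"
  unfolding D0_simps tscale_op_def by (rule restrict_ext) (simp add: poly_alg_simps tscale_plus)

lemma tscale_op_one: "\<one>\<^bsub>diff_op_ring_0 A (poly_alg q V)\<^esub> = tscale_op V (\<lambda>a. 1)"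
  unfolding D0_simps tscale_op_def using q_pos by (intro restrict_ext) (simp add: tscale_const poly_alg_carrier)

lemma cring_C: "cring (C_ring p m)"
proof -
  have r: "ring (C_ring p m)" by (rule diff_op_ring_0_ring) simp
  have comm: "P \<otimes>\<^bsub>C_ring p m\<^esub> Q = Q \<otimes>\<^bsub>C_ring p m\<^esub> P" if PQ: "P \<in> carrier (C_ring p m)" "Q \<in> carrier (C_ring p m)" for P Q
  proof -
    obtain c d where "P = tscale_op {0} c" "Q = tscale_op {0} d" using PQ by (auto simp: C_ring_iff)
    then show ?thesis by (simp add: tscale_op_mult mult.commute)
  qed
  show ?thesis using r comm
    by (intro cring.intro comm_monoid.intro comm_monoid_axioms.intro) (auto simp: ring_def)
qed

lemma periodic_mono: assumes "periodic N c" "N \<le> N'" shows "periodic N' c"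
  unfolding periodic_def
proof
  fix a
  have "p ^ N dvd p ^ N'" using assms(2) by (rule le_imp_power_dvd)
  then have "(a + p ^ N') mod p ^ N = a mod p ^ N" by (metis dvd_imp_mod_0 mod_add_right_eq add.right_neutral)
  then show "[c (a + p ^ N') = c a] (mod q)" using periodic_mod[OF assms(1), of "a + p ^ N'"] periodic_mod[OF assms(1), of a]
    by (metis cong_sym cong_trans)
qed

end

declare single_of_nat [simp del] single_of_int [simp del]

section \<open>Regular elements\<close>

text \<open>Nonvanishing modulo \<open>p\<close>, which makes \<open>f\<close> a nonzerodivisor
  modulo every \<open>p^k\<close>, see \<open>primitive_cancel\<close>.\<close>

definition primitive_at :: "nat \<Rightarrow> int mpoly \<Rightarrow> bool" where
  "primitive_at p f \<longleftrightarrow> (\<exists>e. \<not> int p dvd lookup f e)"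

lemma keys_mult_less:
  fixes f h :: "int mpoly"
  assumes "\<And>x y. x \<in> keys f \<Longrightarrow> y \<in> keys h \<Longrightarrow> x + y \<noteq> e"
  shows "lookup (f * h) e = 0"
proof (rule ccontr)
  assume "lookup (f * h) e \<noteq> 0"
  then have "e \<in> keys (f * h)" by (simp add: in_keys_iff)
  then obtain x y where "e = x + y" "x \<in> keys f" "y \<in> keys h"
    using keys_mult[of f h] by blast
  then show False using assms by blast
qed

text \<open>With respect to the linear order on exponents, \<open>single a (lookup f a)\<close> is
  the leading term of \<open>f\<close> modulo \<open>p\<close>; \<open>f'\<close> collects the
  smaller terms and the rest is a multiple of \<open>p\<close>.\<close>

lemma primitive_split:
  assumes "primitive_at p f"
  obtains a f' f'' where "f = single a (lookup f a) + f' + single 0 (int p) * f''"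
    "\<not> int p dvd lookup f a" "\<And>x. x \<in> keys f' \<Longrightarrow> x < a"
proof -
  define E where "E = {e. \<not> int p dvd lookup f e}"
  have fin: "finite E" by (rule finite_subset[of _ "keys f"]) (auto simp: E_def in_keys_iff)
  have ne: "E \<noteq> {}" using assms by (auto simp: E_def primitive_at_def)
  define a where "a = Max E"
  have a: "a \<in> E" using Max_in[OF fin ne] by (simp add: a_def)
  define f' where "f' = (\<Sum>e\<in>E - {a}. single e (lookup f e))"
  have lf': "lookup f' e = (if e \<in> E - {a} then lookup f e else 0)" for e
    unfolding f'_def using fin by (auto simp: lookup_sum lookup_single when_def sum.delta)
  define f'' where "f'' = Poly_Mapping.map (\<lambda>x. x div int p) (f - single a (lookup f a) - f')"
  have "f - single a (lookup f a) - f' = single 0 (int p) * f''"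
  proof (rule poly_mapping_eqI)
    fix e
    let ?g = "f - single a (lookup f a) - f'"
    have "int p dvd lookup ?g e"
      using a by (cases "e \<in> E"; cases "e = a") (auto simp: lookup_minus lf' lookup_single when_def E_def)
    then show "lookup ?g e = lookup (single 0 (int p) * f'') e"
      by (simp add: f''_def Poly_Mapping.map.rep_eq when_def)
  qed
  then have "f = single a (lookup f a) + f' + single 0 (int p) * f''"
    by (simp add: algebra_simps)
  moreover have "x < a" if "x \<in> keys f'" for x
  proof -
    have "x \<in> E" "x \<noteq> a" using that by (auto simp: in_keys_iff lf' split: if_splits)
    then show ?thesis using Max_ge[OF fin, of x] by (simp add: a_def order_less_le)
  qed
  ultimately show thesis using that a by (simp add: E_def)
qed

text \<open>Gauss's lemma: at the sum of the two leading exponents modulo \<open>p\<close>, the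
  coefficient of the product is congruent to the product of the leading coefficients, since all
  other contributions have smaller exponents or are multiples of \<open>p\<close>.\<close>

lemma primitive_mult:
  assumes p: "prime p" and f: "primitive_at p f" and h: "primitive_at p h"
  shows "primitive_at p (f * h)"
proof -
  obtain a f' f'' where f: "f = single a (lookup f a) + f' + single 0 (int p) * f''"
    "\<not> int p dvd lookup f a" "\<And>x. x \<in> keys f' \<Longrightarrow> x < a"
    using primitive_split[OF f] by blast
  obtain b h' h'' where h: "h = single b (lookup h b) + h' + single 0 (int p) * h''"
    "\<not> int p dvd lookup h b" "\<And>x. x \<in> keys h' \<Longrightarrow> x < b"
    using primitive_split[OF h] by blast
  define c d where "c = lookup f a" and "d = lookup h b"
  let ?P = "single 0 (int p)" and ?sa = "single a c" and ?sb = "single b d"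
  have "f * h = (?sa + f' + ?P * f'') * (?sb + h' + ?P * h'')" using f(1) h(1) by (simp add: c_def d_def)
  also have "\<dots> = ?sa * ?sb + ?sa * h' + f' * ?sb + f' * h' + ?P * (f'' * (?sb + h' + ?P * h'') + (?sa + f') * h'')"
    by (simp add: algebra_simps)
  finally have eq: "f * h = ?sa * ?sb + ?sa * h' + f' * ?sb + f' * h' + ?P * (f'' * (?sb + h' + ?P * h'') + (?sa + f') * h'')" .
  have "lookup (?sa * h') (a + b) = 0" using h(3) by (intro keys_mult_less) (auto split: if_splits)
  moreover have "lookup (f' * ?sb) (a + b) = 0" using f(3) by (intro keys_mult_less) (auto split: if_splits)
  moreover have "lookup (f' * h') (a + b) = 0"
    using add_strict_mono[OF f(3) h(3)] by (intro keys_mult_less) fastforce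
  moreover have "lookup (?sa * ?sb) (a + b) = c * d" by (simp add: mult_single)
  ultimately have "\<exists>k. lookup (f * h) (a + b) = c * d + int p * k"
    unfolding eq lookup_add lookup_const_mult
    by (intro exI[of _ "lookup (f'' * (?sb + h' + ?P * h'')) (a + b) + lookup ((?sa + f') * h'') (a + b)"])
      (simp add: lookup_add)
  moreover have "\<not> int p dvd c * d" using f(2) h(2) p by (simp add: c_def d_def prime_dvd_mult_iff)
  ultimately have "\<not> int p dvd lookup (f * h) (a + b)" by (metis dvd_add_left_iff dvd_triv_left)
  then show ?thesis by (auto simp: primitive_at_def)
qed

lemma primitive_power: "prime p \<Longrightarrow> primitive_at p f \<Longrightarrow> primitive_at p (f ^ k)"
proof (induction k)
  case 0
  then show ?case using not_prime_unit[of "int p"] by (auto simp: primitive_at_def lookup_one intro!: exI[of _ 0])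
qed (auto intro: primitive_mult)

text \<open>If \<open>f h\<close> vanishes modulo \<open>p\<close>, then so does \<open>h\<close> by
  Gauss's lemma. Dividing \<open>h\<close> by \<open>p\<close> lowers the exponent
  \<open>k\<close>.\<close>

lemma primitive_cancel:
  assumes p: "prime p" and f: "primitive_at p f" and "reduce (int p ^ k) (f * h) = 0"
  shows "reduce (int p ^ k) h = 0"
  using assms(3)
proof (induction k arbitrary: h)
  case 0
  then show ?case by (intro poly_mapping_eqI) simp
next
  case (Suc k)
  have "\<not> primitive_at p (f * h)"
  proof -
    have "int p ^ Suc k dvd lookup (f * h) e" for e
      using arg_cong[OF Suc.prems, of "\<lambda>x. lookup x e"] by (simp add: mod_eq_0_iff_dvd del: power_Suc)
    then show ?thesis unfolding primitive_at_def by (metis dvd_mult_left power_Suc)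
  qed
  then have "\<not> primitive_at p h" using primitive_mult[OF p f] by blast
  then have d: "int p dvd lookup h e" for e by (auto simp: primitive_at_def)
  define h' where "h' = Poly_Mapping.map (\<lambda>x. x div int p) h"
  have h: "h = single 0 (int p) * h'"
    by (rule poly_mapping_eqI) (use d in \<open>simp add: h'_def Poly_Mapping.map.rep_eq when_def\<close>)
  have p0: "int p \<noteq> 0" using p by auto
  have "reduce (int p ^ k) (f * h') = 0"
  proof (rule poly_mapping_eqI)
    fix e
    have "f * h = single 0 (int p) * (f * h')" unfolding h by (rule mult.left_commute)
    then have "lookup (f * h) e = int p * lookup (f * h') e" by (simp only: lookup_const_mult)
    then have "int p ^ Suc k dvd int p * lookup (f * h') e"
      using arg_cong[OF Suc.prems, of "\<lambda>x. lookup x e"] by (simp add: mod_eq_0_iff_dvd del: power_Suc)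
    then show "lookup (reduce (int p ^ k) (f * h')) e = lookup 0 e"
      using p0 by (simp add: mod_eq_0_iff_dvd)
  qed
  then have "reduce (int p ^ k) h' = 0" by (rule Suc.IH)
  then have "int p ^ k dvd lookup h' e" for e
    using arg_cong[of _ _ "\<lambda>x. lookup x e"] by (metis lookup_reduce lookup_zero mod_eq_0_iff_dvd)
  then show ?case by (intro poly_mapping_eqI) (subst h, simp add: mod_eq_0_iff_dvd)
qed

lemma primitive_reduce: "p > 0 \<Longrightarrow> primitive_at p (reduce (int p ^ Suc k) f) \<longleftrightarrow> primitive_at p f"
  by (simp add: primitive_at_def dvd_mod_iff)

section \<open>Strength and differential operators on \<open>R\<close>\<close>

lemma left_module_subring:
  assumes "left_module R M" "ring (R\<lparr>carrier := B\<rparr>)" "B \<subseteq> carrier R"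
  shows "left_module (R\<lparr>carrier := B\<rparr>) M"
proof -
  interpret left_module R M by fact
  show ?thesis
    by (intro left_module.intro left_module_axioms.intro assms(2) M.abelian_group_axioms)
      (use assms(3) in \<open>auto simp: smult_l_distr smult_r_distr smult_assoc1 subset_iff\<close>)
qed

lemma (in left_module) left_submodule_cyclic:
  assumes z: "z \<in> carrier M" shows "left_submodule R M {r \<odot>\<^bsub>M\<^esub> z | r. r \<in> carrier R}"
proof (intro left_submodule.intro left_submodule_axioms.intro left_module_axioms)
  show "\<zero>\<^bsub>M\<^esub> \<in> {r \<odot>\<^bsub>M\<^esub> z | r. r \<in> carrier R}" using smult_l_null[OF z] R.zero_closed by (metis (mono_tags, lifting) mem_Collect_eq)
  fix x y assume "x \<in> {r \<odot>\<^bsub>M\<^esub> z | r. r \<in> carrier R}" "y \<in> {r \<odot>\<^bsub>M\<^esub> z | r. r \<in> carrier R}"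
  then obtain r s where rs: "x = r \<odot>\<^bsub>M\<^esub> z" "r \<in> carrier R" "y = s \<odot>\<^bsub>M\<^esub> z" "s \<in> carrier R" by auto
  then have "x \<oplus>\<^bsub>M\<^esub> y = (r \<oplus>\<^bsub>R\<^esub> s) \<odot>\<^bsub>M\<^esub> z" using z by (simp add: smult_l_distr)
  then show "x \<oplus>\<^bsub>M\<^esub> y \<in> {r \<odot>\<^bsub>M\<^esub> z | r. r \<in> carrier R}" using rs by blast
next
  fix r x assume "r \<in> carrier R" "x \<in> {r \<odot>\<^bsub>M\<^esub> z | r. r \<in> carrier R}"
  then obtain s where rs: "x = s \<odot>\<^bsub>M\<^esub> z" "r \<in> carrier R" "s \<in> carrier R" by auto
  then have "r \<odot>\<^bsub>M\<^esub> x = (r \<otimes>\<^bsub>R\<^esub> s) \<odot>\<^bsub>M\<^esub> z" using z by (simp add: smult_assoc1)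
  then show "r \<odot>\<^bsub>M\<^esub> x \<in> {r \<odot>\<^bsub>M\<^esub> z | r. r \<in> carrier R}" using rs by blast
qed (use z in auto)

section \<open>The module \<open>H_g\<close> and the multiples of its element
  \<open>\<delta>\<close>\<close>

locale strength_setup = odd_prime_power +
  fixes n :: nat and g :: "int mpoly"
  assumes g_carrier: "g \<in> carrier (poly_alg q {1..n})" and g_primitive: "primitive_at p g"
begin

abbreviation S where "S \<equiv> poly_alg q {0..n}"
abbreviation R where "R \<equiv> poly_alg q {1..n}"
abbreviation W where "W \<equiv> denominators p m n g"
abbreviation D0 where "D0 \<equiv> diff_op_ring_0 (residue_ring q) S"

sublocale S: frobenius_diff_ops "residue_ring q" S p
  by (rule frobenius_diff_ops_poly_alg) simp

sublocale R: frobenius_diff_ops "residue_ring q" R p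
  by (rule frobenius_diff_ops_poly_alg) simp

definition u where "u = g \<ominus>\<^bsub>S\<^esub> t_var"

lemma q_gt_1: "q > 1" using prime_gt_1_nat[OF prime_p] by (simp add: modulus_def one_less_power del: power_Suc)

lemma g_mpolys: "g \<in> mpolys {1..n}" "reduce q g = g" "g \<in> mpolys {0..n}" "g \<in> carrier S"
  using g_carrier q_pos poly_alg_mono[OF _ g_carrier, of "{0..n}"] by (auto simp: poly_alg_carrier)

lemma t_carrier: "t_var \<in> carrier S"
proof -
  have "reduce q t_var = t_var" using q_gt_1 by (intro poly_mapping_eqI) (simp add: Var_def lookup_single when_def)
  then show ?thesis using q_pos by (simp add: poly_alg_carrier mpolys_Var)
qed

lemma u_eq: "u = reduce q (g - Var 0)" using poly_alg_minus[OF q_pos t_carrier] by (simp add: u_def)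

lemma u_carrier: "u \<in> carrier S" using g_mpolys t_carrier by (simp add: u_def)

lemma u_pow: "u [^]\<^bsub>S\<^esub> (k::nat) = reduce q ((g - Var 0) ^ k)" by (simp add: poly_alg_pow[OF q_pos] u_eq)

lemma primitive_u: "primitive_at p (g - Var 0)"
proof -
  have "lookup g (single 0 1) = 0"
    using g_mpolys(1) by (auto simp: mpolys_iff)
  then have "lookup (g - Var 0) (single 0 1) = -1" by (simp add: lookup_minus Var_def)
  then show ?thesis using prime_gt_1_nat[OF prime_p] unfolding primitive_at_def by (intro exI[of _ "single 0 1"]) simp
qed

lemma W_eq: "W = {reduce q (g ^ i * (g - Var 0) ^ j) | i j. True}"
  unfolding denominators_def Let_def u_def[symmetric] unfolding u_pow
  unfolding poly_alg_pow[OF q_pos] poly_alg_simps reduce_simps ..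

lemma regular_mult:
  assumes "primitive_at p w" "x \<in> carrier S" "reduce q (w * x) = 0" shows "x = 0"
  using primitive_cancel[OF prime_p assms(1), of "m + 1" x] assms(2,3) q_pos by (simp add: modulus_def poly_alg_carrier)

sublocale F: diff_op_localization "residue_ring q" S p W
proof (intro diff_op_localization.intro S.frobenius_diff_ops_axioms diff_op_localization_axioms.intro)
  show "W \<subseteq> carrier S" unfolding W_eq
    by (auto intro!: reduce_in_poly_alg[OF q_pos] mpolys_mult mpolys_power mpolys_diff g_mpolys mpolys_Var)
  have "reduce q (g ^ 0 * (g - Var 0) ^ 0) \<in> W" unfolding W_eq by blast
  then show "\<one>\<^bsub>S\<^esub> \<in> W" by (simp add: poly_alg_simps)
  show "v \<otimes>\<^bsub>S\<^esub> w \<in> W" if vw: "v \<in> W" "w \<in> W" for v w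
  proof -
    obtain i j k l where "v = reduce q (g ^ i * (g - Var 0) ^ j)" "w = reduce q (g ^ k * (g - Var 0) ^ l)"
      using vw unfolding W_eq by blast
    then have "v \<otimes>\<^bsub>S\<^esub> w = reduce q (g ^ (i + k) * (g - Var 0) ^ (j + l))"
      unfolding poly_alg_simps by simp (simp add: power_add ac_simps)
    then show ?thesis unfolding W_eq by blast
  qed
  show "x = \<zero>\<^bsub>S\<^esub>" if wx: "w \<in> W" "x \<in> carrier S" "w \<otimes>\<^bsub>S\<^esub> x = \<zero>\<^bsub>S\<^esub>" for w x
  proof -
    obtain i j where w: "w = reduce q (g ^ i * (g - Var 0) ^ j)" using wx(1) unfolding W_eq by blast
    have "primitive_at p (g ^ i * (g - Var 0) ^ j)"
      by (intro primitive_mult primitive_power prime_p g_primitive primitive_u)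
    then show ?thesis using regular_mult wx(2,3) by (simp add: poly_alg_simps w)
  qed
qed

lemma u_W: "u \<in> W"
proof -
  have "u = reduce q (g ^ 0 * (g - Var 0) ^ 1)" by (simp add: u_eq)
  then show ?thesis unfolding W_eq by blast
qed

lemma g_pow_W: "g [^]\<^bsub>S\<^esub> (i::nat) \<in> W"
proof -
  have "g [^]\<^bsub>S\<^esub> i = reduce q (g ^ i * (g - Var 0) ^ 0)" by (simp add: poly_alg_pow[OF q_pos])
  then show ?thesis unfolding W_eq by blast
qed

abbreviation LM where "LM \<equiv> L_module p m n g"
abbreviation LS where "LS \<equiv> L_sub p m n g"
abbreviation H where "H \<equiv> H_module p m n g"
abbreviation \<delta> where "\<delta> \<equiv> delta p m n g"

lemma L_module_eq: "LM = D_localization (residue_ring q) S W" by (simp add: L_module_def)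

lemma L_sub_eq: "LS = {F.frac x (g [^]\<^bsub>S\<^esub> i) | x (i::nat). x \<in> carrier S}" by (simp add: L_sub_def)

lemma LM_simps: "carrier LM = carrier F.L" "\<zero>\<^bsub>LM\<^esub> = \<zero>\<^bsub>F.L\<^esub>" "x \<oplus>\<^bsub>LM\<^esub> y = x \<oplus>\<^bsub>F.L\<^esub> y"
  by (simp_all add: L_module_eq F.D_localization_eq)

sublocale LM: left_module S.D LM
  unfolding L_module_eq by (rule F.left_module_D_localization)

lemma LM_smult: "\<phi> \<in> carrier S.D \<Longrightarrow> x \<in> carrier S \<Longrightarrow> w \<in> W \<Longrightarrow> commutes_with S \<phi> w
    \<Longrightarrow> \<phi> \<odot>\<^bsub>LM\<^esub> F.frac x w = F.frac (\<phi> x) w"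
  unfolding L_module_eq by (rule F.D_localization_smult)

text \<open>Makes the denominator an \<open>M\<close>-th power, at the cost of
  \<open>w^(M-1)\<close> in the numerator; with \<open>M = p^N\<close>, operators of level
  \<open>N\<close> then act on the numerator.\<close>

lemma frac_expand:
  fixes M :: nat
  assumes "x \<in> carrier S" "w \<in> W" "M > 0"
  shows "F.frac x w = F.frac (w [^]\<^bsub>S\<^esub> (M - 1) \<otimes>\<^bsub>S\<^esub> x) (w [^]\<^bsub>S\<^esub> M)"
proof -
  have "w [^]\<^bsub>S\<^esub> (M - 1) \<otimes>\<^bsub>S\<^esub> w = w [^]\<^bsub>S\<^esub> M" using S.nat_pow_Suc[of w "M - 1"] assms(3) by simp
  then show ?thesis using F.L.fraction_cancel[of x w "w [^]\<^bsub>S\<^esub> (M - 1)"] assms(1,2) F.pow_W[OF assms(2)] by simp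
qed

lemma p_pow_pos: "p ^ N > 0" using prime_gt_0_nat[OF prime_p] by simp

text \<open>Raising a denominator \<open>g^i\<close> to its \<open>p^N\<close>-th power gives a
  power of \<open>g\<close> again, so operators do not introduce denominators
  \<open>g - t\<close>.\<close>

lemma L_sub_submodule: "left_submodule S.D LM LS"
proof (intro left_submodule.intro LM.left_module_axioms left_submodule_axioms.intro)
  have gp: "g [^]\<^bsub>S\<^esub> i \<otimes>\<^bsub>S\<^esub> g [^]\<^bsub>S\<^esub> j = g [^]\<^bsub>S\<^esub> (i + j)" for i j :: nat using g_mpolys(4) by (simp add: S.nat_pow_mult)
  show "LS \<subseteq> carrier LM" unfolding L_sub_eq LM_simps using F.frac_in_L g_pow_W by blast
  have "F.frac \<zero>\<^bsub>S\<^esub> \<one>\<^bsub>S\<^esub> = F.frac \<zero>\<^bsub>S\<^esub> (g [^]\<^bsub>S\<^esub> (0::nat))" by simp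
  then show "\<zero>\<^bsub>LM\<^esub> \<in> LS" unfolding L_sub_eq LM_simps F.L_zero using S.zero_closed by blast
  fix X Y assume "X \<in> LS" "Y \<in> LS"
  then obtain x i y j where x: "x \<in> carrier S" "X = F.frac x (g [^]\<^bsub>S\<^esub> (i::nat))" and y: "y \<in> carrier S" "Y = F.frac y (g [^]\<^bsub>S\<^esub> (j::nat))"
    unfolding L_sub_eq by blast
  have "X \<oplus>\<^bsub>LM\<^esub> Y = F.frac (g [^]\<^bsub>S\<^esub> j \<otimes>\<^bsub>S\<^esub> x \<oplus>\<^bsub>S\<^esub> g [^]\<^bsub>S\<^esub> i \<otimes>\<^bsub>S\<^esub> y) (g [^]\<^bsub>S\<^esub> (i + j))"
    unfolding LM_simps x(2) y(2) using F.L.localization_add[of x "g [^]\<^bsub>S\<^esub> i" y "g [^]\<^bsub>S\<^esub> j"] x(1) y(1) g_pow_W by (simp add: gp)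
  moreover have "g [^]\<^bsub>S\<^esub> j \<otimes>\<^bsub>S\<^esub> x \<oplus>\<^bsub>S\<^esub> g [^]\<^bsub>S\<^esub> i \<otimes>\<^bsub>S\<^esub> y \<in> carrier S" using x(1) y(1) g_mpolys(4) by simp
  ultimately show "X \<oplus>\<^bsub>LM\<^esub> Y \<in> LS" unfolding L_sub_eq by blast
next
  fix \<phi> X assume \<phi>: "\<phi> \<in> carrier S.D" and "X \<in> LS"
  then obtain x i where x: "x \<in> carrier S" "X = F.frac x (g [^]\<^bsub>S\<^esub> (i::nat))" unfolding L_sub_eq by blast
  obtain N where N: "S.has_level \<phi> N" using \<phi> S.D_iff by blast
  define w where "w = g [^]\<^bsub>S\<^esub> i"
  have w: "w \<in> W" "w \<in> carrier S" using g_pow_W F.W_sub by (auto simp: w_def)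
  have X: "X = F.frac (w [^]\<^bsub>S\<^esub> (p ^ N - 1) \<otimes>\<^bsub>S\<^esub> x) (w [^]\<^bsub>S\<^esub> (p ^ N))"
    using frac_expand[OF x(1) w(1) p_pow_pos[of N]] x(2) by (simp add: w_def)
  have y: "w [^]\<^bsub>S\<^esub> (p ^ N - 1) \<otimes>\<^bsub>S\<^esub> x \<in> carrier S" using w x by simp
  have c: "commutes_with S \<phi> (w [^]\<^bsub>S\<^esub> (p ^ N))" using N w by (simp add: S.has_level_def)
  have "\<phi> \<odot>\<^bsub>LM\<^esub> X = F.frac (\<phi> (w [^]\<^bsub>S\<^esub> (p ^ N - 1) \<otimes>\<^bsub>S\<^esub> x)) (g [^]\<^bsub>S\<^esub> (i * p ^ N))"
    unfolding X LM_smult[OF \<phi> y F.pow_W[OF w(1)] c] using g_mpolys(4) by (simp add: w_def S.nat_pow_pow)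
  then show "\<phi> \<odot>\<^bsub>LM\<^esub> X \<in> LS" unfolding L_sub_eq using S.D_closed[OF \<phi> y] by blast
qed

sublocale LS: left_submodule S.D LM LS by (rule L_sub_submodule)

lemma D0_ring: "ring D0" by (rule diff_op_ring_0_ring) simp

lemma D0_eq: "D0 = S.D\<lparr>carrier := carrier D0\<rparr>" by (simp add: diff_op_ring_0_def)

lemma D0_sub: "carrier D0 \<subseteq> carrier S.D" by (auto simp: D0_carrier S.D_carrier)

sublocale H: left_module D0 H
proof -
  have "left_module S.D H" unfolding H_module_def by (rule LS.left_module_quotient)
  then have "left_module (S.D\<lparr>carrier := carrier D0\<rparr>) H"
    using D0_ring D0_eq D0_sub by (intro left_module_subring) simp_all
  then show "left_module D0 H" using D0_eq by simp
qed

lemma frac_u: "F.frac \<one>\<^bsub>S\<^esub> u \<in> carrier LM" using F.frac_in_L[OF S.one_closed u_W] by (simp add: LM_simps)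

lemma delta_carrier: "\<delta> \<in> carrier H"
  unfolding H_module_def delta_def LS.quotient_carrier using frac_u unfolding u_def by blast

abbreviation gop where "gop \<equiv> mult_op S g"

lemma gop_D0: "gop \<in> carrier D0"
proof -
  have "gop h \<in> t_part S i" if h: "h \<in> t_part S i" for i h
  proof -
    have hc: "h \<in> carrier S" using h by (simp add: t_part_def)
    have "gop h \<in> carrier S" using g_mpolys(4) hc by (simp add: mult_op_def)
    moreover have "tcoef a (gop h) = reduce q (g * tcoef a h)" for a
      using hc tcoef_mult[OF g_mpolys(1), of a h] by (simp add: mult_op_def poly_alg_simps tcoef_reduce)
    ultimately show ?thesis using h by (simp add: t_part_iff)
  qed
  then show ?thesis using S.D_mult_op[OF g_mpolys(4)] by (simp add: D0_carrier S.D_carrier)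
qed

text \<open>The numerator of \<open>1/(g - t)\<close> over the denominator
  \<open>(g - t)^(p^N)\<close>.\<close>

definition top_power :: "nat \<Rightarrow> int mpoly" where "top_power N = u [^]\<^bsub>S\<^esub> (p ^ N - 1)"

lemma top_power_carrier: "top_power N \<in> carrier S" using u_carrier by (simp add: top_power_def)

lemma smult_delta:
  assumes \<phi>: "\<phi> \<in> carrier D0" and N: "S.has_level \<phi> N"
  shows "\<phi> \<odot>\<^bsub>H\<^esub> \<delta> = LS +>\<^bsub>LM\<^esub> F.frac (\<phi> (top_power N)) (u [^]\<^bsub>S\<^esub> (p ^ N))"
proof -
  have \<phi>D: "\<phi> \<in> carrier S.D" using \<phi> D0_sub by blast
  have e: "F.frac \<one>\<^bsub>S\<^esub> u = F.frac (top_power N) (u [^]\<^bsub>S\<^esub> (p ^ N))"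
    using frac_expand[OF S.one_closed u_W p_pow_pos[of N]] u_carrier by (simp add: top_power_def)
  have c: "commutes_with S \<phi> (u [^]\<^bsub>S\<^esub> (p ^ N))" using N u_carrier by (simp add: S.has_level_def)
  have "\<phi> \<odot>\<^bsub>H\<^esub> \<delta> = LS +>\<^bsub>LM\<^esub> (\<phi> \<odot>\<^bsub>LM\<^esub> F.frac \<one>\<^bsub>S\<^esub> u)"
    unfolding H_module_def delta_def u_def[symmetric] by (rule LS.quotient_smult[OF \<phi>D frac_u])
  also have "\<phi> \<odot>\<^bsub>LM\<^esub> F.frac \<one>\<^bsub>S\<^esub> u = F.frac (\<phi> (top_power N)) (u [^]\<^bsub>S\<^esub> (p ^ N))"
    unfolding e by (rule LM_smult[OF \<phi>D top_power_carrier F.pow_W[OF u_W] c])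
  finally show ?thesis .
qed

lemma tcoef_monic_mult:
  assumes "\<And>a. a > d \<Longrightarrow> tcoef a x = 0"
  shows "(\<forall>a>M + d. tcoef a ((g - Var 0) ^ M * x) = 0) \<and> tcoef (M + d) ((g - Var 0) ^ M * x) = (-1) ^ M * tcoef d x"
proof (induction M)
  case (Suc M)
  define y where "y = (g - Var 0) ^ M * x"
  have "tcoef a ((g - Var 0) ^ Suc M * x) = g * tcoef a y - (if 1 \<le> a then tcoef (a - 1) y else 0)" for a
  proof -
    have e: "(g - Var 0) ^ Suc M * x = g * y - Var 0 ^ 1 * y" by (simp add: y_def algebra_simps)
    show ?thesis unfolding e tcoef_diff tcoef_t_power_mult tcoef_mult[OF g_mpolys(1), simplified] by simp
  qed
  note step = this
  show ?case unfolding step using Suc[folded y_def] by auto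
qed (use assms in auto)

text \<open>Up to sign, \<open>(g - t)\<^sup>M\<close> is monic of degree \<open>M\<close> in \<open>t\<close>, so it divides no nonzero \<open>g\<^sup>i h\<close> with \<open>h\<close> of smaller degree.\<close>

lemma low_degree_not_fraction:
  assumes h: "h \<in> carrier S" and low: "\<And>a. a \<ge> M \<Longrightarrow> tcoef a h = 0" and x: "x \<in> carrier S"
    and eq: "F.frac h (u [^]\<^bsub>S\<^esub> M) = F.frac x (g [^]\<^bsub>S\<^esub> (i::nat))"
  shows "h = 0"
proof -
  have xr: "reduce q x = x" using x q_pos by (simp add: poly_alg_carrier)
  have "g [^]\<^bsub>S\<^esub> i \<otimes>\<^bsub>S\<^esub> h = u [^]\<^bsub>S\<^esub> M \<otimes>\<^bsub>S\<^esub> x"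
    using F.frac_eq_iff[OF h x F.pow_W[OF u_W] g_pow_W] eq by simp
  then have 1: "reduce q (g ^ i * h) = reduce q ((g - Var 0) ^ M * x)"
    unfolding u_pow unfolding poly_alg_pow[OF q_pos] poly_alg_simps by simp
  have "x = 0"
  proof (rule ccontr)
    assume "x \<noteq> 0"
    then have "{a. tcoef a x \<noteq> 0} \<noteq> {}" using tcoef_eqI[of x 0] by auto
    moreover have fin: "finite {a. tcoef a x \<noteq> 0}"
      by (rule finite_subset[of _ "tdegs x"]) (use tcoef_notin[of _ x] in blast, simp)
    \<comment> \<open>Compare coefficients of \<open>t^(M + d)\<close>: \<open>g^i h\<close> has
      \<open>t\<close>-degree below \<open>M\<close>, while \<open>(g - t)^M x\<close> has
      \<open>(-1)^M\<close> times the leading coefficient of \<open>x\<close> there.\<close>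
    moreover define d where "d = Max {a. tcoef a x \<noteq> 0}"
    ultimately have d: "tcoef d x \<noteq> 0" "\<And>a. a > d \<Longrightarrow> tcoef a x = 0"
      using Max_in[of "{a. tcoef a x \<noteq> 0}"] Max_ge[OF fin] by (auto simp: leD)
    have "reduce q (tcoef (M + d) (g ^ i * h)) = reduce q (tcoef (M + d) ((g - Var 0) ^ M * x))"
      using 1 by (metis tcoef_reduce)
    moreover have "tcoef (M + d) (g ^ i * h) = 0"
      using tcoef_mult[OF mpolys_power[OF g_mpolys(1)], of "M + d" i h] low by simp
    ultimately have "reduce q ((-1) ^ M * tcoef d x) = 0" using tcoef_monic_mult[OF d(2), where M = M] by simp
    then have "reduce q ((-1) ^ M * ((-1) ^ M * tcoef d x)) = 0" by (metis mult_zero_right reduce_simps(6) reduce_zero)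
    then have "reduce q (tcoef d x) = 0" by (simp flip: mult.assoc power_mult_distrib)
    then show False using d(1) xr by (simp flip: tcoef_reduce)
  qed
  then show "h = 0" using 1 regular_mult[OF primitive_power[OF prime_p g_primitive] h] by simp
qed

lemma tcoef_u_power:
  "tcoef a ((g - Var 0) ^ K) = (if a \<le> K then single 0 ((-1) ^ a * int (K choose a)) * g ^ (K - a) else 0)"
proof -
  have free: "single 0 c * g ^ j \<in> mpolys {1..n}" for c j
    using g_mpolys(1) by (intro mpolys_mult mpolys_power) simp_all
  have "(g - Var 0) ^ K = (\<Sum>k\<le>K. of_nat (K choose k) * (- Var 0) ^ k * g ^ (K - k))"
    using binomial_ring[of "- Var 0" g K] by simp
  also have "\<dots> = (\<Sum>k\<le>K. Var 0 ^ k * (single 0 ((-1) ^ k * int (K choose k)) * g ^ (K - k)))"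
  proof (rule sum.cong)
    fix k
    have "single 0 ((-1) ^ k * int (K choose k)) = ((-1) ^ k * of_nat (K choose k) :: int mpoly)"
    proof -
      have "single 0 ((-1) ^ k * int (K choose k)) = (of_int ((-1) ^ k * int (K choose k)) :: int mpoly)"
        using single_of_int[of "(-1) ^ k * int (K choose k)"] by simp
      then show ?thesis by simp
    qed
    then show "of_nat (K choose k) * (- Var 0) ^ k * g ^ (K - k) = Var 0 ^ k * (single 0 ((-1) ^ k * int (K choose k)) * g ^ (K - k))"
      by (simp add: power_minus[of "Var 0"] ac_simps)
  qed simp
  finally have e: "(g - Var 0) ^ K = (\<Sum>k\<le>K. Var 0 ^ k * (single 0 ((-1) ^ k * int (K choose k)) * g ^ (K - k)))" .
  have "tcoef a ((g - Var 0) ^ K) = (\<Sum>k\<le>K. if a = k then single 0 ((-1) ^ k * int (K choose k)) * g ^ (K - k) else 0)"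
    unfolding e tcoef_sum by (simp add: tcoef_t_power_mult_free[OF free])
  then show ?thesis by (simp add: sum.delta)
qed

text \<open>The exponent \<open>p^N - 1 - a\<close> of \<open>g\<close> is congruent to
  \<open>-1 - a\<close> modulo \<open>p^N\<close>; this is where the eigenvalue on
  \<open>t^a\<close> becomes tied to the point \<open>-1 - a\<close> of \<open>Z_p\<close>.\<close>

lemma tcoef_top_power: "tcoef a (top_power N) =
    (if a < p ^ N then reduce q (single 0 ((-1) ^ a * int (p ^ N - 1 choose a)) * g ^ (p ^ N - 1 - a)) else 0)"
proof -
  have "a \<le> p ^ N - 1 \<longleftrightarrow> a < p ^ N" using p_pow_pos[of N] by linarith
  then show ?thesis by (simp add: top_power_def u_pow tcoef_reduce tcoef_u_power)
qed

lemma gop_top_power: "gop (top_power N) = reduce q (g * (g - Var 0) ^ (p ^ N - 1))"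
  using top_power_carrier[of N] by (simp add: mult_op_def poly_alg_simps) (simp add: top_power_def u_pow)

lemma gop_top_power_carrier: "gop (top_power N) \<in> carrier S"
  using S.D_closed[OF _ top_power_carrier] gop_D0 D0_sub by blast

lemma tcoef_gop_top_power: "tcoef a (gop (top_power N)) =
    (if a < p ^ N then reduce q (single 0 ((-1) ^ a * int (p ^ N - 1 choose a)) * g ^ Suc (p ^ N - 1 - a)) else 0)"
proof -
  have "tcoef a (gop (top_power N)) = reduce q (g * tcoef a ((g - Var 0) ^ (p ^ N - 1)))"
    unfolding gop_top_power tcoef_reduce using tcoef_mult[OF g_mpolys(1), of a] by simp
  moreover have "a \<le> p ^ N - 1 \<longleftrightarrow> a < p ^ N" using p_pow_pos[of N] by linarith
  ultimately show ?thesis by (simp add: tcoef_u_power mult.left_commute)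
qed

lemma gop_commutes: "w \<in> carrier S \<Longrightarrow> commutes_with S gop w"
  using g_mpolys(4) by (simp add: commutes_with_def mult_op_def S.m_lcomm)

text \<open>Both sides are classes of fractions over \<open>u^(p^N)\<close> whose numerators have
  \<open>t\<close>-degree below \<open>p^N\<close>, as operators of degree zero do not raise it. By
  \<open>low_degree_not_fraction\<close> such classes agree only if the numerators do.\<close>

lemma smult_delta_eq_iff:
  assumes \<phi>: "\<phi> \<in> carrier D0" "S.has_level \<phi> N" and \<psi>: "\<psi> \<in> carrier D0" "S.has_level \<psi> N"
  shows "\<phi> \<odot>\<^bsub>H\<^esub> \<delta> = \<psi> \<odot>\<^bsub>H\<^esub> (gop \<odot>\<^bsub>H\<^esub> \<delta>) \<longleftrightarrow> \<phi> (top_power N) = \<psi> (gop (top_power N))"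
proof -
  interpret D0r: ring D0 by (rule D0_ring)
  let ?M = "p ^ N" and ?P = "top_power N"
  have D: "\<phi> \<in> carrier S.D" "\<psi> \<in> carrier S.D" using \<phi> \<psi> D0_sub by auto
  have pg: "\<psi> \<otimes>\<^bsub>D0\<^esub> gop \<in> carrier D0" using \<psi> gop_D0 by simp
  have pga: "(\<psi> \<otimes>\<^bsub>D0\<^esub> gop) x = \<psi> (gop x)" if "x \<in> carrier S" for x using that by (simp add: D0_simps compose_def)
  have lv: "S.has_level (\<psi> \<otimes>\<^bsub>D0\<^esub> gop) N"
    unfolding S.has_level_def commutes_with_def
  proof (intro ballI)
    fix w x assume w: "w \<in> carrier S" and x: "x \<in> carrier S"
    have "gop (w [^]\<^bsub>S\<^esub> ?M \<otimes>\<^bsub>S\<^esub> x) = w [^]\<^bsub>S\<^esub> ?M \<otimes>\<^bsub>S\<^esub> gop x" using gop_commutes[of "w [^]\<^bsub>S\<^esub> ?M"] w x by (simp add: commutes_with_def)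
    moreover have "gop x \<in> carrier S" using gop_D0 D0_sub S.D_closed x by blast
    ultimately show "(\<psi> \<otimes>\<^bsub>D0\<^esub> gop) (w [^]\<^bsub>S\<^esub> ?M \<otimes>\<^bsub>S\<^esub> x) = w [^]\<^bsub>S\<^esub> ?M \<otimes>\<^bsub>S\<^esub> (\<psi> \<otimes>\<^bsub>D0\<^esub> gop) x"
      using \<psi>(2) w x by (simp add: pga S.has_level_def commutes_with_def)
  qed
  have 1: "\<psi> \<odot>\<^bsub>H\<^esub> (gop \<odot>\<^bsub>H\<^esub> \<delta>) = LS +>\<^bsub>LM\<^esub> F.frac (\<psi> (gop ?P)) (u [^]\<^bsub>S\<^esub> ?M)"
    using H.smult_assoc1[OF \<psi>(1) gop_D0 delta_carrier] smult_delta[OF pg lv] pga[OF top_power_carrier] by simp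
  have c: "\<phi> ?P \<in> carrier S" "\<psi> (gop ?P) \<in> carrier S" using D top_power_carrier gop_top_power_carrier by auto
  have uM: "u [^]\<^bsub>S\<^esub> ?M \<in> W" by (rule F.pow_W[OF u_W])
  have Lc: "F.frac (\<phi> ?P) (u [^]\<^bsub>S\<^esub> ?M) \<in> carrier LM" "F.frac (\<psi> (gop ?P)) (u [^]\<^bsub>S\<^esub> ?M) \<in> carrier LM"
    using F.frac_in_L[OF c(1) uM] F.frac_in_L[OF c(2) uM] by (simp_all add: LM_simps)
  show ?thesis
  proof
    assume "\<phi> \<odot>\<^bsub>H\<^esub> \<delta> = \<psi> \<odot>\<^bsub>H\<^esub> (gop \<odot>\<^bsub>H\<^esub> \<delta>)"
    then have "F.frac (\<phi> ?P) (u [^]\<^bsub>S\<^esub> ?M) \<ominus>\<^bsub>LM\<^esub> F.frac (\<psi> (gop ?P)) (u [^]\<^bsub>S\<^esub> ?M) \<in> LS"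
      unfolding 1 smult_delta[OF \<phi>] using LS.coset_eq_iff[OF Lc] by simp
    moreover have "\<ominus>\<^bsub>LM\<^esub> F.frac (\<psi> (gop ?P)) (u [^]\<^bsub>S\<^esub> ?M) = F.frac (\<ominus>\<^bsub>S\<^esub> \<psi> (gop ?P)) (u [^]\<^bsub>S\<^esub> ?M)"
    proof (rule LM.M.minus_equality[OF _ Lc(2)])
      have "F.frac \<zero>\<^bsub>S\<^esub> (u [^]\<^bsub>S\<^esub> ?M) = F.frac \<zero>\<^bsub>S\<^esub> \<one>\<^bsub>S\<^esub>"
        using F.frac_eq_iff[OF S.zero_closed S.zero_closed uM F.one_W] uM by simp
      then show "F.frac (\<ominus>\<^bsub>S\<^esub> \<psi> (gop ?P)) (u [^]\<^bsub>S\<^esub> ?M) \<oplus>\<^bsub>LM\<^esub> F.frac (\<psi> (gop ?P)) (u [^]\<^bsub>S\<^esub> ?M) = \<zero>\<^bsub>LM\<^esub>"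
        unfolding LM_simps F.L_zero F.frac_add[OF S.a_inv_closed[OF c(2)] c(2) uM] using c(2) by (simp add: S.l_neg)
      show "F.frac (\<ominus>\<^bsub>S\<^esub> \<psi> (gop ?P)) (u [^]\<^bsub>S\<^esub> ?M) \<in> carrier LM"
        using F.frac_in_L[OF S.a_inv_closed[OF c(2)] uM] by (simp add: LM_simps)
    qed
    ultimately have "F.frac (\<phi> ?P \<ominus>\<^bsub>S\<^esub> \<psi> (gop ?P)) (u [^]\<^bsub>S\<^esub> ?M) \<in> LS"
      unfolding a_minus_def LM_simps using F.frac_add[OF c(1) S.a_inv_closed[OF c(2)] uM] by simp
    then obtain x i where x: "x \<in> carrier S" "F.frac (\<phi> ?P \<ominus>\<^bsub>S\<^esub> \<psi> (gop ?P)) (u [^]\<^bsub>S\<^esub> ?M) = F.frac x (g [^]\<^bsub>S\<^esub> (i::nat))"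
      unfolding L_sub_eq by blast
    have "\<phi> ?P \<ominus>\<^bsub>S\<^esub> \<psi> (gop ?P) = 0"
    proof (rule low_degree_not_fraction[OF S.minus_closed[OF c] _ x])
      fix a assume a: "?M \<le> a"
      have z: "tcomponent n \<chi> a 0 = 0" if "\<chi> \<in> carrier D0" for \<chi>
        using R.additive_endos_zero[OF tcomponent_endo[OF that]] by (simp add: poly_alg_simps(3))
      have "tcoef a (\<phi> ?P) = 0" "tcoef a (\<psi> (gop ?P)) = 0"
        unfolding D0_tcoef[OF \<phi>(1) top_power_carrier] D0_tcoef[OF \<psi>(1) gop_top_power_carrier]
        using a z \<phi> \<psi> by (simp_all add: tcoef_top_power tcoef_gop_top_power)
      then show "tcoef a (\<phi> ?P \<ominus>\<^bsub>S\<^esub> \<psi> (gop ?P)) = 0"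
        unfolding poly_alg_minus[OF q_pos c(2)] by (simp add: tcoef_reduce tcoef_diff)
    qed
    then show "\<phi> ?P = \<psi> (gop ?P)" using c S.r_right_minus_eq by (simp add: poly_alg_simps(3))
  next
    assume "\<phi> ?P = \<psi> (gop ?P)"
    then show "\<phi> \<odot>\<^bsub>H\<^esub> \<delta> = \<psi> \<odot>\<^bsub>H\<^esub> (gop \<odot>\<^bsub>H\<^esub> \<delta>)" unfolding 1 smult_delta[OF \<phi>] by simp
  qed
qed

end

text \<open>In Pascal's rule for \<open>p^N choose (a + 1)\<close> the left side is divisible by
  \<open>p\<close>, so consecutive coefficients of row \<open>p^N - 1\<close> are negatives of each
  other modulo \<open>p\<close>, starting with 1.\<close>

lemma not_dvd_choose_prime_power_minus_one:
  fixes p :: nat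
  assumes p: "prime p" and "a < p ^ N" shows "\<not> p dvd (p ^ N - 1 choose a)"
  using assms(2)
proof (induction a)
  case 0 then show ?case using not_prime_unit p by auto
next
  case (Suc a)
  have "p dvd (p ^ N choose Suc a)" using prime_dvd_choose_prime_power[OF p, of "Suc a" N] Suc.prems by simp
  moreover have "p ^ N choose Suc a = (p ^ N - 1 choose Suc a) + (p ^ N - 1 choose a)"
  proof -
    have "p ^ N = Suc (p ^ N - 1)" using Suc.prems by simp
    then show ?thesis using binomial_Suc_Suc[of "p ^ N - 1" a] by (metis add.commute)
  qed
  ultimately show ?case using Suc by (metis Suc_lessD dvd_add_right_iff)
qed

lemma single_zero_mult:
  "single 0 a * (single 0 b * h) = single 0 (a * b) * h"
  for h :: "int mpoly"
  by (simp add: mult_single flip: mult.assoc)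

text \<open>The condition \<open>p\<^sup>k g\<^sup>b \<in> D g\<^sup>b\<^sup>+\<^sup>1\<close> for \<open>b\<close> close to \<open>\<alpha>\<close>, with an operator that commutes with \<open>p\<^sup>N\<close>-th powers.\<close>

definition power_annihilates :: "nat \<Rightarrow> nat \<Rightarrow> nat \<Rightarrow> int mpoly \<Rightarrow> (nat \<Rightarrow> int) \<Rightarrow> nat \<Rightarrow> bool" where
  "power_annihilates p m n g \<alpha> k \<longleftrightarrow> (\<exists>\<psi>\<in>additive_endos (R_alg p m n). \<exists>N b.
     (\<forall>w\<in>carrier (R_alg p m n). commutes_with (R_alg p m n) \<psi> (w [^]\<^bsub>R_alg p m n\<^esub> (p ^ N))) \<and>
     [int b = \<alpha> N] (mod int p ^ N) \<and>
     \<psi> (reduce (modulus p m) (g ^ Suc b)) = reduce (modulus p m) (single 0 (int p ^ k) * g ^ b))"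

section \<open>The module \<open>N_g\<close> over \<open>C_m\<close> and its localization at
  \<alpha>\<close>

locale strength_at = strength_setup +
  fixes \<alpha> :: "nat \<Rightarrow> int"
  assumes \<alpha>: "\<alpha> \<in> padic_ints p"
begin

abbreviation C where "C \<equiv> C_ring p m"
abbreviation Z where "Z \<equiv> D0_span p m n g \<delta>"
abbreviation B where "B \<equiv> D0_span p m n g (gop \<odot>\<^bsub>H\<^esub> \<delta>)"
abbreviation H0 where "H0 \<equiv> H\<lparr>carrier := Z\<rparr>"
abbreviation NM where "NM \<equiv> N_module p m n g"
abbreviation MI where "MI \<equiv> max_ideal p m \<alpha>"
abbreviation ext where "ext \<equiv> R_extension p m n"

lemma gdelta_carrier: "gop \<odot>\<^bsub>H\<^esub> \<delta> \<in> carrier H" by (rule H.smult_closed[OF gop_D0 delta_carrier])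

lemma span_eq: "D0_span p m n g z = {\<phi> \<odot>\<^bsub>H\<^esub> z | \<phi>. \<phi> \<in> carrier D0}" by (simp add: D0_span_def)

sublocale Z: left_submodule D0 H Z
  unfolding span_eq by (rule H.left_submodule_cyclic[OF delta_carrier])

sublocale BH: left_submodule D0 H B
  unfolding span_eq by (rule H.left_submodule_cyclic[OF gdelta_carrier])

sublocale H0: left_module D0 H0 by (rule Z.left_module_carrier_update)

sublocale B: left_submodule D0 H0 B
proof (intro left_submodule.intro H0.left_module_axioms left_submodule_axioms.intro)
  have "\<psi> \<odot>\<^bsub>H\<^esub> (gop \<odot>\<^bsub>H\<^esub> \<delta>) \<in> Z" if "\<psi> \<in> carrier D0" for \<psi>
  proof -
    have "gop \<odot>\<^bsub>H\<^esub> \<delta> \<in> Z" unfolding span_eq using gop_D0 by blast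
    then show ?thesis using Z.B_smult that by blast
  qed
  then show "B \<subseteq> carrier H0" by (auto simp: span_eq[of "gop \<odot>\<^bsub>H\<^esub> \<delta>"])
qed (use BH.B_zero BH.B_add BH.B_smult in simp_all)

lemma N_module_eq: "NM = with_smult (quotient_module H0 B) (\<lambda>P. module.smult (quotient_module H0 B) (ext P))"
  by (simp add: N_module_def Let_def)

sublocale C: cring C by (rule cring_C)

lemma ext_D0: "P \<in> carrier C \<Longrightarrow> ext P \<in> carrier D0"
  by (auto simp: C_ring_iff R_extension_tscale_op intro: tscale_op_D0[rotated])

lemma ext_mult: "P \<in> carrier C \<Longrightarrow> Q \<in> carrier C \<Longrightarrow> ext (P \<otimes>\<^bsub>C\<^esub> Q) = ext P \<otimes>\<^bsub>D0\<^esub> ext Q"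
  by (auto simp: C_ring_iff tscale_op_mult R_extension_tscale_op)

sublocale N: left_module C NM
  unfolding N_module_eq
proof (rule left_module.left_module_pullback[OF B.left_module_quotient C.ring_axioms])
  show "ext P \<in> carrier D0" if "P \<in> carrier C" for P using that by (rule ext_D0)
  show "ext (P \<otimes>\<^bsub>C\<^esub> Q) = ext P \<otimes>\<^bsub>D0\<^esub> ext Q" if "P \<in> carrier C" "Q \<in> carrier C" for P Q
    using that by (rule ext_mult)
  show "ext (P \<oplus>\<^bsub>C\<^esub> Q) = ext P \<oplus>\<^bsub>D0\<^esub> ext Q" if "P \<in> carrier C" "Q \<in> carrier C" for P Q
    using that by (auto simp: C_ring_iff tscale_op_add R_extension_tscale_op)
  show "ext \<one>\<^bsub>C\<^esub> = \<one>\<^bsub>D0\<^esub>" by (simp add: tscale_op_one R_extension_tscale_op)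
qed

text \<open>Modulo \<open>q\<close> this is a ring homomorphism from \<open>C_m\<close> to
  \<open>A\<close>; by \<open>max_ideal_iff\<close> the maximal ideal is the preimage of
  \<open>pA\<close>.\<close>

definition ev :: "(int mpoly \<Rightarrow> int mpoly) \<Rightarrow> int" where "ev P = eigenvalue_fun p m P \<alpha>"

lemma C_pairE:
  assumes "P \<in> carrier C" "Q \<in> carrier C"
  obtains N c d where "periodic N c" "P = tscale_op {0} c" "periodic N d" "Q = tscale_op {0} d"
proof -
  obtain N1 N2 c d where "periodic N1 c" "P = tscale_op {0} c" "periodic N2 d" "Q = tscale_op {0} d"
    using assms by (auto simp: C_ring_iff)
  then show thesis using that[of "max N1 N2" c d] periodic_mono[of _ _ "max N1 N2"] by simp
qed

lemma ev_tscale_op: "periodic N c \<Longrightarrow> ev (tscale_op {0} c) = c (dual_exponent N \<alpha>) mod q"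
  unfolding ev_def by (rule eigenvalue_fun_tscale_op[OF _ \<alpha>])

lemma ev_add: "P \<in> carrier C \<Longrightarrow> Q \<in> carrier C \<Longrightarrow> [ev (P \<oplus>\<^bsub>C\<^esub> Q) = ev P + ev Q] (mod q)"
proof -
  assume "P \<in> carrier C" "Q \<in> carrier C"
  then obtain N c d where *: "periodic N c" "P = tscale_op {0} c" "periodic N d" "Q = tscale_op {0} d" by (rule C_pairE)
  then have "periodic N (\<lambda>a. c a + d a)" by (simp add: periodic_def cong_add)
  then show ?thesis using * by (simp add: tscale_op_add ev_tscale_op cong_def mod_add_eq)
qed

lemma ev_mult: "P \<in> carrier C \<Longrightarrow> Q \<in> carrier C \<Longrightarrow> [ev (P \<otimes>\<^bsub>C\<^esub> Q) = ev P * ev Q] (mod q)"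
proof -
  assume "P \<in> carrier C" "Q \<in> carrier C"
  then obtain N c d where *: "periodic N c" "P = tscale_op {0} c" "periodic N d" "Q = tscale_op {0} d" by (rule C_pairE)
  then have "periodic N (\<lambda>a. c a * d a)" by (simp add: periodic_def cong_mult)
  then show ?thesis using * by (simp add: tscale_op_mult ev_tscale_op cong_def mod_mult_eq)
qed

lemma max_ideal_iff: "P \<in> MI \<longleftrightarrow> P \<in> carrier C \<and> int p dvd ev P"
proof -
  have "P \<in> carrier C \<Longrightarrow> P \<in> MI \<longleftrightarrow> int p dvd ev P"
    using p_dvd_q by (auto simp: C_ring_iff mem_max_ideal_iff[OF _ \<alpha>] ev_tscale_op dvd_mod_iff)
  then show ?thesis by (auto simp: max_ideal_def)
qed

lemma periodic_const: "periodic N (\<lambda>a. c)" by (simp add: periodic_def)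

sublocale Nloc: module_localization C NM "carrier C - MI"
proof (intro module_localization.intro N.left_module_axioms C.cring_axioms module_localization_axioms.intro)
  show "\<one>\<^bsub>C\<^esub> \<in> carrier C - MI"
  proof -
    have "ev (\<one>\<^bsub>C\<^esub>) = 1" using ev_tscale_op[OF periodic_const, of 1] q_gt_1 by (simp add: tscale_op_one)
    then show ?thesis using max_ideal_iff prime_gt_1_nat[OF prime_p] by simp
  qed
  show "v \<otimes>\<^bsub>C\<^esub> w \<in> carrier C - MI" if "v \<in> carrier C - MI" "w \<in> carrier C - MI" for v w
  proof -
    have "\<not> int p dvd ev v * ev w" using that max_ideal_iff prime_p by (simp add: prime_dvd_mult_iff)
    moreover have "[ev (v \<otimes>\<^bsub>C\<^esub> w) = ev v * ev w] (mod int p)"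
      using cong_dvd_modulus[OF ev_mult p_dvd_q] that by blast
    ultimately show ?thesis using that max_ideal_iff cong_dvd_iff by auto
  qed
qed auto

text \<open>\<open>ev\<close> is multiplicative modulo \<open>q\<close> and maps the maximal ideal
  to multiples of \<open>p\<close>, so it maps products of \<open>k\<close> of its elements, and
  their sums, to multiples of \<open>p^k\<close>.\<close>

lemma max_ideal_power:
  assumes "P \<in> MI [^]\<^bsub>ideals_set C\<^esub> k" shows "P \<in> carrier C \<and> (\<exists>d. [ev P = int p ^ k * d] (mod q))"
  using assms
proof (induction k arbitrary: P)
  case 0
  then show ?case by (auto simp: ideals_set_def nat_pow_def intro!: exI[of _ "ev P"])
next
  case (Suc k)
  have "P \<in> ideal_prod C (MI [^]\<^bsub>ideals_set C\<^esub> k) MI"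
    using Suc.prems by (simp add: nat_pow_def ideals_set_def)
  then show ?case
  proof (induction P rule: ideal_prod.induct)
    case (prod i j)
    obtain d where i: "i \<in> carrier C" "[ev i = int p ^ k * d] (mod q)" using Suc.IH[OF prod(1)] by blast
    note jm = iffD1[OF max_ideal_iff prod(2)]
    note j = conjunct1[OF jm] conjunct2[OF jm]
    from j(2) obtain e where "ev j = int p * e" by (rule dvdE)
    then have "[ev (i \<otimes>\<^bsub>C\<^esub> j) = int p ^ Suc k * (d * e)] (mod q)"
      using cong_trans[OF ev_mult[OF i(1) j(1)] cong_mult[OF i(2) cong_refl]] by (simp add: ac_simps)
    moreover have "i \<otimes>\<^bsub>C\<^esub> j \<in> carrier C" using i(1) j(1) by (rule C.m_closed)
    ultimately show ?case by blast
  next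
    case (sum P Q)
    obtain d where d: "[ev P = int p ^ Suc k * d] (mod q)" using sum.IH(1) by blast
    obtain e where e: "[ev Q = int p ^ Suc k * e] (mod q)" using sum.IH(2) by blast
    have PQ: "P \<in> carrier C" "Q \<in> carrier C" using sum.IH by blast+
    have "[ev (P \<oplus>\<^bsub>C\<^esub> Q) = int p ^ Suc k * (d + e)] (mod q)"
      using cong_trans[OF ev_add[OF PQ] cong_add[OF d e]] unfolding distrib_left .
    moreover have "P \<oplus>\<^bsub>C\<^esub> Q \<in> carrier C" using PQ by (rule C.a_closed)
    ultimately show ?case by blast
  qed
qed

text \<open>The constant \<open>p\<close> has eigenvalue \<open>p\<close> at \<alpha>, so its powers
  are test elements for the powers of the maximal ideal.\<close>

lemma p_power_in: "tscale_op {0} (\<lambda>a. int p ^ k) \<in> MI [^]\<^bsub>ideals_set C\<^esub> k"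
proof (induction k)
  case 0
  have "tscale_op {0} (\<lambda>a. 1) \<in> carrier C" unfolding C_ring_iff using periodic_const by blast
  then show ?case by (simp add: nat_pow_def ideals_set_def)
next
  case (Suc k)
  have "tscale_op {0} (\<lambda>a. int p) \<in> carrier C" unfolding C_ring_iff using periodic_const by blast
  moreover have "int p dvd ev (tscale_op {0} (\<lambda>a. int p))"
    unfolding ev_tscale_op[OF periodic_const] using p_dvd_q by (simp add: dvd_mod)
  ultimately have "tscale_op {0} (\<lambda>a. int p) \<in> MI" by (intro iffD2[OF max_ideal_iff] conjI)
  then have "tscale_op {0} (\<lambda>a. int p ^ k) \<otimes>\<^bsub>C\<^esub> tscale_op {0} (\<lambda>a. int p) \<in> ideal_prod C (MI [^]\<^bsub>ideals_set C\<^esub> k) MI"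
    using Suc by (rule ideal_prod.prod[rotated])
  then show ?case by (simp add: nat_pow_def ideals_set_def tscale_op_mult mult.commute)
qed

lemma N_carrier: "carrier NM = {B +>\<^bsub>H0\<^esub> (\<phi> \<odot>\<^bsub>H\<^esub> \<delta>) | \<phi>. \<phi> \<in> carrier D0}"
proof -
  have "carrier NM = {B +>\<^bsub>H0\<^esub> x | x. x \<in> carrier H0}" unfolding N_module_eq with_smult_simps by (rule B.quotient_carrier)
  also have "carrier H0 = Z" by simp
  finally show ?thesis by (auto simp: span_eq[of \<delta>])
qed

lemma N_smult_zero_iff:
  assumes P: "P \<in> carrier C" and \<phi>: "\<phi> \<in> carrier D0"
  shows "P \<odot>\<^bsub>NM\<^esub> (B +>\<^bsub>H0\<^esub> (\<phi> \<odot>\<^bsub>H\<^esub> \<delta>)) = \<zero>\<^bsub>NM\<^esub> \<longleftrightarrow> ext P \<odot>\<^bsub>H\<^esub> (\<phi> \<odot>\<^bsub>H\<^esub> \<delta>) \<in> B"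
proof -
  have z: "\<phi> \<odot>\<^bsub>H\<^esub> \<delta> \<in> carrier H0" using \<phi> by (auto simp: span_eq[of \<delta>])
  have "P \<odot>\<^bsub>NM\<^esub> (B +>\<^bsub>H0\<^esub> (\<phi> \<odot>\<^bsub>H\<^esub> \<delta>)) = B +>\<^bsub>H0\<^esub> (ext P \<odot>\<^bsub>H0\<^esub> (\<phi> \<odot>\<^bsub>H\<^esub> \<delta>))"
    unfolding N_module_eq with_smult_simps by (rule B.quotient_smult[OF ext_D0[OF P] z])
  moreover have "\<zero>\<^bsub>NM\<^esub> = B" by (simp add: N_module_eq)
  ultimately show ?thesis using B.coset_zero_iff[OF H0.smult_closed[OF ext_D0[OF P] z]] by simp
qed

definition kills :: "nat \<Rightarrow> bool" where
  "kills k \<longleftrightarrow> (\<forall>P \<in> MI [^]\<^bsub>ideals_set C\<^esub> k. \<forall>x \<in> carrier (N_localized p m n \<alpha> g).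
       P \<odot>\<^bsub>N_localized p m n \<alpha> g\<^esub> x = \<zero>\<^bsub>N_localized p m n \<alpha> g\<^esub>)"

lemma strength_eq: "strength p m n \<alpha> g = (LEAST k. kills k)"
  by (simp add: strength_def kills_def)

lemma N_localized_eq: "N_localized p m n \<alpha> g = localization C NM (carrier C - MI)"
  by (simp add: N_localized_def)

text \<open>\<open>P\<close> acts on each \<open>R t^a\<close> by a scalar, and components of
  degree-zero operators are linear. Since \<open>D0\<close> is not commutative, this is what lets
  the vanishing of \<open>P\<close> on the class of \<open>\<delta>\<close> imply its vanishing on
  all of \<open>N_g\<close>.\<close>

lemma ext_commute:
  assumes P: "P \<in> carrier C" and \<phi>: "\<phi> \<in> carrier D0"
  shows "ext P \<otimes>\<^bsub>D0\<^esub> \<phi> = \<phi> \<otimes>\<^bsub>D0\<^esub> ext P"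
proof -
  obtain N c where c: "periodic N c" "P = tscale_op {0} c" using iffD1[OF C_ring_iff P] by blast
  have e: "ext P = tscale_op {0..n} c" using c by (simp add: R_extension_tscale_op)
  have "\<phi> h \<in> carrier S" if "h \<in> carrier S" for h using \<phi> D0_sub S.D_closed that by blast
  note cl = this
  have "tscale_op {0..n} c (\<phi> h) = \<phi> (tscale_op {0..n} c h)" if h: "h \<in> carrier S" for h
  proof (rule tcoef_eqI)
    fix a
    have tc: "tscale_op {0..n} c h \<in> carrier S" using S.additive_endosD(1)[OF tscale_op_endo h] by blast
    have r: "tcoef a h \<in> carrier R" by (rule tcoef_carrier[OF h])
    have rr: "reduce q (tcoef a h) = tcoef a h" using r q_pos by (simp add: poly_alg_carrier)
    have te: "tcomponent n \<phi> a \<in> linear_endos (residue_ring q) R" using tcomponent_endo[OF \<phi>] linear_endos_poly_alg[OF q_pos] by simp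
    have ca: "c a mod q \<in> carrier (residue_ring q)" using q_pos by (simp add: residue_ring_def)
    have "tcoef a (\<phi> (tscale_op {0..n} c h)) = tcomponent n \<phi> a (reduce q (single 0 (c a) * tcoef a h))"
      unfolding D0_tcoef[OF \<phi> tc] using h by (simp add: tscale_op_def tcoef_reduce tcoef_tscale)
    also have "reduce q (single 0 (c a) * tcoef a h) = (c a mod q) \<odot>\<^bsub>R\<^esub> tcoef a h"
      by (simp add: poly_alg_simps reduce_single_mod)
    also have "tcomponent n \<phi> a ((c a mod q) \<odot>\<^bsub>R\<^esub> tcoef a h) = (c a mod q) \<odot>\<^bsub>R\<^esub> tcomponent n \<phi> a (tcoef a h)"
      using te r ca by (simp add: linear_endos_def)
    also have "\<dots> = tcoef a (tscale_op {0..n} c (\<phi> h))"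
      using cl[OF h] by (simp add: tscale_op_def tcoef_reduce tcoef_tscale D0_tcoef[OF \<phi> h] poly_alg_simps reduce_single_mod)
    finally show "tcoef a (tscale_op {0..n} c (\<phi> h)) = tcoef a (\<phi> (tscale_op {0..n} c h))" by simp
  qed
  then show ?thesis unfolding e D0_simps compose_def by (intro restrict_ext) simp
qed

lemma common_level3:
  assumes "\<phi> \<in> carrier D0" "\<psi> \<in> carrier D0"
  obtains N where "N \<ge> N0" "S.has_level \<phi> N" "S.has_level \<psi> N"
proof -
  have D: "\<phi> \<in> carrier S.D" "\<psi> \<in> carrier S.D" using assms D0_sub by auto
  obtain N where N: "S.has_level \<phi> N" "S.has_level \<psi> N" using S.common_level[OF D] by blast
  then show thesis using that[of "max N N0"] S.has_level_mono[OF S.D_endo[OF D(1)] N(1)] S.has_level_mono[OF S.D_endo[OF D(2)] N(2)] by simp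
qed

lemma \<alpha>_trunc: "i \<le> j \<Longrightarrow> [\<alpha> j = \<alpha> i] (mod int p ^ i)"
proof (induction j rule: dec_induct)
  case (step j)
  have "[\<alpha> (Suc j) = \<alpha> j] (mod int p ^ j)" using \<alpha> unfolding padic_ints_def cong_def by (metis (mono_tags, lifting) mem_Collect_eq mod_mod_trivial)
  then have "[\<alpha> (Suc j) = \<alpha> j] (mod int p ^ i)" using step.hyps by (metis cong_dvd_modulus le_imp_power_dvd)
  then show ?case using step.IH cong_trans by blast
qed simp

lemma unit_mod_q:
  assumes "\<not> int p dvd c" obtains d where "[d * c = 1] (mod q)"
proof -
  have "coprime c q" using assms prime_p prime_imp_coprime[of "int p" c] by (simp add: modulus_def coprime_commute)
  then show thesis using cong_solve_coprime_int[of c q] that by (metis mult.commute)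
qed

text \<open>It suffices to test \<open>p^k\<close> on the class of \<open>\<delta>\<close>. Some
  \<open>w\<close> outside the maximal ideal kills the result before localization; reading this off
  at an exponent where the eigenvalue of \<open>w\<close> is a unit gives the operator on
  \<open>R\<close>.\<close>

lemma kills_imp:
  assumes "kills k" shows "power_annihilates p m n g \<alpha> k"
proof -
  let ?P = "tscale_op {0} (\<lambda>a. int p ^ k)" and ?x = "B +>\<^bsub>H0\<^esub> (\<one>\<^bsub>D0\<^esub> \<odot>\<^bsub>H\<^esub> \<delta>)"
  have one: "\<one>\<^bsub>D0\<^esub> \<in> carrier D0" by (rule monoid.one_closed[OF ring.is_monoid[OF D0_ring]])
  have P: "?P \<in> carrier C" unfolding C_ring_iff using periodic_const by blast
  have x: "?x \<in> carrier NM" unfolding N_carrier using one by blast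
  have "fraction NM (carrier C - MI) ?x \<one>\<^bsub>C\<^esub> \<in> carrier (localization C NM (carrier C - MI))"
    unfolding Nloc.localization_carrier using x Nloc.W_one by blast
  then have "?P \<odot>\<^bsub>localization C NM (carrier C - MI)\<^esub> fraction NM (carrier C - MI) ?x \<one>\<^bsub>C\<^esub> = \<zero>\<^bsub>localization C NM (carrier C - MI)\<^esub>"
    using assms p_power_in unfolding kills_def N_localized_eq by blast
  then obtain w where w: "w \<in> carrier C" "w \<notin> MI" "w \<odot>\<^bsub>NM\<^esub> (?P \<odot>\<^bsub>NM\<^esub> ?x) = \<zero>\<^bsub>NM\<^esub>"
    using Nloc.smult_fraction_eq_zero_iff[OF P x Nloc.W_one] by blast
  obtain N0 c where c: "periodic N0 c" "w = tscale_op {0} c" using iffD1[OF C_ring_iff w(1)] by blast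
  have wP: "w \<otimes>\<^bsub>C\<^esub> ?P \<in> carrier C" using w P by simp
  have "(w \<otimes>\<^bsub>C\<^esub> ?P) \<odot>\<^bsub>NM\<^esub> ?x = \<zero>\<^bsub>NM\<^esub>" using w P x by (simp add: N.smult_assoc1)
  then have "ext (w \<otimes>\<^bsub>C\<^esub> ?P) \<odot>\<^bsub>H\<^esub> (\<one>\<^bsub>D0\<^esub> \<odot>\<^bsub>H\<^esub> \<delta>) \<in> B" using N_smult_zero_iff[OF wP one] by blast
  then have "tscale_op {0..n} (\<lambda>a. c a * int p ^ k) \<odot>\<^bsub>H\<^esub> \<delta> \<in> B"
    using delta_carrier by (simp add: c tscale_op_mult R_extension_tscale_op)
  then obtain \<psi> where \<psi>: "\<psi> \<in> carrier D0" "tscale_op {0..n} (\<lambda>a. c a * int p ^ k) \<odot>\<^bsub>H\<^esub> \<delta> = \<psi> \<odot>\<^bsub>H\<^esub> (gop \<odot>\<^bsub>H\<^esub> \<delta>)"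
    unfolding span_eq by blast
  have ck: "periodic N0 (\<lambda>a. c a * int p ^ k)" using c(1) by (simp add: periodic_def cong_mult)
  have tD: "tscale_op {0..n} (\<lambda>a. c a * int p ^ k) \<in> carrier D0" using tscale_op_D0[OF _ ck] by simp
  obtain N where N: "N \<ge> N0" "S.has_level (tscale_op {0..n} (\<lambda>a. c a * int p ^ k)) N" "S.has_level \<psi> N"
    using common_level3[OF tD \<psi>(1)] by blast
  have eq: "tscale_op {0..n} (\<lambda>a. c a * int p ^ k) (top_power N) = \<psi> (gop (top_power N))"
    using smult_delta_eq_iff[OF tD N(2) \<psi>(1) N(3)] \<psi>(2) by blast
  \<comment> \<open>At this exponent \<open>w\<close> has eigenvalue \<open>ev w\<close>, a unit,
    and the remaining exponent \<open>b\<close> of \<open>g\<close> is congruent to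
    \<alpha>.\<close>
  define a where "a = dual_exponent N \<alpha>"
  have aM: "a < p ^ N" by (simp add: a_def dual_exponent_less)
  define b where "b = p ^ N - 1 - a"
  define e where "e = (-1) ^ a * int (p ^ N - 1 choose a)"
  have "\<not> int p dvd e" using not_dvd_choose_prime_power_minus_one[OF prime_p aM]
    by (cases "even a") (simp_all add: e_def int_dvd_int_iff)
  note pe = this
  have "ev w = c a mod q" unfolding c(2) a_def by (rule ev_tscale_op[OF periodic_mono[OF c(1) N(1)]])
  moreover have "\<not> int p dvd ev w" using w(1,2) iffD2[OF max_ideal_iff, of w] by blast
  ultimately have "\<not> int p dvd c a" using p_dvd_q by (simp add: dvd_mod_iff)
  note pc = this
  have "\<not> int p dvd c a * e" using prime_p pc pe by (simp add: prime_dvd_mult_iff)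
  then obtain d where d: "[d * (c a * e) = 1] (mod q)" using unit_mod_q by blast
  \<comment> \<open>Comparing coefficients of \<open>t^a\<close> gives
    \<open>e \<psi>_a(g^(b+1)) = c(a) p^k e g^b\<close>, where \<open>\<psi>_a\<close> is the
    component of \<open>\<psi>\<close>. As \<open>d\<close> inverts \<open>c(a) e\<close>, the
    operator \<open>d e \<psi>_a\<close> maps \<open>g^(b+1)\<close> to
    \<open>p^k g^b\<close>.\<close>
  define \<chi> where "\<chi> = (\<lambda>r\<in>carrier R. reduce q (single 0 (d * e)) \<otimes>\<^bsub>R\<^esub> tcomponent n \<psi> a r)"
  have de: "reduce q (single 0 (d * e)) \<in> carrier R" by (intro reduce_in_poly_alg[OF q_pos]) simp
  have te: "tcomponent n \<psi> a \<in> additive_endos R" by (rule tcomponent_endo[OF \<psi>(1)])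
  have gb: "reduce q (g ^ j) \<in> carrier R" for j using g_mpolys by (intro reduce_in_poly_alg[OF q_pos] mpolys_power)
  have "reduce q (single 0 (c a * int p ^ k) * (single 0 e * g ^ b)) =
     tcomponent n \<psi> a (reduce q (single 0 e * g ^ Suc b))"
  proof -
    have "tcoef a (tscale_op {0..n} (\<lambda>a. c a * int p ^ k) (top_power N)) = reduce q (single 0 (c a * int p ^ k) * (single 0 e * g ^ b))"
      using top_power_carrier aM by (simp add: tscale_op_def tcoef_reduce tcoef_tscale tcoef_top_power e_def b_def)
    moreover have "tcoef a (\<psi> (gop (top_power N))) = tcomponent n \<psi> a (reduce q (single 0 e * g ^ Suc b))"
      unfolding D0_tcoef[OF \<psi>(1) gop_top_power_carrier] using aM by (simp add: tcoef_gop_top_power e_def b_def)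
    ultimately show ?thesis using eq by simp
  qed
  also have "reduce q (single 0 e * g ^ Suc b) = (e mod q) \<odot>\<^bsub>R\<^esub> reduce q (g ^ Suc b)"
    by (simp add: poly_alg_simps reduce_single_mod)
  also have "tcomponent n \<psi> a ((e mod q) \<odot>\<^bsub>R\<^esub> reduce q (g ^ Suc b)) = (e mod q) \<odot>\<^bsub>R\<^esub> tcomponent n \<psi> a (reduce q (g ^ Suc b))"
  proof -
    have "tcomponent n \<psi> a \<in> linear_endos (residue_ring q) R" using te linear_endos_poly_alg[OF q_pos] by simp
    moreover have "e mod q \<in> carrier (residue_ring q)" using q_pos by (simp add: residue_ring_def)
    ultimately show ?thesis using gb[of "Suc b"] unfolding linear_endos_def by blast
  qed
  finally have key: "reduce q (single 0 e * tcomponent n \<psi> a (reduce q (g ^ Suc b))) =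
      reduce q (single 0 (c a * int p ^ k) * (single 0 e * g ^ b))"
    by (simp add: poly_alg_simps reduce_single_mod)
  have "\<chi> (reduce q (g ^ Suc b)) = reduce q (single 0 d * (single 0 e * tcomponent n \<psi> a (reduce q (g ^ Suc b))))"
    using gb[of "Suc b"] by (simp add: \<chi>_def poly_alg_simps mult.assoc[symmetric] mult_single)
  also have "\<dots> = reduce q (single 0 d * (single 0 (c a * int p ^ k) * (single 0 e * g ^ b)))"
    using key by (metis reduce_simps(6))
  also have "single 0 d * (single 0 (c a * int p ^ k) * (single 0 e * g ^ b)) =
     single 0 ((d * (c a * e)) * int p ^ k) * g ^ b"
  proof -
    have "d * (c a * int p ^ k * e) = (d * (c a * e)) * int p ^ k" by simp
    then show ?thesis by (simp only: single_zero_mult)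
  qed
  also have "reduce q \<dots> = reduce q (single 0 (int p ^ k) * g ^ b)"
  proof -
    have "[d * (c a * e) * int p ^ k = 1 * int p ^ k] (mod q)" using d by (intro cong_mult cong_refl)
    then show ?thesis by (simp only: reduce_eq_iff lookup_const_mult mult_1_left) (intro allI cong_mult cong_refl)
  qed
  finally have final: "\<chi> (reduce q (g ^ Suc b)) = reduce q (single 0 (int p ^ k) * g ^ b)" .
  have \<chi>: "\<chi> \<in> additive_endos R" unfolding \<chi>_def by (rule R.additive_endos_lmult[OF te de])
  have comm: "commutes_with R \<chi> (w [^]\<^bsub>R\<^esub> (p ^ N))" if w: "w \<in> carrier R" for w
  proof -
    have wS: "w \<in> carrier S" using poly_alg_mono[OF _ w] by auto
    have "w [^]\<^bsub>S\<^esub> (p ^ N) = w [^]\<^bsub>R\<^esub> (p ^ N)" by (simp add: poly_alg_pow[OF q_pos])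
    then have "commutes_with S \<psi> (w [^]\<^bsub>R\<^esub> (p ^ N))"
      using bspec[OF N(3)[unfolded S.has_level_def] wS] by simp
    then have "commutes_with R (tcomponent n \<psi> a) (w [^]\<^bsub>R\<^esub> (p ^ N))"
      by (rule tcomponent_commutes[OF \<psi>(1) R.nat_pow_closed[OF w]])
    then show ?thesis using R.additive_endosD(1)[OF te] de w unfolding commutes_with_def \<chi>_def by (simp add: R.m_lcomm)
  qed
  have "int b = int p ^ N - 1 - int a" using aM by (simp add: b_def of_nat_diff)
  then have "[int b = \<alpha> N] (mod int p ^ N)"
    unfolding a_def int_dual_exponent by (simp add: cong_def mod_diff_right_eq)
  then show ?thesis unfolding power_annihilates_def using \<chi> comm final by blast
qed

text \<open>\<open>\<psi>\<close> commutes with multiplication by \<open>g^(l p^N)\<close>: this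
  raises \<open>b\<close> by multiples of \<open>p^N\<close>, and lowers it because \<open>g\<close>
  can be cancelled.\<close>

lemma annihilates_shift:
  assumes \<psi>: "\<psi> \<in> additive_endos R" and comm: "\<And>w. w \<in> carrier R \<Longrightarrow> commutes_with R \<psi> (w [^]\<^bsub>R\<^esub> (p ^ N))"
    and b: "\<psi> (reduce q (g ^ Suc b)) = reduce q (single 0 (int p ^ k) * g ^ b)"
    and b': "[int b' = int b] (mod int p ^ N)"
  shows "\<psi> (reduce q (g ^ Suc b')) = reduce q (single 0 (int p ^ k) * g ^ b')"
proof -
  have gb: "reduce q (g ^ j) \<in> carrier R" for j using g_mpolys by (intro reduce_in_poly_alg[OF q_pos] mpolys_power)
  have c: "\<psi> (reduce q (g ^ (l * p ^ N + j))) = reduce q (g ^ (l * p ^ N) * \<psi> (reduce q (g ^ j)))" for l j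
  proof -
    have w: "reduce q (g ^ l) [^]\<^bsub>R\<^esub> (p ^ N) = reduce q (g ^ (l * p ^ N))" by (simp add: poly_alg_pow[OF q_pos] power_mult)
    have "\<psi> (reduce q (g ^ (l * p ^ N)) \<otimes>\<^bsub>R\<^esub> reduce q (g ^ j)) = reduce q (g ^ (l * p ^ N)) \<otimes>\<^bsub>R\<^esub> \<psi> (reduce q (g ^ j))"
      using comm[OF gb[of l]] gb[of j] unfolding commutes_with_def w by blast
    then show ?thesis by (simp add: poly_alg_simps power_add)
  qed
  have "[b' = b] (mod p ^ N)" using b' by (metis cong_int_iff of_nat_power)
  then consider l where "b' = l * p ^ N + b" | l where "b = l * p ^ N + b'"
    by (metis cong_iff_lin_nat cong_sym add.commute mult.commute cong_altdef_nat dvd_def le_add_diff_inverse nat_le_linear)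
  then show ?thesis
  proof cases
    case 1
    then show ?thesis using c[of l "Suc b"] b by (simp add: power_add mult.left_commute)
  next
    case 2
    let ?d = "\<psi> (reduce q (g ^ Suc b')) - reduce q (single 0 (int p ^ k) * g ^ b')"
    have "reduce q (g ^ (l * p ^ N) * \<psi> (reduce q (g ^ Suc b'))) = reduce q (g ^ (l * p ^ N) * (single 0 (int p ^ k) * g ^ b'))"
      using c[of l "Suc b'"] b 2 by (simp add: power_add mult.left_commute)
    then have "reduce q (g ^ (l * p ^ N) * ?d) = 0"
      unfolding right_diff_distrib
      by (metis cancel_comm_monoid_add_class.diff_cancel reduce_diff_cong reduce_simps(6) reduce_zero)
    then have "reduce q ?d = 0"
      using primitive_cancel[OF prime_p primitive_power[OF prime_p g_primitive], of "m + 1" _ ?d] by (simp add: modulus_def)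
    then have "reduce q (\<psi> (reduce q (g ^ Suc b'))) = reduce q (single 0 (int p ^ k) * g ^ b')"
      by (metis add_0 diff_add_cancel reduce_reduce reduce_simps(1))
    moreover have "reduce q (\<psi> (reduce q (g ^ Suc b'))) = \<psi> (reduce q (g ^ Suc b'))"
      using R.additive_endosD(1)[OF \<psi> gb] q_pos by (simp add: poly_alg_carrier del: power_Suc)
    ultimately show ?thesis by simp
  qed
qed

text \<open>Near \<alpha>, an element of the \<open>k\<close>-th power of the maximal ideal is a
  multiple of \<open>p^k\<close>. There \<open>\<psi>\<close>, extended over the powers of
  \<open>t\<close>, carries the numerator of \<open>g\<delta>\<close> to \<open>p^k\<close> times
  that of \<open>\<delta>\<close>.\<close>

lemma imp_kills:
  assumes "power_annihilates p m n g \<alpha> k" shows "kills k"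
  unfolding kills_def N_localized_eq
proof (intro ballI)
  interpret D0r: ring D0 by (rule D0_ring)
  obtain \<psi> N b where \<psi>: "\<psi> \<in> additive_endos R" and comm: "\<And>w. w \<in> carrier R \<Longrightarrow> commutes_with R \<psi> (w [^]\<^bsub>R\<^esub> (p ^ N))"
    and b: "[int b = \<alpha> N] (mod int p ^ N)" "\<psi> (reduce q (g ^ Suc b)) = reduce q (single 0 (int p ^ k) * g ^ b)"
    using assms unfolding power_annihilates_def by blast
  fix P X assume P: "P \<in> MI [^]\<^bsub>ideals_set C\<^esub> k" and "X \<in> carrier (localization C NM (carrier C - MI))"
  then obtain x w where x: "x \<in> carrier NM" "w \<in> carrier C - MI" "X = fraction NM (carrier C - MI) x w"
    unfolding Nloc.localization_carrier by blast
  then obtain \<phi> where \<phi>: "\<phi> \<in> carrier D0" "x = B +>\<^bsub>H0\<^esub> (\<phi> \<odot>\<^bsub>H\<^esub> \<delta>)" unfolding N_carrier by blast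
  have PC: "P \<in> carrier C" using max_ideal_power[OF P] by blast
  obtain d where d: "[ev P = int p ^ k * d] (mod q)" using max_ideal_power[OF P] by blast
  obtain N1 c where c1: "periodic N1 c" "P = tscale_op {0} c" using iffD1[OF C_ring_iff PC] by blast
  define N2 where "N2 = max N N1"
  define a0 where "a0 = dual_exponent N2 \<alpha>"
  have c: "periodic N2 c" using periodic_mono[OF c1(1)] by (simp add: N2_def)
  have ca0: "[c a0 = int p ^ k * d] (mod q)" using d unfolding c1(2) ev_tscale_op[OF c] by (simp add: a0_def cong_def)
  \<comment> \<open>The indicator of the exponents dual to the ball of radius \<open>p^(-N2)\<close>
    around \<alpha>. It defines an element outside the maximal ideal that cuts away all exponents
    where nothing is known about \<open>P\<close>.\<close>
  define e :: "nat \<Rightarrow> int" where "e = (\<lambda>a. if a mod p ^ N2 = a0 then 1 else 0)"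
  have e: "periodic N2 e" by (simp add: periodic_def e_def)
  define u' where "u' = tscale_op {0} e"
  have u'C: "u' \<in> carrier C" unfolding C_ring_iff u'_def using e by blast
  have "ev u' = 1" unfolding u'_def ev_tscale_op[OF e] using q_gt_1 dual_exponent_less[of N2 \<alpha>] by (simp add: e_def a0_def)
  then have "\<not> int p dvd ev u'" using prime_gt_1_nat[OF prime_p] by simp
  then have u'W: "u' \<in> carrier C - MI" using u'C iffD1[OF max_ideal_iff, of u'] by blast
  have ec: "[e a * c a = int p ^ k * (d * e a)] (mod q)" for a
  proof (cases "a mod p ^ N2 = a0")
    case True
    then have "[c a = int p ^ k * d] (mod q)" using periodic_mod[OF c, of a] ca0 cong_sym cong_trans by metis
    then show ?thesis using True by (simp add: e_def)
  qed (simp add: e_def)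
  have extuP: "ext (u' \<otimes>\<^bsub>C\<^esub> P) = tscale_op {0..n} (\<lambda>a. int p ^ k * (d * e a))"
  proof -
    have "tscale_op {0..n} (\<lambda>a. e a * c a) = tscale_op {0..n} (\<lambda>a. int p ^ k * (d * e a))"
      unfolding tscale_op_def by (intro restrict_ext reduce_tscale_cong ec)
    then show ?thesis by (simp add: u'_def c1(2) tscale_op_mult R_extension_tscale_op)
  qed
  \<comment> \<open>With eigenvalues \<open>d * e a\<close> the right side becomes
    \<open>d p^k\<close> times the numerator on the ball and zero elsewhere, just as for
    \<open>u' P\<close>.\<close>
  define \<Psi> where "\<Psi> = tensor_op n (\<lambda>a. d * e a) \<psi>"
  have de: "periodic N2 (\<lambda>a. d * e a)" "periodic N2 (\<lambda>a. int p ^ k * (d * e a))" using e by (simp_all add: periodic_def cong_mult)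
  have comm2: "commutes_with R \<psi> (reduce q (Var i) [^]\<^bsub>R\<^esub> (p ^ N2))" if i: "i \<in> {1..n}" for i
  proof -
    have v: "reduce q (Var i) \<in> carrier R" using i by (intro reduce_in_poly_alg[OF q_pos] mpolys_Var)
    have "p ^ N2 = p ^ N * p ^ (N2 - N)" by (simp add: N2_def flip: power_add)
    then show ?thesis using R.commutes_with_pow[OF \<psi> R.nat_pow_closed[OF v] comm[OF v], of "p ^ (N2 - N)"] v
      by (simp add: R.nat_pow_pow)
  qed
  have \<Psi>: "\<Psi> \<in> carrier D0" unfolding \<Psi>_def by (rule tensor_op_D0[OF \<psi> de(1) comm2])
  have tD: "tscale_op {0..n} (\<lambda>a. int p ^ k * (d * e a)) \<in> carrier D0" by (rule tscale_op_D0[OF _ de(2)]) simp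
  obtain N3 where N3: "N3 \<ge> N2" "S.has_level (tscale_op {0..n} (\<lambda>a. int p ^ k * (d * e a))) N3" "S.has_level \<Psi> N3"
    using common_level3[OF tD \<Psi>] by blast
  have "tscale_op {0..n} (\<lambda>a. int p ^ k * (d * e a)) (top_power N3) = \<Psi> (gop (top_power N3))"
  proof (rule tcoef_eqI)
    fix a
    have l: "tcoef a (tscale_op {0..n} (\<lambda>a. int p ^ k * (d * e a)) (top_power N3)) = reduce q (single 0 (int p ^ k * (d * e a)) * tcoef a (top_power N3))"
      using top_power_carrier by (simp add: tscale_op_def tcoef_reduce tcoef_tscale)
    have r: "tcoef a (\<Psi> (gop (top_power N3))) = reduce q (single 0 (d * e a) * \<psi> (tcoef a (gop (top_power N3))))"
      unfolding \<Psi>_def by (rule tcoef_tensor_op[OF \<psi> gop_top_power_carrier])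
    show "tcoef a (tscale_op {0..n} (\<lambda>a. int p ^ k * (d * e a)) (top_power N3)) = tcoef a (\<Psi> (gop (top_power N3)))"
    proof (cases "a < p ^ N3 \<and> a mod p ^ N2 = a0")
      case True
      define f where "f = (-1) ^ a * int (p ^ N3 - 1 choose a)"
      define b' where "b' = p ^ N3 - 1 - a"
      have gb: "reduce q (g ^ Suc b') \<in> carrier R" using g_mpolys by (intro reduce_in_poly_alg[OF q_pos] mpolys_power)
      have "[int b' = \<alpha> N2] (mod int p ^ N2)"
      proof -
        have i: "int b' = int p ^ N3 - 1 - int a" using True by (simp add: b'_def of_nat_diff)
        have "int a mod int p ^ N2 = (- 1 - \<alpha> N2) mod int p ^ N2"
          using True int_dual_exponent[of N2 \<alpha>] by (simp add: a0_def flip: of_nat_power of_nat_mod)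
        then have 1: "[int a = - 1 - \<alpha> N2] (mod int p ^ N2)" by (simp add: cong_def)
        have 2: "[int p ^ N3 = 0] (mod int p ^ N2)" using N3(1) by (simp add: cong_0_iff le_imp_power_dvd)
        have "[int p ^ N3 - 1 - int a = 0 - 1 - (- 1 - \<alpha> N2)] (mod int p ^ N2)" by (intro cong_diff 1 2 cong_refl)
        then show ?thesis unfolding i by simp
      qed
      then have "[int b' = \<alpha> N2] (mod int p ^ N)" using cong_dvd_modulus le_imp_power_dvd[of N N2] by (metis N2_def max.cobounded1)
      moreover have "[\<alpha> N2 = \<alpha> N] (mod int p ^ N)" by (rule \<alpha>_trunc) (simp add: N2_def)
      ultimately have "[int b' = int b] (mod int p ^ N)" using b(1) cong_sym cong_trans by metis
      from annihilates_shift[OF \<psi> _ b(2) this] comm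
      have \<psi>b: "\<psi> (reduce q (g ^ Suc b')) = reduce q (single 0 (int p ^ k) * g ^ b')" by blast
      have "\<psi> (reduce q (single 0 f * g ^ Suc b')) = reduce q (single 0 f * \<psi> (reduce q (g ^ Suc b')))"
      proof -
        have "\<psi> \<in> linear_endos (residue_ring q) R" using \<psi> linear_endos_poly_alg[OF q_pos] by simp
        moreover have "f mod q \<in> carrier (residue_ring q)" using q_pos by (simp add: residue_ring_def)
        ultimately have "\<psi> ((f mod q) \<odot>\<^bsub>R\<^esub> reduce q (g ^ Suc b')) = (f mod q) \<odot>\<^bsub>R\<^esub> \<psi> (reduce q (g ^ Suc b'))"
          using gb unfolding linear_endos_def by blast
        then show ?thesis by (simp only: poly_alg_simps reduce_single_mod reduce_simps)
      qed
      then have "tcoef a (\<Psi> (gop (top_power N3))) = reduce q (single 0 (d * e a) * reduce q (single 0 f * reduce q (single 0 (int p ^ k) * g ^ b')))"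
        unfolding r using True \<psi>b by (simp only: tcoef_gop_top_power if_True f_def b'_def)
      also have "\<dots> = reduce q (single 0 (int p ^ k * (d * e a)) * (single 0 f * g ^ b'))"
      proof -
        have "d * e a * (f * int p ^ k) = int p ^ k * (d * e a) * f" by simp
        then show ?thesis unfolding reduce_simps by (simp only: single_zero_mult)
      qed
      finally show ?thesis unfolding l using True by (simp add: tcoef_top_power f_def b'_def)
    next
      case False
      then show ?thesis unfolding l r using R.additive_endos_zero[OF \<psi>]
        by (auto simp: tcoef_top_power tcoef_gop_top_power e_def poly_alg_simps(3))
    qed
  qed
  then have "tscale_op {0..n} (\<lambda>a. int p ^ k * (d * e a)) \<odot>\<^bsub>H\<^esub> \<delta> = \<Psi> \<odot>\<^bsub>H\<^esub> (gop \<odot>\<^bsub>H\<^esub> \<delta>)"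
    using smult_delta_eq_iff[OF tD N3(2) \<Psi> N3(3)] by blast
  then have inB: "ext (u' \<otimes>\<^bsub>C\<^esub> P) \<odot>\<^bsub>H\<^esub> \<delta> \<in> B" unfolding extuP span_eq using \<Psi> by blast
  have uPC: "u' \<otimes>\<^bsub>C\<^esub> P \<in> carrier C" using u'C PC by simp
  \<comment> \<open>From the generator to all of \<open>N_g\<close>: \<open>P\<close> and
    \<open>\<phi>\<close> commute.\<close>
  have "ext (u' \<otimes>\<^bsub>C\<^esub> P) \<odot>\<^bsub>H\<^esub> (\<phi> \<odot>\<^bsub>H\<^esub> \<delta>) = \<phi> \<odot>\<^bsub>H\<^esub> (ext (u' \<otimes>\<^bsub>C\<^esub> P) \<odot>\<^bsub>H\<^esub> \<delta>)"
    using H.smult_assoc1[OF ext_D0[OF uPC] \<phi>(1) delta_carrier] H.smult_assoc1[OF \<phi>(1) ext_D0[OF uPC] delta_carrier]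
      ext_commute[OF uPC \<phi>(1)] by simp
  then have "ext (u' \<otimes>\<^bsub>C\<^esub> P) \<odot>\<^bsub>H\<^esub> (\<phi> \<odot>\<^bsub>H\<^esub> \<delta>) \<in> B" using BH.B_smult[OF \<phi>(1) inB] by simp
  then have "(u' \<otimes>\<^bsub>C\<^esub> P) \<odot>\<^bsub>NM\<^esub> x = \<zero>\<^bsub>NM\<^esub>" using N_smult_zero_iff[OF uPC \<phi>(1)] \<phi>(2) by simp
  then have "u' \<odot>\<^bsub>NM\<^esub> (P \<odot>\<^bsub>NM\<^esub> x) = \<zero>\<^bsub>NM\<^esub>" using N.smult_assoc1[OF u'C PC x(1)] by simp
  then show "P \<odot>\<^bsub>localization C NM (carrier C - MI)\<^esub> X = \<zero>\<^bsub>localization C NM (carrier C - MI)\<^esub>"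
    unfolding x(3) using Nloc.smult_fraction_eq_zero_iff[OF PC x(1,2)] u'W by blast
qed

theorem strength_eq_Least: "strength p m n \<alpha> g = (LEAST k. power_annihilates p m n g \<alpha> k)"
proof -
  have "kills = power_annihilates p m n g \<alpha>" using kills_imp imp_kills by blast
  then show ?thesis by (simp add: strength_eq)
qed

end

section \<open>Functional equations\<close>

lemma lookup_mderiv:
  "lookup (mderiv i h) e = of_nat (lookup e i + 1) * lookup h (e + single i 1)"
proof -
  have "lookup (mderiv i h) e = (\<Sum>e'\<in>keys h.
      (of_nat (lookup e' i) * lookup h e' when e' - single i 1 = e))"
    by (simp add: mderiv_def lookup_sum lookup_single)
  also have "\<dots> = (\<Sum>e'\<in>keys h.
      if e' = e + single i 1 then of_nat (lookup e' i) * lookup h e' else 0)"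
  proof (rule sum.cong)
    fix e'
    have "e' - single i 1 = e \<longleftrightarrow> e' = e + single i 1" if "lookup e' i \<noteq> 0"
      using minus_plus_single[of 1 e' i] that by auto
    moreover have "e' \<noteq> e + single i 1" if "lookup e' i = 0"
      using that by (auto simp: lookup_add)
    ultimately show "(of_nat (lookup e' i) * lookup h e' when e' - single i 1 = e) =
        (if e' = e + single i 1 then of_nat (lookup e' i) * lookup h e' else 0)"
      by (cases "lookup e' i = 0") (auto simp: when_def)
  qed simp
  also have "\<dots> = of_nat (lookup (e + single i 1) i) * lookup h (e + single i 1)"
    by (simp add: sum.delta in_keys_iff)
  finally show ?thesis by (simp add: lookup_add)
qed

lemma mderiv_add: "mderiv i (g + h) = mderiv i g + mderiv i h"
  by (rule poly_mapping_eqI) (simp add: lookup_mderiv lookup_add distrib_left)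

lemma mderiv_zero [simp]: "mderiv i 0 = 0"
  by (rule poly_mapping_eqI) (simp add: lookup_mderiv)

lemma mderiv_single:
  "mderiv i (single e c) = single (e - single i 1) (of_nat (lookup e i) * c)"
  by (cases "c = 0") (simp_all add: mderiv_def)

lemma mderiv_mult: "mderiv i (g * h) = mderiv i g * h + g * mderiv i h"
proof (induction g rule: poly_mapping_additive_induct)
  case (single k c)
  show ?case
  proof (induction h rule: poly_mapping_additive_induct)
    case (single l d)
    \<comment> \<open>If the variable does not occur in \<open>k\<close>, the truncated exponent is
      meaningless, but then the coefficient is zero.\<close>
    have 1: "single (k + l - single i 1) (of_nat (lookup k i) * c * d) =
      single (k - single i 1 + l) (of_nat (lookup k i) * c * d)"
      using minus_single_add[of 1 k i l] by (cases "lookup k i = 0") (simp_all add: add.commute)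
    have 2: "single (k + l - single i 1) (c * (of_nat (lookup l i) * d)) =
      single (k + (l - single i 1)) (c * (of_nat (lookup l i) * d))"
      using minus_single_add[of 1 l i k] by (cases "lookup l i = 0") simp_all
    have "of_nat (lookup (k + l) i) * (c * d) = of_nat (lookup k i) * c * d + c * (of_nat (lookup l i) * d)"
      by (simp add: lookup_add algebra_simps)
    then show ?case by (simp add: mult_single mderiv_single single_add 1 2)
  qed (simp_all add: mderiv_add distrib_left algebra_simps)
qed (simp_all add: mderiv_add distrib_right algebra_simps)

lemma mderiv_const [simp]: "mderiv i (single 0 c) = 0"
  by (simp add: mderiv_single)

lemma mderiv_const_mult: "mderiv i (single 0 c * h) = single 0 c * mderiv i h"
  by (simp add: mderiv_mult)

lemma mderiv_power: "mderiv i (h ^ Suc k) = of_nat (Suc k) * h ^ k * mderiv i h"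
proof (induction k)
  case (Suc k)
  have "mderiv i (h ^ Suc (Suc k)) = mderiv i h * h ^ Suc k + h * mderiv i (h ^ Suc k)"
    by (simp only: power_Suc[of h "Suc k"] mderiv_mult)
  then show ?case unfolding Suc by (simp add: algebra_simps)
qed simp

lemma mpolys_mderiv: "h \<in> mpolys V \<Longrightarrow> mderiv i h \<in> mpolys V"
  unfolding mpolys_iff
proof (intro allI impI)
  fix e assume h: "\<forall>e. lookup h e \<noteq> 0 \<longrightarrow> keys e \<subseteq> V" and "lookup (mderiv i h) e \<noteq> 0"
  then have "lookup h (e + single i 1) \<noteq> 0" unfolding lookup_mderiv by (metis mult_zero_right)
  then have "keys (e + single i 1) \<subseteq> V" using h by blast
  moreover have "keys e \<subseteq> keys (e + single i 1)" by (auto simp: in_keys_iff lookup_add)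
  ultimately show "keys e \<subseteq> V" by blast
qed

lemma mderiv_reduce [simp]: "reduce N (mderiv i (reduce N h)) = reduce N (mderiv i h)"
  by (rule poly_mapping_eqI) (simp add: lookup_mderiv mod_mult_right_eq)

lemma lookup_map: "\<phi> 0 = 0 \<Longrightarrow> lookup (Poly_Mapping.map \<phi> h) e = \<phi> (lookup h e)"
  by (simp add: Poly_Mapping.map.rep_eq when_def)

lemma pmap_add:
  assumes "\<phi> 0 = 0" "\<And>x y. \<phi> (x + y) = \<phi> x + \<phi> y"
  shows "Poly_Mapping.map \<phi> (g + h) = Poly_Mapping.map \<phi> g + Poly_Mapping.map \<phi> h"
  by (rule poly_mapping_eqI) (simp add: lookup_map assms lookup_add)

lemma pmap_zero: "\<phi> 0 = 0 \<Longrightarrow> Poly_Mapping.map \<phi> 0 = 0"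
  by (rule poly_mapping_eqI) (simp add: lookup_map)

lemma pmap_single: "\<phi> 0 = 0 \<Longrightarrow> Poly_Mapping.map \<phi> (single e c) = single e (\<phi> c)"
  by (rule poly_mapping_eqI) (simp add: lookup_map lookup_single when_def)

lemma pmap_pmap: "\<phi> 0 = 0 \<Longrightarrow> \<psi> 0 = 0 \<Longrightarrow> Poly_Mapping.map \<phi> (Poly_Mapping.map \<psi> h) = Poly_Mapping.map (\<lambda>x. \<phi> (\<psi> x)) h"
  by (rule poly_mapping_eqI) (simp add: lookup_map)

text \<open>One statement for the ring homomorphisms \<open>int_embed\<close> and
  \<open>peval\<close> and for functionals that respect only multiplication by integers.\<close>

lemma pmap_semilinear:
  fixes \<phi> :: "'a::comm_semiring_1 \<Rightarrow> 'b::comm_semiring_1" and \<psi> :: "'z::comm_semiring_1 \<Rightarrow> 'a" and \<chi> :: "'z \<Rightarrow> 'b"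
  assumes "\<phi> 0 = 0" "\<And>x y. \<phi> (x + y) = \<phi> x + \<phi> y" "\<psi> 0 = 0" "\<And>x y. \<psi> (x + y) = \<psi> x + \<psi> y"
    "\<chi> 0 = 0" "\<And>x y. \<chi> (x + y) = \<chi> x + \<chi> y" and mult: "\<And>z x. \<phi> (\<psi> z * x) = \<chi> z * \<phi> x"
  shows "Poly_Mapping.map \<phi> (Poly_Mapping.map \<psi> h * a) = Poly_Mapping.map \<chi> h * Poly_Mapping.map \<phi> a"
proof (induction h rule: poly_mapping_additive_induct)
  case (single k z)
  show ?case
  proof (induction a rule: poly_mapping_additive_induct)
    case (single l x)
    then show ?case by (simp add: pmap_single assms mult_single)
  qed (simp_all add: pmap_zero pmap_add assms distrib_left)
qed (simp_all add: pmap_zero pmap_add assms distrib_right)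

lemma pmap_mderiv:
  fixes \<phi> :: "'a::comm_semiring_1 \<Rightarrow> 'b::comm_semiring_1"
  assumes "\<phi> 0 = 0" "\<And>x y. \<phi> (x + y) = \<phi> x + \<phi> y"
  shows "Poly_Mapping.map \<phi> (mderiv i h) = mderiv i (Poly_Mapping.map \<phi> h)"
proof -
  have "\<phi> (of_nat k * x) = of_nat k * \<phi> x" for k x
    by (induction k) (simp_all add: assms distrib_right)
  from this[of "Suc k" for k] have "\<phi> ((of_nat k + 1) * x) = (of_nat k + 1) * \<phi> x" for k x
    by (simp add: add.commute)
  then show ?thesis by (intro poly_mapping_eqI) (simp add: lookup_map lookup_mderiv assms(1))
qed

abbreviation const_poly :: "'a::zero mpoly \<Rightarrow> 'a poly mpoly" where
  "const_poly h \<equiv> Poly_Mapping.map (\<lambda>c. [:c:]) h"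

text \<open>The pair \<open>(a, d)\<close> stands for \<open>a f\<^sup>s\<^sup>-\<^sup>d\<close>; the elements of \<open>D[s] f\<^sup>s\<^sup>+\<^sup>1\<close> are described together with all their representations.\<close>

inductive_set fs_module :: "nat \<Rightarrow> 'a::comm_ring_1 mpoly \<Rightarrow> ('a poly mpoly \<times> nat) set"
  for n :: nat and f :: "'a::comm_ring_1 mpoly" where
  base: "(const_poly f, 0) \<in> fs_module n f"
| const: "(a, d) \<in> fs_module n f \<Longrightarrow> (single 0 [:c:] * a, d) \<in> fs_module n f"
| s_mult: "(a, d) \<in> fs_module n f \<Longrightarrow> (single 0 [:0, 1:] * a, d) \<in> fs_module n f"
| var: "i \<in> {1..n} \<Longrightarrow> (a, d) \<in> fs_module n f \<Longrightarrow> (Var i * a, d) \<in> fs_module n f"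
| deriv: "i \<in> {1..n} \<Longrightarrow> (a, d) \<in> fs_module n f \<Longrightarrow>
    (const_poly f * mderiv i a + single 0 [:- of_nat d, 1:] * const_poly (mderiv i f) * a, Suc d) \<in> fs_module n f"
| up: "(a, d) \<in> fs_module n f \<Longrightarrow> (const_poly f * a, Suc d) \<in> fs_module n f"
| add: "(a, d) \<in> fs_module n f \<Longrightarrow> (a', d) \<in> fs_module n f \<Longrightarrow> (a + a', d) \<in> fs_module n f"

lemma map_poly_of_int_add:
  "map_poly of_int (p + q) = (map_poly of_int p + map_poly of_int q :: 'b::comm_ring_1 poly)"
  by (rule poly_eqI) (simp add: coeff_map_poly)

lemma map_poly_semilinear:
  fixes \<mu> :: "'a::comm_ring_1 \<Rightarrow> 'b::comm_ring_1"
  assumes add: "\<And>x y. \<mu> (x + y) = \<mu> x + \<mu> y" and mult: "\<And>z x. \<mu> (of_int z * x) = of_int z * \<mu> x"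
  shows "map_poly \<mu> (map_poly of_int z * x) = map_poly of_int z * map_poly \<mu> x"
proof -
  have 0: "\<mu> 0 = 0" using add[of 0 0] by simp
  have s: "\<mu> (sum f I) = (\<Sum>i\<in>I. \<mu> (f i))" for f and I :: "nat set"
    by (induction I rule: infinite_finite_induct) (simp_all add: 0 add)
  show ?thesis by (rule poly_eqI) (simp add: coeff_map_poly 0 coeff_mult s mult)
qed

abbreviation int_embed :: "int poly mpoly \<Rightarrow> 'b::comm_ring_1 poly mpoly" where
  "int_embed h \<equiv> Poly_Mapping.map (map_poly of_int) h"

lemma int_embed_mult: "int_embed (g * h) = (int_embed g * int_embed h :: 'b::comm_ring_1 poly mpoly)"
proof -
  have id: "Poly_Mapping.map (\<lambda>x. x) g = g" for g :: "int poly mpoly"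
    by (rule poly_mapping_eqI) (simp add: lookup_map)
  have "map_poly of_int (z * x) = (map_poly of_int z * map_poly of_int x :: 'b poly)" for z x :: "int poly"
    using map_poly_semilinear[of "of_int :: int \<Rightarrow> 'b" z x] by (simp add: map_poly_idI)
  then show ?thesis
    using pmap_semilinear[of "map_poly of_int :: int poly \<Rightarrow> 'b poly" "\<lambda>x. x" "map_poly of_int" g h]
    by (simp add: map_poly_of_int_add id)
qed

lemma int_embed_add: "int_embed (g + h) = (int_embed g + int_embed h :: 'b::comm_ring_1 poly mpoly)"
  by (rule pmap_add) (simp_all add: map_poly_of_int_add)

lemma int_embed_power: "int_embed (g ^ k) = (int_embed g ^ k :: 'b::comm_ring_1 poly mpoly)"
proof (induction k)
  case 0
  show ?case using pmap_single[of "map_poly of_int :: int poly \<Rightarrow> 'b poly" 0 1] by simp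
qed (simp add: int_embed_mult)

lemma int_embed_const: "int_embed (single e c) = (single e (map_poly of_int c) :: 'b::comm_ring_1 poly mpoly)"
  by (simp add: pmap_single)

lemma int_embed_Var: "int_embed (Var i) = (Var i :: 'b::comm_ring_1 poly mpoly)"
  by (simp add: Var_def pmap_single)

lemma int_embed_mderiv: "int_embed (mderiv i h) = (mderiv i (int_embed h) :: 'b::comm_ring_1 poly mpoly)"
  by (rule pmap_mderiv) (simp_all add: map_poly_of_int_add)

lemma map_poly_of_int_pCons: "map_poly of_int (pCons c p) = (pCons (of_int c) (map_poly of_int p) :: 'b::comm_ring_1 poly)"
  by (rule map_poly_pCons) simp

lemma int_embed_const_poly: "int_embed (const_poly f) = (const_poly (Poly_Mapping.map of_int f) :: 'b::comm_ring_1 poly mpoly)"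
  by (simp add: pmap_pmap map_poly_of_int_pCons)

lemma map_of_int_mderiv: "Poly_Mapping.map of_int (mderiv i f) = (mderiv i (Poly_Mapping.map of_int f) :: 'b::comm_ring_1 mpoly)"
  by (rule pmap_mderiv) simp_all

lemma fs_module_int_embed:
  "(a, d) \<in> fs_module n f \<Longrightarrow> (int_embed a :: 'b::comm_ring_1 poly mpoly, d) \<in> fs_module n (Poly_Mapping.map of_int f)"
proof (induction a d rule: fs_module.induct)
  case base
  then show ?case unfolding int_embed_const_poly by (rule fs_module.base)
next
  case (const a d c)
  show ?case unfolding int_embed_mult int_embed_const map_poly_of_int_pCons map_poly_0 by (rule fs_module.const[OF const.IH])
next
  case (s_mult a d)
  show ?case unfolding int_embed_mult int_embed_const
    using fs_module.s_mult[OF s_mult.IH] by (simp add: map_poly_of_int_pCons)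
next
  case (var i a d)
  show ?case unfolding int_embed_mult int_embed_Var by (rule fs_module.var[OF var.hyps(1) var.IH])
next
  case (deriv i a d)
  show ?case
    unfolding int_embed_mult int_embed_add int_embed_const int_embed_mderiv int_embed_const_poly map_of_int_mderiv
    using fs_module.deriv[OF deriv.hyps(1) deriv.IH] by (simp add: map_poly_of_int_pCons)
next
  case (up a d)
  show ?case unfolding int_embed_mult int_embed_const_poly by (rule fs_module.up[OF up.IH])
next
  case (add a d a')
  show ?case unfolding int_embed_add by (rule fs_module.add[OF add.IH])
qed

text \<open>Descent to rational coefficients: apply a \<open>\<rat>\<close>-linear functional to all coefficients.\<close>

definition rat_linear :: "(complex \<Rightarrow> rat) \<Rightarrow> bool" where
  "rat_linear \<mu> \<longleftrightarrow> (\<forall>x y. \<mu> (x + y) = \<mu> x + \<mu> y) \<and> (\<forall>r x. \<mu> (of_rat r * x) = r * \<mu> x)"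

lemma rat_linear_props:
  assumes "rat_linear \<mu>"
  shows "\<mu> (x + y) = \<mu> x + \<mu> y" "\<mu> (of_rat r * x) = r * \<mu> x" "\<mu> 0 = 0" "\<mu> (of_int z * x) = of_int z * \<mu> x"
proof -
  show "\<mu> (x + y) = \<mu> x + \<mu> y" "\<mu> (of_rat r * x) = r * \<mu> x" for x y r using assms by (auto simp: rat_linear_def)
  from this(2)[of 0 0] this(2)[of "of_int z" x] show "\<mu> 0 = 0" "\<mu> (of_int z * x) = of_int z * \<mu> x" by simp_all
qed

text \<open>The set \<open>{1}\<close> is independent over the rationals, so a functional can be
  prescribed on it.\<close>

lemma rat_linear_exists: "\<exists>\<mu>. rat_linear \<mu> \<and> \<mu> 1 = 1"
proof -
  interpret V: vector_space "\<lambda>(q::rat) (x::complex). of_rat q * x"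
    by unfold_locales (simp_all add: distrib_left distrib_right of_rat_add of_rat_mult)
  interpret Q: vector_space "\<lambda>(q::rat) (x::rat). q * x"
    by unfold_locales (simp_all add: distrib_left distrib_right)
  interpret VQ: vector_space_pair "\<lambda>(q::rat) (x::complex). of_rat q * x" "\<lambda>(q::rat) (x::rat). q * x" ..
  have "\<not> V.dependent {1}" by (simp add: V.dependent_single)
  then obtain g where "Vector_Spaces.linear (\<lambda>(q::rat) (x::complex). of_rat q * x) (\<lambda>(q::rat) (x::rat). q * x) g" "g 1 = 1"
    using VQ.linear_independent_extend[of "{1}" "\<lambda>_. 1"] by auto
  then show ?thesis unfolding rat_linear_def
    by (intro exI[of _ g]) (auto simp: VQ.linear_add VQ.linear_scale)
qed

abbreviation functional_map :: "(complex \<Rightarrow> rat) \<Rightarrow> complex poly mpoly \<Rightarrow> rat poly mpoly" where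
  "functional_map \<mu> a \<equiv> Poly_Mapping.map (map_poly \<mu>) a"

lemma functional_map_props:
  assumes \<mu>: "rat_linear \<mu>"
  shows "functional_map \<mu> (a + b) = functional_map \<mu> a + functional_map \<mu> b"
    and "functional_map \<mu> (int_embed h * a) = int_embed h * functional_map \<mu> a"
    and "functional_map \<mu> (mderiv i a) = mderiv i (functional_map \<mu> a)"
proof -
  have add: "map_poly \<mu> (x + y) = map_poly \<mu> x + map_poly \<mu> y" for x y
    by (rule poly_eqI) (simp add: coeff_map_poly rat_linear_props[OF \<mu>])
  show "functional_map \<mu> (a + b) = functional_map \<mu> a + functional_map \<mu> b" by (rule pmap_add) (simp_all add: add)
  show "functional_map \<mu> (mderiv i a) = mderiv i (functional_map \<mu> a)" by (rule pmap_mderiv) (simp_all add: add)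
  show "functional_map \<mu> (int_embed h * a) = int_embed h * functional_map \<mu> a"
    by (rule pmap_semilinear)
      (simp_all add: add map_poly_of_int_add map_poly_semilinear[of \<mu>, OF rat_linear_props(1)[OF \<mu>] rat_linear_props(4)[OF \<mu>]])
qed

text \<open>All generating steps except multiplication by a complex constant \<open>c\<close> have
  integer coefficients and commute with \<open>\<mu>\<close>. A constant is absorbed by passing to
  \<open>x \<mapsto> \<mu>(c x)\<close>, which is why \<open>\<mu>\<close> varies in the induction.
  Denominators arise at the start, from \<open>\<mu> 1\<close>, and are made common in sums.\<close>

lemma fs_module_descent:
  assumes "(a, d) \<in> fs_module n (Poly_Mapping.map of_int f :: complex mpoly)" "rat_linear \<mu>"
  shows "\<exists>D b. D > 0 \<and> (b, d) \<in> fs_module n f \<and> int_embed b = single 0 [:of_int D:] * functional_map \<mu> a"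
  using assms
proof (induction a d arbitrary: \<mu> rule: fs_module.induct)
  case base
  obtain u v where uv: "quotient_of (\<mu> 1) = (u, v)" by fastforce
  have v: "v > 0" "\<mu> 1 = of_int u / of_int v" using quotient_of_denom_pos[OF uv] quotient_of_div[OF uv] by auto
  have "functional_map \<mu> (const_poly (Poly_Mapping.map of_int f)) = single 0 [:\<mu> 1:] * int_embed (const_poly f)"
  proof -
    have "functional_map \<mu> (int_embed (const_poly f) * single 0 1) = int_embed (const_poly f) * functional_map \<mu> (single 0 1)"
      by (rule functional_map_props(2)[OF base])
    also have "functional_map \<mu> (single 0 1) = single 0 [:\<mu> 1:]"
      by (subst pmap_single) (simp_all add: map_poly_1 del: single_one)
    finally show ?thesis by (simp add: int_embed_const_poly mult.commute)
  qed
  then have "int_embed (single 0 [:u:] * const_poly f) =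
      single 0 [:of_int v:] * functional_map \<mu> (const_poly (Poly_Mapping.map of_int f))"
    using v by (simp add: int_embed_mult int_embed_const map_poly_of_int_pCons mult_single flip: mult.assoc)
  then show ?case using v(1) fs_module.const[OF fs_module.base] by blast
next
  case (const a d c)
  define \<nu> where "\<nu> = (\<lambda>x. \<mu> (c * x))"
  have \<nu>: "rat_linear \<nu>"
  proof -
    have "c * (of_rat r * x) = of_rat r * (c * x)" for r x by simp
    then show ?thesis unfolding rat_linear_def \<nu>_def distrib_left using rat_linear_props(1,2)[OF const.prems] by metis
  qed
  have "functional_map \<mu> (single 0 [:c:] * a) = functional_map \<nu> a"
    by (intro poly_mapping_eqI poly_eqI)
      (simp add: lookup_map coeff_map_poly rat_linear_props(3)[OF const.prems] rat_linear_props(3)[OF \<nu>], simp add: \<nu>_def)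
  then show ?case using const.IH[OF \<nu>] by simp
next
  case (s_mult a d)
  obtain D b where b: "D > 0" "(b, d) \<in> fs_module n f" "int_embed b = single 0 [:of_int D:] * functional_map \<mu> a"
    using s_mult.IH[OF s_mult.prems] by blast
  have "functional_map \<mu> (single 0 [:0, 1:] * a) = single 0 [:0, 1:] * functional_map \<mu> a"
    using functional_map_props(2)[OF s_mult.prems, of "single 0 [:0, 1:]" a]
    by (simp add: int_embed_const map_poly_of_int_pCons)
  then have "int_embed (single 0 [:0, 1:] * b) = single 0 [:of_int D:] * functional_map \<mu> (single 0 [:0, 1:] * a)"
    using b(3) by (simp add: int_embed_mult int_embed_const map_poly_of_int_pCons mult.left_commute)
  then show ?case using b(1) fs_module.s_mult[OF b(2)] by blast
next
  case (var i a d)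
  obtain D b where b: "D > 0" "(b, d) \<in> fs_module n f" "int_embed b = single 0 [:of_int D:] * functional_map \<mu> a"
    using var.IH[OF var.prems] by blast
  have "int_embed (Var i * b) = single 0 [:of_int D:] * functional_map \<mu> (Var i * a)"
    using functional_map_props(2)[OF var.prems, of "Var i" a] b(3) by (simp add: int_embed_mult int_embed_Var mult.left_commute)
  then show ?case using b(1) fs_module.var[OF var.hyps(1) b(2)] by blast
next
  case (deriv i a d)
  obtain D b where b: "D > 0" "(b, d) \<in> fs_module n f" "int_embed b = single 0 [:of_int D:] * functional_map \<mu> a"
    using deriv.IH[OF deriv.prems] by blast
  let ?s = "single 0 [:- of_nat d, 1:]"
  let ?a = "const_poly (Poly_Mapping.map of_int f) * mderiv i a + ?s * const_poly (mderiv i (Poly_Mapping.map of_int f)) * a"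
  let ?b = "const_poly f * mderiv i b + ?s * const_poly (mderiv i f) * b"
  have s: "int_embed ?s = (?s :: 'b::comm_ring_1 poly mpoly)" by (simp add: int_embed_const map_poly_of_int_pCons)
  have a: "?a = int_embed (const_poly f) * mderiv i a + int_embed (?s * const_poly (mderiv i f)) * a"
    unfolding int_embed_mult s int_embed_const_poly map_of_int_mderiv ..
  have "functional_map \<mu> ?a = int_embed (const_poly f) * mderiv i (functional_map \<mu> a) + int_embed (?s * const_poly (mderiv i f)) * functional_map \<mu> a"
    unfolding a functional_map_props[OF deriv.prems] ..
  moreover have "int_embed ?b = int_embed (const_poly f) * mderiv i (int_embed b) + int_embed (?s * const_poly (mderiv i f)) * (int_embed b :: rat poly mpoly)"
    by (simp only: int_embed_mult int_embed_add int_embed_mderiv)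
  moreover have "X * mderiv i (int_embed b) + Y * (int_embed b :: rat poly mpoly) =
      single 0 [:of_int D:] * (X * mderiv i (functional_map \<mu> a) + Y * functional_map \<mu> a)" for X Y
    by (simp only: b(3) mderiv_const_mult distrib_left mult.left_commute)
  ultimately have "int_embed ?b = single 0 [:of_int D:] * functional_map \<mu> ?a" by (simp only:)
  then show ?case using b(1) fs_module.deriv[OF deriv.hyps(1) b(2)] by blast
next
  case (up a d)
  obtain D b where b: "D > 0" "(b, d) \<in> fs_module n f" "int_embed b = single 0 [:of_int D:] * functional_map \<mu> a"
    using up.IH[OF up.prems] by blast
  have "int_embed (const_poly f * b) = single 0 [:of_int D:] * functional_map \<mu> (const_poly (Poly_Mapping.map of_int f) * a)"
    using functional_map_props(2)[OF up.prems, of "const_poly f" a] b(3) by (simp add: int_embed_mult int_embed_const_poly mult.left_commute)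
  then show ?case using b(1) fs_module.up[OF b(2)] by blast
next
  case (add a d a')
  obtain D b where b: "D > 0" "(b, d) \<in> fs_module n f" "int_embed b = single 0 [:of_int D:] * functional_map \<mu> a"
    using add.IH(1)[OF add.prems] by blast
  obtain D' b' where b': "D' > 0" "(b', d) \<in> fs_module n f" "int_embed b' = single 0 [:of_int D':] * functional_map \<mu> a'"
    using add.IH(2)[OF add.prems] by blast
  have "int_embed (single 0 [:D':] * b + single 0 [:D:] * b') =
     single 0 [:of_int (D * D'):] * functional_map \<mu> (a + a')"
  proof -
    have c: "single 0 [:of_int D':] * (single 0 [:of_int D:] * X) = single 0 [:of_int (D * D'):] * X"
      "single 0 [:of_int D:] * (single 0 [:of_int D':] * X) = single 0 [:of_int (D * D'):] * X"
      for X :: "rat poly mpoly"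
      by (simp_all add: mult_single mult.commute[of "of_int D'"] flip: mult.assoc)
    show ?thesis
      unfolding int_embed_add int_embed_mult int_embed_const map_poly_of_int_pCons b(3) b'(3) functional_map_props(1)[OF add.prems]
      by (simp only: map_poly_0 c distrib_left)
  qed
  moreover have "D * D' > 0" using b(1) b'(1) by simp
  ultimately show ?case using fs_module.add[OF fs_module.const[OF b(2)] fs_module.const[OF b'(2)]] by blast
qed

section \<open>Weyl operators acting on fractions with powers of \<open>f\<close> as
  denominators\<close>

lemma quotient_rule_identity:
  fixes a b a' b' da db da' db' :: "'a::comm_ring_1"
  assumes d: "da * b' + a * db' = da' * b + a' * db" and e: "a * b' = a' * b"
  shows "(da' * b' - a' * db') * (b * b) = (da * b - a * db) * (b' * b')"
proof -
  have "(da' * b' - a' * db') * (b * b) = b * b' * (da' * b + a' * db) - (a' * b) * (db * b' + db' * b)"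
    by (simp add: algebra_simps)
  also have "\<dots> = b * b' * (da * b' + a * db') - (a * b') * (db * b' + db' * b)" by (simp only: d e)
  also have "\<dots> = (da * b - a * db) * (b' * b')" by (simp add: algebra_simps)
  finally show ?thesis .
qed

text \<open>Differentiating \<open>a b' = a' b\<close> shows that the quotient rule gives the same
  value for every representation, so the description in \<open>fderiv\<close> is unique.\<close>

lemma fderiv_Fract:
  assumes b: "b \<noteq> 0"
  shows "fderiv i (Fract a b) = Fract (mderiv i a * b - a * mderiv i b) (b * b)"
  unfolding fderiv_def
proof (rule the_equality)
  show "\<exists>a' b'. b' \<noteq> 0 \<and> Fract a b = Fract a' b' \<and>
      Fract (mderiv i a * b - a * mderiv i b) (b * b) = Fract (mderiv i a' * b' - a' * mderiv i b') (b' * b')"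
    using b by blast
  fix w assume "\<exists>a' b'. b' \<noteq> 0 \<and> Fract a b = Fract a' b' \<and> w = Fract (mderiv i a' * b' - a' * mderiv i b') (b' * b')"
  then obtain a' b' where w: "b' \<noteq> 0" "Fract a b = Fract a' b'" "w = Fract (mderiv i a' * b' - a' * mderiv i b') (b' * b')"
    by blast
  have e: "a * b' = a' * b" using w b by (simp add: eq_fract)
  then have "mderiv i (a * b') = mderiv i (a' * b)" by simp
  then have "mderiv i a * b' + a * mderiv i b' = mderiv i a' * b + a' * mderiv i b" by (simp add: mderiv_mult)
  then have "(mderiv i a' * b' - a' * mderiv i b') * (b * b) = (mderiv i a * b - a * mderiv i b) * (b' * b')"
    by (rule quotient_rule_identity) (rule e)
  then show "w = Fract (mderiv i a * b - a * mderiv i b) (b * b)" using w b by (simp add: eq_fract)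
qed

lemma Fract_add_same: "c \<noteq> 0 \<Longrightarrow> Fract x c + Fract y c = Fract (x + y) c"
  by (simp add: eq_fract algebra_simps)

lemma fs_module_scalar:
  "(a, d) \<in> fs_module n f \<Longrightarrow> (single 0 c * a, d) \<in> fs_module n f"
proof (induction c)
  case 0
  then show ?case using fs_module.const[of a d n f 0] by simp
next
  case (pCons c0 c)
  have "pCons c0 c = [:c0:] + [:0, 1:] * c" by simp
  then have "single 0 (pCons c0 c) = single 0 [:c0:] + single 0 ([:0, 1:] * c)"
    by (simp only: single_add)
  also have "single (0::nat \<Rightarrow>\<^sub>0 nat) ([:0, 1:] * c) = single 0 [:0, 1:] * single 0 c"
    by (simp only: mult_single add_0)
  finally have "single 0 (pCons c0 c) * a =
     single 0 [:c0:] * a + single 0 [:0, 1:] * (single 0 c * a)"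
    by (simp only: distrib_right mult.assoc)
  then show ?case using fs_module.add[OF fs_module.const[OF pCons.prems] fs_module.s_mult[OF pCons.IH[OF pCons.prems]]] by simp
qed

lemma fs_module_up: "(a, d) \<in> fs_module n f \<Longrightarrow> (const_poly f ^ k * a, k + d) \<in> fs_module n f"
  by (induction k) (simp_all add: mult.assoc fs_module.up)

lemma const_poly_Var: "const_poly (Var i) = Var i"
  by (simp add: Var_def pmap_single flip: one_pCons)

lemma const_poly_mderiv: "mderiv i (const_poly f) = const_poly (mderiv i f)" for f :: "'a::comm_semiring_1 mpoly"
  by (rule pmap_mderiv[symmetric]) simp_all

context
  fixes f :: "complex mpoly" and n :: nat
  assumes f: "f \<noteq> 0"
begin

abbreviation (input) F where "F \<equiv> const_poly f"

lemma F_nonzero: "F \<noteq> 0"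
proof -
  obtain e where "lookup f e \<noteq> 0" using f by (metis poly_mapping_eqI lookup_zero)
  then have "lookup F e \<noteq> 0" by (simp add: lookup_map)
  then show ?thesis by auto
qed

text \<open>The extra factor \<open>F\<close> avoids the exponent \<open>d - 1\<close>, so that one
  formula covers \<open>d = 0\<close>.\<close>

lemma F_power_mderiv: "F * mderiv i (F ^ d) = of_nat d * F ^ d * const_poly (mderiv i f)"
  by (cases d) (simp_all add: mderiv_power const_poly_mderiv algebra_simps flip: single_one del: power_Suc of_nat_Suc, simp add: algebra_simps)

text \<open>This is the derivative of \<open>a f^(s-d)\<close>: the quotient rule contributes
  \<open>-d\<close> and the twist by \<open>f^s\<close> contributes \<open>s\<close>. It is the
  origin of the rule \<open>deriv\<close> of \<open>fs_module\<close>.\<close>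

lemma fs_deriv_Fract:
  "fs_deriv f i (Fract a (F ^ d)) = Fract (F * mderiv i a + single 0 [:- of_nat d, 1:] * const_poly (mderiv i f) * a) (F ^ Suc d)"
proof -
  let ?df = "const_poly (mderiv i f)"
  have Fd: "F ^ d \<noteq> 0" "F ^ Suc d \<noteq> 0" using F_nonzero by simp_all
  have "fderiv i (Fract a (F ^ d)) = Fract (mderiv i a * F ^ d - a * mderiv i (F ^ d)) (F ^ d * F ^ d)"
    by (rule fderiv_Fract[OF Fd(1)])
  also have "\<dots> = Fract (F * mderiv i a - of_nat d * ?df * a) (F ^ Suc d)"
  proof -
    have "(mderiv i a * F ^ d - a * mderiv i (F ^ d)) * F ^ Suc d = mderiv i a * F ^ d * F ^ Suc d - a * (F * mderiv i (F ^ d)) * F ^ d"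
      by (simp add: algebra_simps)
    also have "\<dots> = (F * mderiv i a - of_nat d * ?df * a) * (F ^ d * F ^ d)"
      unfolding F_power_mderiv by (simp add: algebra_simps)
    finally show ?thesis using Fd by (simp add: eq_fract)
  qed
  finally have 1: "fderiv i (Fract a (F ^ d)) = Fract (F * mderiv i a - of_nat d * ?df * a) (F ^ Suc d)" .
  have 2: "of_Cs [:0, 1:] * Fract a (F ^ d) * of_Cx (mderiv i f) / of_Cx f = Fract (single 0 [:0, 1:] * a * ?df) (F ^ Suc d)"
    by (simp add: of_Cs_def of_Cx_def mult.commute)
  have 3: "single 0 [:- of_nat d, 1:] = single 0 [:0, 1:] - (of_nat d :: complex poly mpoly)"
  proof -
    have "[:- of_nat d, 1:] = [:0, 1:] - (of_nat d :: complex poly)" by (simp add: of_nat_poly)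
    then show ?thesis by (simp add: single_diff single_of_nat)
  qed
  show ?thesis unfolding fs_deriv_def 1 2 Fract_add_same[OF Fd(2)] 3 by (simp add: algebra_simps)
qed

lemma Weyl_action_fs_module:
  assumes "P \<in> Weyl_s_actions n f" "(a, d) \<in> fs_module n f"
  shows "\<exists>a' d'. (a', d') \<in> fs_module n f \<and> P (Fract a (F ^ d)) = Fract a' (F ^ d')"
  using assms
proof (induction P arbitrary: a d rule: Weyl_s_actions.induct)
  case (scalar c)
  show ?case using fs_module_scalar[OF scalar, of c]
    by (intro exI[of _ "single 0 c * a"] exI[of _ d]) (simp add: of_Cs_def)
next
  case (var i)
  show ?case using fs_module.var[OF var]
    by (intro exI[of _ "Var i * a"] exI[of _ d]) (simp add: of_Cx_def const_poly_Var)
next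
  case (deriv i)
  show ?case using fs_module.deriv[OF deriv] fs_deriv_Fract by blast
next
  case (add P Q)
  obtain a1 d1 where 1: "(a1, d1) \<in> fs_module n f" "P (Fract a (F ^ d)) = Fract a1 (F ^ d1)" using add.IH(1)[OF add.prems] by blast
  obtain a2 d2 where 2: "(a2, d2) \<in> fs_module n f" "Q (Fract a (F ^ d)) = Fract a2 (F ^ d2)" using add.IH(2)[OF add.prems] by blast
  have "Fract a1 (F ^ d1) + Fract a2 (F ^ d2) = Fract (F ^ d2 * a1 + F ^ d1 * a2) (F ^ (d2 + d1))"
    using F_nonzero by (simp add: power_add mult.commute)
  moreover have "(F ^ d2 * a1 + F ^ d1 * a2, d2 + d1) \<in> fs_module n f"
    using fs_module.add[OF fs_module_up[OF 1(1), of d2]] fs_module_up[OF 2(1), of d1] by (simp add: add.commute)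
  ultimately show ?case using 1(2) 2(2) by auto
next
  case (comp P Q)
  then show ?case by (metis comp_apply)
qed

lemma fs_module_Weyl_action:
  "(a, d) \<in> fs_module n f \<Longrightarrow> \<exists>P\<in>Weyl_s_actions n f. P (of_Cx f) = Fract a (F ^ d)"
proof (induction a d rule: fs_module.induct)
  case base
  show ?case by (rule bexI[OF _ Weyl_s_actions.scalar[of 1]]) (simp add: of_Cs_def of_Cx_def)
next
  case (const a d c)
  then obtain P where P: "P \<in> Weyl_s_actions n f" "P (of_Cx f) = Fract a (F ^ d)" by blast
  show ?case by (rule bexI[OF _ Weyl_s_actions.comp[OF Weyl_s_actions.scalar[of "[:c:]"] P(1)]]) (simp add: P(2) of_Cs_def)
next
  case (s_mult a d)
  then obtain P where P: "P \<in> Weyl_s_actions n f" "P (of_Cx f) = Fract a (F ^ d)" by blast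
  show ?case by (rule bexI[OF _ Weyl_s_actions.comp[OF Weyl_s_actions.scalar[of "[:0, 1:]"] P(1)]]) (simp add: P(2) of_Cs_def)
next
  case (var i a d)
  then obtain P where P: "P \<in> Weyl_s_actions n f" "P (of_Cx f) = Fract a (F ^ d)" by blast
  show ?case by (rule bexI[OF _ Weyl_s_actions.comp[OF Weyl_s_actions.var[OF var.hyps(1)] P(1)]]) (unfold comp_apply P(2), simp add: of_Cx_def const_poly_Var)
next
  case (deriv i a d)
  then obtain P where P: "P \<in> Weyl_s_actions n f" "P (of_Cx f) = Fract a (F ^ d)" by blast
  show ?case by (rule bexI[OF _ Weyl_s_actions.comp[OF Weyl_s_actions.deriv[OF deriv.hyps(1)] P(1)]])
    (unfold comp_apply P(2), rule fs_deriv_Fract)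
next
  case (up a d)
  then obtain P where P: "P \<in> Weyl_s_actions n f" "P (of_Cx f) = Fract a (F ^ d)" by blast
  have "Fract a (F ^ d) = Fract (F * a) (F ^ Suc d)" using F_nonzero by (simp add: eq_fract mult.left_commute mult.commute)
  then show ?case using P by auto
next
  case (add a d a')
  then obtain P Q where P: "P \<in> Weyl_s_actions n f" "P (of_Cx f) = Fract a (F ^ d)"
    and Q: "Q \<in> Weyl_s_actions n f" "Q (of_Cx f) = Fract a' (F ^ d)" by blast
  show ?case by (rule bexI[OF _ Weyl_s_actions.add[OF P(1) Q(1)]]) (simp only: P(2) Q(2) Fract_add_same F_nonzero power_not_zero not_False_eq_True)
qed

text \<open>In the form \<open>b f^d / f^d\<close>, the functional equation becomes a statement
  about polynomials, which can be moved between coefficient rings.\<close>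

lemma functional_eq_iff:
  "functional_eq n f b \<longleftrightarrow> (\<exists>d. (single 0 b * F ^ d, d) \<in> fs_module n f)"
proof
  assume "functional_eq n f b"
  then obtain P where P: "P \<in> Weyl_s_actions n f" "of_Cs b = P (of_Cx f)" by (auto simp: functional_eq_def)
  have "of_Cx f = Fract F (F ^ 0)" by (simp add: of_Cx_def)
  then obtain a d where a: "(a, d) \<in> fs_module n f" "of_Cs b = Fract a (F ^ d)"
    using Weyl_action_fs_module[OF P(1) fs_module.base] P(2) by auto
  then have "single 0 b * F ^ d = a" using F_nonzero by (simp add: of_Cs_def eq_fract)
  then show "\<exists>d. (single 0 b * F ^ d, d) \<in> fs_module n f" using a(1) by auto
next
  assume "\<exists>d. (single 0 b * F ^ d, d) \<in> fs_module n f"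
  then obtain d P where "P \<in> Weyl_s_actions n f" "P (of_Cx f) = Fract (single 0 b * F ^ d) (F ^ d)"
    using fs_module_Weyl_action by blast
  moreover have "Fract (single 0 b * F ^ d) (F ^ d) = of_Cs b" using F_nonzero by (simp add: of_Cs_def eq_fract)
  ultimately show "functional_eq n f b" unfolding functional_eq_def by metis
qed

lemma functional_eq_add: assumes "functional_eq n f b" "functional_eq n f c" shows "functional_eq n f (b + c)"
proof -
  obtain d e where d: "(single 0 b * F ^ d, d) \<in> fs_module n f" and e: "(single 0 c * F ^ e, e) \<in> fs_module n f"
    using assms functional_eq_iff by blast
  have "(F ^ e * (single 0 b * F ^ d) + F ^ d * (single 0 c * F ^ e), e + d) \<in> fs_module n f"
    using fs_module.add[OF fs_module_up[OF d, of e]] fs_module_up[OF e, of d] by (simp add: add.commute)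
  moreover have "F ^ e * (single 0 b * F ^ d) + F ^ d * (single 0 c * F ^ e) = single 0 (b + c) * F ^ (e + d)"
    by (simp add: single_add power_add algebra_simps)
  ultimately show ?thesis using functional_eq_iff by metis
qed

lemma functional_eq_smult: assumes "functional_eq n f b" shows "functional_eq n f (smult z b)"
proof -
  obtain d where "(single 0 b * F ^ d, d) \<in> fs_module n f" using assms functional_eq_iff by blast
  from fs_module.const[OF this, of z] have "(single 0 (smult z b) * F ^ d, d) \<in> fs_module n f"
    by (simp add: mult_single flip: mult.assoc)
  then show ?thesis using functional_eq_iff by blast
qed

text \<open>The leading terms cancel in the difference; if it were nonzero, its monic multiple would
  satisfy a functional equation of smaller degree.\<close>

lemma is_bernstein_sato_unique:
  assumes b: "is_bernstein_sato n f b" and c: "lead_coeff c = 1" "functional_eq n f c" "Polynomial.degree c = Polynomial.degree b"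
  shows "c = b"
proof (rule ccontr)
  assume "c \<noteq> b"
  define h where "h = c - b"
  have h0: "h \<noteq> 0" using \<open>c \<noteq> b\<close> by (simp add: h_def)
  have "functional_eq n f (smult (-1) b)" using b by (intro functional_eq_smult) (simp add: is_bernstein_sato_def)
  then have h: "functional_eq n f h" using functional_eq_add[OF c(2)] by (fastforce simp: h_def)
  define h' where "h' = smult (inverse (lead_coeff h)) h"
  have "functional_eq n f h'" "lead_coeff h' = 1" using functional_eq_smult[OF h] h0 by (simp_all add: h'_def)
  then have "Polynomial.degree b \<le> Polynomial.degree h'" using b by (simp add: is_bernstein_sato_def)
  then have le: "Polynomial.degree b \<le> Polynomial.degree h" using h0 by (simp add: h'_def)
  have "lead_coeff b = 1" using b by (simp add: is_bernstein_sato_def)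
  then have "coeff h (Polynomial.degree b) = 0" using c by (simp add: h_def)
  moreover have "Polynomial.degree h \<le> Polynomial.degree b" unfolding h_def using c(3) by (intro degree_diff_le) auto
  ultimately show False using le h0 by (metis antisym leading_coeff_0_iff)
qed

lemma bernstein_sato_is:
  assumes "bernstein_sato n f \<noteq> 0" shows "is_bernstein_sato n f (bernstein_sato n f)"
proof -
  obtain b where b: "is_bernstein_sato n f b" using assms by (auto simp: bernstein_sato_def split: if_splits)
  have "c = b" if c: "is_bernstein_sato n f c" for c
  proof (rule is_bernstein_sato_unique[OF b])
    show c': "lead_coeff c = 1" "functional_eq n f c" using c unfolding is_bernstein_sato_def by simp_all
    have "lead_coeff b = 1" "functional_eq n f b" using b unfolding is_bernstein_sato_def by simp_all
    then show "Polynomial.degree c = Polynomial.degree b"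
      using b c c' unfolding is_bernstein_sato_def by (intro antisym) simp_all
  qed
  then have "(THE b. is_bernstein_sato n f b) = b" using b by (rule the_equality[rotated])
  moreover have "\<exists>b. is_bernstein_sato n f b" using b by (rule exI)
  ultimately show ?thesis using b unfolding bernstein_sato_def by simp
qed

end

lemma rat_poly_clear_denominators: "\<exists>D B. D > (0::int) \<and> map_poly of_int B = smult (of_int D) (r :: rat poly)"
proof (induction r)
  case 0
  show ?case by (rule exI[of _ 1], rule exI[of _ 0]) simp
next
  case (pCons c r)
  then obtain D B where D: "D > 0" "map_poly of_int B = smult (of_int D) r" by blast
  obtain u v where uv: "quotient_of c = (u, v)" by fastforce
  have v: "v > 0" "c = of_int u / of_int v" using quotient_of_denom_pos[OF uv] quotient_of_div[OF uv] by auto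
  have "map_poly of_int (smult v B) = smult (of_int v) (map_poly of_int B :: rat poly)"
    by (rule poly_eqI) (simp add: coeff_map_poly)
  then have "map_poly of_int (pCons (D * u) (smult v B)) = smult (of_int (D * v)) (pCons c r)"
    using v by (simp add: map_poly_of_int_pCons D(2) mult.commute)
  then show ?case using D(1) v(1) by (meson mult_pos_pos)
qed

lemma int_embed_rat_inj: assumes "(int_embed a :: rat poly mpoly) = int_embed b" shows "a = b"
proof (intro poly_mapping_eqI poly_eqI)
  fix e j
  have "coeff (lookup (int_embed a :: rat poly mpoly) e) j = coeff (lookup (int_embed b) e) j" using assms by simp
  then show "coeff (lookup a e) j = coeff (lookup b e) j" by (simp add: lookup_map coeff_map_poly)
qed

text \<open>Applying \<open>\<mu>\<close> to the coefficients of \<open>b\<^sub>f\<close> gives a monic polynomial of the same degree that also satisfies a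
  functional equation; so it is \<open>b\<^sub>f\<close>, by uniqueness.\<close>

lemma integral_functional_equation:
  fixes f :: "int mpoly"
  assumes f: "f \<noteq> 0" and b: "bernstein_sato n (Poly_Mapping.map of_int f) \<noteq> 0"
  obtains D B d where "D > 0" "(single 0 B * const_poly f ^ d, d) \<in> fs_module n f"
    "map_poly of_int B = smult (of_int D) (bernstein_sato n (Poly_Mapping.map of_int f))"
proof -
  let ?f = "Poly_Mapping.map of_int f :: complex mpoly"
  define b where "b = bernstein_sato n ?f"
  obtain e where "lookup f e \<noteq> 0" using f by (metis poly_mapping_eqI lookup_zero)
  then have "lookup ?f e \<noteq> 0" by (simp add: lookup_map)
  then have f0: "?f \<noteq> 0" by auto
  have bs: "is_bernstein_sato n ?f b" using bernstein_sato_is[OF f0] assms(2) by (simp add: b_def)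
  then obtain d where d: "(single 0 b * const_poly ?f ^ d, d) \<in> fs_module n ?f"
    using functional_eq_iff[OF f0] by (auto simp: is_bernstein_sato_def)
  obtain \<mu> where \<mu>: "rat_linear \<mu>" "\<mu> 1 = 1" using rat_linear_exists by blast
  define r where "r = map_poly \<mu> b"
  obtain D1 a where a: "D1 > 0" "(a, d) \<in> fs_module n f"
    "int_embed a = single 0 [:of_int D1:] * functional_map \<mu> (single 0 b * const_poly ?f ^ d)"
    using fs_module_descent[OF d \<mu>(1)] by blast
  have "functional_map \<mu> (int_embed (const_poly f ^ d) * single 0 b) = int_embed (const_poly f ^ d) * functional_map \<mu> (single 0 b)"
    by (rule functional_map_props(2)[OF \<mu>(1)])
  then have "functional_map \<mu> (single 0 b * const_poly ?f ^ d) = single 0 r * int_embed (const_poly f ^ d)"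
    by (simp add: int_embed_power int_embed_const_poly pmap_single r_def mult.commute)
  then have a2: "int_embed a = single 0 (smult (of_int D1) r) * int_embed (const_poly f ^ d)"
    using a(3) by (simp add: mult_single flip: mult.assoc)
  \<comment> \<open>\<open>D1\<close> comes from the descent; \<open>D2\<close> clears the
    denominators that remain in the coefficients of \<open>smult D1 r\<close>.\<close>
  obtain D2 B where B: "D2 > 0" "map_poly of_int B = smult (of_int D2) (smult (of_int D1) r)" using rat_poly_clear_denominators by blast
  have "(int_embed (single 0 [:D2:] * a) :: rat poly mpoly) = int_embed (single 0 B * const_poly f ^ d)"
    unfolding int_embed_mult int_embed_const map_poly_of_int_pCons B(2) a2 by (simp add: mult_single mult.commute[of "of_int D1"] flip: mult.assoc)
  then have "single 0 [:D2:] * a = single 0 B * const_poly f ^ d" by (rule int_embed_rat_inj)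
  then have mem: "(single 0 B * const_poly f ^ d, d) \<in> fs_module n f" using fs_module.const[OF a(2), of D2] by simp
  define D where "D = D2 * D1"
  have D: "D > 0" using a B by (simp add: D_def)
  define c where "c = (map_poly of_rat r :: complex poly)"
  have Bc: "map_poly of_int B = smult (of_int D) c"
  proof (rule poly_eqI)
    fix j
    have "of_rat (coeff (map_poly of_int B) j) = (of_rat (coeff (smult (of_int D2) (smult (of_int D1) r)) j) :: complex)" unfolding B(2) ..
    then show "coeff (map_poly of_int B) j = coeff (smult (of_int D) c) j"
      by (simp add: coeff_map_poly c_def D_def of_rat_mult)
  qed
  \<comment> \<open>Back over the complex numbers, the integral equation shows that
    \<open>c\<close>, the image of \<open>b\<close> under \<open>\<mu>\<close>, satisfies a
    functional equation.\<close>
  have "(int_embed (single 0 B * const_poly f ^ d), d) \<in> fs_module n ?f" by (rule fs_module_int_embed[OF mem])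
  then have "functional_eq n ?f (map_poly of_int B)"
    unfolding functional_eq_iff[OF f0] int_embed_mult int_embed_const int_embed_power int_embed_const_poly by blast
  then have "functional_eq n ?f (smult (inverse (of_int D)) (smult (of_int D) c))" unfolding Bc by (rule functional_eq_smult[OF f0])
  then have fc: "functional_eq n ?f c" using D by simp
  have cj: "coeff c j = of_rat (\<mu> (coeff b j))" for j
    by (simp add: c_def r_def coeff_map_poly rat_linear_props(3)[OF \<mu>(1)])
  have lb: "coeff b (Polynomial.degree b) = 1" using bs by (simp add: is_bernstein_sato_def)
  have "coeff c (Polynomial.degree b) = 1" unfolding cj lb by (simp add: \<mu>(2))
  moreover have "Polynomial.degree c \<le> Polynomial.degree b"
    by (rule degree_le) (auto simp: cj coeff_eq_0 rat_linear_props(3)[OF \<mu>(1)])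
  ultimately have "Polynomial.degree c = Polynomial.degree b" "lead_coeff c = 1"
    using le_degree[of c "Polynomial.degree b"] by auto
  then have "c = b" using is_bernstein_sato_unique[OF f0 bs] fc by blast
  then show thesis using that[OF D mem] Bc by (simp add: b_def)
qed

section \<open>Specialization of functional equations\<close>

abbreviation peval :: "'a::comm_ring_1 \<Rightarrow> 'a poly mpoly \<Rightarrow> 'a mpoly" where
  "peval z a \<equiv> Poly_Mapping.map (\<lambda>c. poly c z) a"

lemma peval_simps:
  fixes z :: "'a::comm_ring_1"
  shows "peval z (a + b) = peval z a + peval z b" "peval z (a * b) = peval z a * peval z b"
    "peval z (single e c) = single e (poly c z)" "peval z (const_poly f) = f"
    "peval z (mderiv i a) = mderiv i (peval z a)"
proof -
  show "peval z (a + b) = peval z a + peval z b" by (rule pmap_add) simp_all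
  have id: "Poly_Mapping.map (\<lambda>x. x) a = a" by (rule poly_mapping_eqI) (simp add: lookup_map)
  show "peval z (a * b) = peval z a * peval z b"
    using pmap_semilinear[of "\<lambda>c. poly c z" "\<lambda>x. x" "\<lambda>c. poly c z" a b] by (simp add: id)
  show "peval z (single e c) = single e (poly c z)" by (rule pmap_single) simp
  show "peval z (const_poly f) = f" by (rule poly_mapping_eqI) (simp add: lookup_map)
  show "peval z (mderiv i a) = mderiv i (peval z a)" by (rule pmap_mderiv) simp_all
qed

lemma peval_power: "peval z (a ^ k) = peval z a ^ k"
proof (induction k)
  case 0
  show ?case using peval_simps(3)[of z 0 1] by simp
qed (simp add: peval_simps)

lemma peval_Var: "peval z (Var i) = Var i" for z :: "'a::comm_ring_1"
  by (simp add: Var_def peval_simps)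

text \<open>Modulo \<open>N\<close>, differential operators with integer coefficients commute
  with multiplication by \<open>N\<close>-th powers, because derivatives of \<open>N\<close>-th powers vanish.\<close>

definition power_linear :: "nat \<Rightarrow> nat \<Rightarrow> (int mpoly \<Rightarrow> int mpoly) \<Rightarrow> bool" where
  "power_linear n N Q \<longleftrightarrow> (\<forall>g h. Q (g + h) = Q g + Q h) \<and> (\<forall>c h. Q (single 0 c * h) = single 0 c * Q h) \<and>
     (\<forall>h\<in>mpolys {1..n}. Q h \<in> mpolys {1..n}) \<and>
     (\<forall>w h. reduce (int N) (Q (w ^ N * h)) = reduce (int N) (w ^ N * Q h))"

lemma power_linearD:
  assumes "power_linear n N Q"
  shows "Q (g + h) = Q g + Q h" "Q (single 0 c * h) = single 0 c * Q h"
    "h \<in> mpolys {1..n} \<Longrightarrow> Q h \<in> mpolys {1..n}" "reduce (int N) (Q (w ^ N * h)) = reduce (int N) (w ^ N * Q h)"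
  using assms by (simp_all add: power_linear_def)

lemma power_linear_reduce:
  assumes Q: "power_linear n N Q" and gh: "reduce (int N) g = reduce (int N) h"
  shows "reduce (int N) (Q g) = reduce (int N) (Q h)"
proof -
  obtain c where "g = h + single 0 (int N) * c" using reduce_eq_imp_multiple[OF gh] by blast
  then have "Q g = Q h + single 0 (int N) * Q c" by (simp add: power_linearD[OF Q])
  then show ?thesis by (simp add: reduce_add_multiple)
qed

lemma power_linear_id: "power_linear n N (\<lambda>h. h)" by (simp add: power_linear_def)

lemma power_linear_mult:
  assumes Q: "power_linear n N Q" and a: "a \<in> mpolys {1..n}" shows "power_linear n N (\<lambda>h. a * Q h)"
  unfolding power_linear_def
proof (intro conjI allI ballI)
  fix w h
  have "reduce (int N) (a * Q (w ^ N * h)) = reduce (int N) (a * (w ^ N * Q h))"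
    by (rule reduce_mult_cong[OF refl power_linearD(4)[OF Q]])
  then show "reduce (int N) (a * Q (w ^ N * h)) = reduce (int N) (w ^ N * (a * Q h))" by (simp add: mult.left_commute)
qed (simp_all add: power_linearD[OF Q] distrib_left mult.left_commute mpolys_mult a)

lemma power_linear_add:
  assumes Q: "power_linear n N Q" and Q': "power_linear n N Q'" shows "power_linear n N (\<lambda>h. Q h + Q' h)"
  unfolding power_linear_def
proof (intro conjI allI ballI)
  fix w h
  have "reduce (int N) (Q (w ^ N * h) + Q' (w ^ N * h)) = reduce (int N) (w ^ N * Q h + w ^ N * Q' h)"
    by (rule reduce_add_cong[OF power_linearD(4)[OF Q] power_linearD(4)[OF Q']])
  then show "reduce (int N) (Q (w ^ N * h) + Q' (w ^ N * h)) = reduce (int N) (w ^ N * (Q h + Q' h))" by (simp add: distrib_left)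
qed (simp_all add: power_linearD[OF Q] power_linearD[OF Q'] distrib_left mpolys_add)

lemma mderiv_reduce_cong: "reduce N a = reduce N b \<Longrightarrow> reduce N (mderiv i a) = reduce N (mderiv i b)"
  by (metis mderiv_reduce)

lemma power_linear_mderiv:
  assumes Q: "power_linear n N Q" and N: "N > 0" shows "power_linear n N (\<lambda>h. mderiv i (Q h))"
  unfolding power_linear_def
proof (intro conjI allI ballI)
  fix w h
  obtain N' where N': "N = Suc N'" using N by (cases N) auto
  have "reduce (int N) (mderiv i (Q (w ^ N * h))) = reduce (int N) (mderiv i (w ^ N * Q h))"
    by (rule mderiv_reduce_cong[OF power_linearD(4)[OF Q]])
  also have "mderiv i (w ^ N * Q h) = w ^ N * mderiv i (Q h) + single 0 (int N) * (w ^ N' * mderiv i w * Q h)"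
  proof -
    have "mderiv i (w ^ N) = single 0 (int N) * (w ^ N' * mderiv i w)"
      unfolding N' mderiv_power by (simp add: single_of_nat mult.assoc del: of_nat_Suc)
    then show ?thesis by (simp only: mderiv_mult mult.assoc add.commute)
  qed
  finally show "reduce (int N) (mderiv i (Q (w ^ N * h))) = reduce (int N) (w ^ N * mderiv i (Q h))"
    by (simp add: reduce_add_multiple)
qed (simp_all add: power_linearD[OF Q] mderiv_add mderiv_const_mult mpolys_mderiv)

lemma reduce_single_cong: "[x = y] (mod N) \<Longrightarrow> reduce N (single e x) = reduce N (single e y)"
  by (rule poly_mapping_eqI) (simp add: lookup_single when_def cong_def)

text \<open>Substitute for \<open>s\<close> an integer \<open>b\<close> congruent to
  \<open>z\<close>: then \<open>a f^(s-d)\<close> becomes a polynomial as soon as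
  \<open>b \<ge> d\<close>, and \<open>s\<close> acts as \<open>z\<close> modulo \<open>N\<close>.
  So one operator \<open>Q\<close> serves all such \<open>b\<close>.\<close>

lemma fs_module_specialize:
  fixes f :: "int mpoly"
  assumes "(a, d) \<in> fs_module n f" and f: "f \<in> mpolys {1..n}" and N: "N > 0"
  shows "\<exists>Q. power_linear n N Q \<and> (\<forall>b\<ge>d. [int b = z] (mod int N) \<longrightarrow>
    reduce (int N) (peval z a * f ^ (b - d)) = reduce (int N) (Q (f ^ Suc b)))"
  using assms(1)
proof (induction a d rule: fs_module.induct)
  case base
  show ?case by (rule exI[of _ "\<lambda>h. h"]) (simp add: power_linear_id peval_simps)
next
  case (const a d c)
  then obtain Q where Q: "power_linear n N Q" "\<And>b. b \<ge> d \<Longrightarrow> [int b = z] (mod int N) \<Longrightarrow>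
    reduce (int N) (peval z a * f ^ (b - d)) = reduce (int N) (Q (f ^ Suc b))" by blast
  show ?case
  proof (intro exI[of _ "\<lambda>h. single 0 c * Q h"] conjI allI impI power_linear_mult[OF Q(1)] mpolys_const)
    fix b assume b: "d \<le> b" "[int b = z] (mod int N)"
    show "reduce (int N) (peval z (single 0 [:c:] * a) * f ^ (b - d)) = reduce (int N) (single 0 c * Q (f ^ Suc b))"
      using reduce_mult_cong[OF refl Q(2)[OF b], of "single 0 c"] by (simp add: peval_simps mult.assoc)
  qed
next
  case (s_mult a d)
  then obtain Q where Q: "power_linear n N Q" "\<And>b. b \<ge> d \<Longrightarrow> [int b = z] (mod int N) \<Longrightarrow>
    reduce (int N) (peval z a * f ^ (b - d)) = reduce (int N) (Q (f ^ Suc b))" by blast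
  show ?case
  proof (intro exI[of _ "\<lambda>h. single 0 z * Q h"] conjI allI impI power_linear_mult[OF Q(1)] mpolys_const)
    fix b assume b: "d \<le> b" "[int b = z] (mod int N)"
    show "reduce (int N) (peval z (single 0 [:0, 1:] * a) * f ^ (b - d)) = reduce (int N) (single 0 z * Q (f ^ Suc b))"
      using reduce_mult_cong[OF refl Q(2)[OF b], of "single 0 z"] by (simp add: peval_simps mult.assoc)
  qed
next
  case (var i a d)
  then obtain Q where Q: "power_linear n N Q" "\<And>b. b \<ge> d \<Longrightarrow> [int b = z] (mod int N) \<Longrightarrow>
    reduce (int N) (peval z a * f ^ (b - d)) = reduce (int N) (Q (f ^ Suc b))" by blast
  show ?case
  proof (intro exI[of _ "\<lambda>h. Var i * Q h"] conjI allI impI power_linear_mult[OF Q(1)] mpolys_Var[OF var.hyps(1)])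
    fix b assume b: "d \<le> b" "[int b = z] (mod int N)"
    show "reduce (int N) (peval z (Var i * a) * f ^ (b - d)) = reduce (int N) (Var i * Q (f ^ Suc b))"
      using reduce_mult_cong[OF refl Q(2)[OF b], of "Var i"] by (simp add: peval_simps peval_Var mult.assoc)
  qed
next
  case (deriv i a d)
  then obtain Q where Q: "power_linear n N Q" "\<And>b. b \<ge> d \<Longrightarrow> [int b = z] (mod int N) \<Longrightarrow>
    reduce (int N) (peval z a * f ^ (b - d)) = reduce (int N) (Q (f ^ Suc b))" by blast
  show ?case
  proof (intro exI[of _ "\<lambda>h. mderiv i (Q h)"] conjI allI impI power_linear_mderiv[OF Q(1) N])
    fix b assume b: "Suc d \<le> b" "[int b = z] (mod int N)"
    define k where "k = b - Suc d"
    have k: "b - d = Suc k" using b by (simp add: k_def)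
    let ?A = "peval z a"
    have "[z - int d = int b - int d] (mod int N)" using b(2) by (intro cong_diff cong_refl) (rule cong_sym)
    moreover have "int b - int d = int (Suc k)" using b(1) k by linarith
    ultimately have c: "[z - int d = int (Suc k)] (mod int N)" by simp
    have "peval z (const_poly f * mderiv i a + single 0 [:- of_nat d, 1:] * const_poly (mderiv i f) * a) * f ^ (b - Suc d)
      = f * mderiv i ?A * f ^ k + single 0 (z - int d) * (mderiv i f * ?A * f ^ k)"
      unfolding peval_simps k_def by (simp add: distrib_right mult.assoc)
    also have "reduce (int N) \<dots> = reduce (int N) (f * mderiv i ?A * f ^ k + single 0 (int (Suc k)) * (mderiv i f * ?A * f ^ k))"
      by (rule reduce_add_cong[OF refl reduce_mult_cong[OF reduce_single_cong[OF c] refl]])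
    \<comment> \<open>The product rule for \<open>A f^(k+1)\<close>: the factor \<open>s - d\<close>
      of \<open>fs_module\<close> has become \<open>k + 1\<close>, as
      \<open>b - d = k + 1\<close>.\<close>
    also have "f * mderiv i ?A * f ^ k + single 0 (int (Suc k)) * (mderiv i f * ?A * f ^ k) = mderiv i (?A * f ^ Suc k)"
    proof -
      have "single 0 (int (Suc k)) = (of_nat (Suc k) :: int mpoly)" by (simp only: single_of_nat of_nat_id)
      then have "mderiv i (f ^ Suc k) = single 0 (int (Suc k)) * f ^ k * mderiv i f" by (simp only: mderiv_power)
      then show ?thesis by (simp only: mderiv_mult) (simp add: mult_ac)
    qed
    also have "reduce (int N) \<dots> = reduce (int N) (mderiv i (Q (f ^ Suc b)))"
      using Q(2)[of b] b by (intro mderiv_reduce_cong) (simp add: k)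
    finally show "reduce (int N) (peval z (const_poly f * mderiv i a + single 0 [:- of_nat d, 1:] * const_poly (mderiv i f) * a) * f ^ (b - Suc d))
      = reduce (int N) (mderiv i (Q (f ^ Suc b)))" .
  qed
next
  case (up a d)
  then obtain Q where Q: "power_linear n N Q" "\<And>b. b \<ge> d \<Longrightarrow> [int b = z] (mod int N) \<Longrightarrow>
    reduce (int N) (peval z a * f ^ (b - d)) = reduce (int N) (Q (f ^ Suc b))" by blast
  show ?case
  proof (intro exI[of _ Q] conjI allI impI Q(1))
    fix b assume b: "Suc d \<le> b" "[int b = z] (mod int N)"
    then have "b - d = Suc (b - Suc d)" by simp
    then have "peval z (const_poly f * a) * f ^ (b - Suc d) = peval z a * f ^ (b - d)" by (simp add: peval_simps mult_ac)
    then show "reduce (int N) (peval z (const_poly f * a) * f ^ (b - Suc d)) = reduce (int N) (Q (f ^ Suc b))" using Q(2)[of b] b by simp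
  qed
next
  case (add a d a')
  obtain Q where Q: "power_linear n N Q" "\<And>b. b \<ge> d \<Longrightarrow> [int b = z] (mod int N) \<Longrightarrow>
    reduce (int N) (peval z a * f ^ (b - d)) = reduce (int N) (Q (f ^ Suc b))" using add.IH(1) by blast
  obtain Q' where Q': "power_linear n N Q'" "\<And>b. b \<ge> d \<Longrightarrow> [int b = z] (mod int N) \<Longrightarrow>
    reduce (int N) (peval z a' * f ^ (b - d)) = reduce (int N) (Q' (f ^ Suc b))" using add.IH(2) by blast
  show ?case
  proof (intro exI[of _ "\<lambda>h. Q h + Q' h"] conjI allI impI power_linear_add[OF Q(1) Q'(1)])
    fix b assume b: "d \<le> b" "[int b = z] (mod int N)"
    show "reduce (int N) (peval z (a + a') * f ^ (b - d)) = reduce (int N) (Q (f ^ Suc b) + Q' (f ^ Suc b))"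
      unfolding peval_simps distrib_right by (rule reduce_add_cong[OF Q(2)[OF b] Q'(2)[OF b]])
  qed
qed

lemma modulus_Suc: "modulus p m = int p ^ Suc m"
  by (simp only: modulus_def Suc_eq_plus1)

text \<open>Level \<open>N = m + 1\<close> suffices, since derivatives of \<open>p^(m+1)\<close>-th
  powers vanish modulo \<open>p^(m+1)\<close>. The factor \<open>v\<close> removes the part of the
  value of \<open>B\<close> that is prime to \<open>p\<close>.\<close>

lemma power_annihilates_specialize:
  assumes p: "prime p" and f: "f \<in> mpolys {1..n}" and mem: "(single 0 B * const_poly f ^ d, d) \<in> fs_module n f"
    and \<alpha>: "\<alpha> \<in> padic_ints p" and v: "[v * poly B (\<alpha> (Suc m)) = int p ^ k] (mod modulus p m)"
  shows "power_annihilates p m n (reduce (modulus p m) f) \<alpha> k"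
proof -
  let ?N = "p ^ Suc m" and ?z = "\<alpha> (Suc m)" and ?q = "modulus p m"
  let ?R = "R_alg p m n"
  have N: "?N > 0" using p prime_gt_0_nat by simp
  have q: "int ?N = ?q" "?q > 0" using N by (simp_all add: modulus_Suc del: power_Suc)
  interpret R: cring ?R by (rule cring_poly_alg[OF q(2)])
  have z0: "?z \<ge> 0" using \<alpha> by (simp add: padic_ints_def)
  obtain Q where Q: "power_linear n ?N Q" and Qb: "\<And>b. b \<ge> d \<Longrightarrow> [int b = ?z] (mod int ?N) \<Longrightarrow>
    reduce (int ?N) (peval ?z (single 0 B * const_poly f ^ d) * f ^ (b - d)) = reduce (int ?N) (Q (f ^ Suc b))"
    using fs_module_specialize[OF mem f N] by blast
  \<comment> \<open>The residue of \<alpha>, raised by a multiple of the modulus until it is at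
    least \<open>d\<close>.\<close>
  define b where "b = nat ?z + ?N * d"
  have bd: "b \<ge> d" using N by (simp add: b_def trans_le_add2)
  have bz: "[int b = ?z] (mod int ?N)" using z0 by (simp add: b_def cong_def)
  have "peval ?z (single 0 B * const_poly f ^ d) * f ^ (b - d) = single 0 (poly B ?z) * f ^ b"
    unfolding peval_simps peval_power using bd by (simp add: mult.assoc flip: power_add)
  then have fe: "reduce ?q (single 0 (poly B ?z) * f ^ b) = reduce ?q (Q (f ^ Suc b))"
    using Qb[OF bd bz] unfolding q(1) by simp
  have Qr: "reduce ?q (Q (reduce ?q h)) = reduce ?q (Q h)" for h
    using power_linear_reduce[OF Q, of "reduce ?q h" h] unfolding q(1) by simp
  define \<psi> where "\<psi> = (\<lambda>r\<in>carrier ?R. reduce ?q (single 0 v * Q r))"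
  have psi: "\<psi> (reduce ?q h) = reduce ?q (single 0 v * Q h)" if "h \<in> mpolys {1..n}" for h
    unfolding \<psi>_def using reduce_in_poly_alg[OF q(2) that] reduce_mult_cong[OF refl Qr] by simp
  have "\<psi> \<in> additive_endos ?R"
  proof (rule R.additive_endosI)
    show "\<psi> x \<in> carrier ?R" if "x \<in> carrier ?R" for x
      using that poly_algD(1)[OF q(2) that] by (simp add: \<psi>_def reduce_in_poly_alg q(2) mpolys_mult power_linearD[OF Q])
    show "\<psi> (x \<oplus>\<^bsub>?R\<^esub> y) = \<psi> x \<oplus>\<^bsub>?R\<^esub> \<psi> y" if "x \<in> carrier ?R" "y \<in> carrier ?R" for x y
      unfolding poly_alg_simps using that psi[OF mpolys_add[OF poly_algD(1)[OF q(2) that(1)] poly_algD(1)[OF q(2) that(2)]]]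
      by (simp add: \<psi>_def power_linearD(1)[OF Q] distrib_left)
  qed (simp add: \<psi>_def)
  moreover have "commutes_with ?R \<psi> (w [^]\<^bsub>?R\<^esub> ?N)" if w: "w \<in> carrier ?R" for w
    unfolding commutes_with_def
  proof
    fix x assume x: "x \<in> carrier ?R"
    have m: "w ^ ?N * x \<in> mpolys {1..n}" using poly_algD(1)[OF q(2)] w x by (intro mpolys_mult mpolys_power) blast+
    have "\<psi> (w [^]\<^bsub>?R\<^esub> ?N \<otimes>\<^bsub>?R\<^esub> x) = \<psi> (reduce ?q (w ^ ?N * x))" unfolding poly_alg_pow[OF q(2)] poly_alg_simps by simp
    also have "\<dots> = reduce ?q (single 0 v * Q (w ^ ?N * x))" by (rule psi[OF m])
    also have "\<dots> = reduce ?q (single 0 v * (w ^ ?N * Q x))"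
      using power_linearD(4)[OF Q, of w x] unfolding q(1) by (rule reduce_mult_cong[OF refl])
    also have "\<dots> = reduce ?q (w ^ ?N * (single 0 v * Q x))" by (simp only: mult.left_commute)
    also have "\<dots> = w [^]\<^bsub>?R\<^esub> ?N \<otimes>\<^bsub>?R\<^esub> \<psi> x" unfolding poly_alg_pow[OF q(2)] poly_alg_simps using x by (simp add: \<psi>_def)
    finally show "\<psi> (w [^]\<^bsub>?R\<^esub> ?N \<otimes>\<^bsub>?R\<^esub> x) = w [^]\<^bsub>?R\<^esub> ?N \<otimes>\<^bsub>?R\<^esub> \<psi> x" .
  qed
  moreover have "[int b = \<alpha> (Suc m)] (mod int p ^ Suc m)" using bz by simp
  moreover have "\<psi> (reduce ?q (reduce ?q f ^ Suc b)) = reduce ?q (single 0 (int p ^ k) * reduce ?q f ^ b)"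
  proof -
    have "\<psi> (reduce ?q (reduce ?q f ^ Suc b)) = reduce ?q (single 0 v * Q (f ^ Suc b))"
      unfolding reduce_simps(7) by (rule psi[OF mpolys_power[OF f]])
    also have "\<dots> = reduce ?q (single 0 v * (single 0 (poly B ?z) * f ^ b))"
      by (rule reduce_mult_cong[OF refl fe[symmetric]])
    also have "\<dots> = reduce ?q (single 0 (int p ^ k) * f ^ b)"
      unfolding single_zero_mult by (rule reduce_mult_cong[OF reduce_single_cong[OF v] refl])
    also have "\<dots> = reduce ?q (single 0 (int p ^ k) * reduce ?q f ^ b)"
      by (rule reduce_mult_cong[OF refl]) simp
    finally show ?thesis .
  qed
  ultimately show ?thesis unfolding power_annihilates_def by blast
qed

section \<open>Monotonicity and the bound\<close>

text \<open>Since \<open>p^(m+1) = 0\<close> the zero operator works. So the minimum in the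
  characterization of the strength is attained.\<close>

lemma power_annihilates_zero:
  assumes p: "prime p" and \<alpha>: "\<alpha> \<in> padic_ints p" and g: "g \<in> mpolys {1..n}"
  shows "power_annihilates p m n g \<alpha> (Suc m)"
proof -
  have q: "modulus p m > 0" using p prime_gt_0_nat by (simp add: modulus_def)
  let ?R = "R_alg p m n"
  interpret R: cring ?R by (rule cring_poly_alg[OF q])
  define \<psi> where "\<psi> = (\<lambda>r\<in>carrier ?R. 0 :: int mpoly)"
  have z: "0 \<in> carrier ?R" using R.zero_closed by (simp add: poly_alg_simps)
  have "\<psi> \<in> additive_endos ?R"
    by (rule R.additive_endosI) (use z in \<open>simp_all add: \<psi>_def, simp_all add: poly_alg_simps\<close>)
  moreover have "commutes_with ?R \<psi> w" if "w \<in> carrier ?R" for w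
    using that by (simp add: commutes_with_def \<psi>_def) (simp add: poly_alg_simps)
  then have "\<forall>w\<in>carrier ?R. commutes_with ?R \<psi> (w [^]\<^bsub>?R\<^esub> (p ^ 0))" by simp
  moreover have "[int 0 = \<alpha> 0] (mod int p ^ 0)" by simp
  moreover have "\<psi> (reduce (modulus p m) (g ^ Suc 0)) = reduce (modulus p m) (single 0 (int p ^ Suc m) * g ^ 0)"
  proof -
    have "\<psi> (reduce (modulus p m) (g ^ Suc 0)) = 0" using reduce_in_poly_alg[OF q g] by (simp add: \<psi>_def)
    moreover have "reduce (modulus p m) (0 + single 0 (modulus p m) * g ^ 0) = 0" unfolding reduce_add_multiple by simp
    ultimately show ?thesis by (simp add: modulus_Suc del: power_Suc)
  qed
  ultimately show ?thesis unfolding power_annihilates_def by blast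
qed

text \<open>An additive map sends multiples of \<open>N\<close> to multiples of \<open>N\<close>, so
  its values modulo \<open>N\<close> depend only on the argument modulo \<open>N\<close>.\<close>

lemma additive_endos_reduce:
  assumes N: "N > 0" "N' > 0" "N dvd N'" and \<psi>: "\<psi> \<in> additive_endos (poly_alg N' V)" and h: "h \<in> mpolys V"
  shows "reduce N (\<psi> (reduce N h)) = reduce N (\<psi> (reduce N' h))"
\<comment> \<open>For \<open>N < N'\<close>, the integer \<open>N\<close> itself is a scalar of
  \<open>Z/N'\<close>; for \<open>N = N'\<close> it is not a reduced representative, but there is
  nothing to prove.\<close>
proof (cases "N = N'")
  case False
  then have lt: "N < N'" using N zdvd_imp_le[of N N'] by simp
  let ?R = "poly_alg N' V"
  interpret R: cring ?R by (rule cring_poly_alg[OF N(2)])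
  have rr: "reduce N (reduce N' x) = reduce N x" "reduce N' (reduce N x) = reduce N x" for x
    using N(1,3) lt by (auto intro!: poly_mapping_eqI simp: mod_mod_cancel mod_pos_pos_trivial pos_mod_bound[THEN less_trans])
  obtain c where c: "h = reduce N h + single 0 N * c" using reduce_eq_imp_multiple[of N h "reduce N h"] by auto
  have "single 0 N * c \<in> mpolys V" using mpolys_diff[OF h mpolys_reduce[OF h, of N]] c by (metis add_diff_cancel_left')
  then have cV: "c \<in> mpolys V" using N(1) by (simp add: mpolys_iff)
  have car: "reduce N h \<in> carrier ?R" "reduce N' c \<in> carrier ?R"
    using reduce_in_poly_alg[OF N(2) mpolys_reduce[OF h]] reduce_in_poly_alg[OF N(2) cV] rr(2) by metis+
  have NR: "N \<in> carrier (residue_ring N')" using N lt by (simp add: residue_ring_def)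
  have sm: "N \<odot>\<^bsub>?R\<^esub> reduce N' c \<in> carrier ?R"
    unfolding poly_alg_simps using cV by (intro reduce_in_poly_alg[OF N(2)] mpolys_mult mpolys_const mpolys_reduce)
  have "reduce N' h = reduce N h \<oplus>\<^bsub>?R\<^esub> N \<odot>\<^bsub>?R\<^esub> reduce N' c" unfolding poly_alg_simps using c by simp
  then have "\<psi> (reduce N' h) = \<psi> (reduce N h) \<oplus>\<^bsub>?R\<^esub> \<psi> (N \<odot>\<^bsub>?R\<^esub> reduce N' c)"
    using R.additive_endosD(2)[OF \<psi> car(1) sm] by simp
  also have "\<psi> (N \<odot>\<^bsub>?R\<^esub> reduce N' c) = N \<odot>\<^bsub>?R\<^esub> \<psi> (reduce N' c)"
    using \<psi> NR car(2) unfolding linear_endos_poly_alg[OF N(2), symmetric] linear_endos_def by simp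
  finally have "\<psi> (reduce N' h) = reduce N' (\<psi> (reduce N h) + single 0 N * \<psi> (reduce N' c))"
    unfolding poly_alg_simps by simp
  then show ?thesis by (simp add: rr reduce_add_multiple)
qed simp

text \<open>By \<open>additive_endos_reduce\<close> the operator descends to the quotient; the same
  \<open>N\<close>, \<open>b\<close> and \<open>k\<close> serve there.\<close>

lemma power_annihilates_Suc_imp:
  assumes p: "prime p" and f: "f \<in> mpolys {1..n}"
    and ann: "power_annihilates p (Suc m) n (reduce (modulus p (Suc m)) f) \<alpha> k"
  shows "power_annihilates p m n (reduce (modulus p m) f) \<alpha> k"
proof -
  let ?q = "modulus p m" and ?q' = "modulus p (Suc m)"
  let ?R = "R_alg p m n" and ?R' = "R_alg p (Suc m) n"
  have q: "?q > 0" "?q' > 0" "?q dvd ?q'" using p prime_gt_0_nat by (simp_all add: modulus_def)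
  interpret R: cring ?R by (rule cring_poly_alg[OF q(1)])
  interpret R': cring ?R' by (rule cring_poly_alg[OF q(2)])
  obtain \<psi> N b where \<psi>: "\<psi> \<in> additive_endos ?R'"
    and comm: "\<And>w. w \<in> carrier ?R' \<Longrightarrow> commutes_with ?R' \<psi> (w [^]\<^bsub>?R'\<^esub> (p ^ N))"
    and b: "[int b = \<alpha> N] (mod int p ^ N)"
    and eq: "\<psi> (reduce ?q' (reduce ?q' f ^ Suc b)) = reduce ?q' (single 0 (int p ^ k) * reduce ?q' f ^ b)"
    using ann unfolding power_annihilates_def by blast
  have rr: "reduce ?q (reduce ?q' x) = reduce ?q x" for x
    by (rule poly_mapping_eqI) (use q in \<open>simp add: mod_mod_cancel\<close>)
  note key = additive_endos_reduce[OF q \<psi>]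
  have \<psi>_mpolys: "\<psi> (reduce ?q' h) \<in> mpolys {1..n}" if "h \<in> mpolys {1..n}" for h
    by (rule poly_algD(1)[OF q(2) R'.additive_endosD(1)[OF \<psi> reduce_in_poly_alg[OF q(2) that]]])
  define \<chi> where "\<chi> = (\<lambda>r\<in>carrier ?R. reduce ?q (\<psi> (reduce ?q' r)))"
  have chi: "\<chi> (reduce ?q h) = reduce ?q (\<psi> (reduce ?q' h))" if "h \<in> mpolys {1..n}" for h
    using reduce_in_poly_alg[OF q(1) that] key[OF that] key[OF mpolys_reduce[OF that, of ?q]] by (simp add: \<chi>_def)
  have "\<chi> \<in> additive_endos ?R"
  proof (rule R.additive_endosI)
    show "\<chi> x \<in> carrier ?R" if "x \<in> carrier ?R" for x
      using that poly_algD(1)[OF q(1) that] by (simp add: \<chi>_def reduce_in_poly_alg q(1) \<psi>_mpolys)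
    show "\<chi> (x \<oplus>\<^bsub>?R\<^esub> y) = \<chi> x \<oplus>\<^bsub>?R\<^esub> \<chi> y" if "x \<in> carrier ?R" "y \<in> carrier ?R" for x y
    proof -
      note xy = poly_algD(1)[OF q(1) that(1)] poly_algD(1)[OF q(1) that(2)]
      have "\<chi> (x \<oplus>\<^bsub>?R\<^esub> y) = reduce ?q (\<psi> (reduce ?q' (reduce ?q' x + reduce ?q' y)))"
        unfolding poly_alg_simps chi[OF mpolys_add[OF xy]] by simp
      also have "\<psi> (reduce ?q' (reduce ?q' x + reduce ?q' y)) = reduce ?q' (\<psi> (reduce ?q' x) + \<psi> (reduce ?q' y))"
        using R'.additive_endosD(2)[OF \<psi> reduce_in_poly_alg[OF q(2) xy(1)] reduce_in_poly_alg[OF q(2) xy(2)]] unfolding poly_alg_simps .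
      also have "reduce ?q \<dots> = \<chi> x \<oplus>\<^bsub>?R\<^esub> \<chi> y" unfolding poly_alg_simps rr using that by (simp add: \<chi>_def)
      finally show ?thesis .
    qed
  qed (simp add: \<chi>_def)
  moreover have "commutes_with ?R \<chi> (w [^]\<^bsub>?R\<^esub> (p ^ N))" if w: "w \<in> carrier ?R" for w
    unfolding commutes_with_def
  proof
    fix x assume x: "x \<in> carrier ?R"
    note wx = poly_algD(1)[OF q(1) w] poly_algD(1)[OF q(1) x]
    have m: "w ^ p ^ N * x \<in> mpolys {1..n}" using wx by (intro mpolys_mult mpolys_power)
    have "\<chi> (w [^]\<^bsub>?R\<^esub> (p ^ N) \<otimes>\<^bsub>?R\<^esub> x) = \<chi> (reduce ?q (w ^ p ^ N * x))" unfolding poly_alg_pow[OF q(1)] poly_alg_simps by simp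
    also have "\<dots> = reduce ?q (\<psi> (reduce ?q' (reduce ?q' (reduce ?q' w ^ p ^ N) * reduce ?q' x)))" unfolding chi[OF m] by simp
    also have "\<psi> (reduce ?q' (reduce ?q' (reduce ?q' w ^ p ^ N) * reduce ?q' x)) = reduce ?q' (reduce ?q' (reduce ?q' w ^ p ^ N) * \<psi> (reduce ?q' x))"
      using comm[OF reduce_in_poly_alg[OF q(2) wx(1)]] reduce_in_poly_alg[OF q(2) wx(2)]
      unfolding commutes_with_def poly_alg_pow[OF q(2)] poly_alg_simps by blast
    also have "reduce ?q \<dots> = reduce ?q (w ^ p ^ N * \<psi> (reduce ?q' x))"
    proof -
      have e: "reduce ?q (reduce ?q' (reduce ?q' w ^ p ^ N)) = reduce ?q (w ^ p ^ N)" unfolding rr by (rule reduce_power_cong[OF rr])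
      show ?thesis unfolding rr by (rule reduce_mult_cong[OF e refl])
    qed
    also have "\<dots> = w [^]\<^bsub>?R\<^esub> (p ^ N) \<otimes>\<^bsub>?R\<^esub> \<chi> x" unfolding poly_alg_pow[OF q(1)] poly_alg_simps using x by (simp add: \<chi>_def)
    finally show "\<chi> (w [^]\<^bsub>?R\<^esub> (p ^ N) \<otimes>\<^bsub>?R\<^esub> x) = w [^]\<^bsub>?R\<^esub> (p ^ N) \<otimes>\<^bsub>?R\<^esub> \<chi> x" .
  qed
  moreover have "\<chi> (reduce ?q (reduce ?q f ^ Suc b)) = reduce ?q (single 0 (int p ^ k) * reduce ?q f ^ b)"
  proof -
    have "\<chi> (reduce ?q (reduce ?q f ^ Suc b)) = reduce ?q (\<psi> (reduce ?q' (reduce ?q' f ^ Suc b)))"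
      unfolding reduce_simps(7) by (rule chi[OF mpolys_power[OF f]])
    also have "\<dots> = reduce ?q (single 0 (int p ^ k) * reduce ?q' f ^ b)" unfolding eq rr ..
    also have "\<dots> = reduce ?q (single 0 (int p ^ k) * reduce ?q f ^ b)"
      by (rule reduce_mult_cong[OF refl reduce_power_cong[OF trans[OF rr reduce_reduce[symmetric]]]])
    finally show ?thesis .
  qed
  ultimately show ?thesis unfolding power_annihilates_def using b by blast
qed

text \<open>Horner's scheme, multiplied at each step by the denominator of \<alpha>, which is prime
  to \<open>p\<close>. The resulting \<open>v\<close> turns the rational value at \<alpha> into an
  integer that the residue of \<alpha> computes modulo \<open>p^N\<close>.\<close>

lemma rational_specialization:
  assumes p: "prime p" and \<alpha>: "\<alpha> \<in> Z_loc p"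
  shows "\<exists>v u. \<not> int p dvd v \<and> of_int v * poly (map_poly of_int B :: rat poly) \<alpha> = of_int u \<and>
    [u = v * poly B (padic_of_rat p \<alpha> N)] (mod int p ^ N)"
proof (induction B)
  case 0
  show ?case using p by (intro exI[of _ 1] exI[of _ 0]) (simp add: prime_nat_iff)
next
  case (pCons c B)
  then obtain v u where vu: "\<not> int p dvd v" "of_int v * poly (map_poly of_int B :: rat poly) \<alpha> = of_int u"
    "[u = v * poly B (padic_of_rat p \<alpha> N)] (mod int p ^ N)" by blast
  let ?z = "padic_of_rat p \<alpha> N"
  obtain n d where nd: "quotient_of \<alpha> = (n, d)" by fastforce
  have d: "d > 0" "\<alpha> = of_int n / of_int d" using quotient_of_denom_pos[OF nd] quotient_of_div[OF nd] by auto
  have "\<not> int p dvd d" using \<alpha> nd by (simp add: Z_loc_def)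
  then have 1: "\<not> int p dvd v * d" using vu(1) p by (simp add: prime_dvd_mult_iff)
  have z: "[?z * d = n] (mod int p ^ N)" using padic_of_rat_props(2)[OF p \<alpha>, of N] nd by simp
  have "of_int (v * d) * poly (map_poly of_int (pCons c B) :: rat poly) \<alpha>
     = of_int (c * v * d) + of_int n * (of_int v * poly (map_poly of_int B :: rat poly) \<alpha>)"
    using d by (simp add: map_poly_of_int_pCons field_simps)
  then have 2: "of_int (v * d) * poly (map_poly of_int (pCons c B) :: rat poly) \<alpha> = of_int (c * v * d + n * u)"
    unfolding vu(2) by simp
  have "[c * v * d + n * u = c * v * d + ?z * d * (v * poly B ?z)] (mod int p ^ N)"
    by (rule cong_add[OF cong_refl cong_mult[OF cong_sym[OF z] vu(3)]])
  also have "c * v * d + ?z * d * (v * poly B ?z) = v * d * poly (pCons c B) ?z" by (simp add: algebra_simps)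
  finally show ?case using 1 2 by blast
qed

text \<open>With \<open>\<beta> = x/y\<close> the hypothesis reads \<open>c x = u y\<close>;
  multiplicities are additive, and \<open>c\<close> contributes nothing.\<close>

lemma padic_valuation_eq:
  assumes p: "prime p" and \<beta>: "\<beta> \<noteq> 0" "of_int c * \<beta> = of_int u" and c: "\<not> int p dvd c"
  shows "padic_valuation p \<beta> = ereal (real (multiplicity (int p) u))"
proof -
  obtain x y where xy: "quotient_of \<beta> = (x, y)" by fastforce
  have y: "y > 0" "\<beta> = of_int x / of_int y" using quotient_of_denom_pos[OF xy] quotient_of_div[OF xy] by auto
  have x: "x \<noteq> 0" using \<beta>(1) y by auto
  have c0: "c \<noteq> 0" using c by auto
  have "of_int (c * x) = (of_int (u * y) :: rat)" using \<beta>(2) y by (simp add: field_simps)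
  then have e: "c * x = u * y" by (simp only: of_int_eq_iff)
  have u: "u \<noteq> 0" using e x c0 by auto
  have "prime_elem (int p)" using p by simp
  then have "multiplicity (int p) c + multiplicity (int p) x = multiplicity (int p) u + multiplicity (int p) y"
    using e u x y(1) c0 by (metis prime_elem_multiplicity_mult_distrib less_irrefl)
  moreover have "multiplicity (int p) c = 0" using c by (rule not_dvd_imp_multiplicity_0)
  ultimately show ?thesis using \<beta>(1) xy by (simp add: padic_valuation_def)
qed

lemma poly_of_rat: "of_rat (poly (map_poly of_int B :: rat poly) \<alpha>) = (poly (map_poly of_int B) (of_rat \<alpha>) :: complex)"
  by (induction B) (simp_all add: map_poly_of_int_pCons of_rat_add of_rat_mult)

context
  fixes p n :: nat and f :: "int mpoly" and \<alpha> :: rat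
  assumes p: "prime p" "odd p" and f: "f \<in> mpolys {1..n}" "primitive_at p f" and \<alpha>: "\<alpha> \<in> Z_loc p"
begin

abbreviation (input) str where "str m \<equiv> strength p m n (padic_of_rat p \<alpha>) (reduce (int p ^ (m + 1)) f)"

lemma str_eq_Least: "str m = (LEAST k. power_annihilates p m n (reduce (modulus p m) f) (padic_of_rat p \<alpha>) k)"
proof -
  have p0: "p > 0" using p by (simp add: prime_gt_0_nat)
  have "modulus p m > 0" using p0 by (simp add: modulus_def)
  then interpret strength_at p m n "reduce (modulus p m) f" "padic_of_rat p \<alpha>"
    using p f reduce_in_poly_alg padic_of_rat_in_padic_ints[OF p(1) \<alpha>] primitive_reduce[OF p0, of m f]
    by unfold_locales (simp_all only: modulus_Suc simp_thms)
  show ?thesis using strength_eq_Least by (simp only: modulus_def)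
qed

lemma power_annihilates_str: "power_annihilates p m n (reduce (modulus p m) f) (padic_of_rat p \<alpha>) (str m)"
  unfolding str_eq_Least
  by (rule LeastI[of _ "Suc m"])
    (rule power_annihilates_zero[OF p(1) padic_of_rat_in_padic_ints[OF p(1) \<alpha>] mpolys_reduce[OF f(1)]])

lemma str_le: "power_annihilates p m n (reduce (modulus p m) f) (padic_of_rat p \<alpha>) k \<Longrightarrow> str m \<le> k"
  unfolding str_eq_Least by (rule Least_le)

lemma mono_str: "mono str"
proof (rule incseq_SucI)
  fix m show "str m \<le> str (Suc m)"
    by (rule str_le[OF power_annihilates_Suc_imp[OF p(1) f(1) power_annihilates_str]])
qed

lemma str_le_valuation:
  assumes mem: "(single 0 B * const_poly f ^ d, d) \<in> fs_module n f"
    and \<beta>: "of_int D * \<beta> = poly (map_poly of_int B :: rat poly) \<alpha>" and D: "\<not> int p dvd D"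
  shows "ereal (real (str m)) \<le> padic_valuation p \<beta>"
proof (cases "\<beta> = 0")
  case False
  let ?z = "padic_of_rat p \<alpha> (Suc m)"
  obtain v u where vu: "\<not> int p dvd v" "of_int v * poly (map_poly of_int B :: rat poly) \<alpha> = of_int u"
    "[u = v * poly B ?z] (mod int p ^ Suc m)" using rational_specialization[OF p(1) \<alpha>, of B "Suc m"] by blast
  define k where "k = multiplicity (int p) u"
  have "of_int (v * D) * \<beta> = of_int u" using vu(2) \<beta> by (simp add: mult.assoc)
  moreover have vD: "\<not> int p dvd v * D" using vu(1) D p(1) by (simp add: prime_dvd_mult_iff)
  ultimately have val: "padic_valuation p \<beta> = ereal (real k)"
    unfolding k_def by (intro padic_valuation_eq[OF p(1) False])
  have u: "u \<noteq> 0" using \<open>of_int (v * D) * \<beta> = of_int u\<close> False vD by auto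
  have "\<not> is_unit (int p)" using p(1) by (simp add: prime_gt_1_nat)
  then obtain y where y: "u = int p ^ k * y" "\<not> int p dvd y"
    unfolding k_def using multiplicity_decompose'[OF u, of "int p"] by metis
  have "coprime y (int p ^ Suc m)" using y(2) p(1) prime_imp_coprime[of "int p" y] by (simp add: coprime_commute)
  \<comment> \<open>Inverting the prime-to-\<open>p\<close> part \<open>y\<close> of
    \<open>u\<close> turns the value of \<open>B\<close> into \<open>p^k\<close>, in the form in
    which it can be specialized.\<close>
  then obtain w where w: "[y * w = 1] (mod int p ^ Suc m)" using cong_solve_coprime_int by blast
  have "[w * v * poly B ?z = w * u] (mod int p ^ Suc m)" using cong_mult[OF cong_refl cong_sym[OF vu(3)], of w] by (simp add: mult.assoc)
  also have "w * u = int p ^ k * (y * w)" unfolding y(1) by (simp add: mult_ac)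
  also have "[int p ^ k * (y * w) = int p ^ k * 1] (mod int p ^ Suc m)" by (rule cong_mult[OF cong_refl w])
  finally have "[w * v * poly B ?z = int p ^ k] (mod modulus p m)" by (simp only: modulus_Suc mult_1_right)
  then have "str m \<le> k"
    by (intro str_le power_annihilates_specialize[OF p(1) f(1) mem padic_of_rat_in_padic_ints[OF p(1) \<alpha>]])
  then show ?thesis unfolding val by simp
qed (simp add: padic_valuation_def)

end

theorem theorem1p5:
  fixes n :: nat and f :: "int mpoly"
  assumes "f \<in> mpolys {1..n}" and "f \<noteq> 0"
  shows "\<exists>p0. \<forall>p\<ge>p0. prime p \<longrightarrow>
    (\<forall>\<alpha>\<in>Z_loc p. \<exists>\<beta> :: rat.
       of_rat \<beta> = poly (bernstein_sato n (Poly_Mapping.map of_int f)) (of_rat \<alpha>) \<and>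
       mono (\<lambda>m. strength p m n (padic_of_rat p \<alpha>) (reduce (int p ^ (m + 1)) f)) \<and>
       (\<forall>m. padic_valuation p \<beta>
              \<ge> ereal (real (strength p m n (padic_of_rat p \<alpha>) (reduce (int p ^ (m + 1)) f)))) \<and>
       (\<not> bdd_above (range (\<lambda>m. strength p m n (padic_of_rat p \<alpha>) (reduce (int p ^ (m + 1)) f)))
          \<longrightarrow> poly (bernstein_sato n (Poly_Mapping.map of_int f)) (of_rat \<alpha>) = 0))"
proof -
  let ?b = "bernstein_sato n (Poly_Mapping.map of_int f) :: complex poly"
  obtain e where e: "lookup f e \<noteq> 0" using assms(2) by (metis poly_mapping_eqI lookup_zero)
  obtain D where D: "D > 0" and bound: "\<And>p \<alpha>. prime p \<Longrightarrow> odd p \<Longrightarrow> primitive_at p f \<Longrightarrow> \<not> int p dvd D \<Longrightarrow> \<alpha> \<in> Z_loc p \<Longrightarrow>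
      \<exists>\<beta> :: rat. of_rat \<beta> = poly ?b (of_rat \<alpha>) \<and>
        (\<forall>m. ereal (real (strength p m n (padic_of_rat p \<alpha>) (reduce (int p ^ (m + 1)) f))) \<le> padic_valuation p \<beta>)"
  proof (cases "?b = 0")
    case True
    \<comment> \<open>The default value 0 of \<open>bernstein_sato\<close>: then
      \<open>\<beta> = 0\<close> has infinite valuation, and any \<open>D\<close> will do.\<close>
    then show thesis by (intro that[of 1]) (auto intro!: exI[of _ "0::rat"] simp: padic_valuation_def)
  next
    case False
    obtain D B d where D: "D > 0" "(single 0 B * const_poly f ^ d, d) \<in> fs_module n f"
      "map_poly of_int B = smult (of_int D) ?b" using integral_functional_equation[OF assms(2) False] by metis
    show thesis
    proof (rule that[OF D(1)])
      fix p \<alpha> assume p: "prime p" "odd p" "primitive_at p f" "\<not> int p dvd D" "\<alpha> \<in> Z_loc p"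
      define \<beta> where "\<beta> = poly (map_poly of_int B :: rat poly) \<alpha> / of_int D"
      have D\<beta>: "of_int D * \<beta> = poly (map_poly of_int B :: rat poly) \<alpha>" using D(1) by (simp add: \<beta>_def)
      have "of_int D * of_rat \<beta> = of_int D * poly ?b (of_rat \<alpha>)"
        using arg_cong[OF D\<beta>, of "of_rat :: rat \<Rightarrow> complex"] unfolding poly_of_rat D(3) by (simp add: of_rat_mult)
      then have "of_rat \<beta> = poly ?b (of_rat \<alpha>)" using D(1) by simp
      then show "\<exists>\<beta> :: rat. of_rat \<beta> = poly ?b (of_rat \<alpha>) \<and>
        (\<forall>m. ereal (real (strength p m n (padic_of_rat p \<alpha>) (reduce (int p ^ (m + 1)) f))) \<le> padic_valuation p \<beta>)"
        using str_le_valuation[OF p(1,2) assms(1) p(3,5) D(2) D\<beta> p(4)] by blast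
    qed
  qed
  show ?thesis
  \<comment> \<open>The summand 3 makes \<open>p\<close> odd, and the others make \<open>p\<close>
    larger than \<open>D\<close> and than the absolute value of the chosen nonzero coefficient of
    \<open>f\<close>, so that it divides neither.\<close>
  proof (intro exI[of _ "nat (3 + D + \<bar>lookup f e\<bar>)"] allI impI ballI)
    fix p \<alpha> assume p: "nat (3 + D + \<bar>lookup f e\<bar>) \<le> p" "prime p" and \<alpha>: "\<alpha> \<in> Z_loc p"
    have odd: "odd p" using p D prime_odd_nat[of p] by simp
    have "\<not> int p dvd D" using p(1) D zdvd_imp_le[of "int p" D] by linarith
    moreover have prim: "primitive_at p f" unfolding primitive_at_def
    proof
      show "\<not> int p dvd lookup f e" using p(1) D dvd_imp_le_int[OF e, of "int p"] by linarith
    qed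
    ultimately obtain \<beta> :: rat where \<beta>: "of_rat \<beta> = poly ?b (of_rat \<alpha>)"
      "\<And>m. ereal (real (strength p m n (padic_of_rat p \<alpha>) (reduce (int p ^ (m + 1)) f))) \<le> padic_valuation p \<beta>"
      using bound[OF p(2) odd _ _ \<alpha>] by blast
    have "poly ?b (of_rat \<alpha>) = 0"
      if unb: "\<not> bdd_above (range (\<lambda>m. strength p m n (padic_of_rat p \<alpha>) (reduce (int p ^ (m + 1)) f)))"
    proof (rule ccontr)
      assume "poly ?b (of_rat \<alpha>) \<noteq> 0"
      then have "\<beta> \<noteq> 0" using \<beta>(1) by auto
      \<comment> \<open>A nonzero value has finite valuation, which bounds all strengths at
        once.\<close>
      then obtain c where c: "padic_valuation p \<beta> = ereal c" by (simp add: padic_valuation_def)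
      have "strength p m n (padic_of_rat p \<alpha>) (reduce (int p ^ (m + 1)) f) \<le> nat \<lfloor>c\<rfloor>" for m
        using \<beta>(2)[of m] unfolding c by (simp add: le_nat_floor)
      then show False using unb by (metis (mono_tags, lifting) bdd_aboveI2)
    qed
    then show "\<exists>\<beta> :: rat. of_rat \<beta> = poly ?b (of_rat \<alpha>) \<and>
       mono (\<lambda>m. strength p m n (padic_of_rat p \<alpha>) (reduce (int p ^ (m + 1)) f)) \<and>
       (\<forall>m. padic_valuation p \<beta> \<ge> ereal (real (strength p m n (padic_of_rat p \<alpha>) (reduce (int p ^ (m + 1)) f)))) \<and>
       (\<not> bdd_above (range (\<lambda>m. strength p m n (padic_of_rat p \<alpha>) (reduce (int p ^ (m + 1)) f))) \<longrightarrow> poly ?b (of_rat \<alpha>) = 0)"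
      using \<beta> mono_str[OF p(2) odd assms(1) prim \<alpha>] by blast
  qed
qed

end
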